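(* Let $p=p_n$ and $k=k_n\in\{1,\dots,p-1\}$ with $p/n\to\infty$ and $(1-k/p)\,n\to\tau\in(0,\infty)$ as $n\to\infty$. For each $n$, let $X_1,\dots,X_n$ be i.i.d. from $\mathrm{Unif}(\mathcal{H}\cap\mathbb{S}^{p-1})$, where $\mathcal{H}$ is a $k$-dimensional linear subspace of $\mathbb{R}^p$. Let $(B_t)_{0\le t\le1}$ be a standard Brownian bridge. Then $$\sqrt{\frac{n(n-1)}{2}}\,T_n\xrightarrow{d}\sup_{t\in[0,1]}\Big|B_t-\frac{\tau}{2\sqrt2}\,\Phi^{-1}(t)\,\phi\big(\Phi^{-1}(t)\big)\Big| .$$
   Context: $\mathbb{S}^{p-1}=\{x\in\mathbb{R}^p:\|x\|_2=1\}$; $\mathrm{Unif}(\mathcal{H}\cap\mathbb{S}^{p-1})$ is the uniform (rotation-invariant) distribution on the unit sphere of $\mathcal{H}$. The statistic is $$T_n=\sup_{t\in[-1,1]}\Big|\frac{2}{n(n-1)}\sum_{1\le i<j\le n}\mathbf 1_{\{X_i^\top X_j\le t\}}-m(t)\Big|,$$ where $m(t)=\mathbb{P}(X^\top Y\le t)$ for $X,Y$ i.i.d. uniform on $\mathbb{S}^{p-1}$. $\Phi$ and $\phi$ are the CDF and density of the standard normal, and $\Phi^{-1}(t)\phi(\Phi^{-1}(t))$ is understood as $0$ at $t=0,1$. *)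

theory Defs
  imports "HOL-Probability.Probability" "HOL-Library.Function_Algebras"
begin

(* Pointwise scalar multiplication turns nat => real into a real vector space, so that
   the library's subspace, dim and linear apply. *)
instantiation "fun" :: (type, real_vector) real_vector
begin

definition scaleR_fun :: "real \<Rightarrow> ('a \<Rightarrow> 'b) \<Rightarrow> 'a \<Rightarrow> 'b"
  where "scaleR_fun c f = (\<lambda>x. c *\<^sub>R f x)"

instance
  by standard (simp_all add: scaleR_fun_def plus_fun_def fun_eq_iff scaleR_add_right scaleR_add_left)

end

(* The dimension p varies with n, so R^p is a set rather than a type: the vectors supported
   on the coordinates 0, ..., p - 1. *)
definition Rp :: "nat \<Rightarrow> (nat \<Rightarrow> real) set"
  where "Rp p = {x. \<forall>i\<ge>p. x i = 0}"

definition inner_p :: "nat \<Rightarrow> (nat \<Rightarrow> real) \<Rightarrow> (nat \<Rightarrow> real) \<Rightarrow> real"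
  where "inner_p p x y = (\<Sum>i<p. x i * y i)"

definition norm_p :: "nat \<Rightarrow> (nat \<Rightarrow> real) \<Rightarrow> real"
  where "norm_p p x = L2_set x {..<p}"

definition unit_sphere :: "nat \<Rightarrow> (nat \<Rightarrow> real) set"
  where "unit_sphere p = {x \<in> Rp p. norm_p p x = 1}"

(* mu = Unif(H \<inter> S^(p-1)), for a subspace H of R^p: the Borel probability measure carried
   by the unit sphere of H and invariant under all linear isometries U of H. Outside H the
   map U is unconstrained (it need not be measurable there), hence the preimages are taken
   within the sphere of H. Reflections are included, so for dim H = 1 this is the law giving
   mass 1/2 to each of the two points. *)
definition uniform_on_unit_sphere ::
    "nat \<Rightarrow> (nat \<Rightarrow> real) set \<Rightarrow> (nat \<Rightarrow> real) measure \<Rightarrow> bool"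
  where "uniform_on_unit_sphere p H \<mu> \<longleftrightarrow>
    prob_space \<mu> \<and> sets \<mu> = sets borel \<and> (AE x in \<mu>. x \<in> H \<inter> unit_sphere p) \<and>
    (\<forall>U. linear U \<and> U ` H \<subseteq> H \<and> (\<forall>x\<in>H. norm_p p (U x) = norm_p p x) \<longrightarrow>
      (\<forall>A\<in>sets borel. emeasure \<mu> {x \<in> H \<inter> unit_sphere p. U x \<in> A} = emeasure \<mu> A))"

(* P(X^T Y \<le> t) for X, Y i.i.d. with law \<nu>. *)
definition inner_cdf :: "nat \<Rightarrow> (nat \<Rightarrow> real) measure \<Rightarrow> real \<Rightarrow> real"
  where "inner_cdf p \<nu> t =
    measure (\<nu> \<Otimes>\<^sub>M \<nu>) {(x, y) \<in> space (\<nu> \<Otimes>\<^sub>M \<nu>). inner_p p x y \<le> t}"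

definition T_stat ::
    "nat \<Rightarrow> (real \<Rightarrow> real) \<Rightarrow> nat \<Rightarrow> (nat \<Rightarrow> nat \<Rightarrow> real) \<Rightarrow> real"
  where "T_stat p m n x = (SUP t\<in>{-1..1}.
    \<bar>2 / (real n * (real n - 1)) *
       (\<Sum>(i, j)\<in>{(i, j). 1 \<le> i \<and> i < j \<and> j \<le> n}. indicator {..t} (inner_p p (x i) (x j)))
     - m t\<bar>)"

definition Phi :: "real \<Rightarrow> real"
  where "Phi = cdf std_normal_distribution"

definition Phi_inv :: "real \<Rightarrow> real"
  where "Phi_inv = inv Phi"

(* Phi is a bijection onto the open interval (0,1); the product is 0 by convention at 0 and 1. *)
definition Phi_inv_phi :: "real \<Rightarrow> real"
  where "Phi_inv_phi t =
    (if 0 < t \<and> t < 1 then Phi_inv t * std_normal_density (Phi_inv t) else 0)"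

(* Normal laws, point masses (sigma = 0) included; normal_density m 0 is not a density. *)
definition normal_law :: "real \<Rightarrow> real \<Rightarrow> real measure"
  where "normal_law m \<sigma> =
    (if \<sigma> = 0 then return borel m else density lborel (\<lambda>x. ennreal (normal_density m \<sigma> x)))"

(* The centred Gaussian process on [0,1] with continuous paths and covariance min(s,t) - s t.
   Being a Gaussian process means that all finite linear combinations are normal. *)
definition standard_brownian_bridge :: "'a measure \<Rightarrow> (real \<Rightarrow> 'a \<Rightarrow> real) \<Rightarrow> bool"
  where "standard_brownian_bridge M B \<longleftrightarrow>
    prob_space M \<and>
    (\<forall>t\<in>{0..1}. B t \<in> borel_measurable M) \<and>
    (\<forall>\<omega>\<in>space M. continuous_on {0..1} (\<lambda>t. B t \<omega>)) \<and>
    (\<forall>J a. finite J \<and> J \<subseteq> {0..1} \<longrightarrow>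
      (\<exists>m \<sigma>. 0 \<le> \<sigma> \<and> distr M borel (\<lambda>\<omega>. \<Sum>t\<in>J. a t * B t \<omega>) = normal_law m \<sigma>)) \<and>
    (\<forall>t\<in>{0..1}. (\<integral>\<omega>. B t \<omega> \<partial>M) = 0) \<and>
    (\<forall>s\<in>{0..1}. \<forall>t\<in>{0..1}. (\<integral>\<omega>. B s \<omega> * B t \<omega> \<partial>M) = min s t - s * t)"

end

theory Submission
  imports Defs "HOL-Real_Asymp.Real_Asymp"
begin

text \<open>
  By rotation invariance, the law of \<open>\<langle>x, X\<rangle>\<close> for a unit vector \<open>x\<close> of \<open>H\<close> does not depend on \<open>x\<close>. Writing
  \<open>F\<close> for its distribution function, each \<open>1{\<langle>x, y\<rangle> \<le> t} - F t\<close> is therefore a completely degenerate kernel,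
  and the statistic is the supremum of a U-process \<open>\<alpha>\<close> shifted by \<open>\<surd>N (F - m)\<close>, with \<open>N = n (n - 1) / 2\<close>.

  Differentiating the invariance under plane rotations gives a Stein identity for \<open>\<langle>x, X\<rangle>\<close>, weighted by any
  bounded function of an orthogonal coordinate. It yields \<open>\<bar>F t - \<Phi> (\<surd>(k - 2) t)\<bar> \<le> 4 / k\<close>, and also the asymptotic
  independence of \<open>\<langle>x, X\<rangle>\<close> and \<open>\<langle>x', X\<rangle>\<close> for typical \<open>x, x'\<close>. The latter is what makes the conditional variances
  of the martingale \<open>m \<mapsto> \<Sum>\<^sub>i\<^sub><\<^sub>j\<^sub>\<le>\<^sub>m h (X\<^sub>i, X\<^sub>j)\<close> nearly constant, so that its characteristic function is asymptotically normal
  with the covariance \<open>F (min s t) - F s F t\<close> of the bridge at time \<open>F\<close>. Fourth moments of increments and dyadic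
  chaining, with the monotonicity of the counts at the finest scale, reduce the supremum to finite grids.

  Since \<open>m t\<close> is close to \<open>\<Phi> (\<surd>(p - 2) t)\<close> in the same way, and \<open>\<surd>N (\<surd>((p - 2) / (k - 2)) - 1)\<close> tends to \<open>\<tau> / (2 \<surd>2)\<close>, a Taylor
  expansion turns the shift into \<open>- \<tau> / (2 \<surd>2) s \<phi> (s)\<close> at \<open>\<Phi> s = F t\<close>.
\<close>

section \<open>The standard normal distribution function\<close>

text \<open>Three quantitative constraints shape the argument. The bias is multiplied by \<surd>N,
  which is of order n, and only n / k \<rightarrow> 0 is available, so the normal approximation must
  have an error of order 1 / k; a rate k^(-1/2) would be too weak. The Stein identity delivers 1 / k
  because it is exact up to the two squared coordinates that the k - 2 rotations leave out, each of
  mean 1 / k; the scale \<surd>(k - 2) has the same origin. Next, an increment of length \<delta>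
  has a fourth moment of order \<delta>^2 + \<delta> / n, whose second part does not improve enough
  on finer grids. Chaining therefore stops after O(log n) levels, when a cell has length at most 1 /
  n^2 and monotonicity of the counts takes over. Finally, finite-dimensional convergence is obtained
  for characteristic functions only, so probabilities of boxes are reached through trigonometric
  polynomials, with second moments controlling the error caused by their periodicity. All
  comparisons of distribution functions keep a gap between two radii r < r', which is closed at the
  end at continuity points of the limit.\<close>

abbreviation nphi :: "real \<Rightarrow> real" where "nphi \<equiv> std_normal_density"

lemma nphi_pos: "0 < nphi x"
  by (simp add: normal_density_pos)

lemma nphi_deriv: "(nphi has_real_derivative - x * nphi x) (at x)"
  unfolding normal_density_def
  by (auto intro!: derivative_eq_intros simp: field_simps power2_eq_square)

lemma nphi_continuous: "continuous_on A nphi"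
  using nphi_deriv by (meson DERIV_isCont continuous_at_imp_continuous_on)

lemma nphi_le: "nphi x \<le> 1/2"
proof -
  have "2 \<le> sqrt (2 * pi)" using pi_gt3 by (intro real_le_rsqrt) simp
  then have "1 / sqrt (2*pi) \<le> 1/2" by (simp add: field_simps)
  moreover have "exp (- x\<^sup>2 / 2) \<le> 1" by simp
  ultimately have "1 / sqrt (2*pi) * exp (- x\<^sup>2 / 2) \<le> 1/2 * 1" by (intro mult_mono) auto
  then show ?thesis by (simp add: normal_density_def)
qed

text \<open>The factor in brackets is the quadratic Taylor polynomial of exp (x^2/2), and the
  density times this exponential is the constant \<open>nphi 0\<close>. The bounds for the weights x
  and x^3 both come from here.\<close>

lemma nphi_exp_bound: "nphi x * (1 + x\<^sup>2/2 + x^4/8) \<le> 1"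
proof -
  have "1 + x\<^sup>2/2 + (x\<^sup>2/2)^2/2 \<le> exp (x\<^sup>2/2)"
    using exp_lower_Taylor_quadratic[of "x\<^sup>2/2"] by simp
  then have *: "1 + x\<^sup>2/2 + x^4/8 \<le> exp (x\<^sup>2/2)"
    by (simp add: power_divide)
  have "nphi x * exp (x\<^sup>2/2) = nphi 0"
    by (simp add: normal_density_def exp_minus field_simps)
  then have "nphi x * exp (x\<^sup>2/2) \<le> 1" using nphi_le[of 0] by simp
  moreover have "nphi x * (1 + x\<^sup>2/2 + x^4/8) \<le> nphi x * exp (x\<^sup>2/2)"
    using * nphi_pos[of x] by (intro mult_left_mono) auto
  ultimately show ?thesis by linarith
qed

text \<open>Both weights are dominated by multiples of the polynomial in
  \<open>nphi_exp_bound\<close>; 8 is the factor that turns x^4/8 into x^4. The first bound controls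
  the linear term of the shift, the second the remainder of a Taylor expansion, uniformly on the
  line.\<close>

lemma abs_x_nphi_le: "\<bar>x * nphi x\<bar> \<le> 1" and abs_x3_nphi_le: "\<bar>x^3 * nphi x\<bar> \<le> 8"
proof -
  have sq: "0 \<le> (\<bar>x\<bar> - 1)\<^sup>2" by simp
  have "(\<bar>x\<bar> - 1)\<^sup>2 = x\<^sup>2 - 2*\<bar>x\<bar> + 1" by (simp add: power2_eq_square algebra_simps)
  then have 1: "\<bar>x\<bar> \<le> 1/2 + x\<^sup>2/2" using sq by linarith
  have "\<bar>x\<bar> * nphi x \<le> (1 + x\<^sup>2/2 + x^4/8) * nphi x"
    using nphi_pos[of x] by (intro mult_right_mono) (auto intro: order.trans[OF 1] simp: add_increasing2)
  then have "\<bar>x\<bar> * nphi x \<le> 1" using nphi_exp_bound[of x] by (simp only: mult.commute)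
  then show "\<bar>x * nphi x\<bar> \<le> 1" using nphi_pos[of x]
    by (simp add: abs_mult)
  have "\<bar>x\<bar>^3 = x\<^sup>2 * \<bar>x\<bar>" by (simp add: power3_eq_cube power2_eq_square abs_mult)
  also have "\<dots> \<le> x\<^sup>2 * (1/2 + x\<^sup>2/2)" using 1 by (intro mult_left_mono) auto
  also have "\<dots> \<le> 8 * (1 + x\<^sup>2/2 + x^4/8)" proof -
    have "x\<^sup>2 * (1/2 + x\<^sup>2/2) = x\<^sup>2/2 + x^4/2" by (simp add: algebra_simps power4_eq_xxxx power2_eq_square)
    moreover have "0 \<le> x\<^sup>2" "0 \<le> x^4" by auto
    ultimately show ?thesis unfolding distrib_left by linarith
  qed
  finally have "\<bar>x\<bar>^3 * nphi x \<le> 8 * (1 + x\<^sup>2/2 + x^4/8) * nphi x"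
    using nphi_pos[of x] by (intro mult_right_mono) auto
  also have "\<dots> = 8 * (nphi x * (1 + x\<^sup>2/2 + x^4/8))" by (simp only: mult_ac)
  also have "\<dots> \<le> 8" using nphi_exp_bound[of x] by simp
  finally show "\<bar>x^3 * nphi x\<bar> \<le> 8" using nphi_pos[of x]
    by (simp add: abs_mult power_abs)
qed

interpretation snd: real_distribution std_normal_distribution
  by (rule real_dist_normal_dist)

lemma Phi_diff: assumes "a \<le> b" shows "Phi b - Phi a = integral {a..b} nphi"
proof (cases "a = b")
  case False
  then have ab: "a < b" using assms by simp
  have "Phi b - Phi a = measure std_normal_distribution {a<..b}"
    unfolding Phi_def using snd.cdf_diff_eq[OF ab] by simp
  also have "\<dots> = (LINT x|std_normal_distribution. indicator {a<..b} x)"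
    by simp
  also have "\<dots> = (LINT x|lborel. nphi x * indicator {a<..b} x)"
    by (subst integral_density) (auto simp: normal_density_nonneg)
  also have "\<dots> = (LINT x:{a<..b}|lborel. nphi x)"
    by (simp add: set_lebesgue_integral_def mult.commute)
  also have "\<dots> = (LINT x:{a..b}|lborel. nphi x)"
  proof (rule set_integral_cong_set)
    show "AE x in lborel. (x \<in> {a..b}) = (x \<in> {a<..b})"
      using AE_lborel_singleton[of a] by eventually_elim auto
  qed (auto simp: set_borel_measurable_def)
  also have "\<dots> = integral {a..b} nphi"
    by (intro set_borel_integral_eq_integral borel_integrable_atLeastAtMost' nphi_continuous)
  finally show ?thesis .
qed simp

lemma Phi_deriv: "(Phi has_real_derivative nphi x) (at x)"
proof -
  have "((\<lambda>u. Phi (x-1) + integral {x-1..u} nphi) has_real_derivative nphi x) (at x within {x-1..x+1})"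
    using integral_has_real_derivative[OF nphi_continuous, of x "x-1" "x+1"]
    by (auto intro!: derivative_eq_intros)
  note d = this
  have eq: "Phi (x-1) + integral {x-1..u} nphi = Phi u" if "u \<in> {x-1..x+1}" for u
    using Phi_diff[of "x-1" u] that by simp
  have "(Phi has_real_derivative nphi x) (at x within {x-1..x+1})"
    by (rule has_field_derivative_transform_within[OF d zero_less_one _ eq]) auto
  then show ?thesis by (simp add: at_within_Icc_at)
qed

lemma Phi_isCont: "isCont Phi x"
  by (rule DERIV_isCont[OF Phi_deriv])

lemma Phi_strict_mono: "x < y \<Longrightarrow> Phi x < Phi y"
  using Phi_deriv nphi_pos by (intro DERIV_pos_imp_increasing[of x y Phi]) blast+

lemma Phi_mono: "x \<le> y \<Longrightarrow> Phi x \<le> Phi y"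
  using Phi_strict_mono by (metis less_eq_real_def)

lemma Phi_at_top: "(Phi \<longlongrightarrow> 1) at_top"
  unfolding Phi_def by (rule snd.cdf_lim_at_top_prob)

lemma Phi_at_bot: "(Phi \<longlongrightarrow> 0) at_bot"
  unfolding Phi_def by (rule snd.cdf_lim_at_bot)

lemma Phi_bounds: "0 < Phi x" "Phi x < 1"
proof -
  have "0 \<le> Phi (x-1)" unfolding Phi_def by (rule snd.cdf_nonneg)
  then show "0 < Phi x" using Phi_strict_mono[of "x-1" x] by simp
  have "Phi (x+1) \<le> 1" unfolding Phi_def by (rule snd.cdf_bounded_prob)
  then show "Phi x < 1" using Phi_strict_mono[of x "x+1"] by simp
qed

lemma Phi_lipschitz: "\<bar>Phi x - Phi y\<bar> \<le> \<bar>x - y\<bar> / 2"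
proof -
  have *: "\<bar>Phi x - Phi y\<bar> \<le> \<bar>x - y\<bar> / 2" if xy: "x < y" for x y
  proof -
    obtain z where "Phi y - Phi x = (y - x) * nphi z"
      using MVT2[OF xy Phi_deriv] by blast
    moreover have "(y-x) * nphi z \<le> (y-x) * (1/2)"
      using nphi_le[of z] xy by (intro mult_left_mono) auto
    moreover have "0 \<le> (y-x) * nphi z"
      using nphi_pos[of z] xy by simp
    ultimately have "\<bar>Phi x - Phi y\<bar> \<le> (y - x) * (1/2)" by linarith
    then show ?thesis using xy by simp
  qed
  show ?thesis
  proof (cases x y rule: linorder_cases)
    case less then show ?thesis by (rule *)
  next
    case greater then show ?thesis using *[of y x] by (simp add: abs_minus_commute)
  qed simp
qed

lemma Phi_surj: assumes "0 < u" "u < 1" shows "\<exists>x. Phi x = u"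
proof -
  have "\<forall>\<^sub>F x in at_top. u < Phi x" using Phi_at_top assms by (intro order_tendstoD) auto
  then obtain b where b: "u < Phi b" by (auto simp: eventually_at_top_linorder)
  have "\<forall>\<^sub>F x in at_bot. Phi x < u" using Phi_at_bot assms by (intro order_tendstoD) auto
  then obtain a where a: "Phi a < u" by (auto simp: eventually_at_bot_linorder)
  have "a \<le> b" using a b Phi_mono[of b a] by (cases "a \<le> b") auto
  then show ?thesis using IVT[of Phi a u b] a b Phi_isCont by auto
qed

lemma Phi_inj: "inj Phi"
  by (rule injI) (metis Phi_strict_mono less_irrefl linorder_neqE)

lemma Phi_inv_Phi [simp]: "Phi_inv (Phi x) = x"
  unfolding Phi_inv_def by (rule inv_f_f[OF Phi_inj])

lemma Phi_inv_phi_Phi [simp]: "Phi_inv_phi (Phi x) = x * nphi x"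
  unfolding Phi_inv_phi_def using Phi_bounds[of x] by simp

lemma x_nphi_tendsto: "((\<lambda>x. x * nphi x) \<longlongrightarrow> 0) at_top" "((\<lambda>x. x * nphi x) \<longlongrightarrow> 0) at_bot"
proof -
  have b: "\<bar>x * nphi x\<bar> \<le> 8 / x\<^sup>2" if "x \<noteq> 0" for x
  proof -
    have "\<bar>x * nphi x\<bar> = \<bar>x^3 * nphi x\<bar> / x\<^sup>2" using that
      by (simp add: abs_mult power2_eq_square power3_eq_cube)
    then show ?thesis using abs_x3_nphi_le[of x] by (simp add: divide_right_mono)
  qed
  show "((\<lambda>x. x * nphi x) \<longlongrightarrow> 0) at_top"
  proof (rule Lim_null_comparison)
    show "\<forall>\<^sub>F x in at_top. norm (x * nphi x) \<le> 8 / x\<^sup>2"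
      using eventually_gt_at_top[of 0] by eventually_elim (rule b[folded real_norm_def], simp)
    show "((\<lambda>x::real. 8 / x\<^sup>2) \<longlongrightarrow> 0) at_top" by real_asymp
  qed
  show "((\<lambda>x. x * nphi x) \<longlongrightarrow> 0) at_bot"
  proof (rule Lim_null_comparison)
    show "\<forall>\<^sub>F x in at_bot. norm (x * nphi x) \<le> 8 / x\<^sup>2"
      using eventually_gt_at_bot[of 0] by eventually_elim (rule b[folded real_norm_def], simp)
    show "((\<lambda>x::real. 8 / x\<^sup>2) \<longlongrightarrow> 0) at_bot" by real_asymp
  qed
qed

text \<open>In the interior this is continuity of the inverse of a strictly increasing function. At
  0 and 1 the conventional value 0 is the limit of x \<open>nphi x\<close> at the two infinities,
  and strict monotonicity of \<open>Phi\<close> carries a half line in x to a neighbourhood of the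
  endpoint.\<close>

lemma Phi_inv_phi_continuous: "continuous_on {0..1} Phi_inv_phi"
proof -
  have "((\<lambda>u. Phi_inv_phi u) \<longlongrightarrow> Phi_inv_phi u) (at u within {0..1})" if u: "u \<in> {0..1}" for u
  proof -
    consider "0 < u" "u < 1" | "u = 0" | "u = 1" using u by fastforce
    then show ?thesis
    proof cases
      case 1
      then obtain x where x: "Phi x = u" using Phi_surj by auto
      have "isCont Phi_inv (Phi x)"
        by (rule isCont_inverse_function[of 1 x Phi_inv Phi]) (auto simp: Phi_isCont)
      then have "isCont Phi_inv u" by (simp add: x)
      moreover have "isCont nphi y" for y using nphi_deriv DERIV_isCont by blast
      ultimately have "isCont (\<lambda>t. Phi_inv t * nphi (Phi_inv t)) u"
        by (intro continuous_intros isCont_o2[of _ Phi_inv nphi])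
      then have "(\<lambda>t. Phi_inv t * nphi (Phi_inv t)) \<midarrow>u\<rightarrow> Phi_inv u * nphi (Phi_inv u)" by (simp add: isCont_def)
      moreover have "Phi_inv u * nphi (Phi_inv u) = Phi_inv_phi u" using 1 by (simp add: Phi_inv_phi_def)
      moreover have "\<forall>\<^sub>F t in at u. Phi_inv t * nphi (Phi_inv t) = Phi_inv_phi t"
      proof -
        have "\<forall>\<^sub>F t in at u. t \<in> {0<..<1}" using 1
          by (intro eventually_at_in_open') auto
        then show ?thesis by eventually_elim (auto simp: Phi_inv_phi_def)
      qed
      ultimately have "(Phi_inv_phi \<longlongrightarrow> Phi_inv_phi u) (at u)"
        using Lim_transform_eventually by metis
      then show ?thesis by (rule tendsto_within_subset) simp
    next
      case 2
      show ?thesis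
      proof (rule tendstoI)
        fix e :: real assume e: "0 < e"
        have "\<forall>\<^sub>F x in at_bot. dist (x * nphi x) 0 < e" using x_nphi_tendsto(2) e by (rule tendstoD)
        then obtain x0 where x0: "\<And>x. x \<le> x0 \<Longrightarrow> \<bar>x * nphi x\<bar> < e"
          by (auto simp: eventually_at_bot_linorder)
        have "\<forall>\<^sub>F t in at u. t \<in> {..<Phi x0}"
          using 2 Phi_bounds(1)[of x0] by (intro eventually_at_in_open') auto
        then have "\<forall>\<^sub>F t in at u within {0..1}. t \<in> {..<Phi x0}"
          by (rule filter_leD[OF at_le, rotated]) simp
        then show "\<forall>\<^sub>F t in at u within {0..1}. dist (Phi_inv_phi t) (Phi_inv_phi u) < e"
        proof eventually_elim
          case (elim t)
          show ?case
          proof (cases "0 < t \<and> t < 1")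
            case True
            then obtain x where "Phi x = t" using Phi_surj by auto
            moreover have "x \<le> x0" using elim calculation Phi_strict_mono[of x0 x] by (cases "x \<le> x0") auto
            ultimately show ?thesis using x0[of x] 2 by (auto simp: Phi_inv_phi_def[of 0])
          next
            case False then show ?thesis using e 2 by (auto simp: Phi_inv_phi_def)
          qed
        qed
      qed
    next
      case 3
      show ?thesis
      proof (rule tendstoI)
        fix e :: real assume e: "0 < e"
        have "\<forall>\<^sub>F x in at_top. dist (x * nphi x) 0 < e" using x_nphi_tendsto(1) e by (rule tendstoD)
        then obtain x0 where x0: "\<And>x. x0 \<le> x \<Longrightarrow> \<bar>x * nphi x\<bar> < e"
          by (auto simp: eventually_at_top_linorder)
        have "\<forall>\<^sub>F t in at u. t \<in> {Phi x0<..}"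
          using 3 Phi_bounds(2)[of x0] by (intro eventually_at_in_open') auto
        then have "\<forall>\<^sub>F t in at u within {0..1}. t \<in> {Phi x0<..}"
          by (rule filter_leD[OF at_le, rotated]) simp
        then show "\<forall>\<^sub>F t in at u within {0..1}. dist (Phi_inv_phi t) (Phi_inv_phi u) < e"
        proof eventually_elim
          case (elim t)
          show ?case
          proof (cases "0 < t \<and> t < 1")
            case True
            then obtain x where "Phi x = t" using Phi_surj by auto
            moreover have "x0 \<le> x" using elim calculation Phi_strict_mono[of x x0] by (cases "x0 \<le> x") auto
            ultimately show ?thesis using x0[of x] 3 by (auto simp: Phi_inv_phi_def[of 1])
          next
            case False then show ?thesis using e 3 by (auto simp: Phi_inv_phi_def)
          qed
        qed
      qed
    qed
  qed
  then show ?thesis by (simp add: continuous_on_def)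
qed

text \<open>The sum \<open>Phi x + Phi (- x)\<close> has derivative 0 because the density is even,
  and its limit at infinity is 1.\<close>

lemma Phi_minus: "Phi (- x) = 1 - Phi x"
proof -
  define G where "G x = Phi x + Phi (- x)" for x
  have "(G has_real_derivative 0) (at x)" for x
    unfolding G_def using Phi_deriv[of x] Phi_deriv[of "-x"]
    by (auto intro!: derivative_eq_intros DERIV_chain2[where g=uminus] simp: normal_density_def)
  then have const: "G x = G y" for x y by (intro DERIV_isconst_all allI)
  have "filterlim (\<lambda>x::real. -x) at_bot at_top" by (rule filterlim_uminus_at_bot_at_top)
  from filterlim_compose[OF Phi_at_bot this] have "((\<lambda>x. Phi (-x)) \<longlongrightarrow> 0) at_top" .
  then have "(G \<longlongrightarrow> 1 + 0) at_top" unfolding G_def by (intro tendsto_add Phi_at_top)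
  moreover have "G = (\<lambda>_. G x)" using const by auto
  then have "(G \<longlongrightarrow> G x) at_top" by (metis tendsto_const)
  ultimately have "G x = 1" using tendsto_unique[OF trivial_limit_at_top_linorder] by fastforce
  then show ?thesis by (simp add: G_def)
qed

text \<open>Mills' ratio: after division by the absolute value of x, the difference \<open>D\<close>
  of the two sides is increasing on the negative axis and vanishes at minus infinity.\<close>

lemma Phi_mills_neg: assumes "x < 0" shows "\<bar>x\<bar> * Phi x \<le> nphi x"
proof -
  define D where "D y = nphi y / (- y) - Phi y" for y
  have d: "(D has_real_derivative nphi y / y\<^sup>2) (at y)" if "y < 0" for y
    unfolding D_def using that nphi_deriv[of y] Phi_deriv[of y]
    by (auto intro!: derivative_eq_intros simp: field_simps power2_eq_square)
  have mono: "D y \<le> D x" if "y \<le> x" for y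
  proof (rule DERIV_nonneg_imp_nondecreasing[OF that])
    fix z assume "y \<le> z" "z \<le> x"
    then show "\<exists>w. (D has_real_derivative w) (at z) \<and> 0 \<le> w"
      using d[of z] assms nphi_pos[of z] by (intro exI[of _ "nphi z / z\<^sup>2"]) auto
  qed
  have "((\<lambda>y. nphi y / (- y)) \<longlongrightarrow> 0) at_bot"
  proof (rule Lim_null_comparison)
    show "\<forall>\<^sub>F y in at_bot. norm (nphi y / (- y)) \<le> 1 / \<bar>y\<bar>"
      using eventually_gt_at_bot[of 0]
    proof eventually_elim
      case (elim y)
      have "nphi y \<le> 1" using nphi_le[of y] by linarith
      then show ?case using elim nphi_pos[of y] by (simp add: abs_of_neg divide_right_mono_neg)
    qed
    show "((\<lambda>y::real. 1 / \<bar>y\<bar>) \<longlongrightarrow> 0) at_bot" by real_asymp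
  qed
  from tendsto_diff[OF this Phi_at_bot] have "(D \<longlongrightarrow> 0) at_bot" by (simp add: D_def[abs_def])
  then have "0 \<le> D x"
    by (rule tendsto_upperbound) (use mono in \<open>auto simp: eventually_at_bot_linorder\<close>)
  then show ?thesis using assms by (simp add: D_def field_simps)
qed

lemma Phi_mills_pos: assumes "0 < x" shows "x * (1 - Phi x) \<le> nphi x"
  using Phi_mills_neg[of "-x"] assms by (simp add: Phi_minus normal_density_def)

section \<open>Orthonormal systems and reflections\<close>

lemma inner_p_commute: "inner_p p x y = inner_p p y x"
  by (simp add: inner_p_def mult.commute)

lemma inner_p_add_left: "inner_p p (x + y) z = inner_p p x z + inner_p p y z"
  by (simp add: inner_p_def algebra_simps sum.distrib)

lemma inner_p_add_right: "inner_p p z (x + y) = inner_p p z x + inner_p p z y"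
  by (simp add: inner_p_def algebra_simps sum.distrib)

lemma inner_p_diff_left: "inner_p p (x - y) z = inner_p p x z - inner_p p y z"
  by (simp add: inner_p_def algebra_simps sum_subtractf)

lemma inner_p_diff_right: "inner_p p z (x - y) = inner_p p z x - inner_p p z y"
  by (simp add: inner_p_def algebra_simps sum_subtractf)

lemma inner_p_scale_left: "inner_p p (c *\<^sub>R x) z = c * inner_p p x z"
  by (simp add: inner_p_def scaleR_fun_def sum_distrib_left mult_ac)

lemma inner_p_scale_right: "inner_p p z (c *\<^sub>R x) = c * inner_p p z x"
  by (simp add: inner_p_def scaleR_fun_def sum_distrib_left mult_ac)

lemma inner_p_zero_left [simp]: "inner_p p 0 z = 0" and inner_p_zero_right [simp]: "inner_p p z 0 = 0"
  by (simp_all add: inner_p_def)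

lemma inner_p_sum_left: "inner_p p (\<Sum>i\<in>I. f i) z = (\<Sum>i\<in>I. inner_p p (f i) z)"
  by (induction I rule: infinite_finite_induct)
     (simp_all only: sum.insert sum.empty sum.infinite inner_p_zero_left inner_p_add_left not_False_eq_True)

lemma inner_p_sum_right: "inner_p p z (\<Sum>i\<in>I. f i) = (\<Sum>i\<in>I. inner_p p z (f i))"
  by (induction I rule: infinite_finite_induct)
     (simp_all only: sum.insert sum.empty sum.infinite inner_p_zero_right inner_p_add_right not_False_eq_True)

lemmas inner_p_simps = inner_p_add_left inner_p_add_right inner_p_diff_left inner_p_diff_right
  inner_p_scale_left inner_p_scale_right

lemma inner_p_nonneg: "0 \<le> inner_p p x x"
  by (simp add: inner_p_def sum_nonneg)

lemma norm_p_inner: "norm_p p x = sqrt (inner_p p x x)"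
  by (simp add: norm_p_def inner_p_def L2_set_def power2_eq_square)

lemma unit_sphere_iff: "x \<in> unit_sphere p \<longleftrightarrow> x \<in> Rp p \<and> inner_p p x x = 1"
  by (simp add: unit_sphere_def norm_p_inner)

lemma inner_p_eq_0_iff: assumes "x \<in> Rp p" shows "inner_p p x x = 0 \<longleftrightarrow> x = 0"
proof
  assume "inner_p p x x = 0"
  then have "x i = 0" if "i < p" for i using that by (simp add: inner_p_def sum_nonneg_eq_0_iff)
  then have "x i = 0" for i using assms by (cases "i < p") (auto simp: Rp_def)
  then show "x = 0" by (simp add: fun_eq_iff)
qed simp

lemma subspace_Rp: "subspace (Rp p)"
  by (auto simp: subspace_def Rp_def scaleR_fun_def)

definition orthonormal_in :: "nat \<Rightarrow> (nat \<Rightarrow> real) set \<Rightarrow> nat \<Rightarrow> (nat \<Rightarrow> nat \<Rightarrow> real) \<Rightarrow> bool" where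
  "orthonormal_in p H m e \<longleftrightarrow> (\<forall>i<m. e i \<in> H) \<and>
     (\<forall>i<m. \<forall>j<m. inner_p p (e i) (e j) = (if i = j then 1 else 0))"

definition orthonormal_basis :: "nat \<Rightarrow> (nat \<Rightarrow> real) set \<Rightarrow> nat \<Rightarrow> (nat \<Rightarrow> nat \<Rightarrow> real) \<Rightarrow> bool" where
  "orthonormal_basis p H k e \<longleftrightarrow> H \<subseteq> Rp p \<and> subspace H \<and> orthonormal_in p H k e \<and>
     (\<forall>y\<in>H. y = (\<Sum>i<k. inner_p p y (e i) *\<^sub>R e i))"

lemma orthonormal_in_inner_sum:
  assumes "orthonormal_in p H m e" "j < m"
  shows "inner_p p (\<Sum>i<m. u i *\<^sub>R e i) (e j) = u j"
proof -
  have "inner_p p (\<Sum>i<m. u i *\<^sub>R e i) (e j) = (\<Sum>i<m. if i = j then u i else 0)"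
    unfolding inner_p_sum_left using assms
    by (intro sum.cong) (auto simp: inner_p_scale_left orthonormal_in_def)
  then show ?thesis using assms by simp
qed

lemma orthonormal_in_inj: assumes "orthonormal_in p H m e" shows "inj_on e {..<m}"
proof (rule inj_onI)
  fix i j assume ij: "i \<in> {..<m}" "j \<in> {..<m}" "e i = e j"
  then have "inner_p p (e i) (e j) = 1" using assms by (auto simp: orthonormal_in_def)
  moreover have "inner_p p (e i) (e j) = (if i = j then 1 else 0)"
    using ij assms unfolding orthonormal_in_def by blast
  ultimately show "i = j" by (simp split: if_splits)
qed

lemma orthonormal_in_independent:
  assumes e: "orthonormal_in p H m e" shows "independent (e ` {..<m})"
proof
  assume "dependent (e ` {..<m})"
  then obtain u v where u: "(\<Sum>v\<in>e ` {..<m}. u v *\<^sub>R v) = 0" "v \<in> e ` {..<m}" "u v \<noteq> 0"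
    by (auto simp: real_vector.dependent_finite)
  then obtain j where j: "j < m" "v = e j" by auto
  have "(\<Sum>i<m. u (e i) *\<^sub>R e i) = 0"
    using u(1) by (simp add: sum.reindex[OF orthonormal_in_inj[OF e]])
  then have "u (e j) = 0" using orthonormal_in_inner_sum[OF e j(1), of "\<lambda>i. u (e i)"] by simp
  then show False using u j by simp
qed

text \<open>One Gram-Schmidt step: the residual \<open>r\<close> of y after projection onto the
  system is nonzero by assumption and orthogonal to the system, and its normalisation is the new
  vector.\<close>

lemma orthonormal_in_Suc:
  assumes e: "orthonormal_in p H m e" and H: "H \<subseteq> Rp p" "subspace H" and y: "y \<in> H"
    and ne: "y \<noteq> (\<Sum>i<m. inner_p p y (e i) *\<^sub>R e i)"
  shows "\<exists>v. orthonormal_in p H (Suc m) (e(m := v))"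
proof -
  define r where "r = y - (\<Sum>i<m. inner_p p y (e i) *\<^sub>R e i)"
  have rH: "r \<in> H" unfolding r_def using e H y
    by (intro subspace_diff subspace_sum subspace_scale) (auto simp: orthonormal_in_def)
  have "r \<noteq> 0" using ne by (simp add: r_def)
  then have pos: "0 < inner_p p r r" using rH H inner_p_eq_0_iff[of r p] inner_p_nonneg[of p r] by force
  have r0: "inner_p p r (e j) = 0" if "j < m" for j
    unfolding r_def inner_p_diff_left orthonormal_in_inner_sum[OF e that] by simp
  define v where "v = (1 / sqrt (inner_p p r r)) *\<^sub>R r"
  have "v \<in> H" unfolding v_def using rH H by (intro subspace_scale)
  moreover have "inner_p p v v = 1" unfolding v_def inner_p_scale_left inner_p_scale_right
    using pos by (simp add: field_simps)
  moreover have "inner_p p v (e j) = 0" "inner_p p (e j) v = 0" if "j < m" for j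
    using r0[OF that] by (simp_all add: v_def inner_p_scale_left inner_p_commute[of p "e j"])
  ultimately have "orthonormal_in p H (Suc m) (e(m := v))"
    using e by (auto simp: orthonormal_in_def less_Suc_eq)
  then show ?thesis by blast
qed

text \<open>Gram-Schmidt steps continue until the system has k members. The linear basis B supplies
  the count in both directions: an orthonormal system in H has at most k members, and one with fewer
  cannot span B.\<close>

lemma orthonormal_basis_extend:
  assumes H: "H \<subseteq> Rp p" "subspace H" and B: "finite B" "independent B" "B \<subseteq> H" "H \<subseteq> span B" "card B = k"
    and e: "orthonormal_in p H m e"
  shows "\<exists>e'. orthonormal_basis p H k e' \<and> (\<forall>i<m. e' i = e i)"
proof -
  have le: "m' \<le> k" if "orthonormal_in p H m' f" for m' f
  proof -
    have "f ` {..<m'} \<subseteq> span B" using that B by (auto simp: orthonormal_in_def)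
    from independent_span_bound[OF B(1) orthonormal_in_independent[OF that] this]
    show ?thesis using B by (simp add: card_image[OF orthonormal_in_inj[OF that]])
  qed
  have "\<exists>e'. orthonormal_in p H (m + d) e' \<and> (\<forall>i<m. e' i = e i)" if "m + d \<le> k" for d
    using that
  proof (induction d)
    case 0 then show ?case using e by auto
  next
    case (Suc d)
    then obtain e' where e': "orthonormal_in p H (m+d) e'" "\<forall>i<m. e' i = e i" by auto
    have "\<exists>y\<in>H. y \<noteq> (\<Sum>i<m+d. inner_p p y (e' i) *\<^sub>R e' i)"
    proof (rule ccontr)
      assume "\<not> ?thesis"
      then have *: "\<And>y. y \<in> H \<Longrightarrow> y = (\<Sum>i<m+d. inner_p p y (e' i) *\<^sub>R e' i)" by blast
      have "B \<subseteq> span (e' ` {..<m+d})"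
      proof
        fix y assume "y \<in> B"
        then have "y = (\<Sum>i<m+d. inner_p p y (e' i) *\<^sub>R e' i)" using * B by blast
        moreover have "(\<Sum>i<m+d. inner_p p y (e' i) *\<^sub>R e' i) \<in> span (e' ` {..<m+d})"
          by (intro span_sum span_scale span_base) auto
        ultimately show "y \<in> span (e' ` {..<m+d})" by simp
      qed
      from independent_span_bound[OF _ B(2) this] have "k \<le> card (e' ` {..<m+d})" using B by auto
      also have "\<dots> \<le> m + d" using card_image_le[of "{..<m+d}" e'] by simp
      finally show False using Suc.prems by simp
    qed
    then obtain v where "orthonormal_in p H (Suc (m+d)) (e'(m+d := v))"
      using orthonormal_in_Suc[OF e'(1) H] by blast
    moreover have "\<forall>i<m. (e'(m+d := v)) i = e i" using e'(2) by auto
    ultimately show ?case by (metis add_Suc_right)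
  qed
  from this[of "k - m"] le[OF e] obtain e' where e': "orthonormal_in p H k e'" "\<forall>i<m. e' i = e i" by auto
  have "y = (\<Sum>i<k. inner_p p y (e' i) *\<^sub>R e' i)" if yH: "y \<in> H" for y
  proof (rule ccontr)
    assume "y \<noteq> (\<Sum>i<k. inner_p p y (e' i) *\<^sub>R e' i)"
    then obtain v where "orthonormal_in p H (Suc k) (e'(k := v))"
      using orthonormal_in_Suc[OF e'(1) H yH] by blast
    from le[OF this] show False by simp
  qed
  then show ?thesis using e' H by (auto simp: orthonormal_basis_def)
qed

text \<open>Prescribed orthonormal vectors become the first members of a basis, so that inner
  products with them are the coordinates 0, 1, ... in Parseval's identity.\<close>

lemma orthonormal_basis_change:
  assumes e: "orthonormal_basis p H k e" and f: "orthonormal_in p H m f"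
  shows "\<exists>e'. orthonormal_basis p H k e' \<and> (\<forall>i<m. e' i = f i)"
proof (rule orthonormal_basis_extend[OF _ _ _ orthonormal_in_independent _ _ _ f])
  show o: "orthonormal_in p H k e" using e by (simp add: orthonormal_basis_def)
  show "e ` {..<k} \<subseteq> H" using o by (auto simp: orthonormal_in_def)
  show "card (e ` {..<k}) = k" by (simp add: card_image[OF orthonormal_in_inj[OF o]])
  show "H \<subseteq> span (e ` {..<k})"
  proof
    fix y assume "y \<in> H"
    then have "y = (\<Sum>i<k. inner_p p y (e i) *\<^sub>R e i)" using e by (auto simp: orthonormal_basis_def)
    moreover have "(\<Sum>i<k. inner_p p y (e i) *\<^sub>R e i) \<in> span (e ` {..<k})"
      by (intro span_sum span_scale span_base) auto
    ultimately show "y \<in> span (e ` {..<k})" by simp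
  qed
qed (use e in \<open>auto simp: orthonormal_basis_def\<close>)

lemma orthonormal_basis_exists:
  assumes H: "H \<subseteq> Rp p" "subspace H" "dim H = k" "1 \<le> k"
  shows "\<exists>e. orthonormal_basis p H k e"
proof -
  obtain B where B: "B \<subseteq> H" "independent B" "H \<subseteq> span B" "card B = dim H"
    by (rule basis_exists)
  have "finite B" using B H by (intro card_ge_0_finite) simp
  then show ?thesis
    using orthonormal_basis_extend[OF H(1,2) _ B(2,1,3), of k 0 undefined] B H by (auto simp: orthonormal_in_def)
qed

lemma sum_apply: "(\<Sum>i\<in>I. f i) x = (\<Sum>i\<in>I. (f i :: 'a \<Rightarrow> real) x)"
  by (induction I rule: infinite_finite_induct) auto

lemma orthonormal_basis_Rp: "\<exists>e. orthonormal_basis p (Rp p) p e"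
proof -
  define e where "e i = (\<lambda>j. if j = i then 1 else 0 :: real)" for i :: nat
  have e_app: "e i j = (if j = i then 1 else 0)" for i j by (simp add: e_def)
  have ip: "inner_p p y (e i) = y i" if "i < p" for y i
    using that by (simp add: inner_p_def e_def if_distrib cong: if_cong)
  have "y = (\<Sum>i<p. inner_p p y (e i) *\<^sub>R e i)" if y: "y \<in> Rp p" for y
  proof
    fix j
    have "(\<Sum>i<p. inner_p p y (e i) *\<^sub>R e i) j = (\<Sum>i<p. (inner_p p y (e i) *\<^sub>R e i) j)"
      by (rule sum_apply)
    also have "\<dots> = (\<Sum>i<p. if i = j then y i else 0)"
      by (intro sum.cong) (auto simp: ip scaleR_fun_def e_app)
    also have "\<dots> = y j" using y by (auto simp: Rp_def)
    finally show "y j = (\<Sum>i<p. inner_p p y (e i) *\<^sub>R e i) j" ..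
  qed
  moreover have "orthonormal_in p (Rp p) p e"
    by (auto simp: orthonormal_in_def ip) (auto simp: e_def Rp_def)
  ultimately show ?thesis by (auto simp: orthonormal_basis_def subspace_Rp)
qed

lemma parseval:
  assumes e: "orthonormal_basis p H k e" and y: "y \<in> H"
  shows "inner_p p x y = (\<Sum>i<k. inner_p p x (e i) * inner_p p y (e i))"
proof -
  have "y = (\<Sum>i<k. inner_p p y (e i) *\<^sub>R e i)" using e y by (auto simp: orthonormal_basis_def)
  then have "inner_p p x y = inner_p p x (\<Sum>i<k. inner_p p y (e i) *\<^sub>R e i)" by simp
  then show ?thesis by (simp add: inner_p_sum_right inner_p_scale_right mult.commute)
qed

lemma inner_p_Cauchy_Schwarz: "(inner_p p x y)\<^sup>2 \<le> inner_p p x x * inner_p p y y"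
proof -
  have "(\<Sum>i<p. x i * y i)\<^sup>2 \<le> (\<Sum>i<p. (x i)\<^sup>2) * (\<Sum>i<p. (y i)\<^sup>2)"
    by (rule Cauchy_Schwarz_ineq_sum)
  then show ?thesis by (simp add: inner_p_def power2_eq_square)
qed

lemma inner_p_abs_le_1:
  assumes "inner_p p x x = 1" "inner_p p y y = 1" shows "\<bar>inner_p p x y\<bar> \<le> 1"
  using inner_p_Cauchy_Schwarz[of p x y] assms by (simp add: abs_square_le_1)

text \<open>The Householder reflection along \<open>x - x'\<close> exchanges the two unit vectors.
  It is given by its vector and coefficient, so that linearity, measurability and stability of H can
  be read off the formula.\<close>

lemma reflection_exists:
  assumes H: "subspace H" "H \<subseteq> Rp p" and x: "x \<in> H \<inter> unit_sphere p" and x': "x' \<in> H \<inter> unit_sphere p"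
  shows "\<exists>w c. w \<in> H \<and> (let U = (\<lambda>y. y - (c * inner_p p y w) *\<^sub>R w) in
    (\<forall>y. inner_p p (U y) (U y) = inner_p p y y) \<and> (\<forall>y. inner_p p x' (U y) = inner_p p x y))"
proof -
  define w where "w = x - x'"
  \<comment> \<open>For x = x' the vector w is 0 and the map is the identity, whatever the
    coefficient; otherwise c times the squared length of w is 2.\<close>
  define c where "c = 2 / inner_p p w w"
  have ww: "inner_p p w w = 2 - 2 * inner_p p x x'" and xw: "inner_p p x' w = inner_p p x x' - 1"
    using x x' by (simp_all add: w_def inner_p_simps unit_sphere_iff inner_p_commute[of p x' x])
  have cw: "c * inner_p p w w = 2 \<or> w = 0"
  proof -
    have "w \<in> Rp p" using x x' H subspace_diff[OF H(1), of x x'] by (auto simp: w_def)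
    then show ?thesis using inner_p_eq_0_iff[of w p] by (auto simp: c_def)
  qed
  have "inner_p p (y - (c * inner_p p y w) *\<^sub>R w) (y - (c * inner_p p y w) *\<^sub>R w) = inner_p p y y" for y
  proof -
    have "inner_p p (y - (c * inner_p p y w) *\<^sub>R w) (y - (c * inner_p p y w) *\<^sub>R w)
       = inner_p p y y - 2 * c * (inner_p p y w)\<^sup>2 + c * (inner_p p y w)\<^sup>2 * (c * inner_p p w w)"
      by (simp add: inner_p_simps inner_p_commute[of p w y] power2_eq_square algebra_simps)
    then show ?thesis using cw by (auto simp: power2_eq_square)
  qed
  moreover have "inner_p p x' (y - (c * inner_p p y w) *\<^sub>R w) = inner_p p x y" for y
  proof -
    have "inner_p p x' (y - (c * inner_p p y w) *\<^sub>R w) = inner_p p x' y - c * inner_p p y w * inner_p p x' w"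
      by (simp add: inner_p_simps)
    also have "inner_p p x' w = - inner_p p w w / 2" using ww xw by simp
    also have "inner_p p x' y - c * inner_p p y w * (- inner_p p w w / 2)
       = inner_p p x' y + (c * inner_p p w w) * inner_p p y w / 2" by simp
    also have "\<dots> = inner_p p x' y + inner_p p y w" using cw by auto
    also have "\<dots> = inner_p p x y" by (simp add: w_def inner_p_simps inner_p_commute[of p y])
    finally show ?thesis .
  qed
  moreover have "w \<in> H" using x x' H by (auto simp: w_def intro: subspace_diff)
  ultimately show ?thesis by (auto simp: Let_def)
qed

section \<open>The uniform law on a sphere\<close>

lemma inner_p_measurable [measurable (raw)]:
  fixes f g :: "'a \<Rightarrow> nat \<Rightarrow> real"
  assumes [measurable]: "f \<in> borel_measurable M" "g \<in> borel_measurable M"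
  shows "(\<lambda>x. inner_p p (f x) (g x)) \<in> borel_measurable M"
  unfolding inner_p_def
  by (intro borel_measurable_sum borel_measurable_times measurable_product_then_coordinatewise[OF assms(1)]
      measurable_product_then_coordinatewise[OF assms(2)])

text \<open>The orthonormal basis of length k encodes that H is a k-dimensional subspace of R^p. The
  locale is used for the given subspace and also for R^p itself with k = p, where it governs the
  centring m.\<close>

locale unit_sphere_law = prob_space \<mu> for \<mu> :: "(nat \<Rightarrow> real) measure" +
  fixes p k :: nat and H :: "(nat \<Rightarrow> real) set"
  assumes unif: "uniform_on_unit_sphere p H \<mu>" and basis: "\<exists>e. orthonormal_basis p H k e"
begin

abbreviation "ip \<equiv> inner_p p"

definition S :: "(nat \<Rightarrow> real) set" where "S = H \<inter> unit_sphere p"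

lemma sets_mu [measurable_cong, simp]: "sets \<mu> = sets borel"
  using unif by (simp add: uniform_on_unit_sphere_def)

lemma space_mu [simp]: "space \<mu> = UNIV"
  using sets_eq_imp_space_eq[OF sets_mu] by simp

lemma AE_S: "AE x in \<mu>. x \<in> S"
  using unif by (simp add: uniform_on_unit_sphere_def S_def)

lemma H_props: "H \<subseteq> Rp p" "subspace H"
  using basis by (auto simp: orthonormal_basis_def)

lemma S_props: "x \<in> S \<Longrightarrow> x \<in> H" "x \<in> S \<Longrightarrow> ip x x = 1"
  by (auto simp: S_def unit_sphere_iff)

lemma S_I: "x \<in> H \<Longrightarrow> ip x x = 1 \<Longrightarrow> x \<in> S"
  using H_props by (auto simp: S_def unit_sphere_iff)

lemma basis_S: "orthonormal_basis p H k e \<Longrightarrow> i < k \<Longrightarrow> e i \<in> S"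
  by (auto simp: orthonormal_basis_def orthonormal_in_def intro: S_I)

lemma basis_ip: "orthonormal_basis p H k e \<Longrightarrow> i < k \<Longrightarrow> j < k \<Longrightarrow> ip (e i) (e j) = (if i = j then 1 else 0)"
  by (auto simp: orthonormal_basis_def orthonormal_in_def)

lemma S_abs_le: "x \<in> S \<Longrightarrow> y \<in> S \<Longrightarrow> \<bar>ip x y\<bar> \<le> 1"
  by (intro inner_p_abs_le_1) (auto simp: S_props)

text \<open>Through the basis expansion, membership in H becomes a countable family of coordinate
  equations, each of them Borel.\<close>

lemma S_measurable [measurable]: "S \<in> sets borel"
proof -
  obtain e where e: "orthonormal_basis p H k e" using basis by blast
  have iff: "y \<in> H \<longleftrightarrow> (\<forall>m. y m = (\<Sum>i<k. ip y (e i) * e i m))" for y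
  proof -
    have "y \<in> H \<longleftrightarrow> y = (\<Sum>i<k. ip y (e i) *\<^sub>R e i)"
    proof
      assume "y = (\<Sum>i<k. ip y (e i) *\<^sub>R e i)"
      moreover have "(\<Sum>i<k. ip y (e i) *\<^sub>R e i) \<in> H"
        using H_props(2) S_props(1)[OF basis_S[OF e]] by (intro subspace_sum subspace_scale) auto
      ultimately show "y \<in> H" by simp
    qed (use e in \<open>auto simp: orthonormal_basis_def\<close>)
    then show ?thesis by (simp add: fun_eq_iff sum_apply scaleR_fun_def)
  qed
  have [measurable]: "(\<lambda>x::nat \<Rightarrow> real. x m) \<in> borel_measurable borel" for m
    by (rule measurable_product_coordinates)
  have [measurable]: "(\<lambda>x. ip x w) \<in> borel_measurable borel" "(\<lambda>x. ip x x) \<in> borel_measurable borel" for w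
    by (intro inner_p_measurable; simp)+
  have "y \<in> S \<longleftrightarrow> (\<forall>m. y m = (\<Sum>i<k. ip y (e i) * e i m)) \<and> ip y y = 1" for y
    using iff[of y] S_I[of y] S_props[of y] by blast
  then have "S = (\<Inter>m. {y \<in> space borel. y m = (\<Sum>i<k. ip y (e i) * e i m)}) \<inter> {y \<in> space borel. ip y y = 1}"
    by auto
  also have "\<dots> \<in> sets borel"
    by (intro sets.Int sets.countable_INT'' measurable_equality_set borel_measurable_sum borel_measurable_times) auto
  finally show ?thesis .
qed

text \<open>The definition of uniformity speaks of preimages inside the sphere. For a measurable
  isometry the full preimage differs from that set by a null set, so the image law is the law
  itself.\<close>

lemma distr_invariant:
  assumes U: "linear U" "U \<in> borel_measurable borel" "U ` H \<subseteq> H" "\<And>y. y \<in> H \<Longrightarrow> ip (U y) (U y) = ip y y"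
  shows "distr \<mu> borel U = \<mu>"
proof (rule measure_eqI)
  note [measurable] = U(2)
  fix A assume "A \<in> sets (distr \<mu> borel U)"
  then have [measurable]: "A \<in> sets borel" by simp
  have "emeasure (distr \<mu> borel U) A = emeasure \<mu> (U -` A \<inter> space \<mu>)"
    by (rule emeasure_distr) (use U(2) in \<open>auto simp: measurable_cong_sets[OF sets_mu refl]\<close>)
  also have "\<dots> = emeasure \<mu> {x \<in> S. U x \<in> A}"
  proof (rule emeasure_eq_AE)
    show "AE x in \<mu>. (x \<in> U -` A \<inter> space \<mu>) = (x \<in> {x \<in> S. U x \<in> A})"
      using AE_S by eventually_elim auto
    have "{x \<in> space borel. U x \<in> A} \<in> sets borel" by measurable
    then show "U -` A \<inter> space \<mu> \<in> sets \<mu>" by (simp add: vimage_def)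
    have "{x \<in> space borel. x \<in> S \<and> U x \<in> A} \<in> sets borel" by measurable
    then show "{x \<in> S. U x \<in> A} \<in> sets \<mu>" by simp
  qed
  also have "\<dots> = emeasure \<mu> A"
    using unif U by (auto simp: uniform_on_unit_sphere_def norm_p_inner S_def)
  finally show "emeasure (distr \<mu> borel U) A = emeasure \<mu> A" .
qed simp

lemma integral_invariant:
  fixes \<phi> :: "(nat \<Rightarrow> real) \<Rightarrow> real"
  assumes U: "linear U" "U \<in> borel_measurable borel" "U ` H \<subseteq> H" "\<And>y. y \<in> H \<Longrightarrow> ip (U y) (U y) = ip y y"
    and \<phi>: "\<phi> \<in> borel_measurable borel"
  shows "(\<integral>y. \<phi> (U y) \<partial>\<mu>) = (\<integral>y. \<phi> y \<partial>\<mu>)"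
proof -
  have "(\<integral>y. \<phi> y \<partial>\<mu>) = (\<integral>y. \<phi> y \<partial>(distr \<mu> borel U))" by (simp add: distr_invariant[OF U])
  also have "\<dots> = (\<integral>y. \<phi> (U y) \<partial>\<mu>)"
    by (rule integral_distr) (use U \<phi> in \<open>auto simp: measurable_cong_sets[OF sets_mu refl]\<close>)
  finally show ?thesis ..
qed

text \<open>Reflections and plane rotations both have this form: the identity plus a displacement
  along at most two fixed vectors.\<close>

lemma measurable_affine: "(\<lambda>y. y + ((a::(nat\<Rightarrow>real) \<Rightarrow> real) y) *\<^sub>R w + b y *\<^sub>R v) \<in> borel_measurable borel"
  if [measurable]: "a \<in> borel_measurable borel" "b \<in> borel_measurable borel"
proof (rule measurable_coordinatewise_then_product)
  have [measurable]: "(\<lambda>x::nat \<Rightarrow> real. x m) \<in> borel_measurable borel" for m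
    by (rule measurable_product_coordinates)
  show "(\<lambda>x. (x + a x *\<^sub>R w + b x *\<^sub>R v) i) \<in> borel_measurable borel" for i
    by (simp add: scaleR_fun_def)
qed

text \<open>The reflection exchanging x and x' preserves the law of the random vector and turns one
  inner product into the other.\<close>

lemma law_const:
  assumes x: "x \<in> S" and x': "x' \<in> S"
  shows "distr \<mu> borel (ip x) = distr \<mu> borel (ip x')"
proof -
  obtain w c where w: "w \<in> H" and
    U1: "\<And>y. ip (y - (c * ip y w) *\<^sub>R w) (y - (c * ip y w) *\<^sub>R w) = ip y y" and
    U2: "\<And>y. ip x' (y - (c * ip y w) *\<^sub>R w) = ip x y"
    using reflection_exists[OF H_props(2,1) x[unfolded S_def] x'[unfolded S_def]]
    unfolding Let_def by blast
  define U where "U = (\<lambda>y. y - (c * ip y w) *\<^sub>R w)"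
  have lin: "linear U"
    by (rule linearI) (simp_all add: U_def inner_p_simps algebra_simps)
  have "U = (\<lambda>y. y + (- (c * ip y w)) *\<^sub>R w + 0 *\<^sub>R w)" by (simp add: U_def fun_eq_iff scaleR_fun_def)
  then have meas [measurable]: "U \<in> borel_measurable borel" using measurable_affine[of "\<lambda>y. - (c * ip y w)" "\<lambda>_. 0" w w] by simp
  have UH: "U ` H \<subseteq> H" using H_props w by (auto simp: U_def intro!: subspace_diff subspace_scale)
  have "distr \<mu> borel U = \<mu>" by (rule distr_invariant[OF lin meas UH]) (simp only: U_def U1)
  then have "distr \<mu> borel (ip x') = distr (distr \<mu> borel U) borel (ip x')" by simp
  also have "\<dots> = distr \<mu> borel (ip x' \<circ> U)" by (rule distr_distr) measurable
  also have "ip x' \<circ> U = ip x" by (simp add: fun_eq_iff U_def U2)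
  finally show ?thesis ..
qed

lemma integral_law_const:
  fixes \<phi> :: "real \<Rightarrow> real"
  assumes "x \<in> S" "x' \<in> S" and [measurable]: "\<phi> \<in> borel_measurable borel"
  shows "(\<integral>y. \<phi> (ip x y) \<partial>\<mu>) = (\<integral>y. \<phi> (ip x' y) \<partial>\<mu>)"
proof -
  have "(\<integral>y. \<phi> (ip x y) \<partial>\<mu>) = integral\<^sup>L (distr \<mu> borel (ip x)) \<phi>" if "x \<in> S" for x
    by (rule integral_distr[symmetric]) measurable
  then show ?thesis using assms law_const[of x x'] by simp
qed

lemma integrable_bounded:
  fixes f :: "(nat \<Rightarrow> real) \<Rightarrow> real"
  assumes "f \<in> borel_measurable borel" "\<And>y. y \<in> S \<Longrightarrow> \<bar>f y\<bar> \<le> C" shows "integrable \<mu> f"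
proof (rule integrable_const_bound[of _ C])
  show "AE x in \<mu>. norm (f x) \<le> C" using AE_S by eventually_elim (use assms(2) in auto)
qed (use assms(1) in \<open>simp add: measurable_cong_sets[OF sets_mu refl]\<close>)

text \<open>In a basis starting with a, the k squared coordinates have equal expectations by
  \<open>law_const\<close> and sum to 1 almost surely.\<close>

lemma second_moment_unit: assumes a: "a \<in> S" and k: "1 \<le> k" shows "(\<integral>y. (ip a y)\<^sup>2 \<partial>\<mu>) = 1 / real k"
proof -
  obtain e0 where e0: "orthonormal_basis p H k e0" using basis by blast
  have "orthonormal_in p H 1 (\<lambda>_. a)" using S_props[OF a] by (simp add: orthonormal_in_def)
  from orthonormal_basis_change[OF e0 this] obtain e where e: "orthonormal_basis p H k e" "e 0 = a"
    using zero_less_one by blast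
  have int: "integrable \<mu> (\<lambda>y. (ip (e i) y)\<^sup>2)" if "i < k" for i
  proof (rule integrable_bounded[of _ 1])
    fix y assume "y \<in> S"
    then show "\<bar>(ip (e i) y)\<^sup>2\<bar> \<le> 1" using S_abs_le[OF basis_S[OF e(1) that]] by (simp add: abs_square_le_1)
  qed measurable
  have "1 = (\<integral>y. (1::real) \<partial>\<mu>)" using prob_space by simp
  also have "\<dots> = (\<integral>y. (\<Sum>i<k. (ip (e i) y)\<^sup>2) \<partial>\<mu>)"
  proof (rule integral_cong_AE)
    show "AE y in \<mu>. 1 = (\<Sum>i<k. (ip (e i) y)\<^sup>2)"
      using AE_S
    proof eventually_elim
      case (elim y)
      have "ip y y = (\<Sum>i<k. (ip (e i) y)\<^sup>2)"
        unfolding parseval[OF e(1) S_props(1)[OF elim], of y]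
        by (intro sum.cong refl) (simp add: power2_eq_square inner_p_commute[of p y "e _"])
      then show ?case using S_props(2)[OF elim] by simp
    qed
  qed measurable
  also have "\<dots> = (\<Sum>i<k. \<integral>y. (ip (e i) y)\<^sup>2 \<partial>\<mu>)" by (intro Bochner_Integration.integral_sum int) auto
  also have "\<dots> = (\<Sum>i<k. \<integral>y. (ip a y)\<^sup>2 \<partial>\<mu>)"
    by (intro sum.cong refl integral_law_const[of _ _ power2] basis_S[OF e(1)] a) auto
  finally show ?thesis using k by (simp add: field_simps)
qed

lemma second_moment: assumes v: "v \<in> H" and k: "1 \<le> k" shows "(\<integral>y. (ip v y)\<^sup>2 \<partial>\<mu>) = ip v v / real k"
proof (cases "v = 0")
  case False
  then have pos: "0 < ip v v" using v H_props inner_p_eq_0_iff[of v p] inner_p_nonneg[of p v] by force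
  define a where "a = (1 / sqrt (ip v v)) *\<^sub>R v"
  have a: "a \<in> S" using pos v H_props
    by (intro S_I) (auto simp: a_def inner_p_scale_left inner_p_scale_right intro: subspace_scale)
  have "(ip v y)\<^sup>2 = ip v v * (ip a y)\<^sup>2" for y
    using pos by (simp add: a_def inner_p_scale_left power_divide)
  then show ?thesis using second_moment_unit[OF a k] by simp
qed simp

text \<open>The derivative at angle 0 of the invariance under rotations of the plane of \<open>a\<close> and \<open>b\<close>.\<close>
lemma rotation_identity:
  fixes f f' G :: "real \<Rightarrow> real"
  assumes ab: "a \<in> S" "b \<in> S" "ip a b = 0" and w: "ip w a = 0" "ip w b = 0"
    and [measurable]: "G \<in> borel_measurable borel" "f \<in> borel_measurable borel" "f' \<in> borel_measurable borel"
    and G: "\<And>x. \<bar>G x\<bar> \<le> 1" and C: "\<And>x y. \<bar>f x - f y\<bar> \<le> C * \<bar>x - y\<bar>"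
    and deriv: "AE y in \<mu>. (f has_real_derivative f' (ip a y)) (at (ip a y))"
  shows "(\<integral>y. G (ip w y) * (f' (ip a y) * (ip b y)\<^sup>2 - ip a y * f (ip a y)) \<partial>\<mu>) = 0"
proof -
  \<comment> \<open>Rotation by \<theta> in the plane of a and b, written as the identity plus a
    correction inside that plane; hence it leaves the inner product with w unchanged.\<close>
  define U where "U \<theta> = (\<lambda>y. y + ((cos \<theta> - 1) * ip a y - sin \<theta> * ip b y) *\<^sub>R a
      + (sin \<theta> * ip a y + (cos \<theta> - 1) * ip b y) *\<^sub>R b)" for \<theta> :: real
  have aa: "ip a a = 1" "ip b b = 1" "ip b a = 0"
    using ab S_props(2)[of a] S_props(2)[of b] by (simp_all add: inner_p_commute[of p b a])
  have aU: "ip a (U \<theta> y) = cos \<theta> * ip a y - sin \<theta> * ip b y" for \<theta> y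
    using aa ab by (simp add: U_def inner_p_simps algebra_simps)
  have bU: "ip b (U \<theta> y) = sin \<theta> * ip a y + cos \<theta> * ip b y" for \<theta> y
    using aa ab by (simp add: U_def inner_p_simps algebra_simps)
  have wU: "ip w (U \<theta> y) = ip w y" for \<theta> y
    using w by (simp add: U_def inner_p_simps)
  have lin: "linear (U \<theta>)" for \<theta>
    by (rule linearI) (simp_all add: U_def inner_p_simps algebra_simps)
  have meas [measurable]: "U \<theta> \<in> borel_measurable borel" for \<theta>
    unfolding U_def by (rule measurable_affine) measurable
  have UH: "U \<theta> ` H \<subseteq> H" for \<theta>
    using H_props ab S_props by (auto simp: U_def intro!: subspace_add subspace_scale)
  have iso: "ip (U \<theta> y) (U \<theta> y) = ip y y" for \<theta> y
  proof -
    let ?u = "(cos \<theta> - 1) * ip a y - sin \<theta> * ip b y" and ?v = "sin \<theta> * ip a y + (cos \<theta> - 1) * ip b y"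
    have "ip (U \<theta> y) (U \<theta> y) = ip y (U \<theta> y) + ?u * ip a (U \<theta> y) + ?v * ip b (U \<theta> y)"
      by (simp only: U_def inner_p_add_left inner_p_scale_left)
    also have "ip y (U \<theta> y) = ip y y + ?u * ip a y + ?v * ip b y"
      by (simp add: U_def inner_p_add_right inner_p_scale_right inner_p_commute[of p y a] inner_p_commute[of p y b])
    also have "ip y y + ?u * ip a y + ?v * ip b y + ?u * ip a (U \<theta> y) + ?v * ip b (U \<theta> y)
      = ip y y + ((ip a y)\<^sup>2 + (ip b y)\<^sup>2) * ((cos \<theta>)\<^sup>2 + (sin \<theta>)\<^sup>2 - 1)"
      unfolding aU bU by algebra
    finally show ?thesis by simp
  qed
  \<comment> \<open>The difference quotient in the angle of
    \<open>G (ip w y) * f (ip a y) * ip b y\<close>. Invariance makes its integral vanish for every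
    angle, and \<open>L\<close> is its pointwise limit at angle 0.\<close>
  define g where "g \<theta> y = G (ip w y) * (f (cos \<theta> * ip a y - sin \<theta> * ip b y) * (sin \<theta> * ip a y + cos \<theta> * ip b y)
      - f (ip a y) * ip b y) / \<theta>" for \<theta> y
  define L where "L y = G (ip w y) * (f (ip a y) * ip a y - f' (ip a y) * (ip b y)\<^sup>2)" for y
  define K where "K = \<bar>f 0\<bar> + C"
  have C0: "0 \<le> C" using C[of 1 0] by simp
  have fK: "\<bar>f x\<bar> \<le> \<bar>f 0\<bar> + C * \<bar>x\<bar>" for x using C[of x 0] by simp
  have fK1: "\<bar>f x\<bar> \<le> K" if "\<bar>x\<bar> \<le> 1" for x
    using fK[of x] mult_left_mono[OF that C0] by (simp add: K_def)
  have fK2: "\<bar>f x\<bar> \<le> \<bar>f 0\<bar> + C * 2" if "\<bar>x\<bar> \<le> 2" for x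
    using fK[of x] mult_left_mono[OF that C0] by simp
  have tri: "\<bar>s * x + t * y\<bar> \<le> \<bar>s\<bar> + \<bar>t\<bar>" "\<bar>s * x - t * y\<bar> \<le> \<bar>s\<bar> + \<bar>t\<bar>" if "\<bar>x\<bar> \<le> 1" "\<bar>y\<bar> \<le> 1" for s t x y :: real
  proof -
    have "\<bar>s * x\<bar> \<le> \<bar>s\<bar>" "\<bar>t * y\<bar> \<le> \<bar>t\<bar>" using that by (simp_all add: abs_mult mult_left_le)
    then show "\<bar>s * x + t * y\<bar> \<le> \<bar>s\<bar> + \<bar>t\<bar>" "\<bar>s * x - t * y\<bar> \<le> \<bar>s\<bar> + \<bar>t\<bar>" by linarith+
  qed
  have int0: "(\<integral>y. g \<theta> y \<partial>\<mu>) = 0" for \<theta>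
  proof -
    define \<phi> where "\<phi> y = G (ip w y) * f (ip a y) * ip b y" for y
    have [measurable]: "\<phi> \<in> borel_measurable borel" unfolding \<phi>_def by measurable
    have i1: "integrable \<mu> \<phi>"
    proof (rule integrable_bounded[of _ K])
      fix y assume y: "y \<in> S"
      have "\<bar>\<phi> y\<bar> \<le> 1 * K * 1" unfolding \<phi>_def abs_mult
        using G fK1[OF S_abs_le[OF ab(1) y]] S_abs_le[OF ab(2) y] by (intro mult_mono) auto
      then show "\<bar>\<phi> y\<bar> \<le> K" by simp
    qed measurable
    have i2: "integrable \<mu> (\<lambda>y. \<phi> (U \<theta> y))"
      using i1 distr_invariant[OF lin meas UH iso] integrable_distr_eq[of "U \<theta>" \<mu> borel \<phi>]
      by (simp add: measurable_cong_sets[OF sets_mu refl])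
    have "g \<theta> y = (\<phi> (U \<theta> y) - \<phi> y) / \<theta>" for y
      by (simp add: g_def \<phi>_def wU aU bU algebra_simps)
    then have "(\<integral>y. g \<theta> y \<partial>\<mu>) = (\<integral>y. \<phi> (U \<theta> y) - \<phi> y \<partial>\<mu>) / \<theta>" by simp
    also have "\<dots> = 0" using i1 i2 integral_invariant[OF lin meas UH iso, of \<phi>] by simp
    finally show ?thesis .
  qed
  \<comment> \<open>The angles 1, 1/2, 1/3, ... suffice for the limit; the Lipschitz bound on f
    dominates the quotients uniformly.\<close>
  have "(\<lambda>m. \<integral>y. g (1 / real (Suc m)) y \<partial>\<mu>) \<longlonglongrightarrow> (\<integral>y. L y \<partial>\<mu>)"
  proof (rule integral_dominated_convergence[where w="\<lambda>_. C * 2 * 2 + K * 2"])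
    show "L \<in> borel_measurable \<mu>" unfolding L_def by measurable
    show "g (1 / real (Suc m)) \<in> borel_measurable \<mu>" for m unfolding g_def by measurable
    show "AE y in \<mu>. norm (g (1 / real (Suc m)) y) \<le> C * 2 * 2 + K * 2" for m
      using AE_S
    proof eventually_elim
      case (elim y)
      define \<theta> where "\<theta> = 1 / real (Suc m)"
      have \<theta>: "0 < \<theta>" "\<theta> \<le> 1" by (auto simp: \<theta>_def)
      let ?x = "ip a y" and ?z = "ip b y"
      have x: "\<bar>?x\<bar> \<le> 1" "\<bar>?z\<bar> \<le> 1" using S_abs_le ab elim by auto
      have s: "\<bar>sin \<theta>\<bar> \<le> \<theta>" using abs_sin_x_le_abs_x[of \<theta>] \<theta> by simp
      have c: "\<bar>cos \<theta> - 1\<bar> \<le> \<theta>"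
      proof -
        have e: "cos \<theta> - 1 = - (2 * (sin (\<theta>/2))\<^sup>2)" using cos_double_sin[of "\<theta>/2"] by simp
        have "(sin (\<theta>/2))\<^sup>2 = \<bar>sin (\<theta>/2)\<bar> * \<bar>sin (\<theta>/2)\<bar>" by (simp add: power2_eq_square)
        also have "\<dots> \<le> \<bar>\<theta>/2\<bar> * 1" by (intro mult_mono abs_sin_x_le_abs_x) auto
        finally show ?thesis unfolding e using \<theta> by simp
      qed
      have sc: "\<bar>sin \<theta>\<bar> \<le> 1" "\<bar>cos \<theta>\<bar> \<le> 1" by auto
      let ?u = "cos \<theta> * ?x - sin \<theta> * ?z" and ?v = "sin \<theta> * ?x + cos \<theta> * ?z"
      have "?u - ?x = (cos \<theta> - 1) * ?x - sin \<theta> * ?z" by (simp add: algebra_simps)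
      then have u: "\<bar>?u - ?x\<bar> \<le> 2 * \<theta>" using tri(2)[OF x, of "cos \<theta> - 1" "sin \<theta>"] s c by simp
      have "?v - ?z = sin \<theta> * ?x + (cos \<theta> - 1) * ?z" by (simp add: algebra_simps)
      then have v: "\<bar>?v - ?z\<bar> \<le> 2 * \<theta>" using tri(1)[OF x, of "sin \<theta>" "cos \<theta> - 1"] s c by simp
      have v2: "\<bar>?v\<bar> \<le> 2" using tri(1)[OF x, of "sin \<theta>" "cos \<theta>"] sc by linarith
      have "f ?u * ?v - f ?x * ?z = (f ?u - f ?x) * ?v + f ?x * (?v - ?z)" by (simp add: algebra_simps)
      then have "\<bar>f ?u * ?v - f ?x * ?z\<bar> \<le> \<bar>f ?u - f ?x\<bar> * \<bar>?v\<bar> + \<bar>f ?x\<bar> * \<bar>?v - ?z\<bar>"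
        by (metis abs_mult abs_triangle_ineq)
      also have "\<dots> \<le> (C * (2 * \<theta>)) * 2 + K * (2 * \<theta>)"
      proof (intro add_mono mult_mono)
        show "\<bar>f ?u - f ?x\<bar> \<le> C * (2 * \<theta>)" using C[of ?u ?x] mult_left_mono[OF u C0] by linarith
        show "0 \<le> C * (2 * \<theta>)" "0 \<le> K" using C0 \<theta> by (auto simp: K_def)
      qed (use v2 v fK1[OF x(1)] in auto)
      finally have "\<bar>f ?u * ?v - f ?x * ?z\<bar> \<le> (C * 2 * 2 + K * 2) * \<theta>" by (simp add: algebra_simps)
      then have "\<bar>G (ip w y)\<bar> * \<bar>f ?u * ?v - f ?x * ?z\<bar> \<le> 1 * ((C * 2 * 2 + K * 2) * \<theta>)"
        using G by (intro mult_mono) auto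
      then show ?case unfolding \<theta>_def[symmetric] g_def
        using \<theta> by (simp add: abs_mult divide_le_eq)
    qed
    show "AE y in \<mu>. (\<lambda>m. g (1 / real (Suc m)) y) \<longlonglongrightarrow> L y"
      using deriv
    proof eventually_elim
      case (elim y)
      define q where "q \<theta> = f (cos \<theta> * ip a y - sin \<theta> * ip b y) * (sin \<theta> * ip a y + cos \<theta> * ip b y)" for \<theta>
      have inner: "((\<lambda>\<theta>. cos \<theta> * ip a y - sin \<theta> * ip b y) has_real_derivative - ip b y) (at 0)"
        by (auto intro!: derivative_eq_intros)
      have "(f has_real_derivative f' (ip a y)) (at (cos 0 * ip a y - sin 0 * ip b y))" using elim by simp
      from DERIV_chain2[OF this inner]
      have "((\<lambda>\<theta>. f (cos \<theta> * ip a y - sin \<theta> * ip b y)) has_real_derivative f' (ip a y) * - ip b y) (at 0)" .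
      then have "(q has_real_derivative (f (ip a y) * ip a y - f' (ip a y) * (ip b y)\<^sup>2)) (at 0)"
        unfolding q_def by (auto intro!: derivative_eq_intros simp: power2_eq_square algebra_simps)
      then have lim: "((\<lambda>h. (q (0 + h) - q 0) / h) \<longlongrightarrow> f (ip a y) * ip a y - f' (ip a y) * (ip b y)\<^sup>2) (at 0)"
        by (simp only: DERIV_def)
      have "filterlim (\<lambda>m. 1 / real (Suc m)) (at 0) sequentially"
        by (rule filterlim_atI[OF LIMSEQ_Suc[OF lim_1_over_n]]) auto
      from filterlim_compose[OF lim this]
      have "(\<lambda>m. (q (1 / real (Suc m)) - q 0) / (1 / real (Suc m))) \<longlonglongrightarrow> f (ip a y) * ip a y - f' (ip a y) * (ip b y)\<^sup>2"
        by (simp only: add_0)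
      from tendsto_mult_left[OF this, of "G (ip w y)"]
      show ?case by (simp add: g_def L_def q_def mult.assoc)
    qed
  qed auto
  then have "(\<lambda>m. 0) \<longlonglongrightarrow> (\<integral>y. L y \<partial>\<mu>)" by (simp only: int0)
  then have "(\<integral>y. L y \<partial>\<mu>) = 0" using LIMSEQ_unique tendsto_const by blast
  moreover have "(\<integral>y. G (ip w y) * (f' (ip a y) * (ip b y)\<^sup>2 - ip a y * f (ip a y)) \<partial>\<mu>) = (\<integral>y. - L y \<partial>\<mu>)"
    by (intro Bochner_Integration.integral_cong) (auto simp: L_def algebra_simps)
  ultimately show ?thesis by simp
qed

end

section \<open>Stein's method on the sphere\<close>

text \<open>The bounded solution f of Stein's equation f'(x) - x f(x) = 1{x \<le> s} - Phi(s) for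
  the standard normal law.\<close>

definition stein_sol :: "real \<Rightarrow> real \<Rightarrow> real" where
  "stein_sol s x = (if x \<le> s then Phi x * (1 - Phi s) else Phi s * (1 - Phi x)) / nphi x"

text \<open>The derivative as Stein's equation prescribes it, so that the equation also holds at the
  kink x = s, where \<open>stein_sol s\<close> is not differentiable.\<close>

definition stein_der :: "real \<Rightarrow> real \<Rightarrow> real" where
  "stein_der s x = x * stein_sol s x + ((if x \<le> s then 1 else 0) - Phi s)"

lemma quotient_nphi_deriv:
  assumes "(A has_real_derivative a) (at x)"
  shows "((\<lambda>x. A x / nphi x) has_real_derivative (x * (A x / nphi x) + a / nphi x)) (at x)"
  using nphi_pos[of x]
  by (auto intro!: derivative_eq_intros assms nphi_deriv simp: field_simps power2_eq_square)

lemma stein_sol_deriv: assumes "x \<noteq> s" shows "(stein_sol s has_real_derivative stein_der s x) (at x)"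
proof (cases "x < s")
  case True
  have "((\<lambda>x. Phi x * (1 - Phi s)) has_real_derivative nphi x * (1 - Phi s)) (at x)"
    by (auto intro!: derivative_eq_intros Phi_deriv)
  from quotient_nphi_deriv[OF this]
  have "((\<lambda>x. Phi x * (1 - Phi s) / nphi x) has_real_derivative stein_der s x) (at x)"
    using True nphi_pos[of x] by (simp add: stein_der_def stein_sol_def)
  then show ?thesis
    by (rule has_field_derivative_transform_within_open[of _ _ _ "{..<s}"]) (use True in \<open>auto simp: stein_sol_def\<close>)
next
  case False
  have "((\<lambda>x. Phi s * (1 - Phi x)) has_real_derivative - (Phi s * nphi x)) (at x)"
    by (auto intro!: derivative_eq_intros Phi_deriv)
  from quotient_nphi_deriv[OF this]
  have "((\<lambda>x. Phi s * (1 - Phi x) / nphi x) has_real_derivative stein_der s x) (at x)"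
    using False assms nphi_pos[of x] by (simp add: stein_der_def stein_sol_def)
  then show ?thesis
    by (rule has_field_derivative_transform_within_open[of _ _ _ "{s<..}"])
       (use False assms in \<open>auto simp: stein_sol_def\<close>)
qed

lemma stein_sol_nonneg: "0 \<le> stein_sol s x"
  using Phi_bounds[of x] Phi_bounds[of s] nphi_pos[of x] by (simp add: stein_sol_def less_imp_le)

lemma stein_sol_le: "stein_sol s x \<le> Phi x / nphi x" "stein_sol s x \<le> (1 - Phi x) / nphi x"
proof -
  have "(if x \<le> s then Phi x * (1 - Phi s) else Phi s * (1 - Phi x)) \<le> Phi x"
  proof (cases "x \<le> s")
    case True then show ?thesis using Phi_bounds[of x] Phi_bounds[of s] by (simp add: mult_left_le)
  next
    case False
    then have "Phi s * (1 - Phi x) \<le> Phi x * 1" using Phi_bounds[of x] Phi_bounds[of s] Phi_mono[of s x]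
      by (intro mult_mono) auto
    then show ?thesis using False by simp
  qed
  then show "stein_sol s x \<le> Phi x / nphi x"
    unfolding stein_sol_def using nphi_pos[of x] by (intro divide_right_mono) auto
  have "(if x \<le> s then Phi x * (1 - Phi s) else Phi s * (1 - Phi x)) \<le> 1 - Phi x"
  proof (cases "x \<le> s")
    case True
    then have "Phi x * (1 - Phi s) \<le> 1 * (1 - Phi x)" using Phi_bounds[of x] Phi_bounds[of s] Phi_mono[of x s]
      by (intro mult_mono) auto
    then show ?thesis using True by simp
  next
    case False
    then show ?thesis using Phi_bounds[of x] Phi_bounds[of s] by (simp add: mult_left_le_one_le)
  qed
  then show "stein_sol s x \<le> (1 - Phi x) / nphi x"
    unfolding stein_sol_def using nphi_pos[of x] by (intro divide_right_mono) auto
qed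

text \<open>Mills' ratio is applied on each half line to the factor that is small there:
  \<open>Phi x\<close> for negative x, \<open>1 - Phi x\<close> for positive x.\<close>

lemma stein_sol_x_le: "\<bar>x * stein_sol s x\<bar> \<le> 1"
proof -
  consider "x < 0" | "x = 0" | "0 < x" by linarith
  then show ?thesis
  proof cases
    case 1
    have "\<bar>x\<bar> * stein_sol s x \<le> \<bar>x\<bar> * (Phi x / nphi x)" using stein_sol_le by (intro mult_left_mono) auto
    also have "\<dots> \<le> 1" using Phi_mills_neg[OF 1] nphi_pos[of x] by (simp add: divide_le_eq)
    finally show ?thesis using stein_sol_nonneg by (simp add: abs_mult)
  next
    case 3
    have "\<bar>x\<bar> * stein_sol s x \<le> x * ((1 - Phi x) / nphi x)" using stein_sol_le(2)[of s x] 3 mult_left_mono[OF stein_sol_le(2)[of s x], of x] by simp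
    also have "\<dots> \<le> 1" using Phi_mills_pos[OF 3] nphi_pos[of x] by (simp add: divide_le_eq)
    finally show ?thesis using stein_sol_nonneg by (simp add: abs_mult)
  qed simp
qed

lemma stein_der_le: "\<bar>stein_der s x\<bar> \<le> 2"
proof -
  have "\<bar>(if x \<le> s then 1 else 0) - Phi s\<bar> \<le> 1" using Phi_bounds[of s] by auto
  then show ?thesis using stein_sol_x_le[of x s] unfolding stein_der_def by linarith
qed

lemma Phi_continuous: "continuous_on A Phi"
  using Phi_isCont by (simp add: continuous_at_imp_continuous_on)

lemma stein_sol_continuous: "continuous_on UNIV (stein_sol s)"
proof -
  have "continuous_on UNIV (\<lambda>x. (if x \<le> s then Phi x * (1 - Phi s) else Phi s * (1 - Phi x)))"
    by (rule continuous_on_cases_le) (auto intro!: continuous_intros continuous_on_subset[OF Phi_continuous])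
  then have "continuous_on UNIV (\<lambda>x. (if x \<le> s then Phi x * (1 - Phi s) else Phi s * (1 - Phi x)) / nphi x)"
    using nphi_pos by (intro continuous_on_divide nphi_continuous) (auto simp: less_le)
  then show ?thesis by (simp add: stein_sol_def[abs_def])
qed

text \<open>The mean value theorem works on either side of the exceptional point s, and an interval
  containing s is cut there, with the same constant on both pieces.\<close>

lemma lipschitz_of_deriv_except:
  fixes f f' :: "real \<Rightarrow> real"
  assumes cont: "continuous_on UNIV f" and d: "\<And>x. x \<noteq> s \<Longrightarrow> (f has_real_derivative f' x) (at x)"
    and C: "\<And>x. \<bar>f' x\<bar> \<le> C"
  shows "\<bar>f x - f y\<bar> \<le> C * \<bar>x - y\<bar>"
proof -
  have *: "\<bar>f b - f a\<bar> \<le> C * (b - a)" if ab: "a < b" and s: "s \<le> a \<or> b \<le> s" for a b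
  proof -
    obtain l z where z: "a < z" "z < b" "DERIV f z :> l" "f b - f a = (b - a) * l"
      using MVT[OF ab continuous_on_subset[OF cont]] d s
      by (metis (no_types, lifting) not_less order_less_irrefl real_differentiable_def subset_UNIV less_le_trans)
    then have "l = f' z" using d[of z] s DERIV_unique by force
    then have "\<bar>f b - f a\<bar> = (b - a) * \<bar>f' z\<bar>" using z ab by (simp add: abs_mult)
    also have "\<dots> \<le> (b - a) * C" using C ab by (intro mult_left_mono) auto
    finally show ?thesis by (simp add: mult.commute)
  qed
  have **: "\<bar>f b - f a\<bar> \<le> C * (b - a)" if ab: "a < b" for a b
  proof (cases "s \<le> a \<or> b \<le> s")
    case False
    then have "\<bar>f s - f a\<bar> \<le> C * (s - a)" "\<bar>f b - f s\<bar> \<le> C * (b - s)" by (auto intro!: *)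
    then show ?thesis by (simp add: algebra_simps)
  qed (rule *[OF ab])
  show ?thesis
    by (cases x y rule: linorder_cases) (use **[of x y] **[of y x] in \<open>simp_all add: abs_minus_commute\<close>)
qed

lemmas stein_sol_lipschitz = lipschitz_of_deriv_except[OF stein_sol_continuous stein_sol_deriv stein_der_le]

lemma stein_sol_measurable [measurable]: "stein_sol s \<in> borel_measurable borel"
  by (rule borel_measurable_continuous_onI[OF stein_sol_continuous])

lemma stein_der_measurable [measurable]: "stein_der s \<in> borel_measurable borel"
  unfolding stein_der_def by measurable

section \<open>Stein's identity for a coordinate on the sphere, absence of atoms, and normal
  approximation\<close>

context unit_sphere_law
begin

lemma orthonormal_pair: "a \<in> S \<Longrightarrow> w \<in> S \<Longrightarrow> ip a w = 0 \<Longrightarrow>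
  \<exists>e. orthonormal_basis p H k e \<and> e 0 = a \<and> e 1 = w"
proof -
  assume aw: "a \<in> S" "w \<in> S" "ip a w = 0"
  obtain e0 where e0: "orthonormal_basis p H k e0" using basis by blast
  define f where "f i = (if i = 0 then a else w)" for i :: nat
  have "orthonormal_in p H 2 f"
    using aw S_props(1)[of a] S_props(1)[of w] S_props(2)[of a] S_props(2)[of w]
    by (auto simp: orthonormal_in_def f_def less_2_cases_iff inner_p_commute[of p w a])
  from orthonormal_basis_change[OF e0 this] obtain e where e: "orthonormal_basis p H k e" "\<forall>i<2. e i = f i" by blast
  then have "e 0 = a" "e 1 = w" by (auto simp: f_def)
  then show ?thesis using e by blast
qed

lemma orthonormal_mate: assumes a: "a \<in> S" and k: "2 \<le> k" shows "\<exists>w\<in>S. ip a w = 0"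
proof -
  obtain e0 where e0: "orthonormal_basis p H k e0" using basis by blast
  have "orthonormal_in p H 1 (\<lambda>_. a)" using S_props[OF a] by (simp add: orthonormal_in_def)
  from orthonormal_basis_change[OF e0 this] obtain e where e: "orthonormal_basis p H k e" "e 0 = a"
    using zero_less_one by blast
  then have "e 1 \<in> S" "ip a (e 1) = 0" using k basis_S[OF e(1), of 1] basis_ip[OF e(1), of 0 1] by auto
  then show ?thesis by blast
qed

lemma parseval_rest:
  assumes e: "orthonormal_basis p H k e" and k: "2 \<le> k" and y: "y \<in> S"
  shows "(\<Sum>i=2..<k. (ip (e i) y)\<^sup>2) = 1 - (ip (e 0) y)\<^sup>2 - (ip (e 1) y)\<^sup>2"
proof -
  have "1 = (\<Sum>i<k. (ip (e i) y)\<^sup>2)"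
    using parseval[OF e S_props(1)[OF y], of y] S_props(2)[OF y]
    by (simp add: power2_eq_square inner_p_commute[of p y "e _"])
  also have "{..<k} = insert 0 (insert 1 {2..<k})" using k by auto
  finally show ?thesis by simp
qed

text \<open>Every basis direction orthogonal to a and w contributes one
  \<open>rotation_identity\<close>. Over these k - 2 directions the squared coordinates sum to 1
  minus those along a and w, and the right hand side is repeated k - 2 times.\<close>

lemma stein_identity:
  fixes f f' G :: "real \<Rightarrow> real"
  assumes aw: "a \<in> S" "w \<in> S" "ip a w = 0" and k: "2 \<le> k"
    and [measurable]: "G \<in> borel_measurable borel" "f \<in> borel_measurable borel" "f' \<in> borel_measurable borel"
    and G: "\<And>x. \<bar>G x\<bar> \<le> 1" and C: "\<And>x y. \<bar>f x - f y\<bar> \<le> C * \<bar>x - y\<bar>" and f': "\<And>x. \<bar>f' x\<bar> \<le> C"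
    and deriv: "AE y in \<mu>. (f has_real_derivative f' (ip a y)) (at (ip a y))"
  shows "(\<integral>y. G (ip w y) * (f' (ip a y) * (1 - (ip a y)\<^sup>2 - (ip w y)\<^sup>2)) \<partial>\<mu>)
    = (\<integral>y. G (ip w y) * (real (k - 2) * (ip a y * f (ip a y))) \<partial>\<mu>)"
proof -
  obtain e where e: "orthonormal_basis p H k e" "e 0 = a" "e 1 = w" using orthonormal_pair[OF aw] by blast
  have C0: "0 \<le> C" using f'[of 0] by linarith
  have fb: "\<bar>f x\<bar> \<le> \<bar>f 0\<bar> + C" if "\<bar>x\<bar> \<le> 1" for x
    using C[of x 0] mult_left_mono[OF that C0] by simp
  have b1: "\<bar>x * y * z\<bar> \<le> u * v * t" if "\<bar>x\<bar> \<le> u" "\<bar>y\<bar> \<le> v" "\<bar>z\<bar> \<le> t" for x y z u v t :: real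
    using that unfolding abs_mult by (intro mult_mono mult_nonneg_nonneg) auto
  have i1: "integrable \<mu> (\<lambda>y. G (ip w y) * f' (ip a y) * (ip b y)\<^sup>2)" if b: "b \<in> S" for b
  proof (rule integrable_bounded[of _ "1 * C * 1"])
    fix y assume "y \<in> S"
    then have "\<bar>(ip b y)\<^sup>2\<bar> \<le> 1" using S_abs_le[OF b] by (simp add: abs_square_le_1)
    then show "\<bar>G (ip w y) * f' (ip a y) * (ip b y)\<^sup>2\<bar> \<le> 1 * C * 1" using G f' by (intro b1) auto
  qed measurable
  have i2: "integrable \<mu> (\<lambda>y. G (ip w y) * ip a y * f (ip a y))"
  proof (rule integrable_bounded[of _ "1 * 1 * (\<bar>f 0\<bar> + C)"])
    fix y assume "y \<in> S"
    then show "\<bar>G (ip w y) * ip a y * f (ip a y)\<bar> \<le> 1 * 1 * (\<bar>f 0\<bar> + C)"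
      by (intro b1 G fb S_abs_le aw(1))
  qed measurable
  have "(\<integral>y. G (ip w y) * f' (ip a y) * (ip (e i) y)\<^sup>2 \<partial>\<mu>) = (\<integral>y. G (ip w y) * ip a y * f (ip a y) \<partial>\<mu>)"
    if i: "i \<in> {2..<k}" for i
  proof -
    have b: "e i \<in> S" "ip a (e i) = 0" "ip w (e i) = 0"
      using i basis_S[OF e(1)] basis_ip[OF e(1), of 0 i] basis_ip[OF e(1), of 1 i] e(2,3) by auto
    have "(\<integral>y. G (ip w y) * (f' (ip a y) * (ip (e i) y)\<^sup>2 - ip a y * f (ip a y)) \<partial>\<mu>) = 0"
      using b aw by (intro rotation_identity[where C=C] G C deriv) (auto simp: inner_p_commute[of p w a])
    moreover have "(\<integral>y. G (ip w y) * (f' (ip a y) * (ip (e i) y)\<^sup>2 - ip a y * f (ip a y)) \<partial>\<mu>)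
      = (\<integral>y. G (ip w y) * f' (ip a y) * (ip (e i) y)\<^sup>2 - G (ip w y) * ip a y * f (ip a y) \<partial>\<mu>)"
      by (simp add: algebra_simps)
    ultimately show ?thesis using i1[OF b(1)] i2 by simp
  qed
  then have "(\<Sum>i=2..<k. \<integral>y. G (ip w y) * f' (ip a y) * (ip (e i) y)\<^sup>2 \<partial>\<mu>)
     = real (k - 2) * (\<integral>y. G (ip w y) * ip a y * f (ip a y) \<partial>\<mu>)" by simp
  moreover have "(\<Sum>i=2..<k. \<integral>y. G (ip w y) * f' (ip a y) * (ip (e i) y)\<^sup>2 \<partial>\<mu>)
     = (\<integral>y. (\<Sum>i=2..<k. G (ip w y) * f' (ip a y) * (ip (e i) y)\<^sup>2) \<partial>\<mu>)"
    by (rule Bochner_Integration.integral_sum[symmetric]) (auto intro!: i1 basis_S[OF e(1)])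
  moreover have "\<dots> = (\<integral>y. G (ip w y) * (f' (ip a y) * (1 - (ip a y)\<^sup>2 - (ip w y)\<^sup>2)) \<partial>\<mu>)"
  proof (rule integral_cong_AE)
    show "AE y in \<mu>. (\<Sum>i=2..<k. G (ip w y) * f' (ip a y) * (ip (e i) y)\<^sup>2)
      = G (ip w y) * (f' (ip a y) * (1 - (ip a y)\<^sup>2 - (ip w y)\<^sup>2))"
      using AE_S
    proof eventually_elim
      case (elim y)
      show ?case using parseval_rest[OF e(1) k elim, unfolded e(2,3)]
        by (simp add: sum_distrib_left[symmetric] mult.assoc)
    qed
  qed measurable
  moreover have "(\<integral>y. G (ip w y) * (real (k - 2) * (ip a y * f (ip a y))) \<partial>\<mu>)
     = real (k - 2) * (\<integral>y. G (ip w y) * ip a y * f (ip a y) \<partial>\<mu>)"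
    unfolding integral_mult_right_zero[symmetric]
    by (intro Bochner_Integration.integral_cong refl) (simp add: mult_ac)
  ultimately show ?thesis by simp
qed

text \<open>The test functions \<open>f m\<close> tend to 0 uniformly while their derivatives tend
  to the indicator of the point c. In the limit the Stein identity says that the indicator of
  \<open>ip a y = c\<close>, times the squared length of the coordinates other than a and w,
  integrates to 0.\<close>

lemma AE_rest_zero:
  assumes aw: "a \<in> S" "w \<in> S" "ip a w = 0" and k: "2 \<le> k"
  shows "AE y in \<mu>. ip a y = c \<longrightarrow> 1 - (ip a y)\<^sup>2 - (ip w y)\<^sup>2 = 0"
proof -
  define f where "f m x = arctan (real (Suc m) * (x - c)) / real (Suc m)" for m x
  define f' where "f' m x = 1 / (1 + (real (Suc m) * (x - c))\<^sup>2)" for m x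
  have der: "(f m has_real_derivative f' m x) (at x)" for m x
  proof -
    have "1 + (real (Suc m) * (x - c))\<^sup>2 > 0" by (simp add: add_pos_nonneg)
    then show ?thesis unfolding f_def f'_def
      by (auto intro!: derivative_eq_intros simp: inverse_eq_divide simp del: of_nat_Suc)
  qed
  have f'1: "\<bar>f' m x\<bar> \<le> 1" for m x
  proof -
    have r: "1 / z \<le> 1" "0 \<le> 1 / z" if "1 \<le> z" for z :: real using that by auto
    have "1 \<le> 1 + (real (Suc m) * (x - c))\<^sup>2" by simp
    then have "1 / (1 + (real (Suc m) * (x - c))\<^sup>2) \<le> 1" "0 \<le> 1 / (1 + (real (Suc m) * (x - c))\<^sup>2)"
      using r by blast+
    then show ?thesis by (simp add: f'_def del: of_nat_Suc)
  qed
  have cont: "continuous_on UNIV (f m)" for m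
    using der by (meson DERIV_isCont continuous_at_imp_continuous_on)
  have [measurable]: "f m \<in> borel_measurable borel" "f' m \<in> borel_measurable borel" for m
    by (auto intro: borel_measurable_continuous_onI cont simp: f'_def[abs_def])
  have lip: "\<bar>f m x - f m y\<bar> \<le> 1 * \<bar>x - y\<bar>" for m x y
    by (rule lipschitz_of_deriv_except[OF cont der f'1])
  have fb: "\<bar>f m x\<bar> \<le> 2 / real (Suc m)" for m x
  proof -
    have "\<bar>arctan z\<bar> \<le> 2" for z using arctan_bounded[of z] pi_half_less_two by auto
    then show ?thesis unfolding f_def abs_divide by (simp add: divide_right_mono del: of_nat_Suc)
  qed
  define R where "R y = 1 - (ip a y)\<^sup>2 - (ip w y)\<^sup>2" for y
  have [measurable]: "R \<in> borel_measurable borel" unfolding R_def by measurable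
  have R: "0 \<le> R y" "R y \<le> 1" if "y \<in> S" for y
  proof -
    obtain e where e: "orthonormal_basis p H k e" "e 0 = a" "e 1 = w" using orthonormal_pair[OF aw] by blast
    have "R y = (\<Sum>i=2..<k. (ip (e i) y)\<^sup>2)" using parseval_rest[OF e(1) k that, unfolded e(2,3)] by (simp add: R_def)
    then show "0 \<le> R y" by (simp add: sum_nonneg)
    show "R y \<le> 1" by (simp add: R_def)
  qed
  have id: "(\<integral>y. f' m (ip a y) * R y \<partial>\<mu>) = (\<integral>y. real (k - 2) * (ip a y * f m (ip a y)) \<partial>\<mu>)" for m
    using stein_identity[OF aw k, of "\<lambda>_. 1" "f m" "f' m" 1] lip der f'1 by (simp add: R_def)
  have l1: "(\<lambda>m. \<integral>y. f' m (ip a y) * R y \<partial>\<mu>) \<longlonglongrightarrow> (\<integral>y. (if ip a y = c then 1 else 0) * R y \<partial>\<mu>)"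
  proof (rule integral_dominated_convergence[where w="\<lambda>_. 1"])
    show "AE y in \<mu>. norm (f' m (ip a y) * R y) \<le> 1" for m
      using AE_S
    proof eventually_elim
      case (elim y)
      have "\<bar>f' m (ip a y)\<bar> * \<bar>R y\<bar> \<le> 1 * 1" using f'1 R[OF elim] by (intro mult_mono) auto
      then show ?case by (simp add: abs_mult)
    qed
    show "AE y in \<mu>. (\<lambda>m. f' m (ip a y) * R y) \<longlonglongrightarrow> (if ip a y = c then 1 else 0) * R y"
    proof (rule AE_I2, rule tendsto_mult_right)
      fix y
      show "(\<lambda>m. f' m (ip a y)) \<longlonglongrightarrow> (if ip a y = c then 1 else 0)"
      proof (cases "ip a y = c")
        case False
        then have "0 < (ip a y - c)\<^sup>2" by simp
        moreover have "(\<lambda>m. 1 / (1 + (real (Suc m))\<^sup>2 * d)) \<longlonglongrightarrow> 0" if "0 < d" for d :: real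
          using that by real_asymp
        ultimately have "(\<lambda>m. 1 / (1 + (real (Suc m))\<^sup>2 * (ip a y - c)\<^sup>2)) \<longlonglongrightarrow> 0" by blast
        then show ?thesis using False by (simp add: f'_def power_mult_distrib)
      qed (simp add: f'_def)
    qed
  qed auto
  have l2: "(\<lambda>m. \<integral>y. real (k - 2) * (ip a y * f m (ip a y)) \<partial>\<mu>) \<longlonglongrightarrow> (\<integral>y. 0 \<partial>\<mu>)"
  proof (rule integral_dominated_convergence[where w="\<lambda>_. real (k - 2) * 2"])
    have b: "\<bar>real (k - 2) * (ip a y * f m (ip a y))\<bar> \<le> real (k - 2) * (2 / real (Suc m))" if "y \<in> S" for y m
    proof -
      have "\<bar>ip a y\<bar> * \<bar>f m (ip a y)\<bar> \<le> 1 * (2 / real (Suc m))"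
        using fb S_abs_le[OF aw(1) that] by (intro mult_mono) auto
      then have "real (k - 2) * (\<bar>ip a y\<bar> * \<bar>f m (ip a y)\<bar>) \<le> real (k - 2) * (1 * (2 / real (Suc m)))"
        by (rule mult_left_mono) simp
      then show ?thesis by (simp add: abs_mult)
    qed
    show "AE y in \<mu>. norm (real (k - 2) * (ip a y * f m (ip a y))) \<le> real (k - 2) * 2" for m
      using AE_S
    proof eventually_elim
      case (elim y)
      have "real (k - 2) * (2 / real (Suc m)) \<le> real (k - 2) * 2"
        by (intro mult_left_mono) (auto simp: divide_le_eq)
      then show ?case using b[OF elim, of m] by (simp only: real_norm_def)
    qed
    show "AE y in \<mu>. (\<lambda>m. real (k - 2) * (ip a y * f m (ip a y))) \<longlonglongrightarrow> 0"
      using AE_S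
    proof eventually_elim
      case (elim y)
      show ?case
      proof (rule Lim_null_comparison)
        show "\<forall>\<^sub>F m in sequentially. norm (real (k - 2) * (ip a y * f m (ip a y))) \<le> real (k - 2) * (2 / real (Suc m))"
          using b[OF elim] by simp
        show "(\<lambda>m. real (k - 2) * (2 / real (Suc m))) \<longlonglongrightarrow> 0" by real_asymp
      qed
    qed
  qed auto
  have "(\<integral>y. (if ip a y = c then 1 else 0) * R y \<partial>\<mu>) = 0"
    using LIMSEQ_unique[OF l1 l2[unfolded id[symmetric]]] by simp
  moreover have "integrable \<mu> (\<lambda>y. (if ip a y = c then 1 else 0) * R y)"
    by (rule integrable_bounded[of _ 1]) (use R in \<open>auto simp: abs_le_iff\<close>)
  moreover have "AE y in \<mu>. 0 \<le> (if ip a y = c then 1 else 0) * R y"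
    using AE_S by eventually_elim (use R in auto)
  ultimately have "AE y in \<mu>. (if ip a y = c then 1 else 0) * R y = 0"
    by (simp add: integral_nonneg_eq_0_iff_AE)
  then show ?thesis by eventually_elim (auto simp: R_def split: if_splits)
qed

text \<open>By \<open>AE_rest_zero\<close>, an atom of the coordinate along a would force the
  coordinates other than a and w to vanish on it. For c = 0, taking w and then \<open>e 2\<close> as
  second direction gives the coordinate along \<open>e 2\<close> both the values 0 and 1 in absolute
  value. So 0 is no atom; by equality of laws the coordinate along \<open>e 2\<close> is almost
  surely nonzero, and this excludes every c.\<close>

lemma no_atom: assumes a: "a \<in> S" and k: "3 \<le> k" shows "AE y in \<mu>. ip a y \<noteq> c"
proof -
  obtain w where w: "w \<in> S" "ip a w = 0" using orthonormal_mate[OF a] k by auto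
  obtain e where e: "orthonormal_basis p H k e" "e 0 = a" "e 1 = w" using orthonormal_pair[OF a w] by blast
  have zero: "ip (e i) y = 0" if "y \<in> S" "1 - (ip (e 0) y)\<^sup>2 - (ip (e 1) y)\<^sup>2 = 0" "i \<in> {2..<k}" for y i
  proof -
    have "(\<Sum>i=2..<k. (ip (e i) y)\<^sup>2) = 0" using parseval_rest[OF e(1) _ that(1)] that(2) k by simp
    then have "\<forall>i\<in>{2..<k}. (ip (e i) y)\<^sup>2 = 0" by (subst (asm) sum_nonneg_eq_0_iff) auto
    then show ?thesis using that by simp
  qed
  have e2: "e 2 \<in> S" "ip a (e 2) = 0" "ip w (e 2) = 0"
    using k basis_S[OF e(1)] basis_ip[OF e(1), of 0 2] basis_ip[OF e(1), of 1 2] e by auto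
  have at0: "AE y in \<mu>. ip a y \<noteq> 0"
  proof -
    have "AE y in \<mu>. ip a y = 0 \<longrightarrow> 1 - (ip a y)\<^sup>2 - (ip w y)\<^sup>2 = 0"
      by (rule AE_rest_zero[OF a w]) (use k in simp)
    moreover have "AE y in \<mu>. ip a y = 0 \<longrightarrow> 1 - (ip a y)\<^sup>2 - (ip (e 2) y)\<^sup>2 = 0"
      by (rule AE_rest_zero[OF a e2(1,2)]) (use k in simp)
    ultimately show ?thesis using AE_S
    proof eventually_elim
      case (elim y)
      show ?case
      proof
        assume 0: "ip a y = 0"
        then have "(ip w y)\<^sup>2 = 1" "(ip (e 2) y)\<^sup>2 = 1" using elim by auto
        moreover have "ip (e 2) y = 0" using zero[of y 2] elim 0 e k by simp
        ultimately show False by simp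
      qed
    qed
  qed
  have law: "AE y in \<mu>. ip (e 2) y \<noteq> 0"
  proof -
    have "AE x in distr \<mu> borel (ip a). x \<noteq> 0" using at0 by (subst AE_distr_iff) auto
    then have "AE x in distr \<mu> borel (ip (e 2)). x \<noteq> 0" unfolding law_const[OF a e2(1)] .
    then show ?thesis by (subst (asm) AE_distr_iff) auto
  qed
  have "AE y in \<mu>. ip a y = c \<longrightarrow> 1 - (ip a y)\<^sup>2 - (ip w y)\<^sup>2 = 0"
    by (rule AE_rest_zero[OF a w]) (use k in simp)
  then show ?thesis using law AE_S
  proof eventually_elim
    case (elim y)
    then show ?case using zero[of y 2] e k by auto
  qed
qed

text \<open>The identity is applied to the Stein solution at scale \<open>q\<close>, where q^2 = k -
  2 cancels the factor on the right; absence of atoms means that the kink is met with probability 0.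
  What remains is \<open>stein_der\<close>, bounded by 2, times the squared coordinates along a and
  w, each of mean 1 / k.\<close>

lemma stein_bound:
  fixes G :: "real \<Rightarrow> real"
  assumes aw: "a \<in> S" "w \<in> S" "ip a w = 0" and k: "3 \<le> k"
    and [measurable]: "G \<in> borel_measurable borel" and G: "\<And>x. \<bar>G x\<bar> \<le> 1"
  shows "\<bar>\<integral>y. G (ip w y) * ((if sqrt (real (k - 2)) * ip a y \<le> s then 1 else 0) - Phi s) \<partial>\<mu>\<bar> \<le> 4 / real k"
proof -
  define q where "q = sqrt (real (k - 2))"
  have q: "0 < q" "q * q = real (k - 2)" using k by (simp_all add: q_def)
  define f where "f x = stein_sol s (q * x)" for x
  define f' where "f' x = q * stein_der s (q * x)" for x
  have [measurable]: "f \<in> borel_measurable borel" "f' \<in> borel_measurable borel"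
    unfolding f_def f'_def by measurable
  have C: "\<bar>f x - f y\<bar> \<le> (2 * q) * \<bar>x - y\<bar>" for x y
  proof -
    have "\<bar>f x - f y\<bar> \<le> 2 * \<bar>q * x - q * y\<bar>" unfolding f_def by (rule stein_sol_lipschitz)
    also have "\<dots> = (2 * q) * \<bar>x - y\<bar>" using q by (simp add: abs_mult flip: right_diff_distrib)
    finally show ?thesis .
  qed
  have f'b: "\<bar>f' x\<bar> \<le> 2 * q" for x using stein_der_le[of s "q * x"] q by (simp add: f'_def abs_mult)
  have der: "AE y in \<mu>. (f has_real_derivative f' (ip a y)) (at (ip a y))"
    using no_atom[OF aw(1) k, of "s / q"]
  proof eventually_elim
    case (elim y)
    then have "q * ip a y \<noteq> s" using q by auto
    from DERIV_chain2[OF stein_sol_deriv[OF this] DERIV_cmult[OF DERIV_ident]]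
    show ?case unfolding f_def f'_def by (simp add: mult.commute)
  qed
  let ?D = "\<lambda>y. stein_der s (q * ip a y)" and ?R = "\<lambda>y. (ip a y)\<^sup>2 + (ip w y)\<^sup>2"
  have b1: "\<bar>x * y * z\<bar> \<le> u * v * t" if "\<bar>x\<bar> \<le> u" "\<bar>y\<bar> \<le> v" "\<bar>z\<bar> \<le> t" for x y z u v t :: real
    using that unfolding abs_mult by (intro mult_mono mult_nonneg_nonneg) auto
  have Rb: "\<bar>?R y\<bar> \<le> 2" if "y \<in> S" for y
  proof -
    have "(ip a y)\<^sup>2 \<le> 1" "(ip w y)\<^sup>2 \<le> 1" using S_abs_le[OF aw(1) that] S_abs_le[OF aw(2) that] by (simp_all add: abs_square_le_1)
    then show ?thesis by simp
  qed
  have iD: "integrable \<mu> (\<lambda>y. G (ip w y) * ?D y * 1)"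
  proof (rule integrable_bounded[of _ "1 * 2 * 1"])
    show "\<bar>G (ip w y) * ?D y * 1\<bar> \<le> 1 * 2 * 1" for y by (intro b1 G stein_der_le) simp
  qed measurable
  have iR: "integrable \<mu> (\<lambda>y. G (ip w y) * ?D y * ?R y)"
  proof (rule integrable_bounded[of _ "1 * 2 * 2"])
    show "\<bar>G (ip w y) * ?D y * ?R y\<bar> \<le> 1 * 2 * 2" if "y \<in> S" for y
      using that by (intro b1 G stein_der_le Rb)
  qed measurable
  have iI: "integrable \<mu> (\<lambda>y. G (ip w y) * ((if q * ip a y \<le> s then 1 else 0) - Phi s))"
  proof (rule integrable_bounded[of _ "1 * 1"])
    fix y
    have "\<bar>(if q * ip a y \<le> s then 1 else 0) - Phi s\<bar> \<le> 1" using Phi_bounds[of s] by auto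
    then show "\<bar>G (ip w y) * ((if q * ip a y \<le> s then 1 else 0) - Phi s)\<bar> \<le> 1 * 1"
      unfolding abs_mult using G by (intro mult_mono) auto
  qed measurable
  have id: "(\<integral>y. G (ip w y) * (f' (ip a y) * (1 - (ip a y)\<^sup>2 - (ip w y)\<^sup>2)) \<partial>\<mu>)
    = (\<integral>y. G (ip w y) * (real (k - 2) * (ip a y * f (ip a y))) \<partial>\<mu>)"
    using k by (intro stein_identity[OF aw _ _ _ _ G C f'b der]) auto
  have e1: "(\<integral>y. G (ip w y) * (f' (ip a y) * (1 - (ip a y)\<^sup>2 - (ip w y)\<^sup>2)) \<partial>\<mu>)
    = q * (\<integral>y. G (ip w y) * ?D y * 1 - G (ip w y) * ?D y * ?R y \<partial>\<mu>)"
    unfolding integral_mult_right_zero[symmetric]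
    by (intro Bochner_Integration.integral_cong refl) (simp add: f'_def algebra_simps)
  have e2: "(\<integral>y. G (ip w y) * (real (k - 2) * (ip a y * f (ip a y))) \<partial>\<mu>)
    = q * (\<integral>y. G (ip w y) * ?D y * 1 - G (ip w y) * ((if q * ip a y \<le> s then 1 else 0) - Phi s) \<partial>\<mu>)"
    unfolding integral_mult_right_zero[symmetric] q(2)[symmetric]
    by (intro Bochner_Integration.integral_cong refl) (simp add: f_def stein_der_def algebra_simps)
  have "(\<integral>y. G (ip w y) * ((if q * ip a y \<le> s then 1 else 0) - Phi s) \<partial>\<mu>)
    = (\<integral>y. G (ip w y) * ?D y * ?R y \<partial>\<mu>)"
    using id q iD iR iI unfolding e1 e2 by simp
  also have "\<bar>\<dots>\<bar> \<le> (\<integral>y. 2 * ?R y \<partial>\<mu>)"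
  proof (rule integral_abs_bound[THEN order.trans], rule integral_mono)
    fix y
    have "\<bar>G (ip w y)\<bar> * \<bar>?D y\<bar> * ?R y \<le> 1 * 2 * ?R y"
      using G stein_der_le by (intro mult_right_mono mult_mono) auto
    then show "\<bar>G (ip w y) * ?D y * ?R y\<bar> \<le> 2 * ?R y" by (simp add: abs_mult)
    show "integrable \<mu> (\<lambda>y. 2 * ?R y)"
      by (intro integrable_mult_right integrable_bounded[of _ 2] Rb) measurable
  qed (use iR in simp)
  also have "\<dots> = 2 * ((\<integral>y. (ip a y)\<^sup>2 \<partial>\<mu>) + (\<integral>y. (ip w y)\<^sup>2 \<partial>\<mu>))"
  proof -
    have "integrable \<mu> (\<lambda>y. (ip b y)\<^sup>2)" if "b \<in> S" for b
      using S_abs_le[OF that] by (intro integrable_bounded[of _ 1]) (auto simp: abs_square_le_1)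
    then show ?thesis using aw by simp
  qed
  also have "\<dots> = 4 / real k" using second_moment_unit aw k by simp
  finally show ?thesis by (simp add: q_def)
qed

section \<open>The distribution function of the inner product with a unit vector, and decorrelation
  of two such products\<close>

lemma prob_UNIV [simp]: "measure \<mu> UNIV = 1"
  using prob_space by simp

text \<open>The chosen unit vector is immaterial by \<open>law_const\<close>;
  \<open>ip_cdf_eq\<close> replaces it by any other.\<close>

definition ip_cdf :: "real \<Rightarrow> real" where
  "ip_cdf t = measure \<mu> {y. ip (SOME a. a \<in> S) y \<le> t}"

lemma S_nonempty: "1 \<le> k \<Longrightarrow> \<exists>a. a \<in> S"
  using basis basis_S[of _ 0] by auto

lemma ip_cdf_eq: assumes a: "a \<in> S" shows "measure \<mu> {y. ip a y \<le> t} = ip_cdf t"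
proof -
  have *: "measure \<mu> {y. ip b y \<le> t} = measure (distr \<mu> borel (ip b)) {..t}" for b
    by (subst measure_distr) (auto simp: vimage_def)
  have "(SOME a. a \<in> S) \<in> S" using a by (rule someI[of "\<lambda>a. a \<in> S"])
  then show ?thesis unfolding ip_cdf_def * using law_const[OF a] by simp
qed

lemma expectation_indicator:
  assumes [measurable]: "Measurable.pred borel Q"
  shows "(\<integral>y. (if Q y then 1 else 0) \<partial>\<mu>) = measure \<mu> {y. Q y}"
proof -
  have "(\<integral>y. (if Q y then 1 else 0) \<partial>\<mu>) = (\<integral>y. indicator {y. Q y} y \<partial>\<mu>)"
    by (intro Bochner_Integration.integral_cong) (auto simp: indicator_def)
  also have "\<dots> = measure \<mu> {y. Q y}"
  proof -
    have "{y \<in> space borel. Q y} \<in> sets borel" by measurable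
    then show ?thesis by simp
  qed
  finally show ?thesis .
qed

lemma integrable_indicator':
  assumes [measurable]: "Measurable.pred borel Q"
  shows "integrable \<mu> (\<lambda>y. if Q y then 1 else 0 :: real)"
  by (rule integrable_bounded[of _ 1]) auto

lemma ip_cdf_normal: assumes k: "3 \<le> k"
  shows "\<bar>ip_cdf t - Phi (sqrt (real (k - 2)) * t)\<bar> \<le> 4 / real k"
proof -
  obtain a where a: "a \<in> S" using S_nonempty k by auto
  obtain w where w: "w \<in> S" "ip a w = 0" using orthonormal_mate[OF a] k by auto
  define q where "q = sqrt (real (k - 2))"
  have q: "0 < q" using k by (simp add: q_def)
  have "(\<integral>y. (if q * ip a y \<le> q * t then 1 else 0) - Phi (q * t) \<partial>\<mu>) = measure \<mu> {y. q * ip a y \<le> q * t} - Phi (q * t)"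
    by (simp add: integrable_indicator' expectation_indicator prob_space)
  also have "{y. q * ip a y \<le> q * t} = {y. ip a y \<le> t}" using q by simp
  finally show ?thesis using stein_bound[OF a w k, of "\<lambda>_. 1" "q * t"] ip_cdf_eq[OF a] by (simp add: q_def)
qed

lemma ip_cdf_cdf: assumes a: "a \<in> S" shows "cdf (distr \<mu> borel (ip a)) = ip_cdf"
  unfolding cdf_def by (rule ext, subst measure_distr) (auto simp: vimage_def ip_cdf_eq[OF a])

lemma ip_law_real_distribution: "real_distribution (distr \<mu> borel (ip a))"
  by (rule real_distribution_distr) simp

lemma ip_cdf_mono: assumes k: "1 \<le> k" and le: "s \<le> t" shows "ip_cdf s \<le> ip_cdf t"
proof -
  obtain a where a: "a \<in> S" using S_nonempty k by auto
  interpret D: real_distribution "distr \<mu> borel (ip a)" by (rule ip_law_real_distribution)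
  show ?thesis using D.cdf_nondecreasing[OF le] ip_cdf_cdf[OF a] by simp
qed

lemma ip_cdf_bounds: "0 \<le> ip_cdf t" "ip_cdf t \<le> 1"
  by (auto simp: ip_cdf_def)

lemma ip_cdf_isCont: assumes k: "3 \<le> k" shows "isCont ip_cdf t"
proof -
  obtain a where a: "a \<in> S" using S_nonempty k by auto
  interpret D: real_distribution "distr \<mu> borel (ip a)" by (rule ip_law_real_distribution)
  have "measure (distr \<mu> borel (ip a)) {t} = measure \<mu> {y. ip a y = t}"
    by (subst measure_distr) (auto simp: vimage_def)
  also have "\<dots> = 0" using no_atom[OF a k, of t]
    by (subst measure_eq_0_null_sets) (auto simp: AE_iff_null)
  finally show ?thesis using D.isCont_cdf ip_cdf_cdf[OF a] by simp
qed

lemma ip_cdf_minus_one: assumes k: "3 \<le> k" shows "ip_cdf (-1) = 0"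
proof -
  obtain a where a: "a \<in> S" using S_nonempty k by auto
  have "AE y in \<mu>. \<not> ip a y \<le> -1"
    using no_atom[OF a k, of "-1"] AE_S by eventually_elim (use S_abs_le[OF a] in fastforce)
  then have "measure \<mu> {y. ip a y \<le> -1} = 0"
    by (subst measure_eq_0_null_sets) (auto simp: AE_iff_null)
  then show ?thesis using ip_cdf_eq[OF a] by simp
qed

lemma ip_cdf_one: assumes k: "1 \<le> k" shows "ip_cdf 1 = 1"
proof -
  obtain a where a: "a \<in> S" using S_nonempty k by auto
  have "AE y in \<mu>. y \<in> {y. ip a y \<le> 1}"
    using AE_S by eventually_elim (use S_abs_le[OF a] in fastforce)
  moreover have "{y \<in> space borel. ip a y \<le> 1} \<in> sets borel" by measurable
  ultimately have "measure \<mu> {y. ip a y \<le> 1} = 1" by (subst prob_eq_1) auto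
  then show ?thesis using ip_cdf_eq[OF a] by simp
qed

text \<open>The vector x is replaced by \<open>z\<close>, its normalised component orthogonal to x',
  for which the weighted bound \<open>stein_bound\<close> gives 4 / k. The indicators for x and
  \<open>z\<close> differ only if \<open>ip z y\<close> is within \<open>\<delta>\<close> of a, or
  if \<open>ip (x - z) y\<close> is at least \<open>\<delta>\<close> in absolute value. The first
  event has probability at most \<eta> + 8 / k by \<open>ip_cdf_normal\<close>, and Chebyshev's
  inequality treats the second.\<close>

lemma indicator_decorrelation:
  assumes k: "3 \<le> k" and x: "x \<in> S" "x' \<in> S" and \<eta>: "0 < \<eta>" "\<eta> \<le> 1"
  shows "\<bar>\<integral>y. ((if ip x y \<le> a then 1 else 0) - ip_cdf a) * ((if ip x' y \<le> b then 1 else 0) - ip_cdf b) \<partial>\<mu>\<bar>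
    \<le> \<eta> + 12 / real k + 2 * (ip x x')\<^sup>2 / \<eta>\<^sup>2" (is "\<bar>?I\<bar> \<le> _")
\<comment> \<open>Parallel vectors leave no orthogonal component to normalise; in that case the last
  summand alone exceeds 1.\<close>
proof (cases "\<bar>ip x x'\<bar> = 1")
  case True
  have b: "\<bar>(if ip x y \<le> a then 1 else 0) - ip_cdf a\<bar> \<le> 1" for x y a
    using ip_cdf_bounds[of a] by auto
  have "\<bar>?I\<bar> \<le> (\<integral>y. 1 \<partial>\<mu>)"
  proof (rule integral_abs_bound[THEN order.trans], rule integral_mono')
    fix y
    show "\<bar>((if ip x y \<le> a then 1 else 0) - ip_cdf a) * ((if ip x' y \<le> b then 1 else 0) - ip_cdf b)\<bar> \<le> 1"
      unfolding abs_mult using b[of x y a] b[of x' y b] by (intro mult_le_one) auto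
  qed auto
  also have "\<dots> \<le> 2 * (ip x x')\<^sup>2 / \<eta>\<^sup>2"
  proof -
    have "(ip x x')\<^sup>2 = 1" using True by (metis power2_abs power_one)
    moreover have "\<eta>\<^sup>2 \<le> 1" using \<eta> by (simp add: power_le_one)
    ultimately show ?thesis using \<eta> by (simp add: prob_space le_divide_eq)
  qed
  finally show ?thesis using \<eta> by (simp add: add_increasing)
next
  case False
  define c where "c = ip x x'"
  have c1: "c\<^sup>2 < 1" using False S_abs_le[OF x] by (simp add: c_def abs_square_less_1)
  define r where "r = sqrt (1 - c\<^sup>2)"
  have r: "0 < r" "r\<^sup>2 = 1 - c\<^sup>2" using c1 by (auto simp: r_def)
  define z where "z = (1/r) *\<^sub>R (x - c *\<^sub>R x')"
  have xx: "ip x x = 1" "ip x' x' = 1" "ip x x' = c" "ip x' x = c"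
    using x S_props by (auto simp: c_def inner_p_commute[of p x' x])
  have zH: "z \<in> H" unfolding z_def using x S_props H_props by (intro subspace_scale subspace_diff) auto
  have "ip (x - c *\<^sub>R x') (x - c *\<^sub>R x') = r\<^sup>2"
    unfolding r by (simp add: inner_p_simps xx power2_eq_square algebra_simps)
  then have "ip z z = 1" using r(1) unfolding z_def
    by (simp add: inner_p_scale_left inner_p_scale_right power2_eq_square)
  then have z: "z \<in> S" by (rule S_I[OF zH])
  have zx': "ip z x' = 0" using r by (simp add: z_def inner_p_simps xx)
  have xz: "ip x z = r"
  proof -
    have "ip x z = (1/r) * (1 - c * c)" by (simp add: z_def inner_p_simps xx)
    also have "1 - c * c = r * r" using r by (simp add: power2_eq_square)
    finally show ?thesis using r by simp
  qed
  have d: "ip (x - z) (x - z) \<le> 2 * c\<^sup>2"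
  proof -
    have "ip (x - z) (x - z) = 2 - 2 * r"
      using xx xz \<open>ip z z = 1\<close> by (simp add: inner_p_simps inner_p_commute[of p z x])
    moreover have "r * r \<le> r * 1" using r c1 by (intro mult_left_mono) (auto simp: r_def)
    then have "r\<^sup>2 \<le> r" by (simp add: power2_eq_square)
    ultimately show ?thesis using r(2) by simp
  qed
  define q where "q = sqrt (real (k - 2))"
  have q: "0 < q" "q\<^sup>2 = real (k - 2)" using k by (simp_all add: q_def)
  define G where "G t = (if t \<le> b then 1 else 0) - ip_cdf b" for t
  have [measurable]: "G \<in> borel_measurable borel" unfolding G_def by measurable
  have G: "\<bar>G t\<bar> \<le> 1" for t using ip_cdf_bounds[of b] by (auto simp: G_def)
  define J where "J v y = (if ip v y \<le> a then 1 else 0 :: real)" for v y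
  have J: "\<bar>J v y\<bar> \<le> 1" for v y by (simp add: J_def)
  have [measurable]: "(\<lambda>y. J v y) \<in> borel_measurable borel" for v unfolding J_def by measurable
  have iG: "integrable \<mu> (\<lambda>y. G (ip x' y))" by (rule integrable_bounded[of _ 1]) (use G in auto)
  have iGJ: "integrable \<mu> (\<lambda>y. G (ip x' y) * J v y)" for v
    by (rule integrable_bounded[of _ 1]) (use G J in \<open>auto simp: abs_mult intro!: mult_le_one\<close>)
  have EG: "(\<integral>y. G (ip x' y) \<partial>\<mu>) = 0"
    by (simp add: G_def integrable_indicator' expectation_indicator ip_cdf_eq[OF x(2)] prob_space)
  have "?I = (\<integral>y. G (ip x' y) * J x y - ip_cdf a * G (ip x' y) \<partial>\<mu>)"
    by (intro Bochner_Integration.integral_cong) (auto simp: G_def J_def algebra_simps)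
  also have "\<dots> = (\<integral>y. G (ip x' y) * J x y \<partial>\<mu>)" using iG iGJ EG by simp
  also have "\<dots> = (\<integral>y. G (ip x' y) * J z y \<partial>\<mu>) + (\<integral>y. G (ip x' y) * J x y - G (ip x' y) * J z y \<partial>\<mu>)"
    using iGJ by simp
  \<comment> \<open>The weight has mean 0, so the other indicator may be centred at the normal value
    \<open>Phi (q * a)\<close>.\<close>
  also have "(\<integral>y. G (ip x' y) * J z y \<partial>\<mu>) = (\<integral>y. G (ip x' y) * (J z y - Phi (q * a)) \<partial>\<mu>)"
    using iG iGJ EG by (simp add: right_diff_distrib)
  finally have I: "?I = (\<integral>y. G (ip x' y) * (J z y - Phi (q * a)) \<partial>\<mu>)
     + (\<integral>y. G (ip x' y) * J x y - G (ip x' y) * J z y \<partial>\<mu>)" .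
  have "J z y = (if q * ip z y \<le> q * a then 1 else 0)" for y using q by (simp add: J_def)
  then have t1: "\<bar>\<integral>y. G (ip x' y) * (J z y - Phi (q * a)) \<partial>\<mu>\<bar> \<le> 4 / real k"
    using stein_bound[OF z x(2) zx' k, of G "q * a"] G by (simp add: q_def)
  \<comment> \<open>On this scale an interval of half-width \<open>\<delta>\<close> has normal
    probability at most \<eta>, while a second moment of order 1 / k divided by the square of
    \<open>\<delta>\<close> is of order 1 / \<eta>^2.\<close>
  define \<delta> where "\<delta> = \<eta> / q"
  have \<delta>: "0 < \<delta>" using \<eta> q by (simp add: \<delta>_def)
  define K1 where "K1 y = (if ip z y \<le> a + \<delta> then 1 else 0) - (if ip z y \<le> a - \<delta> then 1 else 0 :: real)" for y
  define K2 where "K2 y = (ip (x - z) y)\<^sup>2 / \<delta>\<^sup>2" for y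
  have JJ: "\<bar>J x y - J z y\<bar> \<le> K1 y + K2 y" for y
  proof (cases "J x y = J z y \<or> \<bar>ip z y - a\<bar> < \<delta>")
    case True
    have "0 \<le> K2 y" by (simp add: K2_def)
    moreover have "\<bar>J x y - J z y\<bar> \<le> K1 y" using True \<delta> by (auto simp: K1_def J_def)
    ultimately show ?thesis by linarith
  next
    case False
    then have "\<delta> \<le> \<bar>ip (x - z) y\<bar>" by (auto simp: J_def inner_p_diff_left split: if_splits)
    then have "\<delta>\<^sup>2 \<le> (ip (x - z) y)\<^sup>2" using \<delta> power_mono[of \<delta> "\<bar>ip (x - z) y\<bar>" 2] by simp
    then have "1 \<le> K2 y" using \<delta> by (simp add: K2_def)
    moreover have "0 \<le> K1 y" using \<delta> by (simp add: K1_def)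
    moreover have "\<bar>J x y - J z y\<bar> \<le> 1" by (simp add: J_def)
    ultimately show ?thesis by linarith
  qed
  have iK1: "integrable \<mu> K1" unfolding K1_def by (intro Bochner_Integration.integrable_diff integrable_indicator') measurable
  have xzH: "x - z \<in> H" using S_props(1)[OF x(1)] zH H_props by (intro subspace_diff)
  have iK2: "integrable \<mu> K2"
  proof -
    have "integrable \<mu> (\<lambda>y. (ip (x - z) y)\<^sup>2)"
    proof (rule integrable_bounded[of _ "ip (x - z) (x - z)"])
      fix y assume "y \<in> S"
      then show "\<bar>(ip (x - z) y)\<^sup>2\<bar> \<le> ip (x - z) (x - z)"
        using inner_p_Cauchy_Schwarz[of p "x - z" y] S_props(2) by simp
    qed measurable
    then show ?thesis unfolding K2_def by simp
  qed
  have "\<bar>\<integral>y. G (ip x' y) * J x y - G (ip x' y) * J z y \<partial>\<mu>\<bar> \<le> (\<integral>y. K1 y + K2 y \<partial>\<mu>)"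
  proof (rule integral_abs_bound[THEN order.trans], rule integral_mono)
    fix y
    have "\<bar>G (ip x' y)\<bar> * \<bar>J x y - J z y\<bar> \<le> 1 * (K1 y + K2 y)" using G JJ by (intro mult_mono) auto
    then show "\<bar>G (ip x' y) * J x y - G (ip x' y) * J z y\<bar> \<le> K1 y + K2 y"
      by (simp add: abs_mult flip: right_diff_distrib)
  qed (use iGJ iK1 iK2 in auto)
  also have "\<dots> = (\<integral>y. K1 y \<partial>\<mu>) + (\<integral>y. K2 y \<partial>\<mu>)" using iK1 iK2 by simp
  also have "(\<integral>y. K1 y \<partial>\<mu>) = ip_cdf (a + \<delta>) - ip_cdf (a - \<delta>)"
    unfolding K1_def by (simp add: integrable_indicator' expectation_indicator ip_cdf_eq[OF z])
  also have "\<dots> \<le> \<eta> + 8 / real k"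
  proof -
    have "\<bar>Phi (q * (a + \<delta>)) - Phi (q * (a - \<delta>))\<bar> \<le> \<bar>q * (a + \<delta>) - q * (a - \<delta>)\<bar> / 2" by (rule Phi_lipschitz)
    also have "q * (a + \<delta>) - q * (a - \<delta>) = 2 * \<eta>" using q by (simp add: \<delta>_def algebra_simps)
    finally have "Phi (q * (a + \<delta>)) - Phi (q * (a - \<delta>)) \<le> \<eta>" using \<eta> by simp
    then show ?thesis using ip_cdf_normal[OF k, of "a + \<delta>"] ip_cdf_normal[OF k, of "a - \<delta>"]
      unfolding q_def[symmetric] by linarith
  qed
  also have "(\<integral>y. K2 y \<partial>\<mu>) = ip (x - z) (x - z) / real k / \<delta>\<^sup>2"
    using second_moment[OF xzH] k by (simp add: K2_def)
  also have "\<dots> \<le> 2 * c\<^sup>2 / \<eta>\<^sup>2"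
  proof -
    have "ip (x - z) (x - z) / real k / \<delta>\<^sup>2 = ip (x - z) (x - z) / \<eta>\<^sup>2 * (q\<^sup>2 / real k)"
      using q k by (simp add: \<delta>_def power_divide)
    also have "\<dots> \<le> (2 * c\<^sup>2 / \<eta>\<^sup>2) * 1"
      using d k by (intro mult_mono divide_right_mono) (auto simp: q(2) inner_p_nonneg)
    finally show ?thesis by simp
  qed
  finally have "\<bar>\<integral>y. G (ip x' y) * J x y - G (ip x' y) * J z y \<partial>\<mu>\<bar> \<le> \<eta> + 8 / real k + 2 * c\<^sup>2 / \<eta>\<^sup>2" by simp
  then show ?thesis using I t1 unfolding c_def[symmetric] by (simp add: abs_le_iff)
qed

end

text \<open>The indicator of \<open>inner_p p x y \<le> t\<close>, integrated against the product of
  the two laws, gives one distribution function or the other according to the order of integration.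
  Thus observations with different indices share one function.\<close>

lemma ip_cdf_unique:
  assumes 1: "unit_sphere_law \<mu> p k H" and 2: "unit_sphere_law \<mu>' p k H" and k: "1 \<le> k"
  shows "unit_sphere_law.ip_cdf \<mu> p H = unit_sphere_law.ip_cdf \<mu>' p H"
proof
  fix t
  interpret A: unit_sphere_law \<mu> p k H by fact
  interpret B: unit_sphere_law \<mu>' p k H by fact
  interpret AB: pair_prob_space \<mu> \<mu>' by unfold_locales

  define f where "f = (\<lambda>(x, y). if inner_p p x y \<le> t then 1 else 0 :: real)"
  have [measurable]: "f \<in> borel_measurable (\<mu> \<Otimes>\<^sub>M \<mu>')" unfolding f_def by measurable
  have int: "integrable (\<mu> \<Otimes>\<^sub>M \<mu>') f" by (rule AB.integrable_const_bound[of _ 1]) (auto simp: f_def split: prod.split)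
  have "(\<integral>x. (\<integral>y. f (x, y) \<partial>\<mu>') \<partial>\<mu>) = (\<integral>x. B.ip_cdf t \<partial>\<mu>)"
  proof (rule integral_cong_AE)
    show "AE x in \<mu>. (\<integral>y. f (x, y) \<partial>\<mu>') = B.ip_cdf t" using A.AE_S
      by eventually_elim (simp add: f_def B.expectation_indicator B.ip_cdf_eq)
  qed auto
  moreover have "(\<integral>y. (\<integral>x. f (x, y) \<partial>\<mu>) \<partial>\<mu>') = (\<integral>y. A.ip_cdf t \<partial>\<mu>')"
  proof (rule integral_cong_AE)
    show "AE y in \<mu>'. (\<integral>x. f (x, y) \<partial>\<mu>) = A.ip_cdf t" using B.AE_S
    proof eventually_elim
      case (elim y)
      note y = this
      have "f (x, y) = (if inner_p p y x \<le> t then 1 else 0)" for x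
        by (simp add: f_def inner_p_commute[of p y x])
      then show ?case by (simp add: A.expectation_indicator A.ip_cdf_eq[OF y])
    qed
  qed auto
  moreover have "(\<integral>x. (\<integral>y. f (x, y) \<partial>\<mu>') \<partial>\<mu>) = (\<integral>y. (\<integral>x. f (x, y) \<partial>\<mu>) \<partial>\<mu>')"
    using AB.Fubini_integral[of "\<lambda>x y. f (x, y)"] int by simp
  ultimately show "A.ip_cdf t = B.ip_cdf t" by (simp add: A.prob_space B.prob_space)
qed

text \<open>Given the first vector on the sphere, the conditional probability is the constant
  \<open>ip_cdf t\<close>.\<close>

lemma inner_cdf_eq:
  assumes "unit_sphere_law \<mu> p k H" shows "inner_cdf p \<mu> t = unit_sphere_law.ip_cdf \<mu> p H t"
proof -
  interpret A: unit_sphere_law \<mu> p k H by fact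
  interpret AA: pair_prob_space \<mu> \<mu> by unfold_locales
  define f where "f = (\<lambda>(x, y). if inner_p p x y \<le> t then 1 else 0 :: real)"
  have [measurable]: "f \<in> borel_measurable (\<mu> \<Otimes>\<^sub>M \<mu>)" unfolding f_def by measurable
  have int: "integrable (\<mu> \<Otimes>\<^sub>M \<mu>) f" by (rule AA.integrable_const_bound[of _ 1]) (auto simp: f_def split: prod.split)
  have "inner_cdf p \<mu> t = (\<integral>z. indicator {(x, y) \<in> space (\<mu> \<Otimes>\<^sub>M \<mu>). inner_p p x y \<le> t} z \<partial>(\<mu> \<Otimes>\<^sub>M \<mu>))"
    unfolding inner_cdf_def by (simp add: space_pair_measure)
  also have "\<dots> = integral\<^sup>L (\<mu> \<Otimes>\<^sub>M \<mu>) f"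
    by (intro Bochner_Integration.integral_cong) (auto simp: f_def indicator_def split: if_splits)
  also have "\<dots> = (\<integral>x. (\<integral>y. f (x, y) \<partial>\<mu>) \<partial>\<mu>)" using int by (simp add: AA.integral_fst')
  also have "\<dots> = (\<integral>x. A.ip_cdf t \<partial>\<mu>)"
  proof (rule integral_cong_AE)
    show "AE x in \<mu>. (\<integral>y. f (x, y) \<partial>\<mu>) = A.ip_cdf t" using A.AE_S
      by eventually_elim (simp add: f_def A.expectation_indicator A.ip_cdf_eq)
  qed auto
  finally show ?thesis by (simp add: A.prob_space)
qed

section \<open>Moments of degenerate U-statistics\<close>

declare One_nat_def [simp del]

text \<open>The marginals may vary with the index and share only their sigma-algebra. Since the
  underlying space is the whole type, changing one coordinate of a sample within {1..n} stays in the
  product space.\<close>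

locale sample_space =
  fixes \<mu> :: "nat \<Rightarrow> 'x measure" and M0 :: "'x measure" and n :: nat
  assumes prob_mu: "\<And>i. prob_space (\<mu> i)" and sets_mu: "\<And>i. sets (\<mu> i) = sets M0"
    and space_M0: "space M0 = UNIV"
begin

abbreviation "P \<equiv> PiM {1..n} \<mu>"

sublocale PP: product_prob_space \<mu> "{1..n}"
  by (intro product_prob_space.intro product_sigma_finite.intro product_prob_space_axioms.intro
      prob_mu prob_space_imp_sigma_finite)

lemma space_mu: "space (\<mu> i) = UNIV"
  using sets_eq_imp_space_eq[OF sets_mu] space_M0 by simp

lemma measurable_mu_cong: "measurable (\<mu> i) N = measurable M0 N"
  by (rule measurable_cong_sets[OF sets_mu refl])

lemma upd_in_P: "\<xi> \<in> space P \<Longrightarrow> i \<in> {1..n} \<Longrightarrow> \<xi>(i := y) \<in> space P"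
  by (auto simp: space_PiM space_mu PiE_def extensional_def)

text \<open>Bounded measurable functions of the sample. The class is closed under the operations
  used below, so that integrability follows from membership; the codomain is general enough for
  complex exponentials.\<close>

definition bm :: "((nat \<Rightarrow> 'x) \<Rightarrow> 'b::{banach, second_countable_topology}) \<Rightarrow> bool" where
  "bm f \<longleftrightarrow> f \<in> borel_measurable P \<and> (\<exists>C. \<forall>\<xi>\<in>space P. norm (f \<xi>) \<le> C)"

lemma bmI: "f \<in> borel_measurable P \<Longrightarrow> (\<And>\<xi>. \<xi> \<in> space P \<Longrightarrow> norm (f \<xi>) \<le> C) \<Longrightarrow> bm f"
  unfolding bm_def by blast

lemma bm_measurable: "bm f \<Longrightarrow> f \<in> borel_measurable P"
  by (simp add: bm_def)

lemma bm_integrable: "bm f \<Longrightarrow> integrable P f"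
  unfolding bm_def using PP.P.integrable_const_bound[OF AE_I2] by blast

lemma mu_integrable:
  fixes f :: "'x \<Rightarrow> 'b::{banach, second_countable_topology}"
  assumes "f \<in> borel_measurable (\<mu> i)" "\<And>y. norm (f y) \<le> C" shows "integrable (\<mu> i) f"
  using assms prob_space.finite_measure[OF prob_mu] by (intro finite_measure.integrable_const_bound) auto

lemma mu_const: "(\<integral>y. c \<partial>\<mu> i) = (c::'b::{banach, second_countable_topology})"
  using prob_space.prob_space[OF prob_mu, of i] by simp

lemma bm_const: "bm (\<lambda>_. c)"
  by (rule bmI) auto

lemma bm_add: assumes "bm f" "bm g" shows "bm (\<lambda>\<xi>. f \<xi> + g \<xi>)"
proof -
  obtain C D where C: "\<And>\<xi>. \<xi> \<in> space P \<Longrightarrow> norm (f \<xi>) \<le> C" and D: "\<And>\<xi>. \<xi> \<in> space P \<Longrightarrow> norm (g \<xi>) \<le> D"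
    using assms unfolding bm_def by blast
  show ?thesis
    by (rule bmI[of _ "C + D"]) (use assms C D in \<open>auto simp: bm_def intro!: norm_triangle_le add_mono\<close>)
qed

lemma bm_uminus: "bm f \<Longrightarrow> bm (\<lambda>\<xi>. - f \<xi>)"
  unfolding bm_def by auto

lemma bm_diff: "bm f \<Longrightarrow> bm g \<Longrightarrow> bm (\<lambda>\<xi>. f \<xi> - g \<xi>)"
  using bm_add[OF _ bm_uminus, of f g] by simp

lemma bm_sum: "(\<And>i. i \<in> I \<Longrightarrow> bm (f i)) \<Longrightarrow> bm (\<lambda>\<xi>. \<Sum>i\<in>I. f i \<xi>)"
  by (induction I rule: infinite_finite_induct) (auto intro: bm_const bm_add)

lemma bm_mult:
  fixes f g :: "(nat \<Rightarrow> 'x) \<Rightarrow> 'b::{banach, second_countable_topology, real_normed_algebra}"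
  assumes "bm f" "bm g" shows "bm (\<lambda>\<xi>. f \<xi> * g \<xi>)"
proof -
  obtain C D where C: "\<And>\<xi>. \<xi> \<in> space P \<Longrightarrow> norm (f \<xi>) \<le> C" and D: "\<And>\<xi>. \<xi> \<in> space P \<Longrightarrow> norm (g \<xi>) \<le> D"
    using assms unfolding bm_def by blast
  show ?thesis
  proof (rule bmI)
    fix \<xi> assume w: "\<xi> \<in> space P"
    have "norm (f \<xi> * g \<xi>) \<le> norm (f \<xi>) * norm (g \<xi>)" by (rule norm_mult_ineq)
    also have "\<dots> \<le> \<bar>C\<bar> * \<bar>D\<bar>" using C[OF w] D[OF w] by (intro mult_mono) auto
    finally show "norm (f \<xi> * g \<xi>) \<le> \<bar>C\<bar> * \<bar>D\<bar>" .
  qed (use assms in \<open>auto simp: bm_def\<close>)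
qed

lemma bm_power: "bm f \<Longrightarrow> bm (\<lambda>\<xi>. (f \<xi> :: real) ^ q)"
  by (induction q) (auto intro: bm_const bm_mult)

lemma bm_abs: "bm f \<Longrightarrow> bm (\<lambda>\<xi>. \<bar>f \<xi> :: real\<bar>)"
  unfolding bm_def by auto

lemma bm_cmod: "bm f \<Longrightarrow> bm (\<lambda>\<xi>. cmod (f \<xi>))"
  unfolding bm_def by auto

lemma bm_iexp: "bm f \<Longrightarrow> bm (\<lambda>\<xi>. iexp (f \<xi>))"
  by (rule bmI[of _ 1]) (auto dest: bm_measurable)

lemma bm_of_real: "bm f \<Longrightarrow> bm (\<lambda>\<xi>. complex_of_real (f \<xi>))"
  unfolding bm_def by auto

definition kernel :: "('x \<Rightarrow> 'x \<Rightarrow> real) \<Rightarrow> bool" where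
  "kernel h \<longleftrightarrow> (\<lambda>(x, y). h x y) \<in> borel_measurable (M0 \<Otimes>\<^sub>M M0) \<and> (\<exists>C. \<forall>x y. \<bar>h x y\<bar> \<le> C)"

lemma component_measurable: "i \<in> {1..n} \<Longrightarrow> (\<lambda>\<xi>. \<xi> i) \<in> P \<rightarrow>\<^sub>M M0"
  using measurable_component_singleton[of i "{1..n}" \<mu>] by (simp only: measurable_cong_sets[OF refl sets_mu, of P i])

lemma bm_kernel: assumes h: "kernel h" and ij: "i \<in> {1..n}" "j \<in> {1..n}" shows "bm (\<lambda>\<xi>. h (\<xi> i) (\<xi> j))"
proof -
  obtain C where "\<forall>x y. \<bar>h x y\<bar> \<le> C" using h by (auto simp: kernel_def)
  moreover have "(\<lambda>\<xi>. (\<lambda>(x, y). h x y) (\<xi> i, \<xi> j)) \<in> borel_measurable P"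
    using h ij by (intro measurable_compose[OF measurable_Pair]) (auto simp: kernel_def component_measurable)
  ultimately show ?thesis by (intro bmI[of _ C]) auto
qed

lemma kernel_slice: assumes "kernel h" shows "integrable (\<mu> i) (\<lambda>y. h x y)"
proof -
  obtain C where C: "\<forall>x y. \<bar>h x y\<bar> \<le> C" using assms by (auto simp: kernel_def)
  have "(\<lambda>y. (\<lambda>(x, y). h x y) (x, y)) \<in> borel_measurable M0"
    using assms by (intro measurable_compose[OF measurable_Pair1']) (auto simp: kernel_def space_M0)
  then show ?thesis using C by (intro mu_integrable[of _ _ C]) (auto simp: measurable_mu_cong)
qed

lemma kernel_power: assumes "kernel h" shows "kernel (\<lambda>x y. h x y ^ q)"
proof -
  obtain C where C: "\<forall>x y. \<bar>h x y\<bar> \<le> C" using assms by (auto simp: kernel_def)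
  have "(\<lambda>z. (\<lambda>(x, y). h x y) z ^ q) \<in> borel_measurable (M0 \<Otimes>\<^sub>M M0)" using assms by (auto simp: kernel_def)
  moreover have "\<bar>h x y ^ q\<bar> \<le> C ^ q" for x y using C by (auto simp: power_abs intro: power_mono)
  ultimately show ?thesis by (auto simp: kernel_def split_def)
qed

lemma upd_measurable:
  assumes i: "i \<in> {1..n}" shows "(\<lambda>(\<xi>, y). \<xi>(i := y)) \<in> P \<Otimes>\<^sub>M \<mu> i \<rightarrow>\<^sub>M P"
  using measurable_add_dim[of i "{1..n}" \<mu>] by (simp only: insert_absorb[OF i])

lemma slice_integrable:
  assumes f: "bm f" and i: "i \<in> {1..n}" and w: "\<xi> \<in> space P"
  shows "integrable (\<mu> i) (\<lambda>y. f (\<xi>(i := y)))"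
proof -
  obtain C where C: "\<And>\<xi>. \<xi> \<in> space P \<Longrightarrow> norm (f \<xi>) \<le> C" using f by (auto simp: bm_def)
  have "(\<lambda>y. (\<lambda>(\<xi>, y). \<xi>(i := y)) (\<xi>, y)) \<in> \<mu> i \<rightarrow>\<^sub>M P"
    by (rule measurable_compose[OF measurable_Pair1'[OF w] upd_measurable[OF i]])
  then have "(\<lambda>y. f (\<xi>(i := y))) \<in> borel_measurable (\<mu> i)"
    using measurable_compose[OF _ bm_measurable[OF f]] by simp
  then show ?thesis using C upd_in_P[OF w i] by (intro mu_integrable[of _ _ C]) auto
qed

lemma bm_slice_integral:
  assumes f: "bm f" and i: "i \<in> {1..n}"
  shows "bm (\<lambda>\<xi>. \<integral>y. f (\<xi>(i := y)) \<partial>\<mu> i)"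
proof -
  obtain C where C: "\<And>\<xi>. \<xi> \<in> space P \<Longrightarrow> norm (f \<xi>) \<le> C" using f by (auto simp: bm_def)
  have "(\<lambda>z. f ((\<lambda>(\<xi>, y). \<xi>(i := y)) z)) \<in> borel_measurable (P \<Otimes>\<^sub>M \<mu> i)"
    by (rule measurable_compose[OF upd_measurable[OF i] bm_measurable[OF f]])
  then have "(\<lambda>(\<xi>, y). f (\<xi>(i := y))) \<in> borel_measurable (P \<Otimes>\<^sub>M \<mu> i)" by (simp add: split_def)
  then have "(\<lambda>\<xi>. \<integral>y. f (\<xi>(i := y)) \<partial>\<mu> i) \<in> borel_measurable P"
    by (rule sigma_finite_measure.borel_measurable_lebesgue_integral[OF prob_space_imp_sigma_finite[OF prob_mu]])
  moreover have "norm (\<integral>y. f (\<xi>(i := y)) \<partial>\<mu> i) \<le> C" if w: "\<xi> \<in> space P" for \<xi>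
  proof -
    have "norm (\<integral>y. f (\<xi>(i := y)) \<partial>\<mu> i) \<le> (\<integral>y. norm (f (\<xi>(i := y))) \<partial>\<mu> i)" by (rule integral_norm_bound)
    also have "\<dots> \<le> (\<integral>y. C \<partial>\<mu> i)"
      by (intro integral_mono integrable_norm slice_integrable[OF f i w] mu_integrable[of _ _ "\<bar>C\<bar>"]) (auto intro: C upd_in_P[OF w i])
    finally show ?thesis by (simp only: mu_const)
  qed
  ultimately show ?thesis by (rule bmI)
qed

lemmas bm_intros = bm_const bm_add bm_uminus bm_diff bm_sum bm_mult bm_power bm_abs bm_cmod bm_iexp bm_of_real
  bm_kernel bm_slice_integral

text \<open>Integrating over an updated coordinate is the conditional expectation given all other
  coordinates, and this is its tower property. Conditional expectations appear in this form
  throughout.\<close>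

lemma integral_out:
  fixes f :: "(nat \<Rightarrow> 'x) \<Rightarrow> 'b::{banach, second_countable_topology}"
  assumes f: "bm f" and i: "i \<in> {1..n}"
  shows "(\<integral>\<xi>. f \<xi> \<partial>P) = (\<integral>\<xi>. (\<integral>y. f (\<xi>(i := y)) \<partial>\<mu> i) \<partial>P)"
proof -
  define J where "J = {1..n} - {i}"
  have J: "finite J" "i \<notin> J" "insert i J = {1..n}" using i by (auto simp: J_def)
  have ins: "(\<integral>\<xi>. g \<xi> \<partial>P) = (\<integral>\<xi>. (\<integral>y. g (\<xi>(i := y)) \<partial>\<mu> i) \<partial>PiM J \<mu>)" if "bm g" for g :: "_ \<Rightarrow> 'b"
    using PP.product_integral_insert[OF J(1,2), of g] bm_integrable[OF that] J(3) by simp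
  have "(\<integral>\<xi>. (\<integral>y. f (\<xi>(i := y)) \<partial>\<mu> i) \<partial>P)
     = (\<integral>\<xi>. (\<integral>z. (\<integral>y. f ((\<xi>(i := z))(i := y)) \<partial>\<mu> i) \<partial>\<mu> i) \<partial>PiM J \<mu>)"
    by (rule ins[OF bm_slice_integral[OF f i]])
  \<comment> \<open>The second update overwrites the first, so the integral over \<open>z\<close> is
    that of a constant.\<close>
  also have "\<dots> = (\<integral>\<xi>. (\<integral>y. f (\<xi>(i := y)) \<partial>\<mu> i) \<partial>PiM J \<mu>)"
    by (simp only: fun_upd_upd mu_const)
  also have "\<dots> = (\<integral>\<xi>. f \<xi> \<partial>P)" by (rule ins[OF f, symmetric])
  finally show ?thesis ..
qed

lemma factor_out:
  fixes F g :: "_ \<Rightarrow> 'b::{banach, second_countable_topology, real_normed_field}"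
  assumes F: "bm F" and g: "bm g" and i: "i \<in> {1..n}" and inv: "\<And>\<xi> y. F (\<xi>(i := y)) = F \<xi>"
  shows "(\<integral>\<xi>. F \<xi> * g \<xi> \<partial>P) = (\<integral>\<xi>. F \<xi> * (\<integral>y. g (\<xi>(i := y)) \<partial>\<mu> i) \<partial>P)"
proof -
  have "(\<integral>\<xi>. F \<xi> * g \<xi> \<partial>P) = (\<integral>\<xi>. (\<integral>y. F (\<xi>(i := y)) * g (\<xi>(i := y)) \<partial>\<mu> i) \<partial>P)"
    by (rule integral_out[OF bm_mult[OF F g] i])
  also have "\<dots> = (\<integral>\<xi>. F \<xi> * (\<integral>y. g (\<xi>(i := y)) \<partial>\<mu> i) \<partial>P)"
    by (simp add: inv)
  finally show ?thesis .
qed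

lemma Cauchy_Schwarz_bm:
  fixes f g :: "_ \<Rightarrow> real"
  assumes f: "bm f" and g: "bm g"
  shows "(\<integral>\<xi>. \<bar>f \<xi> * g \<xi>\<bar> \<partial>P) \<le> sqrt (\<integral>\<xi>. (f \<xi>)\<^sup>2 \<partial>P) * sqrt (\<integral>\<xi>. (g \<xi>)\<^sup>2 \<partial>P)"
proof -
  define a b x where "a = (\<integral>\<xi>. (f \<xi>)\<^sup>2 \<partial>P)" and "b = (\<integral>\<xi>. (g \<xi>)\<^sup>2 \<partial>P)" and "x = (\<integral>\<xi>. \<bar>f \<xi> * g \<xi>\<bar> \<partial>P)"
  have nn: "0 \<le> a" "0 \<le> b" "0 \<le> x" by (simp_all add: a_def b_def x_def)
  have q: "0 \<le> a * t\<^sup>2 - 2 * x * t + b" for t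
  proof -
    have "0 \<le> (\<integral>\<xi>. (t * \<bar>f \<xi>\<bar> - \<bar>g \<xi>\<bar>)\<^sup>2 \<partial>P)" by simp
    also have "\<dots> = (\<integral>\<xi>. t\<^sup>2 * (f \<xi>)\<^sup>2 - 2 * t * \<bar>f \<xi> * g \<xi>\<bar> + (g \<xi>)\<^sup>2 \<partial>P)"
      by (intro Bochner_Integration.integral_cong) (auto simp: power2_eq_square algebra_simps abs_mult)
    also have "\<dots> = t\<^sup>2 * a - 2 * t * x + b"
    proof -
      have "integrable P (\<lambda>\<xi>. (f \<xi>)\<^sup>2)" "integrable P (\<lambda>\<xi>. (g \<xi>)\<^sup>2)" "integrable P (\<lambda>\<xi>. \<bar>f \<xi> * g \<xi>\<bar>)"
        by (intro bm_integrable bm_intros f g)+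
      then show ?thesis by (simp add: a_def b_def x_def)
    qed
    finally show ?thesis by (simp add: algebra_simps)
  qed
  have "x\<^sup>2 \<le> a * b"
  proof (cases "a = 0")
    case True
    have "x = 0"
    proof (rule ccontr)
      assume "x \<noteq> 0"
      \<comment> \<open>With \<open>a = 0\<close> the quadratic is affine in t, and this t gives it
        the value -1.\<close>
      then show False using q[of "(b + 1) / (2 * x)"] True by simp
    qed
    then show ?thesis using True by simp
  next
    case False
    then have "0 < a" using nn by simp
    then show ?thesis using q[of "x / a"] by (simp add: power2_eq_square field_simps)
  qed
  then have "x \<le> sqrt (a * b)" by (rule real_le_rsqrt)
  then show ?thesis by (simp add: a_def b_def x_def real_sqrt_mult)
qed

text \<open>The martingale difference at time j of m \<mapsto> \<open>U h m\<close>: for degenerate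
  h its mean over the j-th coordinate is 0.\<close>

definition D :: "('x \<Rightarrow> 'x \<Rightarrow> real) \<Rightarrow> nat \<Rightarrow> (nat \<Rightarrow> 'x) \<Rightarrow> real" where
  "D h j \<xi> = (\<Sum>i\<in>{1..<j}. h (\<xi> i) (\<xi> j))"

definition U :: "('x \<Rightarrow> 'x \<Rightarrow> real) \<Rightarrow> nat \<Rightarrow> (nat \<Rightarrow> 'x) \<Rightarrow> real" where
  "U h m \<xi> = (\<Sum>j\<in>{1..m}. D h j \<xi>)"

lemma U_0 [simp]: "U h 0 \<xi> = 0" and U_Suc: "U h (Suc m) \<xi> = U h m \<xi> + D h (Suc m) \<xi>"
  by (simp_all add: U_def)

lemma bm_D: "kernel h \<Longrightarrow> j \<le> n \<Longrightarrow> bm (D h j)"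
  unfolding D_def[abs_def] by (rule bm_sum) (auto intro!: bm_kernel)

lemma bm_U: "kernel h \<Longrightarrow> m \<le> n \<Longrightarrow> bm (U h m)"
  unfolding U_def[abs_def] by (rule bm_sum) (auto intro!: bm_D)

lemma D_upd: "m < j \<Longrightarrow> D h m (\<xi>(j := y)) = D h m \<xi>"
  unfolding D_def by (intro sum.cong) auto

lemma U_upd: "m < j \<Longrightarrow> U h m (\<xi>(j := y)) = U h m \<xi>"
  unfolding U_def by (intro sum.cong) (auto simp: D_upd)

lemma D_upd_same: "D h j (\<xi>(j := y)) = (\<Sum>i\<in>{1..<j}. h (\<xi> i) y)"
  unfolding D_def by (intro sum.cong) auto

text \<open>Partial sums of the j-th martingale difference. With the j-th observation held fixed
  they form a martingale in m themselves when h is degenerate, so moments of \<open>D\<close> are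
  obtained by induction on m.\<close>

definition T :: "('x \<Rightarrow> 'x \<Rightarrow> real) \<Rightarrow> nat \<Rightarrow> nat \<Rightarrow> (nat \<Rightarrow> 'x) \<Rightarrow> real" where
  "T h j m \<xi> = (\<Sum>i\<in>{1..m}. h (\<xi> i) (\<xi> j))"

lemma T_Suc: "T h j (Suc m) \<xi> = T h j m \<xi> + h (\<xi> (Suc m)) (\<xi> j)" and T_0 [simp]: "T h j 0 \<xi> = 0"
  by (simp_all add: T_def)

lemma D_T: "D h (Suc j) \<xi> = T h (Suc j) j \<xi>"
  unfolding D_def T_def by (rule sum.cong) auto

lemma bm_T: "kernel h \<Longrightarrow> j \<in> {1..n} \<Longrightarrow> m \<le> n \<Longrightarrow> bm (T h j m)"
  unfolding T_def[abs_def] by (rule bm_sum) (auto intro!: bm_kernel)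

lemma T_upd: "m < i \<Longrightarrow> i \<noteq> j \<Longrightarrow> T h j m (\<xi>(i := y)) = T h j m \<xi>"
  unfolding T_def by (intro sum.cong) auto

definition degenerate :: "('x \<Rightarrow> 'x \<Rightarrow> real) \<Rightarrow> bool" where
  "degenerate h \<longleftrightarrow> kernel h \<and> (\<forall>x y. h x y = h y x) \<and> (\<forall>i x. (\<integral>y. h x y \<partial>\<mu> i) = 0)"

lemma degenerateD:
  assumes "degenerate h" shows "kernel h" "h x y = h y x" "(\<integral>y. h x y \<partial>\<mu> i) = 0" "(\<integral>y. h y x \<partial>\<mu> i) = 0"
proof -
  show "kernel h" "h x y = h y x" and 2: "(\<integral>y. h x y \<partial>\<mu> i) = 0"
    using assms unfolding degenerate_def by blast+
  have "h y x = h x y" for y using assms unfolding degenerate_def by blast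
  then show "(\<integral>y. h y x \<partial>\<mu> i) = 0" using 2 by simp
qed

lemma T_moment_step:
  assumes h: "degenerate h" and j: "j \<in> {1..n}" and m: "Suc m < j"
  shows "(\<integral>\<xi>. T h j m \<xi> ^ q * h (\<xi> (Suc m)) (\<xi> j) ^ r \<partial>P)
    = (\<integral>\<xi>. T h j m \<xi> ^ q * (\<integral>y. h y (\<xi> j) ^ r \<partial>\<mu> (Suc m)) \<partial>P)"
proof -
  have "(\<integral>\<xi>. T h j m \<xi> ^ q * h (\<xi> (Suc m)) (\<xi> j) ^ r \<partial>P)
    = (\<integral>\<xi>. T h j m \<xi> ^ q * (\<integral>y. h ((\<xi>(Suc m := y)) (Suc m)) ((\<xi>(Suc m := y)) j) ^ r \<partial>\<mu> (Suc m)) \<partial>P)"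
    using m j by (intro factor_out bm_power bm_T bm_kernel degenerateD(1)[OF h]) (auto simp: T_upd)
  then show ?thesis using m by simp
qed

lemma T_first_moment: assumes h: "degenerate h" and j: "j \<in> {1..n}" and m: "m < j"
  shows "(\<integral>\<xi>. T h j m \<xi> \<partial>P) = 0"
  using m
proof (induction m)
  case (Suc m)
  have i: "integrable P (T h j m)" "integrable P (\<lambda>\<xi>. h (\<xi> (Suc m)) (\<xi> j))"
    using Suc.prems j by (auto intro!: bm_integrable bm_T bm_kernel degenerateD(1)[OF h])
  have "(\<integral>\<xi>. h (\<xi> (Suc m)) (\<xi> j) \<partial>P) = 0"
    using T_moment_step[OF h j Suc.prems, of 0 1] degenerateD(4)[OF h] by simp
  then show ?case using Suc i by (simp add: T_Suc)
next
  case 0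
  have "T h j 0 = (\<lambda>_. 0)" by (simp add: fun_eq_iff)
  then show ?case by simp
qed

lemma T_second_moment:
  assumes h: "degenerate h" and j: "j \<in> {1..n}" and m: "m < j"
    and \<rho>: "\<And>i. i < j \<Longrightarrow> i \<in> {1..n} \<Longrightarrow> (\<integral>\<xi>. (h (\<xi> i) (\<xi> j))\<^sup>2 \<partial>P) \<le> \<rho>"
  shows "(\<integral>\<xi>. (T h j m \<xi>)\<^sup>2 \<partial>P) \<le> real m * \<rho>"
  using m
proof (induction m)
  case (Suc m)
  have b: "bm (T h j m)" "bm (\<lambda>\<xi>. h (\<xi> (Suc m)) (\<xi> j))"
    using Suc.prems j by (auto intro!: bm_T bm_kernel degenerateD(1)[OF h])
  have "(\<integral>\<xi>. (T h j (Suc m) \<xi>)\<^sup>2 \<partial>P) = (\<integral>\<xi>. (T h j m \<xi>)\<^sup>2 + 2 * (T h j m \<xi> ^ 1 * h (\<xi> (Suc m)) (\<xi> j) ^ 1) + (h (\<xi> (Suc m)) (\<xi> j))\<^sup>2 \<partial>P)"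
    by (intro Bochner_Integration.integral_cong) (auto simp: T_Suc power2_eq_square algebra_simps)
  also have "\<dots> = (\<integral>\<xi>. (T h j m \<xi>)\<^sup>2 \<partial>P) + 2 * (\<integral>\<xi>. T h j m \<xi> ^ 1 * h (\<xi> (Suc m)) (\<xi> j) ^ 1 \<partial>P) + (\<integral>\<xi>. (h (\<xi> (Suc m)) (\<xi> j))\<^sup>2 \<partial>P)"
  proof -
    have "integrable P (\<lambda>\<xi>. (T h j m \<xi>)\<^sup>2)" "integrable P (\<lambda>\<xi>. T h j m \<xi> ^ 1 * h (\<xi> (Suc m)) (\<xi> j) ^ 1)"
      "integrable P (\<lambda>\<xi>. (h (\<xi> (Suc m)) (\<xi> j))\<^sup>2)"
      by (intro bm_integrable bm_mult bm_power b)+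
    then show ?thesis by simp
  qed
  also have "(\<integral>\<xi>. T h j m \<xi> ^ 1 * h (\<xi> (Suc m)) (\<xi> j) ^ 1 \<partial>P) = 0"
    using T_moment_step[OF h j Suc.prems, of 1 1] degenerateD(4)[OF h] by simp
  also have "(\<integral>\<xi>. (h (\<xi> (Suc m)) (\<xi> j))\<^sup>2 \<partial>P) \<le> \<rho>" using Suc.prems j by (intro \<rho>) auto
  finally show ?case using Suc by (simp add: algebra_simps)
qed simp

lemma D_mean_slice:
  assumes h: "degenerate h" shows "(\<integral>y. D h j (\<xi>(j := y)) \<partial>\<mu> i) = 0"
  unfolding D_upd_same by (subst Bochner_Integration.integral_sum)
    (auto intro: kernel_slice degenerateD(1)[OF h] simp: degenerateD(3)[OF h])

text \<open>Martingale differences are orthogonal, and the one at time m + 1 has second moment at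
  most m times \<rho>; the number of pairs is relaxed to m^2.\<close>

lemma U_second_moment:
  assumes h: "degenerate h" and m: "m \<le> n"
    and \<rho>: "\<And>i j. i < j \<Longrightarrow> i \<in> {1..n} \<Longrightarrow> j \<in> {1..n} \<Longrightarrow> (\<integral>\<xi>. (h (\<xi> i) (\<xi> j))\<^sup>2 \<partial>P) \<le> \<rho>"
    and \<rho>0: "0 \<le> \<rho>"
  shows "(\<integral>\<xi>. (U h m \<xi>)\<^sup>2 \<partial>P) \<le> (real m)\<^sup>2 * \<rho>"
  using m
proof (induction m)
  case (Suc m)
  have b: "bm (U h m)" "bm (D h (Suc m))" using Suc.prems by (auto intro!: bm_U bm_D degenerateD(1)[OF h])
  have "(\<integral>\<xi>. (U h (Suc m) \<xi>)\<^sup>2 \<partial>P) = (\<integral>\<xi>. (U h m \<xi>)\<^sup>2 + 2 * (U h m \<xi> * D h (Suc m) \<xi>) + (D h (Suc m) \<xi>)\<^sup>2 \<partial>P)"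
    by (intro Bochner_Integration.integral_cong) (auto simp: U_Suc power2_eq_square algebra_simps)
  also have "\<dots> = (\<integral>\<xi>. (U h m \<xi>)\<^sup>2 \<partial>P) + 2 * (\<integral>\<xi>. U h m \<xi> * D h (Suc m) \<xi> \<partial>P) + (\<integral>\<xi>. (D h (Suc m) \<xi>)\<^sup>2 \<partial>P)"
  proof -
    have "integrable P (\<lambda>\<xi>. (U h m \<xi>)\<^sup>2)" "integrable P (\<lambda>\<xi>. U h m \<xi> * D h (Suc m) \<xi>)"
      "integrable P (\<lambda>\<xi>. (D h (Suc m) \<xi>)\<^sup>2)"
      by (intro bm_integrable bm_mult bm_power b)+
    then show ?thesis by simp
  qed
  also have "(\<integral>\<xi>. U h m \<xi> * D h (Suc m) \<xi> \<partial>P) = (\<integral>\<xi>. U h m \<xi> * (\<integral>y. D h (Suc m) (\<xi>(Suc m := y)) \<partial>\<mu> (Suc m)) \<partial>P)"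
    using Suc.prems by (intro factor_out b) (auto simp: U_upd)
  also have "\<dots> = 0" using D_mean_slice[OF h] by simp
  also have "(\<integral>\<xi>. (D h (Suc m) \<xi>)\<^sup>2 \<partial>P) \<le> real m * \<rho>"
    unfolding D_T using Suc.prems by (intro T_second_moment h \<rho>) auto
  also have "(\<integral>\<xi>. (U h m \<xi>)\<^sup>2 \<partial>P) \<le> (real m)\<^sup>2 * \<rho>" using Suc by simp
  finally have "(\<integral>\<xi>. (U h (Suc m) \<xi>)\<^sup>2 \<partial>P) \<le> ((real m)\<^sup>2 + real m) * \<rho>" by (simp add: algebra_simps)
  also have "\<dots> \<le> (real (Suc m))\<^sup>2 * \<rho>" using \<rho>0 by (intro mult_right_mono) (auto simp: power2_eq_square algebra_simps)
  finally show ?case .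
qed simp

text \<open>The conditional moments of orders 2, 3 and 4 given one argument are numbers. For
  functions of the inner product this expresses rotation invariance, and it lets these moments be
  pulled out of the expansions below.\<close>

definition stationary :: "('x \<Rightarrow> 'x \<Rightarrow> real) \<Rightarrow> real \<Rightarrow> real \<Rightarrow> real \<Rightarrow> bool" where
  "stationary h v c3 c4 \<longleftrightarrow> degenerate h \<and> (\<forall>i x. (\<integral>y. h x y ^ 2 \<partial>\<mu> i) = v) \<and> (\<forall>i x. (\<integral>y. h x y ^ 3 \<partial>\<mu> i) = c3)
     \<and> (\<forall>i x. (\<integral>y. h x y ^ 4 \<partial>\<mu> i) = c4)"

lemma stationaryD:
  assumes "stationary h v c3 c4"
  shows "degenerate h" "(\<integral>y. h x y ^ 2 \<partial>\<mu> i) = v" "(\<integral>y. h y x ^ 2 \<partial>\<mu> i) = v"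
    "(\<integral>y. h y x ^ 3 \<partial>\<mu> i) = c3" "(\<integral>y. h y x ^ 4 \<partial>\<mu> i) = c4"
proof -
  show d: "degenerate h" and "(\<integral>y. h x y ^ 2 \<partial>\<mu> i) = v" using assms by (auto simp: stationary_def)
  have "h y x = h x y" for y by (rule degenerateD(2)[OF d])
  then show "(\<integral>y. h y x ^ 2 \<partial>\<mu> i) = v" "(\<integral>y. h y x ^ 3 \<partial>\<mu> i) = c3" "(\<integral>y. h y x ^ 4 \<partial>\<mu> i) = c4"
    using assms by (simp_all add: stationary_def)
qed

lemma stationary_nonneg: assumes "stationary h v c3 c4" shows "0 \<le> v" "0 \<le> c4"
proof -
  have "0 \<le> (\<integral>y. h y x ^ 2 \<partial>\<mu> 0)" "0 \<le> (\<integral>y. h y x ^ 4 \<partial>\<mu> 0)" for x by simp_all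
  then show "0 \<le> v" "0 \<le> c4" using stationaryD[OF assms] by auto
qed

lemma stationary_entry:
  assumes h: "stationary h v c3 c4" and ij: "i < j" "i \<in> {1..n}" "j \<in> {1..n}"
  shows "(\<integral>\<xi>. (h (\<xi> i) (\<xi> j))\<^sup>2 \<partial>P) = v"
proof -
  have "(\<integral>\<xi>. (h (\<xi> i) (\<xi> j))\<^sup>2 \<partial>P) = (\<integral>\<xi>. (\<integral>y. (h ((\<xi>(i := y)) i) ((\<xi>(i := y)) j))\<^sup>2 \<partial>\<mu> i) \<partial>P)"
    by (intro integral_out bm_power bm_kernel degenerateD(1) stationaryD(1)[OF h] ij)
  also have "\<dots> = v" using ij stationaryD(3)[OF h] PP.P.prob_space by simp
  finally show ?thesis .
qed

text \<open>In the binomial expansion the term of degrees 3 and 1 vanishes by degeneracy, and that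
  of degrees 1 and 3 because the conditional third moment is a constant and the partial sum has mean
  0.\<close>

lemma T_fourth_moment:
  assumes h: "stationary h v c3 c4" and j: "j \<in> {1..n}" and m: "m < j"
  shows "(\<integral>\<xi>. (T h j m \<xi>)^4 \<partial>P) \<le> real m * c4 + 3 * (real m)\<^sup>2 * v\<^sup>2"
  using m
proof (induction m)
  case (Suc m)
  note deg = stationaryD(1)[OF h]
  let ?h = "\<lambda>\<xi>. h (\<xi> (Suc m)) (\<xi> j)"
  have b: "bm (T h j m)" "bm ?h"
    using Suc.prems j by (auto intro!: bm_T bm_kernel degenerateD(1)[OF deg])
  have "(\<integral>\<xi>. (T h j (Suc m) \<xi>)^4 \<partial>P) = (\<integral>\<xi>. (T h j m \<xi>)^4 + 4 * (T h j m \<xi> ^ 3 * ?h \<xi> ^ 1)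
      + 6 * (T h j m \<xi> ^ 2 * ?h \<xi> ^ 2) + 4 * (T h j m \<xi> ^ 1 * ?h \<xi> ^ 3) + T h j m \<xi> ^ 0 * ?h \<xi> ^ 4 \<partial>P)"
    by (intro Bochner_Integration.integral_cong refl) (auto simp: T_Suc power4_eq_xxxx power3_eq_cube power2_eq_square algebra_simps)
  also have "\<dots> = (\<integral>\<xi>. (T h j m \<xi>)^4 \<partial>P) + 4 * (\<integral>\<xi>. T h j m \<xi> ^ 3 * ?h \<xi> ^ 1 \<partial>P)
      + 6 * (\<integral>\<xi>. T h j m \<xi> ^ 2 * ?h \<xi> ^ 2 \<partial>P) + 4 * (\<integral>\<xi>. T h j m \<xi> ^ 1 * ?h \<xi> ^ 3 \<partial>P) + (\<integral>\<xi>. T h j m \<xi> ^ 0 * ?h \<xi> ^ 4 \<partial>P)"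
  proof -
    have i: "integrable P (\<lambda>\<xi>. T h j m \<xi> ^ q * ?h \<xi> ^ r)" for q r by (intro bm_integrable bm_mult bm_power b)
    have "integrable P (\<lambda>\<xi>. T h j m \<xi> ^ 4)" by (intro bm_integrable bm_power b)
    then show ?thesis using i[of 3 1] i[of 2 2] i[of 1 3] i[of 0 4] by simp
  qed
  also have "(\<integral>\<xi>. T h j m \<xi> ^ 3 * ?h \<xi> ^ 1 \<partial>P) = 0"
    unfolding T_moment_step[OF deg j Suc.prems] using degenerateD(4)[OF deg] by simp
  also have "(\<integral>\<xi>. T h j m \<xi> ^ 2 * ?h \<xi> ^ 2 \<partial>P) = v * (\<integral>\<xi>. T h j m \<xi> ^ 2 \<partial>P)"
    unfolding T_moment_step[OF deg j Suc.prems] stationaryD(3)[OF h] by simp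
  also have "(\<integral>\<xi>. T h j m \<xi> ^ 1 * ?h \<xi> ^ 3 \<partial>P) = 0"
    unfolding T_moment_step[OF deg j Suc.prems] stationaryD(4)[OF h]
    using T_first_moment[OF deg j, of m] Suc.prems by simp
  also have "(\<integral>\<xi>. T h j m \<xi> ^ 0 * ?h \<xi> ^ 4 \<partial>P) = c4"
    unfolding T_moment_step[OF deg j Suc.prems] stationaryD(5)[OF h] using PP.P.prob_space by simp
  also have "(\<integral>\<xi>. (T h j m \<xi>)^4 \<partial>P) \<le> real m * c4 + 3 * (real m)\<^sup>2 * v\<^sup>2" using Suc by simp
  also have "v * (\<integral>\<xi>. T h j m \<xi> ^ 2 \<partial>P) \<le> v * (real m * v)"
    using Suc.prems j by (intro mult_left_mono T_second_moment[OF deg] stationary_nonneg[OF h])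
      (auto simp: stationary_entry[OF h])
  finally have "(\<integral>\<xi>. (T h j (Suc m) \<xi>)^4 \<partial>P) \<le> real (Suc m) * c4 + (3 * (real m)\<^sup>2 + 6 * real m) * v\<^sup>2"
    by (simp add: algebra_simps power2_eq_square)
  also have "(3 * (real m)\<^sup>2 + 6 * real m) * v\<^sup>2 \<le> (3 * (real (Suc m))\<^sup>2) * v\<^sup>2"
    by (intro mult_right_mono) (auto simp: power2_eq_square algebra_simps)
  finally show ?case by simp
qed simp

lemma D_second_moment: assumes h: "stationary h v c3 c4" and j: "j \<in> {1..n}"
  shows "(\<integral>\<xi>. (D h j \<xi>)\<^sup>2 \<partial>P) \<le> real j * v"
proof -
  obtain m where m: "j = Suc m" using j by (cases j) auto
  have "(\<integral>\<xi>. (D h j \<xi>)\<^sup>2 \<partial>P) \<le> real m * v"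
    unfolding m D_T using j m by (intro T_second_moment[OF stationaryD(1)[OF h]]) (simp_all add: stationary_entry[OF h])
  also have "\<dots> \<le> real j * v" using stationary_nonneg[OF h] m by (intro mult_right_mono) auto
  finally show ?thesis .
qed

lemma D_fourth_moment: assumes h: "stationary h v c3 c4" and j: "j \<in> {1..n}"
  shows "(\<integral>\<xi>. (D h j \<xi>)^4 \<partial>P) \<le> real j * c4 + 3 * (real j)\<^sup>2 * v\<^sup>2"
proof -
  obtain m where m: "j = Suc m" using j by (cases j) auto
  have "(\<integral>\<xi>. (D h j \<xi>)^4 \<partial>P) \<le> real m * c4 + 3 * (real m)\<^sup>2 * v\<^sup>2"
    unfolding m D_T using j m by (intro T_fourth_moment[OF h]) auto
  also have "\<dots> \<le> real j * c4 + 3 * (real j)\<^sup>2 * v\<^sup>2" using stationary_nonneg[OF h] m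
    by (intro add_mono mult_right_mono mult_left_mono power_mono) auto
  finally show ?thesis .
qed

text \<open>The square roots of the fourth moments satisfy a Minkowski-type recursion.\<close>
lemma U_fourth_moment:
  assumes h: "stationary h v c3 c4" and m: "m \<le> n"
    and d: "\<And>j. j \<in> {1..n} \<Longrightarrow> sqrt (\<integral>\<xi>. (D h j \<xi>)^4 \<partial>P) \<le> d"
  shows "sqrt (\<integral>\<xi>. (U h m \<xi>)^4 \<partial>P) \<le> 4 * real m * d"
  using m
proof (induction m)
  case (Suc m)
  note deg = stationaryD(1)[OF h]
  let ?u = "U h m" and ?d = "D h (Suc m)"
  have b: "bm ?u" "bm ?d" using Suc.prems by (auto intro!: bm_U bm_D degenerateD(1)[OF deg])
  define x where "x = sqrt (\<integral>\<xi>. (?u \<xi>)^4 \<partial>P)"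
  have x: "0 \<le> x" "(\<integral>\<xi>. (?u \<xi>)^4 \<partial>P) = x\<^sup>2" by (simp_all add: x_def)
  have dd: "sqrt (\<integral>\<xi>. (?d \<xi>)^4 \<partial>P) \<le> d" using Suc.prems by (intro d) auto
  have d0: "0 \<le> d" by (rule order.trans[OF _ dd]) simp
  have d4: "(\<integral>\<xi>. (?d \<xi>)^4 \<partial>P) \<le> d\<^sup>2" using dd by (rule sqrt_le_D)
  have i: "integrable P (\<lambda>\<xi>. ?u \<xi> ^ q * ?d \<xi> ^ r)" for q r by (intro bm_integrable bm_mult bm_power b)
  have i4: "integrable P (\<lambda>\<xi>. ?u \<xi> ^ 4)" "integrable P (\<lambda>\<xi>. ?d \<xi> ^ 4)" by (intro bm_integrable bm_power b)+
  \<comment> \<open>The mixed term 4 u e^3 is traded for 2 u^2 e^2 + 2 e^4, so that every mixed term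
    left either has mean 0 or is controlled by the Cauchy-Schwarz inequality.\<close>
  have pw: "(u + e)^4 \<le> u^4 + 4 * (u^3 * e^1) + 8 * (u^2 * e^2) + 3 * e^4" for u e :: real
  proof -
    have "0 \<le> 2 * (u * e - e\<^sup>2)\<^sup>2" by simp
    also have "\<dots> = u^4 + 4 * (u^3 * e^1) + 8 * (u^2 * e^2) + 3 * e^4 - (u + e)^4"
      by (simp add: power4_eq_xxxx power3_eq_cube power2_eq_square algebra_simps)
    finally show ?thesis by simp
  qed
  have "(\<integral>\<xi>. (U h (Suc m) \<xi>)^4 \<partial>P) \<le> (\<integral>\<xi>. ?u \<xi>^4 + 4 * (?u \<xi>^3 * ?d \<xi>^1) + 8 * (?u \<xi>^2 * ?d \<xi>^2) + 3 * ?d \<xi>^4 \<partial>P)"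
    unfolding U_Suc
    by (intro integral_mono pw bm_integrable bm_intros b)
  also have "\<dots> = x\<^sup>2 + 4 * (\<integral>\<xi>. ?u \<xi>^3 * ?d \<xi>^1 \<partial>P) + 8 * (\<integral>\<xi>. ?u \<xi>^2 * ?d \<xi>^2 \<partial>P) + 3 * (\<integral>\<xi>. ?d \<xi>^4 \<partial>P)"
    using i[of 3 1] i[of 2 2] i4 x by simp
  also have "(\<integral>\<xi>. ?u \<xi>^3 * ?d \<xi>^1 \<partial>P) = (\<integral>\<xi>. ?u \<xi>^3 * (\<integral>y. ?d (\<xi>(Suc m := y)) ^ 1 \<partial>\<mu> (Suc m)) \<partial>P)"
    using Suc.prems by (intro factor_out bm_power b) (auto simp: U_upd)
  also have "\<dots> = 0" using D_mean_slice[OF deg] by simp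
  also have "(\<integral>\<xi>. ?u \<xi>^2 * ?d \<xi>^2 \<partial>P) \<le> x * d"
  proof -
    have "(\<integral>\<xi>. ?u \<xi>^2 * ?d \<xi>^2 \<partial>P) = (\<integral>\<xi>. \<bar>?u \<xi>^2 * ?d \<xi>^2\<bar> \<partial>P)" by simp
    also have "\<dots> \<le> sqrt (\<integral>\<xi>. (?u \<xi>^2)\<^sup>2 \<partial>P) * sqrt (\<integral>\<xi>. (?d \<xi>^2)\<^sup>2 \<partial>P)"
      by (intro Cauchy_Schwarz_bm bm_power b)
    also have "\<dots> = x * sqrt (\<integral>\<xi>. (?d \<xi>)^4 \<partial>P)" by (simp add: x_def flip: power_mult)
    also have "\<dots> \<le> x * d" using x dd by (intro mult_left_mono)
    finally show ?thesis .
  qed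
  also have "3 * (\<integral>\<xi>. ?d \<xi>^4 \<partial>P) \<le> 3 * d\<^sup>2" using d4 by simp
  finally have "(\<integral>\<xi>. (U h (Suc m) \<xi>)^4 \<partial>P) \<le> x\<^sup>2 + 8 * (x * d) + 3 * d\<^sup>2" by simp
  also have "\<dots> \<le> (x + 4 * d)\<^sup>2" by (simp add: power2_eq_square algebra_simps)
  finally have "sqrt (\<integral>\<xi>. (U h (Suc m) \<xi>)^4 \<partial>P) \<le> x + 4 * d" using x d0 by (simp add: real_le_lsqrt)
  also have "x \<le> 4 * real m * d" using Suc unfolding x_def by simp
  finally show ?case by (simp add: algebra_simps)
qed simp

end

section \<open>Characteristic function of a degenerate U-statistic\<close>

text \<open>For the upper bound on exp (- a): the product of 1 - a + a^2/2 and 1 + a + a^2/2 is 1 +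
  a^4/4, hence at least 1, and the second factor is at most exp a.\<close>

lemma exp_minus_quadratic: assumes "0 \<le> (a::real)" shows "\<bar>1 - a - exp (- a)\<bar> \<le> a\<^sup>2 / 2"
proof -
  have 1: "1 - a \<le> exp (- a)" using exp_ge_add_one_self[of "-a"] by simp
  have q: "1 + a + a\<^sup>2 / 2 \<le> exp a" by (rule exp_lower_Taylor_quadratic[OF assms])
  have "0 \<le> (1 - a)\<^sup>2" by simp
  then have pos: "0 < 1 - a + a\<^sup>2 / 2" by (simp add: power2_eq_square algebra_simps)
  have "(1 - a + a\<^sup>2 / 2) * (1 + a + a\<^sup>2 / 2) = 1 + (a\<^sup>2)\<^sup>2 / 4"
    by (simp add: power2_eq_square algebra_simps)
  then have "1 \<le> (1 - a + a\<^sup>2 / 2) * (1 + a + a\<^sup>2 / 2)" by simp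
  also have "\<dots> \<le> (1 - a + a\<^sup>2 / 2) * exp a" using q pos by (intro mult_left_mono) auto
  finally have "exp (- a) \<le> 1 - a + a\<^sup>2 / 2" by (simp add: exp_minus field_simps)
  then show ?thesis using 1 by simp
qed

lemma square_sum_pairs:
  fixes a :: "nat \<Rightarrow> real"
  shows "(\<Sum>i\<in>{1..m}. a i)\<^sup>2 = (\<Sum>i\<in>{1..m}. a i * a i) + 2 * (\<Sum>j\<in>{1..m}. \<Sum>i\<in>{1..<j}. a i * a j)"
proof (induction m)
  case (Suc m)
  have "{1..<Suc m} = {1..m}" by auto
  then have "(\<Sum>i\<in>{1..<Suc m}. a i * a (Suc m)) = (\<Sum>i\<in>{1..m}. a i) * a (Suc m)"
    by (simp add: sum_distrib_right)
  then show ?case using Suc by (simp add: power2_eq_square algebra_simps)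
qed simp

context sample_space
begin

text \<open>The conditional covariance, given two observations, of their kernel values with the j-th
  one. Its off-diagonal sum is the random part of the conditional variance of \<open>D h j\<close>;
  being degenerate itself, it is again controlled as a U-statistic.\<close>

definition HH :: "nat \<Rightarrow> ('x \<Rightarrow> 'x \<Rightarrow> real) \<Rightarrow> 'x \<Rightarrow> 'x \<Rightarrow> real" where
  "HH j h x x' = (\<integral>y. h x y * h x' y \<partial>\<mu> j)"

lemma kernel_slice_mult: assumes h: "kernel h" shows "integrable (\<mu> j) (\<lambda>y. h x y * h x' y)"
proof -
  obtain C where C: "\<forall>x y. \<bar>h x y\<bar> \<le> C" using h by (auto simp: kernel_def)
  have "norm (h x y * h x' y) \<le> C * C" for y
    unfolding norm_mult using C order.trans[OF abs_ge_zero C[rule_format]] by (intro mult_mono) auto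
  then show ?thesis
    using kernel_slice[OF h, THEN borel_measurable_integrable] by (intro mu_integrable) auto
qed

lemma kernel_HH: assumes h: "kernel h" shows "kernel (HH j h)"
proof -
  obtain C where C: "\<forall>x y. \<bar>h x y\<bar> \<le> C" using h by (auto simp: kernel_def)
  have C0: "0 \<le> C" using C abs_ge_zero order.trans by blast
  have [measurable]: "(\<lambda>(x, y). h x y) \<in> borel_measurable (M0 \<Otimes>\<^sub>M M0)" using h by (simp add: kernel_def)
  have "(\<lambda>(z, y). h (fst z) y * h (snd z) y) \<in> borel_measurable ((M0 \<Otimes>\<^sub>M M0) \<Otimes>\<^sub>M M0)"
    by measurable
  then have "(\<lambda>(z, y). h (fst z) y * h (snd z) y) \<in> borel_measurable ((M0 \<Otimes>\<^sub>M M0) \<Otimes>\<^sub>M \<mu> j)"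
    by (subst measurable_cong_sets[OF sets_pair_measure_cong[OF refl sets_mu] refl])
  then have "(\<lambda>z. \<integral>y. h (fst z) y * h (snd z) y \<partial>\<mu> j) \<in> borel_measurable (M0 \<Otimes>\<^sub>M M0)"
    by (rule sigma_finite_measure.borel_measurable_lebesgue_integral[OF prob_space_imp_sigma_finite[OF prob_mu]])
  moreover have "\<bar>HH j h x x'\<bar> \<le> C * C" for x x'
  proof -
    have "\<bar>HH j h x x'\<bar> \<le> (\<integral>y. \<bar>h x y * h x' y\<bar> \<partial>\<mu> j)" unfolding HH_def by (rule integral_abs_bound)
    also have "\<dots> \<le> (\<integral>y. C * C \<partial>\<mu> j)"
      using C C0 by (intro integral_mono integrable_abs kernel_slice_mult[OF h] mu_integrable[of _ _ "C * C"])
        (auto simp: abs_mult intro!: mult_mono)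
    finally show ?thesis by (simp only: mu_const)
  qed
  ultimately show ?thesis unfolding kernel_def HH_def by (auto simp: split_def)
qed

lemma degenerate_HH: assumes h: "degenerate h" shows "degenerate (HH j h)"
proof -
  note k = degenerateD(1)[OF h]
  obtain C where C: "\<forall>x y. \<bar>h x y\<bar> \<le> C" using k by (auto simp: kernel_def)
  have C0: "0 \<le> C" using C abs_ge_zero order.trans by blast
  have "(\<integral>x'. HH j h x x' \<partial>\<mu> i) = 0" for i x
  proof -
    interpret Q: pair_prob_space "\<mu> i" "\<mu> j"
      by (intro pair_prob_space.intro pair_sigma_finite.intro prob_mu prob_space_imp_sigma_finite)
    have [measurable]: "(\<lambda>(x, y). h x y) \<in> borel_measurable (M0 \<Otimes>\<^sub>M M0)" using k by (simp add: kernel_def)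
    have "(\<lambda>(x', y). h x y * h x' y) \<in> borel_measurable (M0 \<Otimes>\<^sub>M M0)"
      using measurable_compose[OF measurable_Pair1'[of x M0 M0]] by (simp add: space_M0) measurable
    then have m: "(\<lambda>(x', y). h x y * h x' y) \<in> borel_measurable (\<mu> i \<Otimes>\<^sub>M \<mu> j)"
      by (subst measurable_cong_sets[OF sets_pair_measure_cong[OF sets_mu sets_mu] refl])
    have int: "integrable (\<mu> i \<Otimes>\<^sub>M \<mu> j) (\<lambda>(x', y). h x y * h x' y)"
      using m C C0 by (intro Q.integrable_const_bound[of _ "C * C"]) (auto simp: abs_mult split_def intro!: mult_mono)
    have "(\<integral>x'. HH j h x x' \<partial>\<mu> i) = (\<integral>y. (\<integral>x'. h x y * h x' y \<partial>\<mu> i) \<partial>\<mu> j)"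
      unfolding HH_def using Q.Fubini_integral[OF int] by simp
    also have "\<dots> = 0" using degenerateD(4)[OF h] by simp
    finally show ?thesis .
  qed
  moreover have "HH j h x y = HH j h y x" for x y by (simp add: HH_def mult.commute)
  ultimately show ?thesis unfolding degenerate_def using kernel_HH[OF k] by blast
qed

text \<open>When the square is expanded, each diagonal term contributes the constant v by
  stationarity, and the off-diagonal terms form the kernel \<open>HH\<close>. The conditional
  variance is therefore deterministic up to a degenerate U-statistic.\<close>

lemma D_square_slice:
  assumes h: "stationary h v c3 c4"
  shows "(\<integral>y. (D h (Suc m) (\<xi>(Suc m := y)))\<^sup>2 \<partial>\<mu> (Suc m)) = real m * v + 2 * U (HH (Suc m) h) m \<xi>"
proof -
  note k = degenerateD(1)[OF stationaryD(1)[OF h]]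
  have e: "{1..<Suc m} = {1..m}" by auto
  have "(\<integral>y. (D h (Suc m) (\<xi>(Suc m := y)))\<^sup>2 \<partial>\<mu> (Suc m))
    = (\<integral>y. (\<Sum>i\<in>{1..m}. h (\<xi> i) y * h (\<xi> i) y)
        + 2 * (\<Sum>j\<in>{1..m}. \<Sum>i\<in>{1..<j}. h (\<xi> i) y * h (\<xi> j) y) \<partial>\<mu> (Suc m))"
    unfolding D_upd_same e square_sum_pairs ..
  also have "\<dots> = (\<Sum>i\<in>{1..m}. HH (Suc m) h (\<xi> i) (\<xi> i)) + 2 * U (HH (Suc m) h) m \<xi>"
    unfolding HH_def U_def D_def by (simp add: kernel_slice_mult[OF k])
  also have "(\<Sum>i\<in>{1..m}. HH (Suc m) h (\<xi> i) (\<xi> i)) = real m * v"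
    unfolding HH_def using stationaryD(2)[OF h] by (simp add: power2_eq_square)
  finally show ?thesis .
qed

lemma expectation_abs_le:
  fixes f :: "_ \<Rightarrow> real"
  assumes f: "bm f" shows "(\<integral>\<xi>. \<bar>f \<xi>\<bar> \<partial>P) \<le> sqrt (\<integral>\<xi>. (f \<xi>)\<^sup>2 \<partial>P)"
  using Cauchy_Schwarz_bm[OF f bm_const[of 1]] PP.P.prob_space by simp

text \<open>The conditional characteristic function of the last difference is replaced by exp (- a),
  where a is half of \<theta>^2 times the deterministic part of the conditional variance. The three
  errors are the third order Taylor remainder, the random part of that variance, and the gap between
  1 - a and exp (- a).\<close>

lemma char_step:
  fixes \<theta> :: real
  assumes h: "stationary h v c3 c4" and m: "Suc m \<le> n"
  shows "cmod ((\<integral>\<xi>. iexp (\<theta> * U h (Suc m) \<xi>) \<partial>P) - exp (- (\<theta>\<^sup>2 * (real m * v) / 2)) * (\<integral>\<xi>. iexp (\<theta> * U h m \<xi>) \<partial>P))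
    \<le> \<bar>\<theta>\<bar>^3 / 6 * (\<integral>\<xi>. \<bar>D h (Suc m) \<xi>\<bar>^3 \<partial>P) + \<theta>\<^sup>2 * (\<integral>\<xi>. \<bar>U (HH (Suc m) h) m \<xi>\<bar> \<partial>P)
      + (\<theta>\<^sup>2 * (real m * v) / 2)\<^sup>2 / 2"
proof -
  note deg = stationaryD(1)[OF h]
  note k = degenerateD(1)[OF deg]
  let ?j = "Suc m" and ?d = "D h (Suc m)" and ?u = "U h m"
  define a where "a = \<theta>\<^sup>2 * (real m * v) / 2"
  have a0: "0 \<le> a" using stationary_nonneg[OF h] by (simp add: a_def)
  have j: "?j \<in> {1..n}" using m by simp
  have b: "bm ?u" "bm ?d" "bm (U (HH ?j h) m)" using m by (auto intro!: bm_U bm_D k kernel_HH)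
  define \<kappa> where "\<kappa> \<xi> = (\<integral>y. iexp (\<theta> * ?d (\<xi>(?j := y))) \<partial>\<mu> ?j)" for \<xi>
  have bd: "bm (\<lambda>\<xi>. iexp (\<theta> * ?d \<xi>))" "bm (\<lambda>\<xi>. iexp (\<theta> * ?u \<xi>))" by (intro bm_iexp bm_mult bm_const b)+
  have bk: "bm \<kappa>" unfolding \<kappa>_def[abs_def] by (rule bm_slice_integral[OF bd(1) j])
  have "(\<integral>\<xi>. iexp (\<theta> * U h ?j \<xi>) \<partial>P) = (\<integral>\<xi>. iexp (\<theta> * ?u \<xi>) * iexp (\<theta> * ?d \<xi>) \<partial>P)"
    by (simp add: U_Suc distrib_left exp_add)
  also have "\<dots> = (\<integral>\<xi>. iexp (\<theta> * ?u \<xi>) * \<kappa> \<xi> \<partial>P)"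
    unfolding \<kappa>_def by (rule factor_out[OF bd(2,1) j]) (simp add: U_upd)
  finally have "(\<integral>\<xi>. iexp (\<theta> * U h ?j \<xi>) \<partial>P) - exp (- a) * (\<integral>\<xi>. iexp (\<theta> * ?u \<xi>) \<partial>P)
    = (\<integral>\<xi>. iexp (\<theta> * ?u \<xi>) * \<kappa> \<xi> - complex_of_real (exp (- a)) * iexp (\<theta> * ?u \<xi>) \<partial>P)"
    using bm_integrable[OF bm_mult[OF bd(2) bk]] bm_integrable[OF bd(2)] by (simp add: exp_of_real)
  also have "\<dots> = (\<integral>\<xi>. iexp (\<theta> * ?u \<xi>) * (\<kappa> \<xi> - complex_of_real (exp (- a))) \<partial>P)"
    by (intro Bochner_Integration.integral_cong) (auto simp: algebra_simps)
  also have "cmod \<dots> \<le> (\<integral>\<xi>. cmod (iexp (\<theta> * ?u \<xi>) * (\<kappa> \<xi> - complex_of_real (exp (- a)))) \<partial>P)"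
    by (rule integral_norm_bound)
  also have "\<dots> = (\<integral>\<xi>. cmod (\<kappa> \<xi> - complex_of_real (exp (- a))) \<partial>P)" by (simp add: norm_mult)
  also have "\<dots> \<le> (\<integral>\<xi>. \<bar>\<theta>\<bar>^3 / 6 * (\<integral>y. \<bar>?d (\<xi>(?j := y))\<bar>^3 \<partial>\<mu> ?j) + \<theta>\<^sup>2 * \<bar>U (HH ?j h) m \<xi>\<bar> + a\<^sup>2 / 2 \<partial>P)"
  proof (rule integral_mono)
    show "integrable P (\<lambda>\<xi>. cmod (\<kappa> \<xi> - complex_of_real (exp (- a))))"
      by (intro bm_integrable bm_cmod bm_diff bk bm_const)
    show "integrable P (\<lambda>\<xi>. \<bar>\<theta>\<bar>^3 / 6 * (\<integral>y. \<bar>?d (\<xi>(?j := y))\<bar>^3 \<partial>\<mu> ?j) + \<theta>\<^sup>2 * \<bar>U (HH ?j h) m \<xi>\<bar> + a\<^sup>2 / 2)"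
      by (intro bm_integrable bm_add bm_mult bm_const bm_abs b bm_slice_integral[OF _ j, of "\<lambda>\<xi>. \<bar>?d \<xi>\<bar>^3"] bm_power)
    fix \<xi> assume xi: "\<xi> \<in> space P"
    let ?e = "\<lambda>y. ?d (\<xi>(?j := y))"
    have i: "integrable (\<mu> ?j) (\<lambda>y. f (\<xi>(?j := y)))" if "bm f" for f :: "_ \<Rightarrow> 'c::{banach, second_countable_topology}"
      by (rule slice_integrable[OF that j xi])
    have i0: "integrable (\<mu> ?j) (\<lambda>y. iexp (\<theta> * ?e y))" by (rule i[OF bd(1)])
    have i1: "integrable (\<mu> ?j) (\<lambda>y. complex_of_real (?e y))" by (rule i[OF bm_of_real[OF b(2)]])
    have i2: "integrable (\<mu> ?j) (\<lambda>y. complex_of_real ((?e y)\<^sup>2))" by (rule i[OF bm_of_real[OF bm_power[OF b(2)]]])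
    have i3: "integrable (\<mu> ?j) (\<lambda>y. \<bar>?e y\<bar>^3)" by (rule i[OF bm_power[OF bm_abs[OF b(2)]]])
    have c1: "integrable (\<mu> ?j) (\<lambda>y. 1::complex)" by (rule mu_integrable[of _ _ 1]) auto
    define R where "R = U (HH ?j h) m \<xi>"
    have "(\<integral>y. 1 + \<i> * \<theta> * complex_of_real (?e y) - (\<theta>\<^sup>2 / 2) * complex_of_real ((?e y)\<^sup>2) \<partial>\<mu> ?j)
      = 1 - complex_of_real (\<theta>\<^sup>2 / 2 * (real m * v + 2 * R))"
    proof -
      have "(\<integral>y. complex_of_real (?e y) \<partial>\<mu> ?j) = 0"
        unfolding integral_complex_of_real D_mean_slice[OF deg] by simp
      moreover have "(\<integral>y. complex_of_real ((?e y)\<^sup>2) \<partial>\<mu> ?j) = complex_of_real (real m * v + 2 * R)"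
        unfolding integral_complex_of_real D_square_slice[OF h] R_def ..
      moreover have "(\<integral>y. 1 + \<i> * \<theta> * complex_of_real (?e y) - (\<theta>\<^sup>2 / 2) * complex_of_real ((?e y)\<^sup>2) \<partial>\<mu> ?j)
        = (\<integral>y. 1 \<partial>\<mu> ?j) + \<i> * \<theta> * (\<integral>y. complex_of_real (?e y) \<partial>\<mu> ?j)
          - (\<theta>\<^sup>2 / 2) * (\<integral>y. complex_of_real ((?e y)\<^sup>2) \<partial>\<mu> ?j)"
        using i1 i2 c1 by (simp del: of_real_power integral_complex_of_real lebesgue_integral_const)
      ultimately show ?thesis unfolding mu_const by simp
    qed
    then have eq: "\<kappa> \<xi> - (1 - complex_of_real (\<theta>\<^sup>2 / 2 * (real m * v + 2 * R)))
      = (\<integral>y. iexp (\<theta> * ?e y) - (1 + \<i> * \<theta> * complex_of_real (?e y) - (\<theta>\<^sup>2 / 2) * complex_of_real ((?e y)\<^sup>2)) \<partial>\<mu> ?j)"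
      unfolding \<kappa>_def using i0 i1 i2 c1 by (simp del: of_real_power)
    have "cmod (\<kappa> \<xi> - (1 - complex_of_real (\<theta>\<^sup>2 / 2 * (real m * v + 2 * R)))) \<le> (\<integral>y. \<bar>\<theta>\<bar>^3 / 6 * \<bar>?e y\<bar>^3 \<partial>\<mu> ?j)"
      unfolding eq
    proof (rule integral_norm_bound[THEN order.trans], rule integral_mono)
      show "integrable (\<mu> ?j) (\<lambda>y. cmod (iexp (\<theta> * ?e y) - (1 + \<i> * \<theta> * complex_of_real (?e y) - (\<theta>\<^sup>2 / 2) * complex_of_real ((?e y)\<^sup>2))))"
        using i0 i1 i2 c1 by (intro integrable_norm Bochner_Integration.integrable_diff Bochner_Integration.integrable_add integrable_mult_right)
      show "integrable (\<mu> ?j) (\<lambda>y. \<bar>\<theta>\<bar>^3 / 6 * \<bar>?e y\<bar>^3)" using i3 by simp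
      fix y
      define z where "z = \<theta> * ?e y"
      have "(\<Sum>k\<le>2. (\<i> * complex_of_real z)^k / fact k) = 1 + \<i> * complex_of_real z - complex_of_real (z\<^sup>2) / 2"
        by (simp add: numeral_2_eq_2 power2_eq_square algebra_simps)
      then have "cmod (iexp z - (1 + \<i> * complex_of_real z - complex_of_real (z\<^sup>2) / 2)) \<le> \<bar>z\<bar>^3 / 6"
        using iexp_approx1[of z 2] by (simp add: fact_numeral numeral_3_eq_3)
      then show "cmod (iexp (\<theta> * ?e y) - (1 + \<i> * \<theta> * complex_of_real (?e y) - (\<theta>\<^sup>2 / 2) * complex_of_real ((?e y)\<^sup>2)))
        \<le> \<bar>\<theta>\<bar>^3 / 6 * \<bar>?e y\<bar>^3"
        by (simp add: z_def abs_mult power_mult_distrib mult_ac)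
    qed
    then have 1: "cmod (\<kappa> \<xi> - (1 - complex_of_real (\<theta>\<^sup>2 / 2 * (real m * v + 2 * R)))) \<le> \<bar>\<theta>\<bar>^3 / 6 * (\<integral>y. \<bar>?e y\<bar>^3 \<partial>\<mu> ?j)"
      by simp
    have 2: "cmod ((1 - complex_of_real (\<theta>\<^sup>2 / 2 * (real m * v + 2 * R))) - complex_of_real (exp (- a))) \<le> \<theta>\<^sup>2 * \<bar>R\<bar> + a\<^sup>2 / 2"
    proof -
      have e: "\<theta>\<^sup>2 / 2 * (real m * v + 2 * R) = a + \<theta>\<^sup>2 * R"
        by (simp add: a_def field_simps)
      have "(1 - complex_of_real (\<theta>\<^sup>2 / 2 * (real m * v + 2 * R))) - complex_of_real (exp (- a))
        = complex_of_real (1 - (a + \<theta>\<^sup>2 * R) - exp (- a))"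
        unfolding e by (simp only: of_real_diff of_real_1)
      then have "cmod ((1 - complex_of_real (\<theta>\<^sup>2 / 2 * (real m * v + 2 * R))) - complex_of_real (exp (- a)))
        = \<bar>1 - (a + \<theta>\<^sup>2 * R) - exp (- a)\<bar>" by (simp only: norm_of_real)
      moreover have "\<bar>\<theta>\<^sup>2 * R\<bar> = \<theta>\<^sup>2 * \<bar>R\<bar>" by (simp add: abs_mult)
      ultimately show ?thesis using exp_minus_quadratic[OF a0] by linarith
    qed
    show "cmod (\<kappa> \<xi> - complex_of_real (exp (- a)))
      \<le> \<bar>\<theta>\<bar>^3 / 6 * (\<integral>y. \<bar>?e y\<bar>^3 \<partial>\<mu> ?j) + \<theta>\<^sup>2 * \<bar>U (HH ?j h) m \<xi>\<bar> + a\<^sup>2 / 2"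
      using norm_triangle_mono[OF 1 2] unfolding R_def by simp
  qed
  also have "\<dots> = \<bar>\<theta>\<bar>^3 / 6 * (\<integral>\<xi>. (\<integral>y. \<bar>?d (\<xi>(?j := y))\<bar>^3 \<partial>\<mu> ?j) \<partial>P) + \<theta>\<^sup>2 * (\<integral>\<xi>. \<bar>U (HH ?j h) m \<xi>\<bar> \<partial>P) + a\<^sup>2 / 2"
  proof -
    have "integrable P (\<lambda>\<xi>. (\<integral>y. \<bar>?d (\<xi>(?j := y))\<bar>^3 \<partial>\<mu> ?j))" "integrable P (\<lambda>\<xi>. \<bar>U (HH ?j h) m \<xi>\<bar>)"
      by (intro bm_integrable bm_abs b bm_slice_integral[OF _ j, of "\<lambda>\<xi>. \<bar>?d \<xi>\<bar>^3"] bm_power)+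
    then show ?thesis using PP.P.prob_space by simp
  qed
  also have "(\<integral>\<xi>. (\<integral>y. \<bar>?d (\<xi>(?j := y))\<bar>^3 \<partial>\<mu> ?j) \<partial>P) = (\<integral>\<xi>. \<bar>?d \<xi>\<bar>^3 \<partial>P)"
    by (rule integral_out[symmetric, OF _ j]) (intro bm_power bm_abs b)
  finally show ?thesis unfolding a_def by (simp add: exp_of_real)
qed

lemma stationary_bounds:
  assumes h: "stationary h v c3 c4" and A: "\<And>x y. \<bar>h x y\<bar> \<le> A"
  shows "v \<le> A\<^sup>2" "c4 \<le> A\<^sup>2 * v" "c4 \<le> A^4"
proof -
  note k = degenerateD(1)[OF stationaryD(1)[OF h]]
  have A2: "(h x y)\<^sup>2 \<le> A\<^sup>2" for x y using A[of x y] by (metis abs_ge_zero power2_abs power_mono)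
  have "v = (\<integral>y. h undefined y ^ 2 \<partial>\<mu> 0)" by (simp add: stationaryD[OF h])
  also have "\<dots> \<le> (\<integral>y. A\<^sup>2 \<partial>\<mu> 0)" using A2
    by (intro integral_mono kernel_slice kernel_power k mu_integrable[of _ _ "A\<^sup>2"]) auto
  finally show v: "v \<le> A\<^sup>2" by (simp only: mu_const)
  have "c4 = (\<integral>y. h y undefined ^ 4 \<partial>\<mu> 0)" by (simp add: stationaryD[OF h])
  also have "\<dots> = (\<integral>y. h undefined y ^ 4 \<partial>\<mu> 0)" by (simp add: degenerateD(2)[OF stationaryD(1)[OF h], of _ undefined])
  also have "\<dots> \<le> (\<integral>y. A\<^sup>2 * h undefined y ^ 2 \<partial>\<mu> 0)"
  proof (intro integral_mono integrable_mult_right kernel_slice kernel_power k)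
    fix y
    have "h undefined y ^ 4 = (h undefined y)\<^sup>2 * (h undefined y)\<^sup>2" by (simp add: power2_eq_square power4_eq_xxxx)
    also have "\<dots> \<le> A\<^sup>2 * (h undefined y)\<^sup>2" by (intro mult_right_mono A2) simp
    finally show "h undefined y ^ 4 \<le> A\<^sup>2 * h undefined y ^ 2" .
  qed
  also have "\<dots> = A\<^sup>2 * v" by (simp add: stationaryD[OF h])
  finally show c4: "c4 \<le> A\<^sup>2 * v" .
  also have "\<dots> \<le> A\<^sup>2 * A\<^sup>2" using v by (intro mult_left_mono) auto
  finally show "c4 \<le> A^4" by (simp add: power2_eq_square power4_eq_xxxx)
qed

text \<open>The third absolute moment is interpolated between the second and the fourth by the
  arithmetic-geometric inequality; the weight \<open>t\<close>, the square root of n, balances their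
  orders n and n^2.\<close>

lemma D_third_moment:
  assumes h: "stationary h v c3 c4" and A: "\<And>x y. \<bar>h x y\<bar> \<le> A" "1 \<le> A" and j: "j \<in> {1..n}"
  shows "(\<integral>\<xi>. \<bar>D h j \<xi>\<bar>^3 \<partial>P) \<le> 3 * (real n * sqrt (real n)) * A^4"
proof -
  note k = degenerateD(1)[OF stationaryD(1)[OF h]]
  have b: "bm (D h j)" using j by (intro bm_D k) auto
  define t where "t = sqrt (real n)"
  have t: "0 < t" "t * t = real n" using j by (auto simp: t_def)
  have pw: "\<bar>x\<bar>^3 \<le> (t * x\<^sup>2 + x^4 / t) / 2" for x :: real
  proof -
    have "0 \<le> (x\<^sup>2 - t * \<bar>x\<bar>)\<^sup>2" by simp
    also have "\<dots> = x^4 - 2 * t * \<bar>x\<bar>^3 + t * t * x\<^sup>2"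
      by (simp add: power2_eq_square power3_eq_cube power4_eq_xxxx algebra_simps abs_if)
    finally have "2 * t * \<bar>x\<bar>^3 \<le> t * t * x\<^sup>2 + x^4" by simp
    also have "\<dots> = t * (t * x\<^sup>2 + x^4 / t)" using t(1) by (simp add: distrib_left)
    finally have "t * (2 * \<bar>x\<bar>^3) \<le> t * (t * x\<^sup>2 + x^4 / t)" by (simp add: mult_ac)
    then show ?thesis using t(1) by simp
  qed
  have j1: "1 \<le> real j" "real j \<le> real n" using j by auto
  have A4: "A\<^sup>2 \<le> A^4" using A by (intro power_increasing) auto
  have d2: "(\<integral>\<xi>. (D h j \<xi>)\<^sup>2 \<partial>P) \<le> real n * A^4"
  proof -
    have "(\<integral>\<xi>. (D h j \<xi>)\<^sup>2 \<partial>P) \<le> real j * v" by (rule D_second_moment[OF h j])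
    also have "\<dots> \<le> real n * A^4" using j1 stationary_bounds(1)[OF h A(1)] A4 stationary_nonneg[OF h] by (intro mult_mono) auto
    finally show ?thesis .
  qed
  have d4: "(\<integral>\<xi>. (D h j \<xi>)^4 \<partial>P) \<le> 4 * (real n)\<^sup>2 * A^4"
  proof -
    have "(\<integral>\<xi>. (D h j \<xi>)^4 \<partial>P) \<le> real j * c4 + 3 * (real j)\<^sup>2 * v\<^sup>2" by (rule D_fourth_moment[OF h j])
    also have "\<dots> \<le> (real n)\<^sup>2 * A^4 + 3 * (real n)\<^sup>2 * A^4"
    proof (intro add_mono mult_mono)
      have "real j * 1 \<le> real n * real n" using j1 by (intro mult_mono) auto
      then show "real j \<le> (real n)\<^sup>2" by (simp add: power2_eq_square)
      have "v\<^sup>2 \<le> (A\<^sup>2)\<^sup>2" using stationary_bounds(1)[OF h A(1)] stationary_nonneg[OF h] by (intro power_mono) auto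
      then show "v\<^sup>2 \<le> A^4" by (simp flip: power_mult)
    qed (use j1 stationary_bounds[OF h A(1)] stationary_nonneg[OF h] in \<open>auto intro: power_mono\<close>)
    finally show ?thesis by (simp add: mult_ac)
  qed
  have "(\<integral>\<xi>. \<bar>D h j \<xi>\<bar>^3 \<partial>P) \<le> (\<integral>\<xi>. (t * (D h j \<xi>)\<^sup>2 + (D h j \<xi>)^4 / t) / 2 \<partial>P)"
    unfolding divide_inverse by (intro integral_mono pw[unfolded divide_inverse] bm_integrable bm_intros b)
  also have "\<dots> = (t * (\<integral>\<xi>. (D h j \<xi>)\<^sup>2 \<partial>P) + (\<integral>\<xi>. (D h j \<xi>)^4 \<partial>P) / t) / 2"
    using bm_integrable[OF bm_power[OF b], of 2] bm_integrable[OF bm_power[OF b], of 4] by simp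
  also have "\<dots> \<le> (t * (real n * A^4) + (4 * (real n)\<^sup>2 * A^4) / t) / 2"
    using d2 d4 t by (intro divide_right_mono add_mono mult_left_mono) auto
  also have "(4 * (real n)\<^sup>2 * A^4) / t = 4 * (real n * t) * A^4"
    using t by (simp add: power2_eq_square field_simps)
  also have "(t * (real n * A^4) + 4 * (real n * t) * A^4) / 2 \<le> 3 * (real n * t) * A^4"
    using t A by (simp add: algebra_simps)
  finally show ?thesis by (simp add: t_def)
qed

text \<open>Induction with \<open>char_step\<close>: the factors exp (- a) are at most 1, so the
  errors add up at most linearly in m, while the multiples 0, 1, ..., m - 1 of v in the exponents
  add up to the number of pairs.\<close>

lemma char_bound:
  fixes \<theta> :: real
  assumes h: "stationary h v c3 c4" and A: "\<And>x y. \<bar>h x y\<bar> \<le> A" "1 \<le> A"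
    and \<rho>: "\<And>i i' j. i < i' \<Longrightarrow> i \<in> {1..n} \<Longrightarrow> i' \<in> {1..n} \<Longrightarrow> j \<in> {1..n} \<Longrightarrow> (\<integral>\<xi>. (HH j h (\<xi> i) (\<xi> i'))\<^sup>2 \<partial>P) \<le> \<rho>"
    and \<rho>0: "0 \<le> \<rho>" and m: "m \<le> n"
  shows "cmod ((\<integral>\<xi>. iexp (\<theta> * U h m \<xi>) \<partial>P) - exp (- (\<theta>\<^sup>2 * v * (real m * (real m - 1) / 2) / 2)))
    \<le> real m * (\<bar>\<theta>\<bar>^3 / 2 * (real n * sqrt (real n)) * A^4 + \<theta>\<^sup>2 * (real n * sqrt \<rho>) + \<theta>^4 * (real n)\<^sup>2 * A^4 / 8)"
  using m
proof (induction m)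
  case 0
  have "U h 0 = (\<lambda>_. 0)" by (simp add: fun_eq_iff)
  then show ?case using PP.P.prob_space by simp
next
  case (Suc m)
  note deg = stationaryD(1)[OF h]
  let ?B = "\<bar>\<theta>\<bar>^3 / 2 * (real n * sqrt (real n)) * A^4 + \<theta>\<^sup>2 * (real n * sqrt \<rho>) + \<theta>^4 * (real n)\<^sup>2 * A^4 / 8"
  define a where "a = \<theta>\<^sup>2 * (real m * v) / 2"
  have v: "0 \<le> v" "v \<le> A\<^sup>2" using stationary_bounds[OF h A(1)] stationary_nonneg[OF h] by auto
  have a: "0 \<le> a" using v by (simp add: a_def)
  define x where "x = (\<integral>\<xi>. iexp (\<theta> * U h m \<xi>) \<partial>P)"
  define y where "y = (\<integral>\<xi>. iexp (\<theta> * U h (Suc m) \<xi>) \<partial>P)"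
  define e where "e = - (\<theta>\<^sup>2 * v * (real m * (real m - 1) / 2) / 2)"
  have step: "cmod (y - exp (- a) * x) \<le> ?B"
  proof -
    have "cmod (y - exp (- a) * x) \<le> \<bar>\<theta>\<bar>^3 / 6 * (\<integral>\<xi>. \<bar>D h (Suc m) \<xi>\<bar>^3 \<partial>P)
      + \<theta>\<^sup>2 * (\<integral>\<xi>. \<bar>U (HH (Suc m) h) m \<xi>\<bar> \<partial>P) + a\<^sup>2 / 2"
      unfolding x_def y_def a_def by (rule char_step[OF h Suc.prems])
    also have "\<dots> \<le> \<bar>\<theta>\<bar>^3 / 6 * (3 * (real n * sqrt (real n)) * A^4) + \<theta>\<^sup>2 * (real n * sqrt \<rho>) + (\<theta>^4 * (real n)\<^sup>2 * A^4 / 4) / 2"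
    proof (intro add_mono mult_left_mono divide_right_mono)
      show "(\<integral>\<xi>. \<bar>D h (Suc m) \<xi>\<bar>^3 \<partial>P) \<le> 3 * (real n * sqrt (real n)) * A^4"
        using Suc.prems by (intro D_third_moment[OF h A]) auto
      have "(\<integral>\<xi>. \<bar>U (HH (Suc m) h) m \<xi>\<bar> \<partial>P) \<le> sqrt (\<integral>\<xi>. (U (HH (Suc m) h) m \<xi>)\<^sup>2 \<partial>P)"
        using Suc.prems by (intro expectation_abs_le bm_U kernel_HH degenerateD(1)[OF deg]) auto
      also have "\<dots> \<le> sqrt ((real m)\<^sup>2 * \<rho>)"
        using Suc.prems by (intro real_sqrt_le_mono U_second_moment degenerate_HH deg \<rho> \<rho>0) auto
      also have "\<dots> \<le> real n * sqrt \<rho>" using Suc.prems \<rho>0 by (simp add: real_sqrt_mult mult_right_mono)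
      finally show "(\<integral>\<xi>. \<bar>U (HH (Suc m) h) m \<xi>\<bar> \<partial>P) \<le> real n * sqrt \<rho>" .
      have "real m * v \<le> real n * A\<^sup>2" using Suc.prems v by (intro mult_mono) auto
      then have "a \<le> \<theta>\<^sup>2 * (real n * A\<^sup>2) / 2" unfolding a_def by (intro divide_right_mono mult_left_mono) auto
      then have "a\<^sup>2 \<le> (\<theta>\<^sup>2 * (real n * A\<^sup>2) / 2)\<^sup>2" using a by (intro power_mono)
      also have "\<dots> = \<theta>^4 * (real n)\<^sup>2 * A^4 / 4" by (simp add: power2_eq_square power4_eq_xxxx)
      finally show "a\<^sup>2 \<le> \<theta>^4 * (real n)\<^sup>2 * A^4 / 4" .
    qed auto
    finally show ?thesis by (simp add: algebra_simps)
  qed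
  have ee: "- (\<theta>\<^sup>2 * v * (real (Suc m) * (real (Suc m) - 1) / 2) / 2) = - a + e"
    by (simp add: a_def e_def field_simps)
  have "y - complex_of_real (exp (- a + e)) = (y - exp (- a) * x) + exp (- a) * (x - exp e)"
  proof -
    have "exp (- a + e) = exp (- a) * exp e" by (rule exp_add)
    then have "complex_of_real (exp (- a + e)) = complex_of_real (exp (- a)) * complex_of_real (exp e)"
      by (simp only: of_real_mult)
    then show ?thesis by (simp only:) (simp add: algebra_simps)
  qed
  then have "cmod (y - complex_of_real (exp (- a + e))) \<le> cmod (y - exp (- a) * x) + cmod (exp (- a) * (x - exp e))"
    by (metis norm_triangle_ineq)
  also have "cmod (exp (- a) * (x - exp e)) = exp (- a) * cmod (x - exp e)" by (simp add: norm_mult exp_of_real)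
  also have "\<dots> \<le> 1 * (real m * ?B)"
    using Suc a unfolding x_def e_def by (intro mult_mono) (auto simp: exp_of_real)
  finally have "cmod (y - complex_of_real (exp (- a + e))) \<le> cmod (y - exp (- a) * x) + 1 * (real m * ?B)"
    by (simp only: add_left_mono)
  moreover have gen: "u \<le> (1 + t) * b" if "u \<le> d + 1 * (t * b)" "d \<le> b" for u t b d :: real
    using that by (simp add: distrib_right)
  ultimately have "cmod (y - complex_of_real (exp (- a + e))) \<le> real (Suc m) * ?B"
    unfolding of_nat_Suc by (intro gen[OF _ step])
  then show ?case unfolding ee y_def by (simp add: exp_of_real)
qed

text \<open>At \<theta> = 1 / \<surd>N, which is at most 2 / n, the errors of
  \<open>char_bound\<close> become 4 A^4 / \<surd>n, 4 \<surd>\<rho> and 2 A^4 / n; the first and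
  the third are merged.\<close>

lemma clt_bound:
  assumes h: "stationary h v c3 c4" and A: "\<And>x y. \<bar>h x y\<bar> \<le> A" "1 \<le> A"
    and \<rho>: "\<And>i i' j. i < i' \<Longrightarrow> i \<in> {1..n} \<Longrightarrow> i' \<in> {1..n} \<Longrightarrow> j \<in> {1..n} \<Longrightarrow> (\<integral>\<xi>. (HH j h (\<xi> i) (\<xi> i'))\<^sup>2 \<partial>P) \<le> \<rho>"
    and \<rho>0: "0 \<le> \<rho>" and n: "2 \<le> n"
  shows "cmod ((\<integral>\<xi>. iexp (U h n \<xi> / sqrt (real n * (real n - 1) / 2)) \<partial>P) - exp (- v / 2))
    \<le> 6 * A^4 / sqrt (real n) + 4 * sqrt \<rho>"
proof -
  define N where "N = real n * (real n - 1) / 2"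
  define \<theta> where "\<theta> = 1 / sqrt N"
  have n2: "2 \<le> real n" using n by simp
  have N: "(real n)\<^sup>2 / 4 \<le> N" using n2 by (simp add: N_def power2_eq_square field_simps)
  moreover have "0 < (real n)\<^sup>2 / 4" using n2 by simp
  ultimately have N0: "0 < N" by linarith
  have \<theta>0: "0 < \<theta>" "\<theta>\<^sup>2 * N = 1" using N0 by (auto simp: \<theta>_def power_divide)
  have "real n / 2 \<le> sqrt N" using N by (intro real_le_rsqrt) (simp add: power_divide)
  then have \<theta>: "\<theta> \<le> 2 / real n" using n2 N0 by (simp add: \<theta>_def field_simps)
  have "\<theta>\<^sup>2 * v * (real n * (real n - 1) / 2) / 2 = (\<theta>\<^sup>2 * N) * v / 2" by (simp add: N_def)
  then have e: "\<theta>\<^sup>2 * v * (real n * (real n - 1) / 2) / 2 = v / 2" using \<theta>0 by simp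
  define s where "s = sqrt (real n)"
  have s: "0 < s" "s * s = real n" "1 \<le> s" using n2 by (auto simp: s_def)
  have p: "\<theta>^q \<le> (2 / real n)^q" for q using \<theta> \<theta>0 by (intro power_mono) auto
  have "cmod ((\<integral>\<xi>. iexp (\<theta> * U h n \<xi>) \<partial>P) - exp (- (v / 2)))
    \<le> real n * (\<bar>\<theta>\<bar>^3 / 2 * (real n * sqrt (real n)) * A^4 + \<theta>\<^sup>2 * (real n * sqrt \<rho>) + \<theta>^4 * (real n)\<^sup>2 * A^4 / 8)"
    using char_bound[OF h A \<rho> \<rho>0 order_refl, of \<theta>] unfolding e .
  also have "\<dots> \<le> real n * ((2 / real n)^3 / 2 * (real n * s) * A^4 + (2 / real n)\<^sup>2 * (real n * sqrt \<rho>) + (2 / real n)^4 * (real n)\<^sup>2 * A^4 / 8)"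
    using p[of 3] p[of 2] p[of 4] \<theta>0 s A(2) \<rho>0 n2 unfolding s_def[symmetric]
    by (intro mult_left_mono add_mono divide_right_mono mult_right_mono) auto
  also have "\<dots> = 4 * A^4 / s + 4 * sqrt \<rho> + 2 * A^4 / (s * s)"
    using s n2 by (simp add: field_simps power2_eq_square power3_eq_cube power4_eq_xxxx flip: s(2))
  also have "2 * A^4 / (s * s) \<le> 2 * A^4 / s"
  proof (intro divide_left_mono)
    show "s \<le> s * s" using mult_left_mono[of 1 s s] s(1,3) by simp
    show "0 < s * s * s" using s(1) by simp
  qed (use A(2) in auto)
  finally show ?thesis unfolding s_def \<theta>_def N_def by (simp add: add_divide_distrib algebra_simps)
qed

end

section \<open>The empirical process of the kernel values\<close>

text \<open>The law F is required for every first argument of g, not only almost every one. Then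
  each bounded function of g with mean 0 is a stationary kernel, and its moments are integrals
  against one law on the line.\<close>

locale law_kernel = sample_space \<mu> M0 n for \<mu> :: "nat \<Rightarrow> 'x measure" and M0 :: "'x measure" and n :: nat +
  fixes g :: "'x \<Rightarrow> 'x \<Rightarrow> real" and F :: "real \<Rightarrow> real"
  assumes g_measurable: "(\<lambda>(x, y). g x y) \<in> borel_measurable (M0 \<Otimes>\<^sub>M M0)"
    and g_sym: "g x y = g y x"
    and law: "measure (\<mu> i) {y. g x y \<le> t} = F t"
    and F_isCont: "isCont F t" and F_minus_one: "F (- 1) = 0" and F_one: "F 1 = 1"
    and n2: "2 \<le> n"
begin

text \<open>The index 0 and the undefined first argument are placeholders: \<open>law_eq\<close>
  identifies all choices.\<close>

definition \<Lambda> :: "real measure" where "\<Lambda> = distr (\<mu> 0) borel (g undefined)"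

lemma g_slice_measurable: "g x \<in> borel_measurable (\<mu> i)"
proof -
  have "(\<lambda>y. (\<lambda>(x, y). g x y) (x, y)) \<in> borel_measurable M0"
    by (rule measurable_compose[OF measurable_Pair1' g_measurable]) (simp add: space_M0)
  then show ?thesis by (simp add: measurable_mu_cong)
qed

lemma real_distribution_slice: "real_distribution (distr (\<mu> i) borel (g x))"
  by (rule prob_space.real_distribution_distr[OF prob_mu g_slice_measurable])

lemma cdf_slice: "cdf (distr (\<mu> i) borel (g x)) = F"
proof
  fix t
  have "cdf (distr (\<mu> i) borel (g x)) t = measure (\<mu> i) (g x -` {..t} \<inter> space (\<mu> i))"
    unfolding cdf_def by (rule measure_distr[OF g_slice_measurable]) simp
  then show "cdf (distr (\<mu> i) borel (g x)) t = F t" using law[of i x t] by (simp add: vimage_def space_mu)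
qed

lemma law_eq: "distr (\<mu> i) borel (g x) = \<Lambda>"
  unfolding \<Lambda>_def by (intro cdf_unique real_distribution_slice) (simp add: cdf_slice)

lemma Lambda_real_distribution: "real_distribution \<Lambda>"
  unfolding \<Lambda>_def by (rule real_distribution_slice)

sublocale L: real_distribution \<Lambda>
  by (rule Lambda_real_distribution)

lemma cdf_Lambda: "cdf \<Lambda> = F"
  unfolding \<Lambda>_def by (rule cdf_slice)

lemma F_mono: "s \<le> t \<Longrightarrow> F s \<le> F t"
  using L.cdf_nondecreasing[of s t] by (simp add: cdf_Lambda)

lemma F_bounds: "0 \<le> F t" "F t \<le> 1"
  using L.cdf_nonneg[of t] L.cdf_bounded_prob[of t] by (simp_all add: cdf_Lambda)

lemma integral_slice:
  fixes \<phi> :: "real \<Rightarrow> real"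
  assumes "\<phi> \<in> borel_measurable borel" shows "(\<integral>y. \<phi> (g x y) \<partial>\<mu> i) = (\<integral>z. \<phi> z \<partial>\<Lambda>)"
  unfolding law_eq[of i x, symmetric] by (rule integral_distr[symmetric, OF g_slice_measurable assms])

lemma Lambda_integrable:
  fixes \<phi> :: "real \<Rightarrow> real"
  assumes "\<phi> \<in> borel_measurable borel" "\<And>z. \<bar>\<phi> z\<bar> \<le> A" shows "integrable \<Lambda> \<phi>"
  using assms by (intro L.integrable_const_bound[of _ A]) auto

lemma kernel_compose:
  fixes \<phi> :: "real \<Rightarrow> real"
  assumes "\<phi> \<in> borel_measurable borel" "\<And>z. \<bar>\<phi> z\<bar> \<le> A" shows "kernel (\<lambda>x y. \<phi> (g x y))"
  unfolding kernel_def using measurable_compose[OF g_measurable assms(1)] assms(2) by (auto simp: split_def)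

lemma stationary_compose:
  fixes \<phi> :: "real \<Rightarrow> real"
  assumes \<phi>: "\<phi> \<in> borel_measurable borel" "\<And>z. \<bar>\<phi> z\<bar> \<le> A" "(\<integral>z. \<phi> z \<partial>\<Lambda>) = 0"
  shows "stationary (\<lambda>x y. \<phi> (g x y)) (\<integral>z. \<phi> z ^ 2 \<partial>\<Lambda>) (\<integral>z. \<phi> z ^ 3 \<partial>\<Lambda>) (\<integral>z. \<phi> z ^ 4 \<partial>\<Lambda>)"
proof -
  have "(\<lambda>z. \<phi> z ^ q) \<in> borel_measurable borel" for q using \<phi>(1) by measurable
  then show ?thesis unfolding stationary_def degenerate_def
    using kernel_compose[OF \<phi>(1,2)] integral_slice[OF \<phi>(1)] \<phi>(3) g_sym
    by (auto simp: integral_slice[of "\<lambda>z. \<phi> z ^ _"])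
qed

definition cent :: "real \<Rightarrow> real \<Rightarrow> real" where
  "cent t z = (if z \<le> t then 1 else 0) - F t"

lemma cent_measurable [measurable]: "cent t \<in> borel_measurable borel"
  unfolding cent_def[abs_def] by measurable

lemma cent_abs_le: "\<bar>cent t z\<bar> \<le> 1"
  using F_bounds[of t] by (auto simp: cent_def)

lemma indicator_integral: "(\<integral>z. (if z \<le> t then 1 else 0) \<partial>\<Lambda>) = F t"
proof -
  have "(\<integral>z. (if z \<le> t then 1 else 0) \<partial>\<Lambda>) = (\<integral>z. indicator {..t} z \<partial>\<Lambda>)"
    by (intro Bochner_Integration.integral_cong) (auto simp: indicator_def)
  also have "\<dots> = F t" by (simp add: cdf_Lambda[symmetric] cdf_def)
  finally show ?thesis .
qed

lemma indicator_integrable: "integrable \<Lambda> (\<lambda>z. if z \<le> t then 1 else 0 :: real)"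
  by (rule Lambda_integrable[of _ 1]) auto

lemma cent_integral: "(\<integral>z. cent t z \<partial>\<Lambda>) = 0"
  unfolding cent_def using L.prob_space by (simp add: indicator_integrable indicator_integral)

lemma cent_cov: "(\<integral>z. cent s z * cent t z \<partial>\<Lambda>) = min (F s) (F t) - F s * F t"
proof -
  have "(\<integral>z. cent s z * cent t z \<partial>\<Lambda>) = (\<integral>z. (if z \<le> min s t then 1 else 0) - F t * (if z \<le> s then 1 else 0)
      - F s * (if z \<le> t then 1 else 0) + F s * F t \<partial>\<Lambda>)"
    by (intro Bochner_Integration.integral_cong) (auto simp: cent_def algebra_simps)
  also have "\<dots> = F (min s t) - F t * F s - F s * F t + F s * F t"
    using indicator_integrable L.prob_space by (simp add: indicator_integral del: min.bounded_iff)
  also have "F (min s t) = min (F s) (F t)" using F_mono[of s t] F_mono[of t s] by (auto simp: min_def)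
  finally show ?thesis by simp
qed

definition N :: real where "N = real n * (real n - 1) / 2"

lemma N_props: "0 < N" "(real n)\<^sup>2 / 4 \<le> N" "N \<le> (real n)\<^sup>2"
proof -
  have n: "2 \<le> real n" using n2 by simp
  then show N: "(real n)\<^sup>2 / 4 \<le> N" by (simp add: N_def power2_eq_square field_simps)
  have "0 < (real n)\<^sup>2 / 4" using n by simp
  then show "0 < N" using N by linarith
  have "real n * (real n - 1) \<le> 2 * (real n * real n)" using n by (simp add: algebra_simps)
  then show "N \<le> (real n)\<^sup>2" by (simp add: N_def power2_eq_square)
qed

definition alpha :: "real \<Rightarrow> (nat \<Rightarrow> 'x) \<Rightarrow> real" where
  "alpha t \<xi> = U (\<lambda>x y. cent t (g x y)) n \<xi> / sqrt N"

definition cnt :: "real \<Rightarrow> (nat \<Rightarrow> 'x) \<Rightarrow> real" where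
  "cnt t \<xi> = U (\<lambda>x y. if g x y \<le> t then 1 else 0) n \<xi>"

lemma pair_count: "(\<Sum>j\<in>{1..m}. \<Sum>i\<in>{1..<j}. (1::real)) = real m * (real m - 1) / 2"
proof (induction m)
  case (Suc m)
  then show ?case by (simp add: field_simps)
qed simp

lemma alpha_cnt: "alpha t \<xi> = (cnt t \<xi> - N * F t) / sqrt N"
proof -
  have "U (\<lambda>x y. cent t (g x y)) n \<xi> = cnt t \<xi> - (\<Sum>j\<in>{1..n}. \<Sum>i\<in>{1..<j}. 1) * F t"
    unfolding U_def D_def cnt_def cent_def by (simp add: sum_subtractf sum_distrib_right del: sum_constant)
  then show ?thesis unfolding pair_count by (simp add: alpha_def N_def)
qed

lemma cnt_mono: "s \<le> t \<Longrightarrow> cnt s \<xi> \<le> cnt t \<xi>"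
  unfolding cnt_def U_def D_def by (intro sum_mono) auto

lemma bm_alpha: "bm (alpha t)"
proof -
  have "bm (\<lambda>\<xi>. U (\<lambda>x y. cent t (g x y)) n \<xi> * (1 / sqrt N))"
    by (intro bm_mult bm_U bm_const kernel_compose[of _ 1] cent_abs_le) auto
  then show ?thesis by (simp add: alpha_def[abs_def])
qed

lemma U_linear: "U (\<lambda>x y. \<Sum>u\<in>J. a u * k u x y) m \<xi> = (\<Sum>u\<in>J. a u * U (k u) m \<xi>)"
proof -
  have D: "D (\<lambda>x y. \<Sum>u\<in>J. a u * k u x y) j \<xi> = (\<Sum>u\<in>J. a u * D (k u) j \<xi>)" for j
    unfolding D_def sum_distrib_left by (rule sum.swap)
  show ?thesis unfolding U_def D sum_distrib_left by (rule sum.swap)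
qed

text \<open>A bound in mean, uniform in both thresholds, on the conditional covariance of two
  indicators given two distinct observations. For inner products it is supplied by
  \<open>indicator_decorrelation\<close>.\<close>

definition dec :: "real \<Rightarrow> bool" where
  "dec \<epsilon> \<longleftrightarrow> (\<forall>i i' j s t. i \<in> {1..n} \<longrightarrow> i' \<in> {1..n} \<longrightarrow> i \<noteq> i' \<longrightarrow>
     (\<integral>\<xi>. \<bar>\<integral>y. cent s (g (\<xi> i) y) * cent t (g (\<xi> i') y) \<partial>\<mu> j\<bar> \<partial>P) \<le> \<epsilon>)"

lemma cent_prod_kernel: "kernel (\<lambda>x x'. \<integral>y. cent s (g x y) * cent t (g x' y) \<partial>\<mu> j)"
proof -
  have [measurable]: "(\<lambda>(x, y). g x y) \<in> borel_measurable (M0 \<Otimes>\<^sub>M M0)" by (rule g_measurable)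
  have "(\<lambda>(z, y). cent s (g (fst z) y) * cent t (g (snd z) y)) \<in> borel_measurable ((M0 \<Otimes>\<^sub>M M0) \<Otimes>\<^sub>M M0)"
    by measurable
  then have "(\<lambda>(z, y). cent s (g (fst z) y) * cent t (g (snd z) y)) \<in> borel_measurable ((M0 \<Otimes>\<^sub>M M0) \<Otimes>\<^sub>M \<mu> j)"
    by (subst measurable_cong_sets[OF sets_pair_measure_cong[OF refl sets_mu] refl])
  then have m: "(\<lambda>z. \<integral>y. cent s (g (fst z) y) * cent t (g (snd z) y) \<partial>\<mu> j) \<in> borel_measurable (M0 \<Otimes>\<^sub>M M0)"
    by (rule sigma_finite_measure.borel_measurable_lebesgue_integral[OF prob_space_imp_sigma_finite[OF prob_mu]])
  have "\<bar>\<integral>y. cent s (g x y) * cent t (g x' y) \<partial>\<mu> j\<bar> \<le> 1" for x x'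
  proof -
    have "\<bar>\<integral>y. cent s (g x y) * cent t (g x' y) \<partial>\<mu> j\<bar> \<le> (\<integral>y. \<bar>cent s (g x y) * cent t (g x' y)\<bar> \<partial>\<mu> j)"
      by (rule integral_abs_bound)
    also have "\<dots> \<le> (\<integral>y. 1 \<partial>\<mu> j)"
      by (intro integral_mono' mu_integrable[of _ _ 1]) (auto simp: abs_mult intro!: mult_le_one cent_abs_le)
    finally show ?thesis by (simp only: mu_const)
  qed
  then show ?thesis using m unfolding kernel_def by (auto simp: split_def)
qed

lemma cent_prod_integrable: "integrable (\<mu> j) (\<lambda>y. cent s (g x y) * cent t (g x' y))"
  using g_slice_measurable[of x j] g_slice_measurable[of x' j]
  by (intro mu_integrable[of _ _ 1]) (auto simp: abs_mult intro!: mult_le_one cent_abs_le)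

text \<open>The Cramer-Wold device: a linear combination of values of \<open>alpha\<close> is one
  U-statistic, whose kernel is a function of g, so \<open>clt_bound\<close> applies. The summand 1
  in A ensures that A is at least 1.\<close>

lemma char_alpha:
  fixes a q :: "real \<Rightarrow> real"
  assumes J: "finite J" and \<epsilon>: "dec \<epsilon>" "0 \<le> \<epsilon>"
  defines "A \<equiv> 1 + (\<Sum>u\<in>J. \<bar>a u\<bar>)"
  shows "cmod ((\<integral>\<xi>. iexp (\<Sum>u\<in>J. a u * alpha (q u) \<xi>) \<partial>P)
      - exp (- (\<Sum>u\<in>J. \<Sum>w\<in>J. a u * a w * (min (F (q u)) (F (q w)) - F (q u) * F (q w))) / 2))
    \<le> 6 * A^4 / sqrt (real n) + 4 * sqrt (A^4 * \<epsilon>)"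
proof -
  define \<phi> where "\<phi> z = (\<Sum>u\<in>J. a u * cent (q u) z)" for z
  have \<phi>m [measurable]: "\<phi> \<in> borel_measurable borel" unfolding \<phi>_def[abs_def] by measurable
  have A1: "1 \<le> A" by (simp add: A_def sum_nonneg)
  have \<phi>A: "\<bar>\<phi> z\<bar> \<le> A" for z
  proof -
    have "\<bar>\<phi> z\<bar> \<le> (\<Sum>u\<in>J. \<bar>a u * cent (q u) z\<bar>)" unfolding \<phi>_def by (rule sum_abs)
    also have "\<dots> \<le> (\<Sum>u\<in>J. \<bar>a u\<bar>)" by (intro sum_mono) (auto simp: abs_mult intro!: mult_left_le cent_abs_le)
    finally show ?thesis by (simp add: A_def)
  qed
  have ic: "integrable \<Lambda> (cent t)" for t by (rule Lambda_integrable[OF _ cent_abs_le]) simp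
  have \<phi>0: "(\<integral>z. \<phi> z \<partial>\<Lambda>) = 0" unfolding \<phi>_def using ic by (simp add: cent_integral)
  have ic2: "integrable \<Lambda> (\<lambda>z. cent s z * cent t z)" for s t
    by (rule Lambda_integrable[of _ 1]) (auto simp: abs_mult intro!: mult_le_one cent_abs_le)
  have "(\<integral>z. \<phi> z ^ 2 \<partial>\<Lambda>) = (\<integral>z. (\<Sum>u\<in>J. \<Sum>w\<in>J. (a u * a w) * (cent (q u) z * cent (q w) z)) \<partial>\<Lambda>)"
    unfolding \<phi>_def power2_eq_square sum_product by (simp add: mult_ac)
  also have "\<dots> = (\<Sum>u\<in>J. \<Sum>w\<in>J. a u * a w * (min (F (q u)) (F (q w)) - F (q u) * F (q w)))"
    using ic2 by (simp add: cent_cov)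
  finally have var: "(\<integral>z. \<phi> z ^ 2 \<partial>\<Lambda>) = (\<Sum>u\<in>J. \<Sum>w\<in>J. a u * a w * (min (F (q u)) (F (q w)) - F (q u) * F (q w)))" .
  define h where "h = (\<lambda>x y. \<phi> (g x y))"
  have h: "stationary h (\<integral>z. \<phi> z ^ 2 \<partial>\<Lambda>) (\<integral>z. \<phi> z ^ 3 \<partial>\<Lambda>) (\<integral>z. \<phi> z ^ 4 \<partial>\<Lambda>)"
    unfolding h_def by (rule stationary_compose[OF \<phi>m \<phi>A \<phi>0])
  have hA: "\<bar>h x y\<bar> \<le> A" for x y by (simp add: h_def \<phi>A)
  have \<rho>: "(\<integral>\<xi>. (HH j h (\<xi> i) (\<xi> i'))\<^sup>2 \<partial>P) \<le> A^4 * \<epsilon>" if "i < i'" "i \<in> {1..n}" "i' \<in> {1..n}" for i i' j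
  proof -
    define K where "K s t \<xi> = \<bar>\<integral>y. cent s (g (\<xi> i) y) * cent t (g (\<xi> i') y) \<partial>\<mu> j\<bar>" for s t and \<xi> :: "nat \<Rightarrow> 'x"
    have bK: "bm (K s t)" for s t unfolding K_def[abs_def] using that by (intro bm_abs bm_kernel[OF cent_prod_kernel])
    have EK: "(\<integral>\<xi>. K s t \<xi> \<partial>P) \<le> \<epsilon>" for s t using \<epsilon>(1) that unfolding dec_def K_def by auto
    have HH1: "\<bar>HH j h x x'\<bar> \<le> A\<^sup>2" for x x'
    proof -
      have "\<bar>HH j h x x'\<bar> \<le> (\<integral>y. \<bar>h x y * h x' y\<bar> \<partial>\<mu> j)" unfolding HH_def by (rule integral_abs_bound)
      also have "\<dots> \<le> (\<integral>y. A\<^sup>2 \<partial>\<mu> j)"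
        using A1 by (intro integral_mono' mu_integrable[of _ _ "A\<^sup>2"]) (auto simp: abs_mult power2_eq_square intro!: mult_mono hA)
      finally show ?thesis by (simp only: mu_const)
    qed
    have HH2: "\<bar>HH j h (\<xi> i) (\<xi> i')\<bar> \<le> (\<Sum>u\<in>J. \<Sum>w\<in>J. \<bar>a u\<bar> * \<bar>a w\<bar> * K (q u) (q w) \<xi>)" for \<xi>
    proof -
      have "HH j h (\<xi> i) (\<xi> i') = (\<integral>y. (\<Sum>u\<in>J. \<Sum>w\<in>J. (a u * a w) * (cent (q u) (g (\<xi> i) y) * cent (q w) (g (\<xi> i') y))) \<partial>\<mu> j)"
        unfolding HH_def h_def \<phi>_def sum_product by (simp add: mult_ac)
      also have "\<dots> = (\<Sum>u\<in>J. \<Sum>w\<in>J. (a u * a w) * (\<integral>y. cent (q u) (g (\<xi> i) y) * cent (q w) (g (\<xi> i') y) \<partial>\<mu> j))"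
        using cent_prod_integrable by simp
      finally have e: "HH j h (\<xi> i) (\<xi> i') = (\<Sum>u\<in>J. \<Sum>w\<in>J. (a u * a w) * (\<integral>y. cent (q u) (g (\<xi> i) y) * cent (q w) (g (\<xi> i') y) \<partial>\<mu> j))" .
      have s: "\<bar>\<Sum>u\<in>J. \<Sum>w\<in>J. f u w\<bar> \<le> (\<Sum>u\<in>J. \<Sum>w\<in>J. \<bar>f u w\<bar>)" for f :: "real \<Rightarrow> real \<Rightarrow> real"
        by (rule order.trans[OF sum_abs sum_mono[OF sum_abs]])
      show ?thesis unfolding e K_def abs_mult[symmetric] by (rule s)
    qed
    \<comment> \<open>One factor of the square is bounded by its supremum A^2, the other in mean
      through \<open>dec\<close>.\<close>
    have "(\<integral>\<xi>. (HH j h (\<xi> i) (\<xi> i'))\<^sup>2 \<partial>P) \<le> (\<integral>\<xi>. A\<^sup>2 * (\<Sum>u\<in>J. \<Sum>w\<in>J. \<bar>a u\<bar> * \<bar>a w\<bar> * K (q u) (q w) \<xi>) \<partial>P)"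
    proof (rule integral_mono)
      show "integrable P (\<lambda>\<xi>. (HH j h (\<xi> i) (\<xi> i'))\<^sup>2)" using that
        by (intro bm_integrable bm_power bm_kernel kernel_HH degenerateD(1) stationaryD(1)[OF h])
      show "integrable P (\<lambda>\<xi>. A\<^sup>2 * (\<Sum>u\<in>J. \<Sum>w\<in>J. \<bar>a u\<bar> * \<bar>a w\<bar> * K (q u) (q w) \<xi>))"
        by (intro bm_integrable bm_mult bm_sum bm_const bK)
      fix \<xi>
      have "(HH j h (\<xi> i) (\<xi> i'))\<^sup>2 = \<bar>HH j h (\<xi> i) (\<xi> i')\<bar> * \<bar>HH j h (\<xi> i) (\<xi> i')\<bar>" by (simp add: power2_eq_square)
      also have "\<dots> \<le> A\<^sup>2 * (\<Sum>u\<in>J. \<Sum>w\<in>J. \<bar>a u\<bar> * \<bar>a w\<bar> * K (q u) (q w) \<xi>)"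
        by (intro mult_mono HH1 HH2) auto
      finally show "(HH j h (\<xi> i) (\<xi> i'))\<^sup>2 \<le> A\<^sup>2 * (\<Sum>u\<in>J. \<Sum>w\<in>J. \<bar>a u\<bar> * \<bar>a w\<bar> * K (q u) (q w) \<xi>)" .
    qed
    also have "\<dots> = A\<^sup>2 * (\<Sum>u\<in>J. \<Sum>w\<in>J. \<bar>a u\<bar> * \<bar>a w\<bar> * (\<integral>\<xi>. K (q u) (q w) \<xi> \<partial>P))"
      using bm_integrable[OF bK] by simp
    also have "\<dots> \<le> A\<^sup>2 * (\<Sum>u\<in>J. \<Sum>w\<in>J. \<bar>a u\<bar> * \<bar>a w\<bar> * \<epsilon>)"
      by (intro mult_left_mono sum_mono EK) auto
    also have "(\<Sum>u\<in>J. \<Sum>w\<in>J. \<bar>a u\<bar> * \<bar>a w\<bar> * \<epsilon>) = (A - 1)\<^sup>2 * \<epsilon>"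
    proof -
      have "A - 1 = (\<Sum>u\<in>J. \<bar>a u\<bar>)" by (simp add: A_def)
      then have "(A - 1)\<^sup>2 = (\<Sum>u\<in>J. \<Sum>w\<in>J. \<bar>a u\<bar> * \<bar>a w\<bar>)" by (simp only: power2_eq_square sum_product)
      then show ?thesis by (simp only: sum_distrib_right)
    qed
    also have "A\<^sup>2 * ((A - 1)\<^sup>2 * \<epsilon>) \<le> A\<^sup>2 * (A\<^sup>2 * \<epsilon>)"
      using A1 \<epsilon>(2) by (intro mult_left_mono mult_right_mono power_mono) auto
    also have "\<dots> = A^4 * \<epsilon>" by (simp add: power2_eq_square power4_eq_xxxx)
    finally show ?thesis .
  qed
  have "(\<Sum>u\<in>J. a u * alpha (q u) \<xi>) = U h n \<xi> / sqrt (real n * (real n - 1) / 2)" for \<xi>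
    unfolding h_def \<phi>_def U_linear alpha_def N_def[symmetric] by (simp add: sum_divide_distrib)
  then show ?thesis unfolding var[symmetric]
    using clt_bound[OF h hA A1 \<rho> _ n2] A1 \<epsilon>(2) by simp
qed

section \<open>Moments of the process and of its increments\<close>

lemma alpha_second_moment: "(\<integral>\<xi>. (alpha t \<xi>)\<^sup>2 \<partial>P) \<le> 4"
proof -
  define h where "h = (\<lambda>x y. cent t (g x y))"
  define v where "v = (\<integral>z. cent t z ^ 2 \<partial>\<Lambda>)"
  have h: "stationary h v (\<integral>z. cent t z ^ 3 \<partial>\<Lambda>) (\<integral>z. cent t z ^ 4 \<partial>\<Lambda>)"
    unfolding h_def v_def by (rule stationary_compose[OF _ cent_abs_le cent_integral]) simp
  have v: "v \<le> 1" using stationary_bounds(1)[OF h, of 1] by (simp add: h_def cent_abs_le)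
  have v0: "0 \<le> v" using stationary_nonneg[OF h] by simp
  have "(\<integral>\<xi>. (alpha t \<xi>)\<^sup>2 \<partial>P) = (\<integral>\<xi>. (U h n \<xi>)\<^sup>2 \<partial>P) / N"
    using N_props by (simp add: alpha_def h_def power_divide)
  also have "\<dots> \<le> ((real n)\<^sup>2 * v) / N"
    using N_props by (intro divide_right_mono U_second_moment stationaryD(1)[OF h] v0) (auto simp: stationary_entry[OF h])
  also have "\<dots> \<le> ((real n)\<^sup>2 * 1) / N" using v N_props by (intro divide_right_mono mult_left_mono) auto
  also have "\<dots> \<le> 4" using N_props by (simp add: divide_le_eq)
  finally show ?thesis .
qed

text \<open>The increment kernel is a centred indicator of probability \<open>\<delta>\<close>, so
  its variance and its fourth moment are both at most \<open>\<delta>\<close>. After normalisation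
  the fourth moment enters with a factor 1 / n, whence the term linear in the increment of F. The
  computation gives the constants 768 and 256, rounded up to 2048.\<close>

lemma alpha_increment:
  assumes st: "F s \<le> F t"
  shows "(\<integral>\<xi>. (alpha t \<xi> - alpha s \<xi>)^4 \<partial>P) \<le> 2048 * ((F t - F s)\<^sup>2 + (F t - F s) / real n)"
proof -
  define \<delta> where "\<delta> = F t - F s"
  have \<delta>: "0 \<le> \<delta>" "\<delta> \<le> 1" using st F_bounds[of s] F_bounds[of t] by (auto simp: \<delta>_def)
  define \<psi> where "\<psi> z = cent t z - cent s z" for z
  have \<psi>m: "\<psi> \<in> borel_measurable borel" unfolding \<psi>_def[abs_def] by measurable
  have ic: "integrable \<Lambda> (cent t)" for t by (rule Lambda_integrable[OF _ cent_abs_le]) simp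
  have \<psi>0: "(\<integral>z. \<psi> z \<partial>\<Lambda>) = 0" unfolding \<psi>_def using ic by (simp add: cent_integral)
  have \<psi>1: "\<bar>\<psi> z\<bar> \<le> 1" for z
  proof (cases "s \<le> t")
    case True then show ?thesis using \<delta> by (auto simp: \<psi>_def cent_def \<delta>_def)
  next
    \<comment> \<open>With t < s the assumption makes F constant between them; the kernel is then
      minus an indicator and still bounded by 1.\<close>
    case False
    then have "\<delta> = 0" using F_mono[of t s] \<delta> by (simp add: \<delta>_def)
    then show ?thesis by (auto simp: \<psi>_def cent_def \<delta>_def)
  qed
  define h where "h = (\<lambda>x y. \<psi> (g x y))"
  define v c4 where "v = (\<integral>z. \<psi> z ^ 2 \<partial>\<Lambda>)" and "c4 = (\<integral>z. \<psi> z ^ 4 \<partial>\<Lambda>)"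
  have h: "stationary h v (\<integral>z. \<psi> z ^ 3 \<partial>\<Lambda>) c4"
    unfolding h_def v_def c4_def by (rule stationary_compose[OF \<psi>m \<psi>1 \<psi>0])
  have h1: "\<bar>h x y\<bar> \<le> 1" for x y by (simp add: h_def \<psi>1)
  have ic2: "integrable \<Lambda> (\<lambda>z. cent s z * cent t z)" for s t
    by (rule Lambda_integrable[of _ 1]) (auto simp: abs_mult intro!: mult_le_one cent_abs_le)
  have "v = (\<integral>z. cent t z * cent t z - 2 * (cent s z * cent t z) + cent s z * cent s z \<partial>\<Lambda>)"
    unfolding v_def \<psi>_def by (intro Bochner_Integration.integral_cong) (auto simp: power2_eq_square algebra_simps)
  also have "\<dots> = (F t - F t * F t) - 2 * (F s - F s * F t) + (F s - F s * F s)"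
    using ic2 st by (simp add: cent_cov)
  also have "\<dots> = \<delta> - \<delta>\<^sup>2" by (simp add: \<delta>_def power2_eq_square algebra_simps)
  finally have v: "v \<le> \<delta>" by simp
  have v0: "0 \<le> v" "0 \<le> c4" using stationary_nonneg[OF h] by auto
  have c4: "c4 \<le> \<delta>" using stationary_bounds(2)[OF h h1] v by simp
  define d where "d = sqrt (real n * \<delta> + 3 * (real n)\<^sup>2 * \<delta>\<^sup>2)"
  have "sqrt (\<integral>\<xi>. (D h j \<xi>)^4 \<partial>P) \<le> d" if j: "j \<in> {1..n}" for j
  proof -
    have "(\<integral>\<xi>. (D h j \<xi>)^4 \<partial>P) \<le> real j * c4 + 3 * (real j)\<^sup>2 * v\<^sup>2" by (rule D_fourth_moment[OF h j])
    also have "\<dots> \<le> real n * \<delta> + 3 * (real n)\<^sup>2 * \<delta>\<^sup>2"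
      using j v v0 c4 \<delta> by (intro add_mono mult_mono power_mono) auto
    finally show ?thesis unfolding d_def by (rule real_sqrt_le_mono)
  qed
  then have "sqrt (\<integral>\<xi>. (U h n \<xi>)^4 \<partial>P) \<le> 4 * real n * d" by (rule U_fourth_moment[OF h order_refl])
  then have "(\<integral>\<xi>. (U h n \<xi>)^4 \<partial>P) \<le> (4 * real n * d)\<^sup>2" by (rule sqrt_le_D)
  also have "\<dots> = 16 * (real n)\<^sup>2 * (real n * \<delta> + 3 * (real n)\<^sup>2 * \<delta>\<^sup>2)"
    using \<delta> by (simp add: d_def power_mult_distrib)
  finally have u4: "(\<integral>\<xi>. (U h n \<xi>)^4 \<partial>P) \<le> 16 * (real n)\<^sup>2 * (real n * \<delta> + 3 * (real n)\<^sup>2 * \<delta>\<^sup>2)" .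
  have "alpha t \<xi> - alpha s \<xi> = U h n \<xi> / sqrt N" for \<xi>
    unfolding alpha_def h_def \<psi>_def U_def D_def by (simp add: sum_subtractf diff_divide_distrib)
  moreover have "sqrt N ^ 4 = N\<^sup>2" using N_props by (simp add: power4_eq_xxxx power2_eq_square)
  ultimately have "(\<integral>\<xi>. (alpha t \<xi> - alpha s \<xi>)^4 \<partial>P) = (\<integral>\<xi>. (U h n \<xi>)^4 \<partial>P) / N\<^sup>2"
    by (simp add: power_divide)
  also have "\<dots> \<le> 16 * (real n)\<^sup>2 * (real n * \<delta> + 3 * (real n)\<^sup>2 * \<delta>\<^sup>2) / N\<^sup>2"
    by (intro divide_right_mono u4) simp
  also have "\<dots> \<le> 16 * (real n)\<^sup>2 * (real n * \<delta> + 3 * (real n)\<^sup>2 * \<delta>\<^sup>2) / ((real n)\<^sup>2 / 4)\<^sup>2"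
    using N_props \<delta> n2 by (intro divide_left_mono power_mono mult_pos_pos) auto
  also have "\<dots> = 256 * (\<delta> / real n) + 768 * \<delta>\<^sup>2"
    using n2 by (simp add: field_simps power2_eq_square)
  also have "\<dots> \<le> 2048 * (\<delta>\<^sup>2 + \<delta> / real n)"
  proof -
    have "0 \<le> \<delta>\<^sup>2" "0 \<le> \<delta> / real n" using \<delta> by auto
    moreover have "256 * y + 768 * x \<le> 2048 * (x + y)" if "0 \<le> x" "0 \<le> y" for x y :: real
      using that by simp
    ultimately show ?thesis by blast
  qed
  finally show ?thesis by (simp add: \<delta>_def)
qed

text \<open>The quantile function of F on [-1, 1]. Arguments outside (0, 1) go to the endpoints, so
  that \<open>F (quant u) = u\<close> holds on the closed unit interval.\<close>

definition quant :: "real \<Rightarrow> real" where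
  "quant u = (if u \<le> 0 then -1 else if 1 \<le> u then 1 else Inf {t \<in> {-1..1}. u \<le> F t})"

lemma quant_Inf:
  assumes u: "0 < u" "u < 1"
  shows "F (quant u) = u" "quant u \<in> {-1..1}" "\<And>t. t \<in> {-1..1} \<Longrightarrow> u \<le> F t \<Longrightarrow> quant u \<le> t"
proof -
  let ?T = "{t \<in> {-1..1}. u \<le> F t}"
  have q: "quant u = Inf ?T" using u by (simp add: quant_def)
  have bdd: "bdd_below ?T" by (rule bdd_belowI[of _ "-1"]) auto
  have "\<exists>t\<ge>-1. t \<le> 1 \<and> F t = u" using u F_isCont by (intro IVT) (auto simp: F_minus_one F_one)
  then obtain t0 where t0: "-1 \<le> t0" "t0 \<le> 1" "F t0 = u" by blast
  have ne: "?T \<noteq> {}" using t0 by auto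
  have "continuous_on {-1..1} F" using F_isCont by (simp add: continuous_at_imp_continuous_on)
  then have "closed ({-1..1} \<inter> F -` {u..})" by (rule continuous_closed_preimage) auto
  moreover have "?T = {-1..1} \<inter> F -` {u..}" by auto
  ultimately have cl: "closed ?T" by simp
  have "Inf ?T \<in> ?T" by (rule closed_contains_Inf[OF ne bdd cl])
  moreover have le: "Inf ?T \<le> t" if "t \<in> ?T" for t by (rule cInf_lower[OF that bdd])
  moreover have "F (Inf ?T) \<le> u" using F_mono[OF le[of t0]] t0 by simp
  ultimately show "F (quant u) = u" "quant u \<in> {-1..1}" "\<And>t. t \<in> {-1..1} \<Longrightarrow> u \<le> F t \<Longrightarrow> quant u \<le> t"
    unfolding q by auto
qed

lemma F_quant: "0 \<le> u \<Longrightarrow> u \<le> 1 \<Longrightarrow> F (quant u) = u"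
  using quant_Inf(1)[of u] by (cases "u = 0 \<or> u = 1") (auto simp: quant_def F_minus_one F_one)

lemma quant_range: "quant u \<in> {-1..1}"
  using quant_Inf(2)[of u] by (cases "0 < u \<and> u < 1") (auto simp: quant_def)

lemma quant_le: "u < 1 \<Longrightarrow> t \<in> {-1..1} \<Longrightarrow> u \<le> F t \<Longrightarrow> quant u \<le> t"
  using quant_Inf(3)[of u t] by (cases "0 < u") (auto simp: quant_def)

text \<open>The inequality is strict below u = 1 because F may be flat, and the quantile is the
  leftmost point of its level set.\<close>

lemma le_quant: assumes t: "t \<in> {-1..1}" and u: "0 \<le> u" "u \<le> 1" and F: "F t < u \<or> u = 1"
  shows "t \<le> quant u"
proof (cases "u = 1")
  case False
  then have "F t < F (quant u)" using F F_quant u by simp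
  then show ?thesis using F_mono[of "quant u" t] by (cases "t \<le> quant u") auto
qed (use t in \<open>simp add: quant_def\<close>)

section \<open>Dyadic chaining on the quantile scale\<close>

definition gr :: "nat \<Rightarrow> nat \<Rightarrow> (nat \<Rightarrow> 'x) \<Rightarrow> real" where
  "gr l i = alpha (quant (real i / 2 ^ l))"

text \<open>The l^4 norm of the increments between neighbours at level l: it dominates their
  maximum, and its expectation is accessible through fourth moments.\<close>

definition inc :: "nat \<Rightarrow> (nat \<Rightarrow> 'x) \<Rightarrow> real" where
  "inc l \<xi> = sqrt (sqrt (\<Sum>i<2^l. (gr l (Suc i) \<xi> - gr l i \<xi>)^4))"

lemma inc_ge: assumes "i < 2^l" shows "\<bar>gr l (Suc i) \<xi> - gr l i \<xi>\<bar> \<le> inc l \<xi>"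
proof -
  have "(gr l (Suc i) \<xi> - gr l i \<xi>)^4 \<le> (\<Sum>i<2^l. (gr l (Suc i) \<xi> - gr l i \<xi>)^4)"
    using assms by (intro member_le_sum) auto
  then have "sqrt (sqrt ((gr l (Suc i) \<xi> - gr l i \<xi>)^4)) \<le> inc l \<xi>" unfolding inc_def by simp
  moreover have "sqrt (sqrt (x^4)) = \<bar>x\<bar>" for x :: real
  proof -
    have "x^4 = (x\<^sup>2)\<^sup>2" by (simp flip: power_mult)
    then have "sqrt (x^4) = x\<^sup>2" by (simp only: real_sqrt_abs abs_power2)
    then show ?thesis by simp
  qed
  ultimately show ?thesis by simp
qed

lemma inc_nonneg: "0 \<le> inc l \<xi>"
  by (simp add: inc_def sum_nonneg)

lemma gr_coarse: "gr (Suc l) (2 * i) = gr l i"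
  by (simp add: gr_def)

text \<open>A grid point is moved to \<open>j div 2\<close> on the next coarser level at the price
  of at most one increment between neighbours; d such moves lead to
  \<open>j div 2 ^ d\<close>.\<close>

lemma chaining:
  assumes "j \<le> 2 ^ (L + d)"
  shows "\<bar>gr (L + d) j \<xi> - gr L (j div 2 ^ d) \<xi>\<bar> \<le> (\<Sum>l\<in>{L<..L + d}. inc l \<xi>)"
  using assms
proof (induction d arbitrary: j)
  case (Suc d)
  have le: "j div 2 \<le> 2 ^ (L + d)" using Suc.prems by simp
  have IH: "\<bar>gr (L + d) (j div 2) \<xi> - gr L (j div 2 div 2 ^ d) \<xi>\<bar> \<le> (\<Sum>l\<in>{L<..L + d}. inc l \<xi>)"
    by (rule Suc.IH[OF le])
  have step: "\<bar>gr (Suc (L + d)) j \<xi> - gr (L + d) (j div 2) \<xi>\<bar> \<le> inc (Suc (L + d)) \<xi>"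
  proof (cases "even j")
    case True
    then show ?thesis using gr_coarse[of "L + d" "j div 2"] inc_nonneg by simp
  next
    case False
    then have j: "j = Suc (2 * (j div 2))" by presburger
    have "2 * (j div 2) < 2 ^ Suc (L + d)" using j Suc.prems by simp
    from inc_ge[OF this, of \<xi>] show ?thesis using j by (simp add: gr_coarse)
  qed
  have "{L<..L + Suc d} = insert (Suc (L + d)) {L<..L + d}" by auto
  then have s: "(\<Sum>l\<in>{L<..L + Suc d}. inc l \<xi>) = inc (Suc (L + d)) \<xi> + (\<Sum>l\<in>{L<..L + d}. inc l \<xi>)" by simp
  have "j div 2 ^ Suc d = j div 2 div 2 ^ d" by (simp add: div_mult2_eq)
  then show ?case using IH step unfolding s by simp
qed simp

text \<open>The cost of replacing the process by its values on the grid of level L: chaining through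
  d levels, one bracketing increment at the finest level, and the drift of F over one finest
  cell.\<close>

definition rem :: "nat \<Rightarrow> nat \<Rightarrow> (nat \<Rightarrow> 'x) \<Rightarrow> real" where
  "rem L d \<xi> = (\<Sum>l\<in>{L<..L + d}. inc l \<xi>) + inc (L + d) \<xi> + real n / 2 ^ (L + d)"

text \<open>The counts and F are both increasing, so between s and s' the process exceeds the
  bracket by no more than the drift \<surd>N times the increment of F, and \<surd>N is at most
  n.\<close>

lemma alpha_bracket:
  assumes le: "s \<le> t" "t \<le> s'" shows "\<bar>alpha t \<xi> - alpha s \<xi>\<bar> \<le> \<bar>alpha s' \<xi> - alpha s \<xi>\<bar> + real n * (F s' - F s)"
proof -
  have N: "0 < sqrt N" "N / sqrt N = sqrt N" using N_props by (auto simp: real_div_sqrt)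
  have a: "alpha r \<xi> = cnt r \<xi> / sqrt N - sqrt N * F r" for r
  proof -
    have "alpha r \<xi> = cnt r \<xi> / sqrt N - N / sqrt N * F r" by (simp add: alpha_cnt diff_divide_distrib)
    then show ?thesis using N by simp
  qed
  have c: "cnt s \<xi> / sqrt N \<le> cnt t \<xi> / sqrt N" "cnt t \<xi> / sqrt N \<le> cnt s' \<xi> / sqrt N"
    using le N by (auto intro!: divide_right_mono cnt_mono)
  have f: "sqrt N * F s \<le> sqrt N * F t" "sqrt N * F t \<le> sqrt N * F s'"
    using le N by (auto intro!: mult_left_mono F_mono)
  have "sqrt N \<le> real n" using N_props by (intro real_le_lsqrt) auto
  then have n: "sqrt N * (F s' - F s) \<le> real n * (F s' - F s)" using le F_mono[of s s'] by (intro mult_right_mono) auto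
  have "alpha t \<xi> - alpha s \<xi> \<le> alpha s' \<xi> - alpha s \<xi> + sqrt N * (F s' - F s)"
    using c f unfolding a right_diff_distrib by linarith
  moreover have "alpha t \<xi> - alpha s \<xi> \<ge> - (sqrt N * (F s' - F s))"
    using c f unfolding a right_diff_distrib by linarith
  ultimately show ?thesis using n f unfolding right_diff_distrib by linarith
qed

lemma alpha_approx:
  assumes t: "t \<in> {-1..1}"
  shows "\<exists>i\<le>2^L. \<bar>alpha t \<xi> - alpha (quant (real i / 2^L)) \<xi>\<bar> \<le> rem L d \<xi> \<and> \<bar>F t - real i / 2^L\<bar> \<le> 1 / 2^L"
proof -
  define K where "K = L + d"
  \<comment> \<open>The finest cell containing F t; the cap at 2^K - 1 keeps its right end on the
    grid when F t = 1.\<close>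
  define j where "j = min (nat \<lfloor>F t * 2^K\<rfloor>) (2^K - 1)"
  have F0: "0 \<le> F t * 2^K" "F t * 2^K \<le> 2^K" using F_bounds[of t] by (auto simp: mult_left_le_one_le)
  have jK: "j < 2^K" by (simp add: j_def min_less_iff_disj)
  have j1: "real j \<le> F t * 2^K"
  proof -
    have "real j \<le> real (nat \<lfloor>F t * 2^K\<rfloor>)" by (simp add: j_def)
    also have "\<dots> \<le> F t * 2^K" using F0 by simp
    finally show ?thesis .
  qed
  have j2: "F t * 2^K < real (Suc j) \<or> Suc j = 2^K"
  proof (cases "nat \<lfloor>F t * 2^K\<rfloor> \<le> 2^K - 1")
    case True
    then have "j = nat \<lfloor>F t * 2^K\<rfloor>" by (simp add: j_def)
    then have "F t * 2^K < real j + 1" using F0 by linarith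
    then show ?thesis by simp
  qed (auto simp: j_def)
  have j2': "F t * 2^K \<le> real (Suc j)"
    using j2 F0 by (metis less_imp_le of_nat_numeral of_nat_power)
  let ?u = "real j / 2^K" and ?u' = "real (Suc j) / 2^K"
  have "real j < 2^K" using jK by (metis of_nat_less_iff of_nat_numeral of_nat_power)
  then have u1: "?u < 1" by simp
  have "real (Suc j) \<le> 2^K" using jK by (metis Suc_leI of_nat_le_iff of_nat_numeral of_nat_power)
  then have u'1: "?u' \<le> 1" by (simp del: of_nat_Suc)
  have q1: "quant ?u \<le> t" using j1 by (intro quant_le u1 t) (simp add: field_simps)
  have q2: "t \<le> quant ?u'"
  proof (intro le_quant t u'1)
    show "F t < ?u' \<or> ?u' = 1"
    proof (cases "Suc j = 2^K")
      case True
      then have "real (Suc j) = 2^K" by simp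
      then show ?thesis by (simp del: of_nat_Suc)
    next
      case False then show ?thesis using j2 by (simp add: field_simps)
    qed
  qed simp
  have Fq: "F (quant ?u) = ?u" "F (quant ?u') = ?u'" using u1 u'1 by (auto intro!: F_quant)
  have "\<bar>alpha t \<xi> - gr K j \<xi>\<bar> \<le> \<bar>gr K (Suc j) \<xi> - gr K j \<xi>\<bar> + real n * (?u' - ?u)"
    using alpha_bracket[OF q1 q2, of \<xi>] unfolding Fq gr_def .
  also have "\<dots> \<le> inc K \<xi> + real n / 2^K"
    using inc_ge[OF jK, of \<xi>] by (simp add: diff_divide_distrib[symmetric])
  finally have a1: "\<bar>alpha t \<xi> - gr K j \<xi>\<bar> \<le> inc K \<xi> + real n / 2^K" .
  define i where "i = j div 2^d"
  have a2: "\<bar>gr K j \<xi> - gr L i \<xi>\<bar> \<le> (\<Sum>l\<in>{L<..L + d}. inc l \<xi>)"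
    unfolding K_def i_def using jK by (intro chaining) (simp add: K_def)
  have iL: "i \<le> 2^L"
  proof -
    have "i \<le> 2^K div 2^d" unfolding i_def using jK by (intro div_le_mono) simp
    then show ?thesis by (simp add: K_def power_add)
  qed
  have K2: "(2::real)^K = 2^L * 2^d" by (simp add: K_def power_add)
  have i1: "real i * 2^d \<le> real j"
  proof -
    have "i * 2^d \<le> j" by (simp add: i_def)
    then have "real (i * 2^d) \<le> real j" by (simp only: of_nat_le_iff)
    then show ?thesis by simp
  qed
  have i2: "real (Suc j) \<le> (real i + 1) * 2^d"
  proof -
    have "Suc j \<le> (i + 1) * 2^d" using dividend_less_div_times[of "2^d" j] by (simp add: i_def algebra_simps)
    then have "real (Suc j) \<le> real ((i + 1) * 2^d)" by (simp only: of_nat_le_iff)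
    then show ?thesis by simp
  qed
  have "real i / 2^L \<le> F t"
  proof -
    have "real i * 2^d \<le> F t * (2^L * 2^d)" using order.trans[OF i1 j1] unfolding K2 .
    then have "real i * 2^d \<le> (F t * 2^L) * 2^d" by (simp only: mult.assoc)
    then have "real i \<le> F t * 2^L" by (rule mult_right_le_imp_le) simp
    then show ?thesis by (simp add: divide_le_eq)
  qed
  moreover have "F t \<le> real i / 2^L + 1 / 2^L"
  proof -
    have "F t * (2^L * 2^d) \<le> (real i + 1) * 2^d" using order.trans[OF j2' i2] unfolding K2 .
    then have "(F t * 2^L) * 2^d \<le> (real i + 1) * 2^d" by (simp only: mult.assoc)
    then have "F t * 2^L \<le> real i + 1" by (rule mult_right_le_imp_le) simp
    then show ?thesis by (simp add: field_simps)
  qed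
  ultimately have "\<bar>F t - real i / 2^L\<bar> \<le> 1 / 2^L" by simp
  moreover have "\<bar>alpha t \<xi> - gr L i \<xi>\<bar> \<le> rem L d \<xi>" using a1 a2 unfolding rem_def K_def by linarith
  ultimately show ?thesis using iL unfolding gr_def by blast
qed

lemma bm_sqrt: "bm f \<Longrightarrow> (\<And>\<xi>. 0 \<le> f \<xi>) \<Longrightarrow> bm (\<lambda>\<xi>. sqrt (f \<xi>))"
proof -
  assume f: "bm f" "\<And>\<xi>. 0 \<le> f \<xi>"
  then obtain C where C: "\<And>\<xi>. \<xi> \<in> space P \<Longrightarrow> norm (f \<xi>) \<le> C" by (auto simp: bm_def)
  show ?thesis
  proof (rule bmI[of _ "sqrt C"])
    show "norm (sqrt (f \<xi>)) \<le> sqrt C" if "\<xi> \<in> space P" for \<xi> using C[OF that] f(2)[of \<xi>] by simp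
  qed (use bm_measurable[OF f(1)] in measurable)
qed

lemma bm_inc: "bm (inc l)"
  unfolding inc_def[abs_def] gr_def
  by (intro bm_sqrt bm_sum bm_power bm_diff bm_alpha real_sqrt_ge_zero sum_nonneg zero_le_even_power) auto

text \<open>Two applications of Jensen's inequality reduce to the mean of the sum of fourth powers.
  The 2^l cells of length 2^(-l) give 2^(-l) + 1 / n up to the factor 2048, whose fourth root is
  below 7.\<close>

lemma expectation_inc: "(\<integral>\<xi>. inc l \<xi> \<partial>P) \<le> 7 * (sqrt (sqrt (1/2)) ^ l + sqrt (sqrt (1 / real n)))"
proof -
  let ?X = "\<lambda>\<xi>. (\<Sum>i<2^l. (gr l (Suc i) \<xi> - gr l i \<xi>)^4)"
  have bg: "bm (gr l i)" for i unfolding gr_def by (rule bm_alpha)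
  have bX: "bm ?X" by (intro bm_sum bm_power bm_diff bg)
  have X0: "0 \<le> ?X \<xi>" for \<xi> by (intro sum_nonneg zero_le_even_power) auto
  have e1: "(\<integral>\<xi>. inc l \<xi> \<partial>P) \<le> sqrt (\<integral>\<xi>. (inc l \<xi>)\<^sup>2 \<partial>P)"
    using expectation_abs_le[OF bm_inc, of l] by (simp add: inc_nonneg)
  have e2: "(\<integral>\<xi>. (inc l \<xi>)\<^sup>2 \<partial>P) \<le> sqrt (\<integral>\<xi>. ?X \<xi> \<partial>P)"
    using expectation_abs_le[OF bm_sqrt[OF bX X0]] X0 by (simp add: inc_def)
  have "(\<integral>\<xi>. ?X \<xi> \<partial>P) = (\<Sum>i<2^l. \<integral>\<xi>. (gr l (Suc i) \<xi> - gr l i \<xi>)^4 \<partial>P)"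
    by (intro Bochner_Integration.integral_sum bm_integrable bm_power bm_diff bg)
  also have "\<dots> \<le> (\<Sum>i<(2::nat)^l. 2048 * ((1 / 2^l)\<^sup>2 + (1 / 2^l) / real n))"
  proof (intro sum_mono)
    fix i :: nat assume i: "i \<in> {..<2^l}"
    then have "real (Suc i) \<le> 2^l" by (metis Suc_leI lessThan_iff of_nat_le_iff of_nat_numeral of_nat_power)
    then have "real (Suc i) \<le> 2^l" "real i \<le> 2^l" by linarith+
    then have u: "real (Suc i) / 2^l \<le> 1" "real i / 2^l \<le> 1"
      by (simp_all only: divide_le_eq_1_pos zero_less_power zero_less_numeral)
    have F: "F (quant (real (Suc i) / 2^l)) = real (Suc i) / 2^l" "F (quant (real i / 2^l)) = real i / 2^l"
      using u by (auto intro!: F_quant)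
    have e: "real (Suc i) / 2^l - real i / 2^l = 1 / 2^l" by (simp add: diff_divide_distrib[symmetric])
    show "(\<integral>\<xi>. (gr l (Suc i) \<xi> - gr l i \<xi>)^4 \<partial>P) \<le> 2048 * ((1 / 2^l)\<^sup>2 + (1 / 2^l) / real n)"
      unfolding gr_def using alpha_increment[of "quant (real i / 2^l)" "quant (real (Suc i) / 2^l)"]
      unfolding F e by (simp add: divide_right_mono)
  qed
  also have "(\<Sum>i<(2::nat)^l. 2048 * ((1 / 2^l)\<^sup>2 + (1 / 2^l) / real n)) = 2048 * ((1/2)^l + 1 / real n)"
    by (simp add: power2_eq_square field_simps)
  finally have e3: "(\<integral>\<xi>. ?X \<xi> \<partial>P) \<le> 2048 * ((1/2)^l + 1 / real n)" .
  have "(\<integral>\<xi>. inc l \<xi> \<partial>P) \<le> sqrt (sqrt (2048 * ((1/2)^l + 1 / real n)))"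
    by (rule order.trans[OF e1 real_sqrt_le_mono[OF order.trans[OF e2 real_sqrt_le_mono[OF e3]]]])
  also have "\<dots> = sqrt (sqrt 2048) * sqrt (sqrt ((1/2)^l + 1 / real n))"
    by (simp only: real_sqrt_mult)
  also have "\<dots> \<le> 7 * (sqrt (sqrt (1/2)) ^ l + sqrt (sqrt (1 / real n)))"
  proof (intro mult_mono)
    show "sqrt (sqrt 2048) \<le> (7::real)" by (intro real_le_lsqrt) auto
    have "sqrt ((1/2)^l + 1 / real n) \<le> sqrt ((1/2)^l) + sqrt (1 / real n)" by (intro sqrt_add_le_add_sqrt) auto
    then have "sqrt (sqrt ((1/2)^l + 1 / real n)) \<le> sqrt (sqrt ((1/2)^l) + sqrt (1 / real n))" by simp
    also have "\<dots> \<le> sqrt (sqrt ((1/2)^l)) + sqrt (sqrt (1 / real n))" by (intro sqrt_add_le_add_sqrt) auto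
    finally show "sqrt (sqrt ((1/2)^l + 1 / real n)) \<le> sqrt (sqrt (1/2)) ^ l + sqrt (sqrt (1 / real n))"
      by (simp only: real_sqrt_power)
  qed auto
  finally show ?thesis .
qed

lemma bm_rem: "bm (rem L d)"
  unfolding rem_def[abs_def] by (intro bm_add bm_sum bm_inc bm_const)

lemma rem_nonneg: "0 \<le> rem L d \<xi>"
  unfolding rem_def by (intro add_nonneg_nonneg sum_nonneg inc_nonneg) auto

text \<open>The levels contribute a geometric series of ratio (1/2)^(1/4), made small by the choice
  of L, and a term of order n^(-1/4) each, which limits the depth d.\<close>

lemma expectation_rem:
  "(\<integral>\<xi>. rem L d \<xi> \<partial>P) \<le> 14 * (sqrt (sqrt (1/2)) ^ L / (1 - sqrt (sqrt (1/2)))) + 7 * (real d + 1) * sqrt (sqrt (1 / real n)) + real n / 2^(L + d)"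
proof -
  define r where "r = sqrt (sqrt (1/2 :: real))"
  have r: "0 < r" "r < 1" by (auto simp: r_def)
  define e where "e = sqrt (sqrt (1 / real n))"
  have "(\<integral>\<xi>. rem L d \<xi> \<partial>P) = (\<Sum>l\<in>{L<..L + d}. \<integral>\<xi>. inc l \<xi> \<partial>P) + (\<integral>\<xi>. inc (L + d) \<xi> \<partial>P) + real n / 2^(L + d)"
    unfolding rem_def using bm_integrable[OF bm_inc] PP.P.prob_space by simp
  also have "\<dots> \<le> (\<Sum>l\<in>{L<..L + d}. 7 * (r ^ l + e)) + 7 * (r ^ (L + d) + e) + real n / 2^(L + d)"
    unfolding r_def e_def by (intro add_mono sum_mono expectation_inc order_refl)
  also have "(\<Sum>l\<in>{L<..L + d}. 7 * (r ^ l + e)) = 7 * (\<Sum>l\<in>{L<..L + d}. r ^ l) + 7 * real d * e"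
    by (simp add: sum_distrib_left sum.distrib algebra_simps)
  also have "(\<Sum>l\<in>{L<..L + d}. r ^ l) \<le> r ^ L / (1 - r)"
  proof (induction d)
    case 0 then show ?case using r by simp
  next
    case (Suc d)
    have "(1 - r) * (\<Sum>l\<in>{L<..L + d}. r ^ l) = r ^ Suc L - r ^ Suc (L + d)" for d
    proof (induction d)
      case (Suc d)
      have "{L<..L + Suc d} = insert (Suc (L + d)) {L<..L + d}" by auto
      then have "(1 - r) * (\<Sum>l\<in>{L<..L + Suc d}. r ^ l) = (1 - r) * r ^ Suc (L + d) + (1 - r) * (\<Sum>l\<in>{L<..L + d}. r ^ l)"
        by (simp add: distrib_left)
      then show ?case unfolding Suc.IH by (simp add: algebra_simps)
    qed simp
    then have gen: "(\<Sum>l\<in>{L<..L + d}. r ^ l) = (r ^ Suc L - r ^ Suc (L + d)) / (1 - r)" for d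
      using r by (simp add: nonzero_eq_divide_eq mult.commute)
    have "r ^ Suc L \<le> r ^ L" using r by (intro power_decreasing) auto
    moreover have "0 \<le> r ^ Suc (L + Suc d)" using r by simp
    ultimately have "r ^ Suc L - r ^ Suc (L + Suc d) \<le> r ^ L" by linarith
    then show ?case unfolding gen using r by (intro divide_right_mono) auto
  qed
  also have "r ^ (L + d) \<le> r ^ L / (1 - r)"
  proof -
    have "r ^ (L + d) \<le> r ^ L" using r by (intro power_decreasing) auto
    also have "\<dots> \<le> r ^ L / (1 - r)" using r by (simp add: le_divide_eq mult_left_le)
    finally show ?thesis .
  qed
  finally show ?thesis unfolding r_def[symmetric] e_def[symmetric] by (simp add: algebra_simps)
qed

end

section \<open>Convergence of finite maxima\<close>

text \<open>The linear span of the characters in the coordinates of J. It is an algebra, and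
  convergence of characteristic functions extends to it by linearity.\<close>

inductive trig :: "'u set \<Rightarrow> (('u \<Rightarrow> real) \<Rightarrow> complex) \<Rightarrow> bool" for J where
  trig_exp: "trig J (\<lambda>x. iexp (\<Sum>u\<in>J. a u * x u))"
| trig_add: "trig J f \<Longrightarrow> trig J g \<Longrightarrow> trig J (\<lambda>x. f x + g x)"
| trig_scale: "trig J f \<Longrightarrow> trig J (\<lambda>x. c * f x)"

lemma trig_exp_mult:
  assumes "trig J g" shows "trig J (\<lambda>x. iexp (\<Sum>u\<in>J. a u * x u) * g x)"
  using assms
proof induction
  case (trig_exp b)
  have "iexp (\<Sum>u\<in>J. a u * x u) * iexp (\<Sum>u\<in>J. b u * x u) = iexp (\<Sum>u\<in>J. (a u + b u) * x u)" for x
    by (simp add: exp_add[symmetric] distrib_right sum.distrib distrib_left)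
  then show ?case using trig.trig_exp[of J "\<lambda>u. a u + b u"] by simp
next
  case (trig_add f g)
  then show ?case by (simp add: distrib_left trig.trig_add)
next
  case (trig_scale f c)
  then have "trig J (\<lambda>x. c * (iexp (\<Sum>u\<in>J. a u * x u) * f x))" by (intro trig.trig_scale)
  then show ?case by (simp add: mult.left_commute)
qed

lemma trig_mult:
  assumes f: "trig J f" and g: "trig J g" shows "trig J (\<lambda>x. f x * g x)"
  using f
proof induction
  case (trig_exp a) show ?case by (rule trig_exp_mult[OF g])
next
  case (trig_add f1 f2) then show ?case by (simp add: distrib_right trig.trig_add)
next
  case (trig_scale f c) then show ?case using trig.trig_scale[of J "\<lambda>x. f x * g x" c] by (simp add: mult.assoc)
qed

lemma trig_const: "trig J (\<lambda>x. c)"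
  using trig_scale[OF trig_exp[of J "\<lambda>_. 0"], of c] by simp

lemma trig_sum: "finite I \<Longrightarrow> (\<And>i. i \<in> I \<Longrightarrow> trig J (f i)) \<Longrightarrow> trig J (\<lambda>x. \<Sum>i\<in>I. f i x)"
  by (induction I rule: finite_induct) (auto intro: trig_const trig_add)

lemma trig_prod: "finite I \<Longrightarrow> (\<And>i. i \<in> I \<Longrightarrow> trig J (f i)) \<Longrightarrow> trig J (\<lambda>x. \<Prod>i\<in>I. f i x)"
  by (induction I rule: finite_induct) (auto intro: trig_const trig_mult)

lemma trig_power: "trig J f \<Longrightarrow> trig J (\<lambda>x. f x ^ k)"
  by (induction k) (auto intro: trig_const trig_mult)

lemma trig_cos: assumes J: "finite J" "u \<in> J" shows "trig J (\<lambda>x. complex_of_real (cos (w * (x u + b))))"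
proof -
  have e: "trig J (\<lambda>x. iexp (s * x u))" for s
  proof -
    have "(\<Sum>v\<in>J. (if v = u then s else 0) * x v) = (\<Sum>v\<in>J. if v = u then s * x v else 0)" for x
      by (intro sum.cong) auto
    then have "(\<Sum>v\<in>J. (if v = u then s else 0) * x v) = s * x u" for x using J by simp
    then show ?thesis using trig_exp[of J "\<lambda>v. if v = u then s else 0"] by simp
  qed
  have "complex_of_real (cos (w * (x u + b))) = (iexp (w * b) / 2) * iexp (w * x u) + (iexp (- (w * b)) / 2) * iexp ((- w) * x u)" for x
  proof -
    define \<theta> where "\<theta> = w * (x u + b)"
    have "complex_of_real (cos \<theta>) = (iexp \<theta> + iexp (- \<theta>)) / 2"
      by (simp add: cos_of_real[symmetric] cos_exp_eq)
    moreover have "iexp \<theta> = iexp (w * b) * iexp (w * x u)" "iexp (- \<theta>) = iexp (- (w * b)) * iexp ((- w) * x u)"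
      by (simp_all add: \<theta>_def exp_add[symmetric] algebra_simps)
    ultimately show ?thesis by (simp add: \<theta>_def add_divide_distrib)
  qed
  then show ?thesis by (simp only:) (intro trig_add trig_scale e)
qed

lemma trig_bounded: "trig J f \<Longrightarrow> \<exists>C. \<forall>x. cmod (f x) \<le> C"
proof (induction rule: trig.induct)
  case (trig_exp a)
  then show ?case by (intro exI[of _ 1]) simp
next
  case (trig_add f g)
  then obtain C D where "\<forall>x. cmod (f x) \<le> C" "\<forall>x. cmod (g x) \<le> D" by blast
  then have "\<forall>x. cmod (f x + g x) \<le> C + D" by (meson add_mono norm_triangle_le)
  then show ?case by blast
next
  case (trig_scale f c)
  then obtain C where "\<forall>x. cmod (f x) \<le> C" by blast
  then have "\<forall>x. cmod (c * f x) \<le> cmod c * C" by (simp add: norm_mult mult_left_mono)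
  then show ?case by blast
qed

lemma trig_measurable:
  assumes "trig J f" and V: "\<And>u. u \<in> J \<Longrightarrow> V u \<in> borel_measurable M"
  shows "(\<lambda>\<xi>. f (\<lambda>u. V u \<xi>)) \<in> borel_measurable M"
  using assms(1)
proof induction
  case (trig_exp a)
  have [measurable]: "(\<lambda>\<xi>. \<Sum>u\<in>J. a u * V u \<xi>) \<in> borel_measurable M"
    by (intro borel_measurable_sum borel_measurable_times borel_measurable_const V)
  show ?case by measurable
qed auto

lemma trig_integrable:
  assumes "trig J f" "\<And>u. u \<in> J \<Longrightarrow> V u \<in> borel_measurable M" "prob_space M"
  shows "integrable M (\<lambda>\<xi>. f (\<lambda>u. V u \<xi>))"
proof -
  obtain C where "\<forall>x. cmod (f x) \<le> C" using trig_bounded[OF assms(1)] by blast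
  then show ?thesis using prob_space.finite_measure[OF assms(3)] trig_measurable[OF assms(1,2)]
    by (intro finite_measure.integrable_const_bound[of _ _ C]) auto
qed

text \<open>From convergence of joint characteristic functions the locale derives a two-sided
  comparison of box probabilities. Each n may have its own probability space.\<close>

locale char_convergence =
  fixes M :: "nat \<Rightarrow> 'a measure" and Q :: "'b measure" and J :: "'u set"
    and V :: "nat \<Rightarrow> 'u \<Rightarrow> 'a \<Rightarrow> real" and W :: "'u \<Rightarrow> 'b \<Rightarrow> real"
  assumes J: "finite J"
    and M: "\<forall>\<^sub>F n in sequentially. prob_space (M n) \<and> (\<forall>u\<in>J. V n u \<in> borel_measurable (M n))"
    and Q: "prob_space Q" and W: "\<And>u. u \<in> J \<Longrightarrow> W u \<in> borel_measurable Q"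
    and conv: "\<And>a. (\<lambda>n. \<integral>\<xi>. iexp (\<Sum>u\<in>J. a u * V n u \<xi>) \<partial>M n) \<longlonglongrightarrow> (\<integral>\<xi>. iexp (\<Sum>u\<in>J. a u * W u \<xi>) \<partial>Q)"
begin

lemma trig_conv:
  assumes "trig J f"
  shows "(\<lambda>n. \<integral>\<xi>. f (\<lambda>u. V n u \<xi>) \<partial>M n) \<longlonglongrightarrow> (\<integral>\<xi>. f (\<lambda>u. W u \<xi>) \<partial>Q)"
  using assms
proof induction
  case (trig_exp a) show ?case by (rule conv)
next
  case (trig_add f g)
  have "\<forall>\<^sub>F n in sequentially. (\<integral>\<xi>. f (\<lambda>u. V n u \<xi>) \<partial>M n) + (\<integral>\<xi>. g (\<lambda>u. V n u \<xi>) \<partial>M n)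
      = (\<integral>\<xi>. f (\<lambda>u. V n u \<xi>) + g (\<lambda>u. V n u \<xi>) \<partial>M n)"
    using M
  proof eventually_elim
    case (elim n)
    have "integrable (M n) (\<lambda>\<xi>. f (\<lambda>u. V n u \<xi>))" "integrable (M n) (\<lambda>\<xi>. g (\<lambda>u. V n u \<xi>))"
      using elim trig_add.hyps by (auto intro: trig_integrable)
    then show ?case by simp
  qed
  moreover have "(\<integral>\<xi>. f (\<lambda>u. W u \<xi>) + g (\<lambda>u. W u \<xi>) \<partial>Q) = (\<integral>\<xi>. f (\<lambda>u. W u \<xi>) \<partial>Q) + (\<integral>\<xi>. g (\<lambda>u. W u \<xi>) \<partial>Q)"
    using trig_integrable[OF trig_add.hyps(1) W Q] trig_integrable[OF trig_add.hyps(2) W Q] by simp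
  ultimately show ?case using tendsto_add[OF trig_add.IH] by (simp add: Lim_transform_eventually)
next
  case (trig_scale f c)
  then show ?case by (simp add: tendsto_mult_left)
qed

definition tprod :: "(real \<Rightarrow> real) \<Rightarrow> real \<Rightarrow> ('u \<Rightarrow> real) \<Rightarrow> ('u \<Rightarrow> real) \<Rightarrow> real" where
  "tprod ch w b x = (\<Prod>u\<in>J. ch ((cos (w * (x u + b u)))\<^sup>2))"

lemma cos_sq_range: "(cos (x::real))\<^sup>2 \<in> {0..1}"
  by (simp add: abs_square_le_1)

text \<open>The squared cosine maps into [0,1], so Bernstein polynomials approximate uniformly on the whole line.\<close>
lemma tprod_conv:
  assumes ch: "continuous_on {0..1} ch" "\<And>y. y \<in> {0..1} \<Longrightarrow> 0 \<le> ch y \<and> ch y \<le> 1" and [measurable]: "ch \<in> borel_measurable borel"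
  shows "(\<lambda>n. \<integral>\<xi>. tprod ch w b (\<lambda>u. V n u \<xi>) \<partial>M n) \<longlonglongrightarrow> (\<integral>\<xi>. tprod ch w b (\<lambda>u. W u \<xi>) \<partial>Q)"
proof (rule LIMSEQ_I)
  fix e :: real assume e: "0 < e"
  \<comment> \<open>The number of factors enters because two products with factors in [0, 1] differ
    by at most the sum of the differences of the factors; the added 1 covers an empty J.\<close>
  define \<delta> where "\<delta> = e / (4 * (real (card J) + 1))"
  have \<delta>: "0 < \<delta>" "real (card J) * \<delta> \<le> e / 4"
  proof -
    show "0 < \<delta>" using e by (simp add: \<delta>_def)
    have "real (card J) * \<delta> \<le> (real (card J) + 1) * \<delta>" using \<open>0 < \<delta>\<close> by (intro mult_right_mono) auto
    also have "\<dots> = e / 4" by (simp add: \<delta>_def field_simps)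
    finally show "real (card J) * \<delta> \<le> e / 4" .
  qed
  obtain m where m: "\<And>y. y \<in> {0..1} \<Longrightarrow> \<bar>ch y - (\<Sum>k\<le>m. ch (k/m) * Bernstein m k y)\<bar> < \<delta>"
    using Bernstein_Weierstrass[OF ch(1) \<delta>(1)] by blast
  define p where "p y = (\<Sum>k\<le>m. ch (k/m) * Bernstein m k y)" for y
  have p: "\<bar>ch y - p y\<bar> < \<delta>" if "y \<in> {0..1}" for y using m[OF that] by (simp add: p_def)
  have p01: "0 \<le> p y \<and> p y \<le> 1" if y: "y \<in> {0..1}" for y
  proof -
    have c: "0 \<le> ch (real k / real m) \<and> ch (real k / real m) \<le> 1" if "k \<le> m" for k
      using that by (intro ch(2)) (auto simp: divide_le_eq_1)
    have B: "0 \<le> Bernstein m k y" for k using y by (intro Bernstein_nonneg) auto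
    have "p y \<le> (\<Sum>k\<le>m. Bernstein m k y)"
      unfolding p_def using c B by (intro sum_mono) (auto intro: mult_left_le_one_le)
    moreover have "0 \<le> p y" unfolding p_def using c B by (intro sum_nonneg) auto
    ultimately show ?thesis by simp
  qed
  define f where "f x = complex_of_real (tprod p w b x)" for x
  have tf: "trig J f"
  proof -
    have y: "trig J (\<lambda>x. complex_of_real ((cos (w * (x u + b u)))\<^sup>2))" if "u \<in> J" for u
      using trig_power[OF trig_cos[OF J that, of w "b u"], of 2] by simp
    have "trig J (\<lambda>x. \<Prod>u\<in>J. \<Sum>k\<le>m. complex_of_real (ch (k/m) * real (m choose k))
      * (complex_of_real ((cos (w * (x u + b u)))\<^sup>2) ^ k * (1 + (-1) * complex_of_real ((cos (w * (x u + b u)))\<^sup>2)) ^ (m - k)))"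
      by (intro trig_prod J trig_sum trig_scale trig_mult trig_power trig_add trig_const y finite_atMost)
    then show ?thesis unfolding f_def tprod_def p_def Bernstein_def by (simp add: mult_ac)
  qed
  have close: "\<bar>tprod ch w b x - tprod p w b x\<bar> \<le> e / 4" for x
  proof -
    have "\<bar>tprod ch w b x - tprod p w b x\<bar> \<le> (\<Sum>u\<in>J. \<bar>ch ((cos (w * (x u + b u)))\<^sup>2) - p ((cos (w * (x u + b u)))\<^sup>2)\<bar>)"
      unfolding tprod_def real_norm_def[symmetric]
      using ch(2)[OF cos_sq_range] p01[OF cos_sq_range] by (intro norm_prod_diff) auto
    also have "\<dots> \<le> (\<Sum>u\<in>J. \<delta>)" by (intro sum_mono less_imp_le p cos_sq_range)
    finally show ?thesis using \<delta>(2) by simp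
  qed
  have b1: "\<bar>tprod ch w b x\<bar> \<le> 1" for x
    unfolding tprod_def abs_prod using ch(2)[OF cos_sq_range] by (intro prod_le_1) auto
  have [measurable]: "p \<in> borel_measurable borel" unfolding p_def[abs_def] Bernstein_def by measurable
  have diff: "\<bar>(\<integral>\<xi>. tprod ch w b (\<lambda>u. X u \<xi>) \<partial>R) - Re (\<integral>\<xi>. f (\<lambda>u. X u \<xi>) \<partial>R)\<bar> \<le> e / 4"
    if R: "prob_space R" and X: "\<And>u. u \<in> J \<Longrightarrow> X u \<in> borel_measurable R" for R :: "'c measure" and X :: "'u \<Rightarrow> 'c \<Rightarrow> real"
  proof -
    have "(\<lambda>\<xi>. tprod ch w b (\<lambda>u. X u \<xi>)) \<in> borel_measurable R" unfolding tprod_def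
    proof (rule borel_measurable_prod)
      fix u assume "u \<in> J"
      note [measurable] = X[OF this]
      show "(\<lambda>\<xi>. ch ((cos (w * (X u \<xi> + b u)))\<^sup>2)) \<in> borel_measurable R" by measurable
    qed
    then have i1: "integrable R (\<lambda>\<xi>. tprod ch w b (\<lambda>u. X u \<xi>))"
      using b1 prob_space.finite_measure[OF R] by (intro finite_measure.integrable_const_bound[of _ _ 1]) auto
    have i2: "integrable R (\<lambda>\<xi>. Re (f (\<lambda>u. X u \<xi>)))" by (intro integrable_Re trig_integrable[OF tf X R])
    have "Re (\<integral>\<xi>. f (\<lambda>u. X u \<xi>) \<partial>R) = (\<integral>\<xi>. Re (f (\<lambda>u. X u \<xi>)) \<partial>R)"
      by (rule integral_Re[symmetric, OF trig_integrable[OF tf X R]])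
    then have "(\<integral>\<xi>. tprod ch w b (\<lambda>u. X u \<xi>) \<partial>R) - Re (\<integral>\<xi>. f (\<lambda>u. X u \<xi>) \<partial>R)
      = (\<integral>\<xi>. tprod ch w b (\<lambda>u. X u \<xi>) - Re (f (\<lambda>u. X u \<xi>)) \<partial>R)" using i1 i2 by simp
    then have "\<bar>(\<integral>\<xi>. tprod ch w b (\<lambda>u. X u \<xi>) \<partial>R) - Re (\<integral>\<xi>. f (\<lambda>u. X u \<xi>) \<partial>R)\<bar>
      \<le> (\<integral>\<xi>. \<bar>tprod ch w b (\<lambda>u. X u \<xi>) - Re (f (\<lambda>u. X u \<xi>))\<bar> \<partial>R)" by (simp only: integral_abs_bound)
    also have "\<dots> \<le> (\<integral>\<xi>. e / 4 \<partial>R)"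
      using close e by (intro integral_mono' finite_measure.integrable_const prob_space.finite_measure[OF R]) (auto simp: f_def)
    finally show ?thesis using prob_space.prob_space[OF R] by simp
  qed
  have "(\<lambda>n. Re (\<integral>\<xi>. f (\<lambda>u. V n u \<xi>) \<partial>M n)) \<longlonglongrightarrow> Re (\<integral>\<xi>. f (\<lambda>u. W u \<xi>) \<partial>Q)"
    by (rule tendsto_Re[OF trig_conv[OF tf]])
  then have "\<forall>\<^sub>F n in sequentially. \<bar>Re (\<integral>\<xi>. f (\<lambda>u. V n u \<xi>) \<partial>M n) - Re (\<integral>\<xi>. f (\<lambda>u. W u \<xi>) \<partial>Q)\<bar> < e / 4"
    unfolding dist_real_def[symmetric] by (rule tendstoD) (use e in simp)
  then have "\<forall>\<^sub>F n in sequentially. norm ((\<integral>\<xi>. tprod ch w b (\<lambda>u. V n u \<xi>) \<partial>M n) - (\<integral>\<xi>. tprod ch w b (\<lambda>u. W u \<xi>) \<partial>Q)) < e"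
    using M
  proof eventually_elim
    case (elim n)
    have "\<bar>(\<integral>\<xi>. tprod ch w b (\<lambda>u. V n u \<xi>) \<partial>M n) - Re (\<integral>\<xi>. f (\<lambda>u. V n u \<xi>) \<partial>M n)\<bar> \<le> e / 4"
      using elim by (intro diff) auto
    moreover have "\<bar>(\<integral>\<xi>. tprod ch w b (\<lambda>u. W u \<xi>) \<partial>Q) - Re (\<integral>\<xi>. f (\<lambda>u. W u \<xi>) \<partial>Q)\<bar> \<le> e / 4"
      by (intro diff Q W)
    ultimately show ?case using elim(1) e unfolding real_norm_def by linarith
  qed
  then show "\<exists>no. \<forall>n\<ge>no. norm ((\<integral>\<xi>. tprod ch w b (\<lambda>u. V n u \<xi>) \<partial>M n) - (\<integral>\<xi>. tprod ch w b (\<lambda>u. W u \<xi>) \<partial>Q)) < e"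
    by (simp add: eventually_sequentially)
qed

definition inside :: "('u \<Rightarrow> real) \<Rightarrow> real \<Rightarrow> ('u \<Rightarrow> real) \<Rightarrow> bool" where
  "inside b r x \<longleftrightarrow> (\<forall>u\<in>J. \<bar>x u + b u\<bar> \<le> r)"

text \<open>For \<open>w\<close> = pi / (2 R) the squared cosine decreases on [0, R], so a
  continuous ramp between its values at r' and at r separates the boxes of these radii. Beyond R
  periodicity may lift the product again, whence the last summand.\<close>

lemma tprod_sandwich:
  assumes r: "0 \<le> r" "r < r'" "r' < R"
  shows "\<exists>ch w. continuous_on {0..1} ch \<and> (\<forall>y\<in>{0..1}. 0 \<le> ch y \<and> ch y \<le> 1) \<and> ch \<in> borel_measurable borel \<and>
    (\<forall>x. (if inside b r x then 1 else 0) \<le> tprod ch w b x \<and>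
      tprod ch w b x \<le> (if inside b r' x then 1 else 0) + (if inside b R x then 0 else 1))"
proof -
  define w where "w = pi / (2 * R)"
  have R: "0 < R" using r by simp
  have w: "0 < w" "w * R = pi / 2" using R pi_gt_zero by (auto simp: w_def)
  have mon: "(cos (w * s))\<^sup>2 \<le> (cos (w * t))\<^sup>2" if "0 \<le> t" "t \<le> s" "s \<le> R" for s t
  proof -
    have 1: "w * s \<le> pi / 2" using mult_left_mono[OF that(3), of w] w by simp
    have 2: "w * t \<le> w * s" using that w by (intro mult_left_mono) auto
    have 3: "0 \<le> w * t" using that w by simp
    have 4: "w * s \<le> pi" using 1 pi_gt_zero by linarith
    have 5: "- (pi / 2) \<le> w * s" using 2 3 pi_gt_zero by linarith
    show ?thesis using cos_monotone_0_pi_le[OF 3 2 4] cos_ge_zero[OF 5 1] by (rule power_mono)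
  qed
  have cabs: "(cos (w * z))\<^sup>2 = (cos (w * \<bar>z\<bar>))\<^sup>2" for z by (simp add: abs_if)
  define A B where "A = (cos (w * r'))\<^sup>2" and "B = (cos (w * r))\<^sup>2"
  have AB: "A < B"
  proof -
    have 1: "w * r' \<le> pi / 2" using mult_left_mono[of r' R w] r w by simp
    have 2: "w * r < w * r'" using r w by simp
    have 3: "0 \<le> w * r" using r w by simp
    have 4: "w * r' \<le> pi" using 1 pi_gt_zero by linarith
    have 5: "- (pi / 2) \<le> w * r'" using 2 3 pi_gt_zero by linarith
    show ?thesis unfolding A_def B_def
      using cos_monotone_0_pi[OF 3 2 4] cos_ge_zero[OF 5 1] by (rule power_strict_mono) simp
  qed
  define ch where "ch y = 1 - cts_step A B y" for y
  have c01: "0 \<le> ch y" "ch y \<le> 1" for y using AB by (auto simp: ch_def cts_step_def field_simps)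
  have "uniformly_continuous_on UNIV (cts_step A B)" by (rule cts_step_uniformly_continuous[OF AB])
  then have cc: "continuous_on UNIV (cts_step A B)" by (rule uniformly_continuous_imp_continuous)
  then have c: "continuous_on UNIV ch" unfolding ch_def[abs_def] by (intro continuous_intros)
  have lo: "(if inside b r x then 1 else 0) \<le> tprod ch w b x" for x
  proof (cases "inside b r x")
    case True
    have "ch ((cos (w * (x u + b u)))\<^sup>2) = 1" if "u \<in> J" for u
    proof -
      have "B \<le> (cos (w * (x u + b u)))\<^sup>2"
        unfolding B_def cabs[of "x u + b u"] using True that r by (intro mon) (auto simp: inside_def)
      then show ?thesis using AB by (simp add: ch_def cts_step_def)
    qed
    then show ?thesis by (simp add: tprod_def)
  qed (simp add: tprod_def prod_nonneg c01)
  have le1: "tprod ch w b x \<le> 1" for x unfolding tprod_def using c01 by (intro prod_le_1) auto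
  have hi: "tprod ch w b x \<le> (if inside b r' x then 1 else 0) + (if inside b R x then 0 else 1)" for x
  proof (cases "inside b r' x \<or> \<not> inside b R x")
    case True then show ?thesis using le1[of x] by auto
  next
    case False
    then obtain u where u: "u \<in> J" "r' < \<bar>x u + b u\<bar>" "\<bar>x u + b u\<bar> \<le> R" by (force simp: inside_def)
    have "(cos (w * (x u + b u)))\<^sup>2 \<le> A"
      unfolding A_def cabs[of "x u + b u"] using u r by (intro mon) auto
    then have "ch ((cos (w * (x u + b u)))\<^sup>2) = 0" by (simp add: ch_def cts_step_def)
    then have "tprod ch w b x = 0" unfolding tprod_def using u J by (intro prod_zero) auto
    then show ?thesis using False by simp
  qed
  have m: "ch \<in> borel_measurable borel" by (rule borel_measurable_continuous_onI[OF c])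
  show ?thesis
    by (rule exI[of _ ch], rule exI[of _ w]) (use c c01 lo hi m in \<open>auto intro: continuous_on_subset\<close>)
qed

lemma inside_measurable:
  assumes "\<And>u. u \<in> J \<Longrightarrow> X u \<in> borel_measurable R" shows "{\<xi> \<in> space R. inside b r (\<lambda>u. X u \<xi>)} \<in> sets R"
proof -
  have "{\<xi> \<in> space R. \<bar>X u \<xi> + b u\<bar> \<le> r} \<in> sets R" if "u \<in> J" for u
    using assms[OF that] by measurable
  then have "{\<xi> \<in> space R. \<forall>u\<in>J. \<bar>X u \<xi> + b u\<bar> \<le> r} \<in> sets R" using J by (intro sets.sets_Collect_finite_All)
  then show ?thesis by (simp add: inside_def)
qed

end

section \<open>The supremum of a shifted Brownian bridge\<close>

context char_convergence
begin

text \<open>Chebyshev's inequality in each coordinate and a union bound, with (x + b)^2 \<le> 2 (x^2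
  + b^2). Only second moments enter, so the bound can be used uniformly along a sequence to control
  the periodicity error.\<close>

lemma tail_bound:
  assumes R: "prob_space R" and X: "\<And>u. u \<in> J \<Longrightarrow> X u \<in> borel_measurable R"
    and X2: "\<And>u. u \<in> J \<Longrightarrow> integrable R (\<lambda>\<xi>. (X u \<xi>)\<^sup>2) \<and> (\<integral>\<xi>. (X u \<xi>)\<^sup>2 \<partial>R) \<le> C" and s: "0 < s"
  shows "measure R {\<xi> \<in> space R. \<not> inside b s (\<lambda>u. X u \<xi>)} \<le> (\<Sum>u\<in>J. 2 * (C + (b u)\<^sup>2)) / s\<^sup>2"
proof -
  interpret R: prob_space R by fact
  have m: "{\<xi> \<in> space R. inside b s (\<lambda>u. X u \<xi>)} \<in> sets R" by (rule inside_measurable[OF X])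
  have eq: "{\<xi> \<in> space R. \<not> inside b s (\<lambda>u. X u \<xi>)} = space R - {\<xi> \<in> space R. inside b s (\<lambda>u. X u \<xi>)}" by auto
  have m': "{\<xi> \<in> space R. \<not> inside b s (\<lambda>u. X u \<xi>)} \<in> sets R" unfolding eq using m by auto
  have i: "integrable R (\<lambda>\<xi>. 2 * ((X u \<xi>)\<^sup>2 + (b u)\<^sup>2) / s\<^sup>2)" if "u \<in> J" for u
    using X2[OF that] by simp
  have "measure R {\<xi> \<in> space R. \<not> inside b s (\<lambda>u. X u \<xi>)} = (\<integral>\<xi>. indicator {\<xi> \<in> space R. \<not> inside b s (\<lambda>u. X u \<xi>)} \<xi> \<partial>R)"
    using m' by simp
  also have "\<dots> \<le> (\<integral>\<xi>. (\<Sum>u\<in>J. 2 * ((X u \<xi>)\<^sup>2 + (b u)\<^sup>2) / s\<^sup>2) \<partial>R)"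
  proof (rule integral_mono)
    show "integrable R (indicat_real {\<xi> \<in> space R. \<not> inside b s (\<lambda>u. X u \<xi>)})"
      using m' by (intro integrable_real_indicator) (auto simp: R.emeasure_eq_measure)
    show "integrable R (\<lambda>\<xi>. (\<Sum>u\<in>J. 2 * ((X u \<xi>)\<^sup>2 + (b u)\<^sup>2) / s\<^sup>2))" by (intro Bochner_Integration.integrable_sum i)
    fix \<xi> assume "\<xi> \<in> space R"
    show "indicat_real {\<xi> \<in> space R. \<not> inside b s (\<lambda>u. X u \<xi>)} \<xi> \<le> (\<Sum>u\<in>J. 2 * ((X u \<xi>)\<^sup>2 + (b u)\<^sup>2) / s\<^sup>2)"
    proof (cases "inside b s (\<lambda>u. X u \<xi>)")
      case False
      then obtain u where u: "u \<in> J" "s < \<bar>X u \<xi> + b u\<bar>" by (force simp: inside_def)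
      have "s\<^sup>2 \<le> \<bar>X u \<xi> + b u\<bar>\<^sup>2" using u s by (intro power_mono) auto
      also have "\<dots> \<le> 2 * ((X u \<xi>)\<^sup>2 + (b u)\<^sup>2)"
        using zero_le_power2[of "X u \<xi> - b u"] by (simp add: power2_eq_square algebra_simps)
      finally have "1 \<le> 2 * ((X u \<xi>)\<^sup>2 + (b u)\<^sup>2) / s\<^sup>2" using s by (simp add: le_divide_eq)
      also have "\<dots> \<le> (\<Sum>u\<in>J. 2 * ((X u \<xi>)\<^sup>2 + (b u)\<^sup>2) / s\<^sup>2)"
        using u J by (intro member_le_sum[of u J "\<lambda>u. 2 * ((X u \<xi>)\<^sup>2 + (b u)\<^sup>2) / s\<^sup>2"]) auto
      finally show ?thesis by (simp add: indicator_def)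
    qed (simp add: sum_nonneg)
  qed
  also have "\<dots> = (\<Sum>u\<in>J. 2 * ((\<integral>\<xi>. (X u \<xi>)\<^sup>2 \<partial>R) + (b u)\<^sup>2) / s\<^sup>2)"
    using X2 i by (subst Bochner_Integration.integral_sum) (auto simp: R.prob_space intro!: sum.cong)
  also have "\<dots> \<le> (\<Sum>u\<in>J. 2 * (C + (b u)\<^sup>2) / s\<^sup>2)"
    using X2 by (intro sum_mono divide_right_mono mult_left_mono add_mono) auto
  finally show ?thesis by (simp add: sum_divide_distrib)
qed

lemma sandwich_integral:
  assumes R: "prob_space R" and X: "\<And>u. u \<in> J \<Longrightarrow> X u \<in> borel_measurable R"
    and [measurable]: "ch \<in> borel_measurable borel" and b01: "\<And>y. y \<in> {0..1} \<Longrightarrow> 0 \<le> ch y \<and> ch y \<le> 1"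
    and sw: "\<And>x. (if inside b r x then 1 else 0) \<le> tprod ch w b x \<and>
      tprod ch w b x \<le> (if inside b r' x then 1 else 0) + (if inside b s x then 0 else 1)"
  shows "measure R {\<xi> \<in> space R. inside b r (\<lambda>u. X u \<xi>)} \<le> (\<integral>\<xi>. tprod ch w b (\<lambda>u. X u \<xi>) \<partial>R)"
    and "(\<integral>\<xi>. tprod ch w b (\<lambda>u. X u \<xi>) \<partial>R) \<le> measure R {\<xi> \<in> space R. inside b r' (\<lambda>u. X u \<xi>)}
      + measure R {\<xi> \<in> space R. \<not> inside b s (\<lambda>u. X u \<xi>)}"
proof -
  interpret R: prob_space R by fact
  have m: "{\<xi> \<in> space R. inside b s (\<lambda>u. X u \<xi>)} \<in> sets R" for s by (rule inside_measurable[OF X])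
  have eq: "{\<xi> \<in> space R. \<not> inside b s (\<lambda>u. X u \<xi>)} = space R - {\<xi> \<in> space R. inside b s (\<lambda>u. X u \<xi>)}" for s by auto
  have m': "{\<xi> \<in> space R. \<not> inside b s (\<lambda>u. X u \<xi>)} \<in> sets R" for s unfolding eq using m by auto
  have "(\<lambda>\<xi>. tprod ch w b (\<lambda>u. X u \<xi>)) \<in> borel_measurable R" unfolding tprod_def
  proof (rule borel_measurable_prod)
    fix u assume "u \<in> J"
    note [measurable] = X[OF this]
    show "(\<lambda>\<xi>. ch ((cos (w * (X u \<xi> + b u)))\<^sup>2)) \<in> borel_measurable R" by measurable
  qed
  moreover have "\<bar>tprod ch w b x\<bar> \<le> 1" for x
    unfolding tprod_def abs_prod using b01[OF cos_sq_range] by (intro prod_le_1) auto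
  ultimately have it: "integrable R (\<lambda>\<xi>. tprod ch w b (\<lambda>u. X u \<xi>))" by (intro R.integrable_const_bound[of _ 1]) auto
  have ind: "integrable R (indicat_real A)" if "A \<in> sets R" for A
    using that by (intro integrable_real_indicator) (auto simp: R.emeasure_eq_measure)
  have "measure R {\<xi> \<in> space R. inside b r (\<lambda>u. X u \<xi>)} = (\<integral>\<xi>. indicator {\<xi> \<in> space R. inside b r (\<lambda>u. X u \<xi>)} \<xi> \<partial>R)"
    using m by simp
  also have "\<dots> \<le> (\<integral>\<xi>. tprod ch w b (\<lambda>u. X u \<xi>) \<partial>R)"
  proof (rule integral_mono[OF ind[OF m] it])
    show "indicat_real {\<xi> \<in> space R. inside b r (\<lambda>u. X u \<xi>)} \<xi> \<le> tprod ch w b (\<lambda>u. X u \<xi>)" if "\<xi> \<in> space R" for \<xi>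
      using sw[of "\<lambda>u. X u \<xi>"] that by (auto simp: indicator_def split: if_splits)
  qed
  finally show "measure R {\<xi> \<in> space R. inside b r (\<lambda>u. X u \<xi>)} \<le> (\<integral>\<xi>. tprod ch w b (\<lambda>u. X u \<xi>) \<partial>R)" .
  have "(\<integral>\<xi>. tprod ch w b (\<lambda>u. X u \<xi>) \<partial>R) \<le> (\<integral>\<xi>. indicator {\<xi> \<in> space R. inside b r' (\<lambda>u. X u \<xi>)} \<xi>
      + indicator {\<xi> \<in> space R. \<not> inside b s (\<lambda>u. X u \<xi>)} \<xi> \<partial>R)"
  proof (rule integral_mono[OF it Bochner_Integration.integrable_add[OF ind[OF m] ind[OF m']]])
    show "tprod ch w b (\<lambda>u. X u \<xi>) \<le> indicat_real {\<xi> \<in> space R. inside b r' (\<lambda>u. X u \<xi>)} \<xi>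
      + indicat_real {\<xi> \<in> space R. \<not> inside b s (\<lambda>u. X u \<xi>)} \<xi>" if "\<xi> \<in> space R" for \<xi>
      using sw[of "\<lambda>u. X u \<xi>"] that by (auto simp: indicator_def split: if_splits)
  qed
  also have "\<dots> = measure R {\<xi> \<in> space R. inside b r' (\<lambda>u. X u \<xi>)} + measure R {\<xi> \<in> space R. \<not> inside b s (\<lambda>u. X u \<xi>)}"
    using ind[OF m] ind[OF m'] m m' by simp
  finally show "(\<integral>\<xi>. tprod ch w b (\<lambda>u. X u \<xi>) \<partial>R) \<le> measure R {\<xi> \<in> space R. inside b r' (\<lambda>u. X u \<xi>)}
      + measure R {\<xi> \<in> space R. \<not> inside b s (\<lambda>u. X u \<xi>)}" .
qed

text \<open>The window size \<open>s\<close> is chosen so that the tails are below e / 2, uniformly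
  in n; then one trigonometric cutoff is integrated against both laws. The gap between r and r'
  absorbs its transition zone.\<close>

lemma inside_conv:
  assumes MV: "\<forall>\<^sub>F n in sequentially. \<forall>u\<in>J. integrable (M n) (\<lambda>\<xi>. (V n u \<xi>)\<^sup>2) \<and> (\<integral>\<xi>. (V n u \<xi>)\<^sup>2 \<partial>M n) \<le> C"
    and MW: "\<And>u. u \<in> J \<Longrightarrow> integrable Q (\<lambda>\<xi>. (W u \<xi>)\<^sup>2) \<and> (\<integral>\<xi>. (W u \<xi>)\<^sup>2 \<partial>Q) \<le> C"
    and r: "0 \<le> r" "r < r'" and e: "0 < e"
  shows "\<forall>\<^sub>F n in sequentially.
    measure (M n) {\<xi> \<in> space (M n). inside b r (\<lambda>u. V n u \<xi>)} \<le> measure Q {\<xi> \<in> space Q. inside b r' (\<lambda>u. W u \<xi>)} + e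
    \<and> measure Q {\<xi> \<in> space Q. inside b r (\<lambda>u. W u \<xi>)} \<le> measure (M n) {\<xi> \<in> space (M n). inside b r' (\<lambda>u. V n u \<xi>)} + e"
proof -
  define D where "D = (\<Sum>u\<in>J. 2 * (C + (b u)\<^sup>2))"
  have "(\<lambda>m. D / (r' + 1 + real m)\<^sup>2) \<longlonglongrightarrow> 0" by real_asymp
  then have "\<forall>\<^sub>F m in sequentially. D / (r' + 1 + real m)\<^sup>2 < e / 2" using e by (intro order_tendstoD) auto
  then obtain m where m: "D / (r' + 1 + real m)\<^sup>2 < e / 2" by (auto simp: eventually_sequentially)
  define s where "s = r' + 1 + real m"
  have s: "r' < s" "0 < s" "D / s\<^sup>2 < e / 2" using m r by (auto simp: s_def)
  obtain ch w where ch: "continuous_on {0..1} ch" "\<forall>y\<in>{0..1}. 0 \<le> ch y \<and> ch y \<le> 1" "ch \<in> borel_measurable borel"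
    and sw: "\<And>x. (if inside b r x then 1 else 0) \<le> tprod ch w b x \<and>
      tprod ch w b x \<le> (if inside b r' x then 1 else 0) + (if inside b s x then 0 else 1)"
    using tprod_sandwich[OF r s(1), of b] by blast
  have "(\<lambda>n. \<integral>\<xi>. tprod ch w b (\<lambda>u. V n u \<xi>) \<partial>M n) \<longlonglongrightarrow> (\<integral>\<xi>. tprod ch w b (\<lambda>u. W u \<xi>) \<partial>Q)"
    using ch by (intro tprod_conv) auto
  then have "\<forall>\<^sub>F n in sequentially. dist (\<integral>\<xi>. tprod ch w b (\<lambda>u. V n u \<xi>) \<partial>M n) (\<integral>\<xi>. tprod ch w b (\<lambda>u. W u \<xi>) \<partial>Q) < e / 2"
    by (rule tendstoD) (use e in simp)
  then show ?thesis using M MV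
  proof eventually_elim
    case (elim n)
    let ?IV = "\<integral>\<xi>. tprod ch w b (\<lambda>u. V n u \<xi>) \<partial>M n" and ?IW = "\<integral>\<xi>. tprod ch w b (\<lambda>u. W u \<xi>) \<partial>Q"
    have pn: "prob_space (M n)" and Vm: "\<And>u. u \<in> J \<Longrightarrow> V n u \<in> borel_measurable (M n)" using elim(2) by auto
    have d: "\<bar>?IV - ?IW\<bar> < e / 2" using elim(1) by (simp only: dist_real_def)
    have b01: "\<And>y. y \<in> {0..1} \<Longrightarrow> 0 \<le> ch y \<and> ch y \<le> 1" using ch(2) by blast
    note 1 = sandwich_integral[OF pn Vm ch(3) b01 sw, simplified]
    have 2: "measure Q {\<xi> \<in> space Q. inside b r (\<lambda>u. W u \<xi>)} \<le> ?IW"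
      by (rule sandwich_integral(1)[OF Q W ch(3) b01 sw])
    have 3: "?IW \<le> measure Q {\<xi> \<in> space Q. inside b r' (\<lambda>u. W u \<xi>)} + measure Q {\<xi> \<in> space Q. \<not> inside b s (\<lambda>u. W u \<xi>)}"
      by (rule sandwich_integral(2)[OF Q W ch(3) b01 sw])
    have 4: "measure (M n) {\<xi> \<in> space (M n). inside b r (\<lambda>u. V n u \<xi>)} \<le> ?IV"
      by (rule sandwich_integral(1)[OF pn Vm ch(3) b01 sw])
    have 5: "?IV \<le> measure (M n) {\<xi> \<in> space (M n). inside b r' (\<lambda>u. V n u \<xi>)} + measure (M n) {\<xi> \<in> space (M n). \<not> inside b s (\<lambda>u. V n u \<xi>)}"
      by (rule sandwich_integral(2)[OF pn Vm ch(3) b01 sw])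
    have 6: "measure Q {\<xi> \<in> space Q. \<not> inside b s (\<lambda>u. W u \<xi>)} \<le> D / s\<^sup>2"
      unfolding D_def by (rule tail_bound[OF Q W MW s(2)])
    have 7: "measure (M n) {\<xi> \<in> space (M n). \<not> inside b s (\<lambda>u. V n u \<xi>)} \<le> D / s\<^sup>2"
      unfolding D_def using elim(3) by (intro tail_bound[OF pn Vm _ s(2)]) auto
    show ?case using d 2 3 4 5 6 7 s(3) by linarith
  qed
qed

end

text \<open>As affine images of the standard normal law, point masses and laws with densities are
  treated alike; moments and the characteristic function are then transported at once.\<close>

lemma normal_law_distr: assumes "0 \<le> \<sigma>"
  shows "normal_law m \<sigma> = distr std_normal_distribution borel (\<lambda>x. m + \<sigma> * x)"
proof (cases "\<sigma> = 0")
  case True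
  then show ?thesis using prob_space.distr_const[OF snd.prob_space_axioms, of m borel]
    by (simp add: normal_law_def)
next
  case False
  then have s: "0 < \<sigma>" using assms by simp
  have "distributed std_normal_distribution lborel (\<lambda>x. x) std_normal_density"
    unfolding distributed_def by (auto simp: distr_id2 sets_density)
  from snd.normal_density_affine[OF this, of \<sigma> m] s
  have "distributed std_normal_distribution lborel (\<lambda>x. m + \<sigma> * x) (normal_density m \<sigma>)" by simp
  from distributed_distr_eq_density[OF this]
  have "distr std_normal_distribution lborel (\<lambda>x. m + \<sigma> * x) = density lborel (\<lambda>x. ennreal (normal_density m \<sigma> x))" .
  moreover have "distr std_normal_distribution borel (\<lambda>x. m + \<sigma> * x) = distr std_normal_distribution lborel (\<lambda>x. m + \<sigma> * x)"
    by (intro distr_cong) auto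
  ultimately show ?thesis using False by (simp add: normal_law_def)
qed

lemma std_normal_moments:
  "integrable std_normal_distribution (\<lambda>x. x)" "(\<integral>x. x \<partial>std_normal_distribution) = 0"
  "integrable std_normal_distribution (\<lambda>x. x\<^sup>2)" "(\<integral>x. x\<^sup>2 \<partial>std_normal_distribution) = 1"
  using integrable_std_normal_distribution_moment[of 1] integral_std_normal_distribution_moment_odd[of 1]
    std_normal_distribution_even_moments[of 1] by simp_all

lemma normal_law_moments:
  assumes s: "0 \<le> \<sigma>" and Y [measurable]: "Y \<in> borel_measurable R" and d: "distr R borel Y = normal_law m \<sigma>"
  shows "integrable R Y" "(\<integral>\<xi>. Y \<xi> \<partial>R) = m" "integrable R (\<lambda>\<xi>. (Y \<xi>)\<^sup>2)" "(\<integral>\<xi>. (Y \<xi>)\<^sup>2 \<partial>R) = m\<^sup>2 + \<sigma>\<^sup>2"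
    "(\<integral>\<xi>. iexp (Y \<xi>) \<partial>R) = iexp m * exp (- (\<sigma>\<^sup>2) / 2)"
proof -
  let ?S = std_normal_distribution
  have d': "distr R borel Y = distr ?S borel (\<lambda>x. m + \<sigma> * x)" using d normal_law_distr[OF s] by simp
  have mt: "(\<lambda>x. m + \<sigma> * x) \<in> borel_measurable ?S" by simp
  have ii: "integrable R (\<lambda>\<xi>. f (Y \<xi>)) \<longleftrightarrow> integrable ?S (\<lambda>x. f (m + \<sigma> * x))"
    if "f \<in> borel_measurable borel" for f :: "real \<Rightarrow> 'c::{banach, second_countable_topology}"
    using integrable_distr_eq[OF Y that] integrable_distr_eq[OF mt that] d' by simp
  have ee: "(\<integral>\<xi>. f (Y \<xi>) \<partial>R) = (\<integral>x. f (m + \<sigma> * x) \<partial>?S)"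
    if "f \<in> borel_measurable borel" for f :: "real \<Rightarrow> 'c::{banach, second_countable_topology}"
    using integral_distr[OF Y that] integral_distr[OF mt that] d' by simp
  have id: "(\<lambda>x::real. x) \<in> borel_measurable borel" by simp
  have "integrable ?S (\<lambda>x. m + \<sigma> * x)"
    by (intro Bochner_Integration.integrable_add integrable_mult_right std_normal_moments snd.integrable_const)
  then show "integrable R Y" by (rule iffD2[OF ii[OF id]])
  show "(\<integral>\<xi>. Y \<xi> \<partial>R) = m"   proof -
    have "(\<integral>x. m + \<sigma> * x \<partial>?S) = (\<integral>x. m \<partial>?S) + (\<integral>x. \<sigma> * x \<partial>?S)"
      by (intro Bochner_Integration.integral_add integrable_mult_right std_normal_moments snd.integrable_const)
    also have "\<dots> = m" unfolding integral_mult_right_zero std_normal_moments(2) using snd.prob_space by simp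
    finally have m: "(\<integral>x. m + \<sigma> * x \<partial>?S) = m" .
    from ee[OF id] show ?thesis unfolding m .
  qed
  have sq: "(m + \<sigma> * x)\<^sup>2 = m\<^sup>2 + 2 * m * \<sigma> * x + \<sigma>\<^sup>2 * x\<^sup>2" for x by (simp add: power2_eq_square algebra_simps)
  have id2: "(\<lambda>x::real. x\<^sup>2) \<in> borel_measurable borel" by simp
  have i2: "integrable ?S (\<lambda>x. (m + \<sigma> * x)\<^sup>2)" unfolding sq
    by (intro Bochner_Integration.integrable_add integrable_mult_right std_normal_moments snd.integrable_const)
  then show "integrable R (\<lambda>\<xi>. (Y \<xi>)\<^sup>2)" by (rule iffD2[OF ii[OF id2]])
  have "(\<integral>x. (m + \<sigma> * x)\<^sup>2 \<partial>?S) = (\<integral>x. m\<^sup>2 + 2 * m * \<sigma> * x \<partial>?S) + (\<integral>x. \<sigma>\<^sup>2 * x\<^sup>2 \<partial>?S)" unfolding sq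
    by (intro Bochner_Integration.integral_add Bochner_Integration.integrable_add integrable_mult_right std_normal_moments snd.integrable_const)
  also have "(\<integral>x. m\<^sup>2 + 2 * m * \<sigma> * x \<partial>?S) = (\<integral>x. m\<^sup>2 \<partial>?S) + (\<integral>x. 2 * m * \<sigma> * x \<partial>?S)"
    by (intro Bochner_Integration.integral_add integrable_mult_right std_normal_moments snd.integrable_const)
  also have "\<dots> = m\<^sup>2" unfolding integral_mult_right_zero std_normal_moments(2) using snd.prob_space by simp
  also have "(\<integral>x. \<sigma>\<^sup>2 * x\<^sup>2 \<partial>?S) = \<sigma>\<^sup>2" unfolding integral_mult_right_zero std_normal_moments(4) by simp
  finally have m2: "(\<integral>x. (m + \<sigma> * x)\<^sup>2 \<partial>?S) = m\<^sup>2 + \<sigma>\<^sup>2" .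
  from ee[OF id2] show "(\<integral>\<xi>. (Y \<xi>)\<^sup>2 \<partial>R) = m\<^sup>2 + \<sigma>\<^sup>2" unfolding m2 .
  have "(\<integral>\<xi>. iexp (Y \<xi>) \<partial>R) = (\<integral>x. iexp (m + \<sigma> * x) \<partial>?S)" by (rule ee) simp
  also have "\<dots> = (\<integral>x. iexp m * iexp (\<sigma> * x) \<partial>?S)" by (simp add: exp_add distrib_left)
  also have "\<dots> = iexp m * char ?S \<sigma>" by (simp add: char_def)
  also have "\<dots> = iexp m * exp (- (\<sigma>\<^sup>2) / 2)" by (simp add: char_std_normal_distribution)
  finally show "(\<integral>\<xi>. iexp (Y \<xi>) \<partial>R) = iexp m * exp (- (\<sigma>\<^sup>2) / 2)" .
qed

section \<open>The bridge on dyadic grids and the supremum of its shifted path\<close>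

locale brownian_bridge =
  fixes Q :: "'b measure" and B :: "real \<Rightarrow> 'b \<Rightarrow> real"
  assumes bb: "standard_brownian_bridge Q B"
begin

lemma prob_Q: "prob_space Q"
  using bb by (simp add: standard_brownian_bridge_def)

lemma B_measurable: "u \<in> {0..1} \<Longrightarrow> B u \<in> borel_measurable Q"
  using bb by (simp add: standard_brownian_bridge_def)

lemma B_continuous: "\<omega> \<in> space Q \<Longrightarrow> continuous_on {0..1} (\<lambda>t. B t \<omega>)"
  using bb by (simp add: standard_brownian_bridge_def)

lemma B_gauss: "finite J \<Longrightarrow> J \<subseteq> {0..1} \<Longrightarrow> \<exists>m \<sigma>. 0 \<le> \<sigma> \<and> distr Q borel (\<lambda>\<omega>. \<Sum>t\<in>J. a t * B t \<omega>) = normal_law m \<sigma>"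
  using bb unfolding standard_brownian_bridge_def by blast

lemma B_single: assumes u: "u \<in> {0..1}"
  shows "integrable Q (B u)" "integrable Q (\<lambda>\<omega>. (B u \<omega>)\<^sup>2)"
proof -
  obtain m \<sigma> where s: "0 \<le> \<sigma>" and d: "distr Q borel (\<lambda>\<omega>. \<Sum>t\<in>{u}. 1 * B t \<omega>) = normal_law m \<sigma>"
    using B_gauss[of "{u}" "\<lambda>_. 1"] u by blast
  have "distr Q borel (B u) = normal_law m \<sigma>" using d by simp
  from normal_law_moments[OF s B_measurable[OF u] this] show "integrable Q (B u)" "integrable Q (\<lambda>\<omega>. (B u \<omega>)\<^sup>2)" by auto
qed

lemma B_mean: "u \<in> {0..1} \<Longrightarrow> (\<integral>\<omega>. B u \<omega> \<partial>Q) = 0"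
  using bb by (simp add: standard_brownian_bridge_def)

lemma B_cov: "s \<in> {0..1} \<Longrightarrow> t \<in> {0..1} \<Longrightarrow> (\<integral>\<omega>. B s \<omega> * B t \<omega> \<partial>Q) = min s t - s * t"
  using bb by (simp add: standard_brownian_bridge_def)

lemma B_second: assumes u: "u \<in> {0..1}" shows "(\<integral>\<omega>. (B u \<omega>)\<^sup>2 \<partial>Q) \<le> 1"
proof -
  have "0 \<le> u * u" using u by simp
  moreover have "(\<integral>\<omega>. (B u \<omega>)\<^sup>2 \<partial>Q) = u - u * u" using B_cov[OF u u] by (simp add: power2_eq_square)
  moreover have "u \<le> 1" using u by simp
  ultimately show ?thesis by linarith
qed

text \<open>A linear combination of values is normal by the definition of a Gaussian process. Its
  mean is 0, and its variance is read off from the second moment, which expands into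
  covariances.\<close>

lemma B_char:
  assumes J: "finite J" "J \<subseteq> {0..1}"
  shows "(\<integral>\<omega>. iexp (\<Sum>u\<in>J. a u * B u \<omega>) \<partial>Q) = exp (- (\<Sum>u\<in>J. \<Sum>w\<in>J. a u * a w * (min u w - u * w)) / 2)"
proof -
  let ?Y = "\<lambda>\<omega>. \<Sum>u\<in>J. a u * B u \<omega>"
  obtain m \<sigma> where s: "0 \<le> \<sigma>" and d: "distr Q borel ?Y = normal_law m \<sigma>" using B_gauss[OF J] by blast
  have Y: "?Y \<in> borel_measurable Q" using J B_measurable by (intro borel_measurable_sum borel_measurable_times) auto
  note nm = normal_law_moments[OF s Y d]
  have iB: "integrable Q (B u)" "integrable Q (\<lambda>\<omega>. (B u \<omega>)\<^sup>2)" if "u \<in> J" for u using B_single[of u] J that by auto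
  have m: "m = 0" using nm(2) iB(1) J B_mean by (auto simp: subset_iff)
  have ip: "integrable Q (\<lambda>\<omega>. B u \<omega> * B w \<omega>)" if "u \<in> J" "w \<in> J" for u w
  proof (rule Bochner_Integration.integrable_bound[of Q "\<lambda>\<omega>. (B u \<omega>)\<^sup>2 + (B w \<omega>)\<^sup>2"])
    show "integrable Q (\<lambda>\<omega>. (B u \<omega>)\<^sup>2 + (B w \<omega>)\<^sup>2)" using iB that by simp
    show "(\<lambda>\<omega>. B u \<omega> * B w \<omega>) \<in> borel_measurable Q" using B_measurable J that by (intro borel_measurable_times) auto
    have "\<bar>x * y\<bar> \<le> x\<^sup>2 + y\<^sup>2" for x y :: real
    proof -
      have "0 \<le> (\<bar>x\<bar> - \<bar>y\<bar>)\<^sup>2" by simp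
      then have "2 * \<bar>x * y\<bar> \<le> x\<^sup>2 + y\<^sup>2" by (simp add: power2_eq_square algebra_simps abs_mult)
      moreover have "0 \<le> \<bar>x * y\<bar>" by simp
      ultimately show ?thesis by linarith
    qed
    then show "AE \<omega> in Q. norm (B u \<omega> * B w \<omega>) \<le> norm ((B u \<omega>)\<^sup>2 + (B w \<omega>)\<^sup>2)" by (intro AE_I2) simp
  qed
  have "\<sigma>\<^sup>2 = (\<integral>\<omega>. (?Y \<omega>)\<^sup>2 \<partial>Q)" using nm(4) m by simp
  also have "\<dots> = (\<integral>\<omega>. (\<Sum>u\<in>J. \<Sum>w\<in>J. a u * a w * (B u \<omega> * B w \<omega>)) \<partial>Q)"
    by (simp add: power2_eq_square sum_product mult_ac)
  also have "\<dots> = (\<Sum>u\<in>J. \<Sum>w\<in>J. \<integral>\<omega>. a u * a w * (B u \<omega> * B w \<omega>) \<partial>Q)"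
    using ip by (simp add: Bochner_Integration.integral_sum)
  also have "\<dots> = (\<Sum>u\<in>J. \<Sum>w\<in>J. a u * a w * (min u w - u * w))"
    using J by (intro sum.cong refl) (auto simp: B_cov subset_iff)
  finally have "\<sigma>\<^sup>2 = (\<Sum>u\<in>J. \<Sum>w\<in>J. a u * a w * (min u w - u * w))" .
  then show ?thesis using nm(5) m by simp
qed

definition grid :: "nat \<Rightarrow> real set" where "grid L = (\<lambda>i. real i / 2^L) ` {..2^L}"

lemma grid: "finite (grid L)" "grid L \<subseteq> {0..1}"
proof -
  have "real i / 2^L \<le> 1" if "i \<le> 2^L" for i
  proof -
    have "real i \<le> real (2^L)" using that by (simp only: of_nat_le_iff)
    then show ?thesis by simp
  qed
  then show "finite (grid L)" "grid L \<subseteq> {0..1}" by (auto simp: grid_def)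
qed

lemma grid_mono: "grid L \<subseteq> grid (Suc L)"
proof
  fix u assume "u \<in> grid L"
  then obtain i where i: "i \<le> 2^L" "u = real i / 2^L" by (auto simp: grid_def)
  then have "u = real (2 * i) / 2^Suc L" "2 * i \<le> 2^Suc L" by auto
  then show "u \<in> grid (Suc L)" unfolding grid_def by blast
qed

lemma grid_dense:
  assumes f: "continuous_on {0..1} f" and le: "\<And>L u. u \<in> grid L \<Longrightarrow> \<bar>f u\<bar> \<le> (r::real)" and u: "u \<in> {0..1}"
  shows "\<bar>f u\<bar> \<le> r"
proof -
  define x where "x L = real (nat \<lfloor>u * 2^L\<rfloor>) / 2^L" for L
  have x: "x L \<in> grid L" for L
  proof -
    have "nat \<lfloor>u * 2^L\<rfloor> \<le> 2^L" using u by (simp add: nat_le_iff floor_le_iff mult_left_le_one_le less_le_trans[of _ "2^L"] le_less_trans[of _ "2^L"])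
    then show ?thesis by (auto simp: x_def grid_def)
  qed
  have xu: "\<bar>x L - u\<bar> \<le> (1/2)^L" for L
  proof -
    have f0: "0 \<le> u * 2^L" using u by simp
    have "real (nat \<lfloor>u * 2^L\<rfloor>) \<le> u * 2^L" "u * 2^L \<le> real (nat \<lfloor>u * 2^L\<rfloor>) + 1" using f0 by linarith+
    then have "x L \<le> u" "u \<le> x L + 1 / 2^L" unfolding x_def by (simp_all add: field_simps)
    then show ?thesis by (simp add: power_one_over)
  qed
  have "(\<lambda>L. (1/2::real)^L) \<longlonglongrightarrow> 0" by (rule LIMSEQ_realpow_zero) auto
  then have "(\<lambda>L. x L - u) \<longlonglongrightarrow> 0" by (rule Lim_null_comparison[rotated]) (use xu in auto)
  then have "x \<longlonglongrightarrow> u" by (simp add: LIM_zero_iff)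
  then have "(\<lambda>L. f (x L)) \<longlonglongrightarrow> f u"
    by (rule continuous_on_tendsto_compose[OF f _ u]) (intro always_eventually allI subsetD[OF grid(2) x])
  then have "(\<lambda>L. \<bar>f (x L)\<bar>) \<longlonglongrightarrow> \<bar>f u\<bar>" by (rule tendsto_rabs)
  then show ?thesis by (rule LIMSEQ_le_const2) (use le[OF x] in auto)
qed

definition Z :: "(real \<Rightarrow> real) \<Rightarrow> 'b \<Rightarrow> real" where
  "Z \<beta> \<omega> = (SUP u\<in>{0..1}. \<bar>B u \<omega> + \<beta> u\<bar>)"

lemma Z_le_iff:
  assumes \<beta>: "continuous_on {0..1} \<beta>" and w: "\<omega> \<in> space Q"
  shows "Z \<beta> \<omega> \<le> r \<longleftrightarrow> (\<forall>L. \<forall>u\<in>grid L. \<bar>B u \<omega> + \<beta> u\<bar> \<le> r)"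
proof -
  have c: "continuous_on {0..1} (\<lambda>u. B u \<omega> + \<beta> u)" by (intro continuous_intros B_continuous w \<beta>)
  then have "continuous_on {0..1} (\<lambda>u. \<bar>B u \<omega> + \<beta> u\<bar>)" by (rule continuous_on_rabs)
  then have "bdd_above ((\<lambda>u. \<bar>B u \<omega> + \<beta> u\<bar>) ` {0..1})"
    by (intro bounded_imp_bdd_above compact_imp_bounded compact_continuous_image) auto
  then have "Z \<beta> \<omega> \<le> r \<longleftrightarrow> (\<forall>u\<in>{0..1}. \<bar>B u \<omega> + \<beta> u\<bar> \<le> r)" unfolding Z_def by (subst cSUP_le_iff) auto
  also have "\<dots> \<longleftrightarrow> (\<forall>L. \<forall>u\<in>grid L. \<bar>B u \<omega> + \<beta> u\<bar> \<le> r)"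
    using grid_dense[OF c, of r] grid(2) by blast
  finally show ?thesis .
qed

lemma grid_event_measurable:
  "{\<omega> \<in> space Q. \<forall>u\<in>grid L. \<bar>B u \<omega> + \<beta> u\<bar> \<le> r} \<in> sets Q"
proof -
  have "{\<omega> \<in> space Q. \<bar>B u \<omega> + \<beta> u\<bar> \<le> r} \<in> sets Q" if "u \<in> grid L" for u
  proof -
    have [measurable]: "B u \<in> borel_measurable Q" by (rule B_measurable[OF subsetD[OF grid(2) that]])
    show ?thesis by measurable
  qed
  then show ?thesis using grid by (intro sets.sets_Collect_finite_All)
qed

lemma Z_event:
  assumes "continuous_on {0..1} \<beta>"
  shows "{\<omega> \<in> space Q. Z \<beta> \<omega> \<le> r} = (\<Inter>L. {\<omega> \<in> space Q. \<forall>u\<in>grid L. \<bar>B u \<omega> + \<beta> u\<bar> \<le> r})"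
  using Z_le_iff[OF assms] by auto

lemma Z_measurable: assumes "continuous_on {0..1} \<beta>" shows "Z \<beta> \<in> borel_measurable Q"
  unfolding borel_measurable_iff_le
proof
  fix r
  have "{\<omega> \<in> space Q. Z \<beta> \<omega> \<le> r} = {\<omega> \<in> space Q. \<forall>L. \<forall>u\<in>grid L. \<bar>B u \<omega> + \<beta> u\<bar> \<le> r}"
    using Z_le_iff[OF assms] by auto
  also have "\<dots> \<in> sets Q" by (rule sets.sets_Collect_countable_All[OF grid_event_measurable])
  finally show "{\<omega> \<in> space Q. Z \<beta> \<omega> \<le> r} \<in> sets Q" .
qed

text \<open>The grid events decrease in L, and their intersection is the event for the supremum
  because the shifted paths are continuous; the measure is continuous from above.\<close>

lemma Z_limit:
  assumes "continuous_on {0..1} \<beta>"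
  shows "(\<lambda>L. measure Q {\<omega> \<in> space Q. \<forall>u\<in>grid L. \<bar>B u \<omega> + \<beta> u\<bar> \<le> r}) \<longlonglongrightarrow> measure Q {\<omega> \<in> space Q. Z \<beta> \<omega> \<le> r}"
  unfolding Z_event[OF assms]
proof (rule finite_measure.finite_Lim_measure_decseq[OF prob_space.finite_measure[OF prob_Q]])
  show "decseq (\<lambda>L. {\<omega> \<in> space Q. \<forall>u\<in>grid L. \<bar>B u \<omega> + \<beta> u\<bar> \<le> r})"
    unfolding decseq_Suc_iff using grid_mono by blast
qed (auto simp: grid_event_measurable)

end

section \<open>The supremum of the empirical process\<close>

text \<open>A countable set that determines the supremum of a right-continuous function on [-1, 1]:
  rationals to the right approximate every t < 1, and the endpoint 1 belongs to the set.\<close>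

definition sup_points :: "real set" where "sup_points = (\<rat> \<inter> {-1..1}) \<union> {1}"

lemma sup_points: "countable sup_points" "sup_points \<subseteq> {-1..1}"
  by (auto simp: sup_points_def countable_rat)

lemma SUP_right_continuous_le_iff:
  fixes f :: "real \<Rightarrow> real"
  assumes rc: "\<And>t. t \<in> {-1..<1} \<Longrightarrow> (f \<longlongrightarrow> f t) (at_right t)" and bdd: "bdd_above ((\<lambda>t. \<bar>f t\<bar>) ` {-1..1})"
  shows "(SUP t\<in>{-1..1}. \<bar>f t\<bar>) \<le> r \<longleftrightarrow> (\<forall>t\<in>{-1..1}. \<bar>f t\<bar> \<le> r)"
    and "(SUP t\<in>{-1..1}. \<bar>f t\<bar>) \<le> r \<longleftrightarrow> (\<forall>t\<in>sup_points. \<bar>f t\<bar> \<le> r)"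
proof -
  show 1: "(SUP t\<in>{-1..1}. \<bar>f t\<bar>) \<le> r \<longleftrightarrow> (\<forall>t\<in>{-1..1}. \<bar>f t\<bar> \<le> r)"
    by (rule cSUP_le_iff[OF _ bdd]) simp
  have "\<bar>f t\<bar> \<le> r" if D: "\<forall>t\<in>sup_points. \<bar>f t\<bar> \<le> r" and t: "t \<in> {-1..1}" for t
  proof (cases "t = 1")
    case True then show ?thesis using D by (simp add: sup_points_def)
  next
    case False
    then have t': "t \<in> {-1..<1}" using t by simp
    show ?thesis
    proof (rule ccontr)
      assume "\<not> \<bar>f t\<bar> \<le> r"
      then have "\<forall>\<^sub>F s in at_right t. r < \<bar>f s\<bar>"
        using tendsto_rabs[OF rc[OF t']] by (intro order_tendstoD) auto
      then obtain c where c: "t < c" "\<And>s. t < s \<Longrightarrow> s < c \<Longrightarrow> r < \<bar>f s\<bar>"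
        by (auto simp: eventually_at_right_field)
      have "t < min c 1" using c t' by simp
      then obtain q where q: "q \<in> \<rat>" "t < q" "q < min c 1" using Rats_dense_in_real by blast
      then have "q \<in> sup_points" using t by (auto simp: sup_points_def)
      then show False using D c(2)[of q] q by force
    qed
  qed
  then show "(SUP t\<in>{-1..1}. \<bar>f t\<bar>) \<le> r \<longleftrightarrow> (\<forall>t\<in>sup_points. \<bar>f t\<bar> \<le> r)"
    unfolding 1 using sup_points(2) by blast
qed

lemma SUP_right_continuous_measurable:
  fixes f :: "real \<Rightarrow> 'a \<Rightarrow> real"
  assumes m: "\<And>t. t \<in> {-1..1} \<Longrightarrow> f t \<in> borel_measurable M"
    and rc: "\<And>\<omega> t. \<omega> \<in> space M \<Longrightarrow> t \<in> {-1..<1} \<Longrightarrow> ((\<lambda>s. f s \<omega>) \<longlongrightarrow> f t \<omega>) (at_right t)"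
    and bdd: "\<And>\<omega>. \<omega> \<in> space M \<Longrightarrow> bdd_above ((\<lambda>t. \<bar>f t \<omega>\<bar>) ` {-1..1})"
  shows "(\<lambda>\<omega>. SUP t\<in>{-1..1}. \<bar>f t \<omega>\<bar>) \<in> borel_measurable M"
  unfolding borel_measurable_iff_le
proof
  fix r
  have "{\<omega> \<in> space M. \<bar>f t \<omega>\<bar> \<le> r} \<in> sets M" if "t \<in> sup_points" for t
  proof -
    have [measurable]: "f t \<in> borel_measurable M" using m that sup_points(2) by blast
    show ?thesis by measurable
  qed
  then have "{\<omega> \<in> space M. \<forall>t\<in>sup_points. \<bar>f t \<omega>\<bar> \<le> r} \<in> sets M"
    by (rule sets.sets_Collect_countable_All'[OF _ sup_points(1)])
  also have "{\<omega> \<in> space M. \<forall>t\<in>sup_points. \<bar>f t \<omega>\<bar> \<le> r} = {\<omega> \<in> space M. (SUP t\<in>{-1..1}. \<bar>f t \<omega>\<bar>) \<le> r}"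
    using SUP_right_continuous_le_iff(2)[OF rc bdd] by auto
  finally show "{\<omega> \<in> space M. (SUP t\<in>{-1..1}. \<bar>f t \<omega>\<bar>) \<le> r} \<in> sets M" .
qed

lemma indicator_right_continuous: "((\<lambda>s. if z \<le> s then 1 else 0 :: real) \<longlongrightarrow> (if z \<le> t then 1 else 0)) (at_right (t::real))"
proof (rule tendsto_eventually)
  show "\<forall>\<^sub>F s in at_right t. (if z \<le> s then 1 else 0) = (if z \<le> t then 1 else 0 :: real)"
  proof (cases "z \<le> t")
    case True
    then show ?thesis by (auto simp: eventually_at_filter)
  next
    case False
    then have "\<forall>\<^sub>F s in at_right t. s < z" by (intro order_tendstoD(2)[OF tendsto_ident_at]) auto
    then show ?thesis by eventually_elim (use False in auto)
  qed
qed

section \<open>Regularity of the shifted process and its comparison with grids\<close>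

context law_kernel
begin

lemma alpha_right_continuous: "((\<lambda>s. alpha s \<xi>) \<longlongrightarrow> alpha t \<xi>) (at_right t)"
proof -
  have "(F \<longlongrightarrow> F t) (at_right t)" by (rule tendsto_within_subset[OF F_isCont[of t, unfolded isCont_def] subset_UNIV])
  then show ?thesis unfolding alpha_def U_def D_def cent_def using N_props
    by (intro tendsto_divide tendsto_sum tendsto_diff indicator_right_continuous tendsto_const) auto
qed

lemma cnt_bounds: "0 \<le> cnt t \<xi>" "cnt t \<xi> \<le> N"
proof -
  show "0 \<le> cnt t \<xi>" unfolding cnt_def U_def D_def by (intro sum_nonneg) auto
  have "cnt t \<xi> \<le> (\<Sum>j\<in>{1..n}. \<Sum>i\<in>{1..<j}. 1)" unfolding cnt_def U_def D_def by (intro sum_mono) auto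
  then show "cnt t \<xi> \<le> N" unfolding pair_count N_def .
qed

lemma alpha_bounded: "\<bar>alpha t \<xi>\<bar> \<le> N / sqrt N"
proof -
  have "0 \<le> N * F t" "N * F t \<le> N" using F_bounds[of t] N_props by (auto simp: mult_left_le)
  then have "\<bar>cnt t \<xi> - N * F t\<bar> \<le> N" using cnt_bounds[of t \<xi>] by linarith
  then show ?thesis using N_props by (simp add: alpha_cnt divide_right_mono)
qed

definition stat :: "(real \<Rightarrow> real) \<Rightarrow> (nat \<Rightarrow> 'x) \<Rightarrow> real" where
  "stat b \<xi> = (SUP t\<in>{-1..1}. \<bar>alpha t \<xi> + b t\<bar>)"

lemma stat_shift_regular:
  assumes b: "\<And>t. isCont b t"
  shows "((\<lambda>s. alpha s \<xi> + b s) \<longlongrightarrow> alpha t \<xi> + b t) (at_right t)"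
    and "bdd_above ((\<lambda>t. \<bar>alpha t \<xi> + b t\<bar>) ` {-1..1})"
proof -
  have "(b \<longlongrightarrow> b t) (at_right t)" by (rule tendsto_within_subset[OF b[of t, unfolded isCont_def] subset_UNIV])
  then show "((\<lambda>s. alpha s \<xi> + b s) \<longlongrightarrow> alpha t \<xi> + b t) (at_right t)"
    by (intro tendsto_add alpha_right_continuous)
  have "compact (b ` {-1..1})" using b by (intro compact_continuous_image continuous_at_imp_continuous_on) auto
  then obtain C where C: "\<And>t. t \<in> {-1..1} \<Longrightarrow> \<bar>b t\<bar> \<le> C"
    using compact_imp_bounded bounded_iff by (metis imageI real_norm_def)
  show "bdd_above ((\<lambda>t. \<bar>alpha t \<xi> + b t\<bar>) ` {-1..1})"
  proof (rule bdd_aboveI2)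
    fix t :: real assume "t \<in> {-1..1}"
    then show "\<bar>alpha t \<xi> + b t\<bar> \<le> N / sqrt N + C" using C[of t] alpha_bounded[of t \<xi>] by linarith
  qed
qed

lemma stat_le_iff: "(\<And>t. isCont b t) \<Longrightarrow> stat b \<xi> \<le> r \<longleftrightarrow> (\<forall>t\<in>{-1..1}. \<bar>alpha t \<xi> + b t\<bar> \<le> r)"
  unfolding stat_def by (intro SUP_right_continuous_le_iff stat_shift_regular)

lemma stat_measurable: "(\<And>t. isCont b t) \<Longrightarrow> stat b \<in> borel_measurable P"
  unfolding stat_def[abs_def]
  by (intro SUP_right_continuous_measurable stat_shift_regular borel_measurable_add borel_measurable_const bm_measurable[OF bm_alpha])

lemma grid_le_stat:
  assumes b: "\<And>t. isCont b t" and e: "\<And>t. t \<in> {-1..1} \<Longrightarrow> \<bar>b t - \<beta> (F t)\<bar> \<le> e"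
    and Z: "stat b \<xi> \<le> r" and u: "u \<in> {0..1}"
  shows "\<bar>alpha (quant u) \<xi> + \<beta> u\<bar> \<le> r + e"
proof -
  have "\<bar>alpha (quant u) \<xi> + b (quant u)\<bar> \<le> r" using Z quant_range[of u] unfolding stat_le_iff[OF b] by blast
  moreover have "\<bar>b (quant u) - \<beta> u\<bar> \<le> e" using e[OF quant_range[of u]] F_quant[of u] u by simp
  ultimately show ?thesis by linarith
qed

text \<open>Each t is compared with a point of the coarse grid: \<open>rem\<close> bounds the change
  of the process, \<kappa> the oscillation of \<beta> over a cell, and e the replacement of the
  shift b by \<beta> at time F t.\<close>

lemma stat_le_grid:
  assumes b: "\<And>t. isCont b t" and e: "\<And>t. t \<in> {-1..1} \<Longrightarrow> \<bar>b t - \<beta> (F t)\<bar> \<le> e"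
    and r: "\<And>i. i \<le> 2^L \<Longrightarrow> \<bar>alpha (quant (real i / 2^L)) \<xi> + \<beta> (real i / 2^L)\<bar> \<le> r"
    and osc: "\<And>s t. s \<in> {0..1} \<Longrightarrow> t \<in> {0..1} \<Longrightarrow> \<bar>s - t\<bar> \<le> 1 / 2^L \<Longrightarrow> \<bar>\<beta> s - \<beta> t\<bar> \<le> \<kappa>"
  shows "stat b \<xi> \<le> r + rem L d \<xi> + \<kappa> + e"
  unfolding stat_le_iff[OF b]
proof
  fix t :: real assume t: "t \<in> {-1..1}"
  obtain i where i: "i \<le> 2^L" "\<bar>alpha t \<xi> - alpha (quant (real i / 2^L)) \<xi>\<bar> \<le> rem L d \<xi>" "\<bar>F t - real i / 2^L\<bar> \<le> 1 / 2^L"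
    using alpha_approx[OF t] by blast
  have "real i \<le> real (2^L)" using i(1) by (simp only: of_nat_le_iff)
  then have "real i / 2^L \<in> {0..1}" by simp
  then have "\<bar>\<beta> (F t) - \<beta> (real i / 2^L)\<bar> \<le> \<kappa>" using F_bounds[of t] i(3) by (intro osc) auto
  then show "\<bar>alpha t \<xi> + b t\<bar> \<le> r + rem L d \<xi> + \<kappa> + e" using r[OF i(1)] i(2) e[OF t] by linarith
qed

lemma rem_Markov:
  assumes "0 < \<kappa>" shows "measure P {\<xi> \<in> space P. \<kappa> < rem L d \<xi>} \<le> (\<integral>\<xi>. rem L d \<xi> \<partial>P) / \<kappa>"
proof -
  have [measurable]: "rem L d \<in> borel_measurable P" by (rule bm_measurable[OF bm_rem])
  have s: "{\<xi> \<in> space P. \<kappa> < rem L d \<xi>} \<in> sets P" by measurable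
  have "measure P {\<xi> \<in> space P. \<kappa> < rem L d \<xi>} = (\<integral>\<xi>. indicator {\<xi> \<in> space P. \<kappa> < rem L d \<xi>} \<xi> \<partial>P)"
    using s by simp
  also have "\<dots> \<le> (\<integral>\<xi>. rem L d \<xi> * (1 / \<kappa>) \<partial>P)"
  proof (rule integral_mono)
    show "integrable P (indicat_real {\<xi> \<in> space P. \<kappa> < rem L d \<xi>})"
      using s by (intro integrable_real_indicator) (auto simp: PP.P.emeasure_eq_measure)
    show "integrable P (\<lambda>\<xi>. rem L d \<xi> * (1 / \<kappa>))" by (intro integrable_mult_left bm_integrable bm_rem)
    show "indicat_real {\<xi> \<in> space P. \<kappa> < rem L d \<xi>} \<xi> \<le> rem L d \<xi> * (1 / \<kappa>)" for \<xi>
      using assms rem_nonneg[of L d \<xi>] by (auto simp: indicator_def le_divide_eq)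
  qed
  finally show ?thesis by simp
qed

end

text \<open>Depth d = 2 log2 n, rounded up, makes the drift n / 2^d at most 1 / n, while d n^(-1/4)
  still tends to 0.\<close>

lemma rem_rate: "(\<lambda>n. 7 * (real (2 * nat \<lceil>log 2 (real n)\<rceil>) + 1) * sqrt (sqrt (1 / real n))
    + real n / 2 ^ (L + 2 * nat \<lceil>log 2 (real n)\<rceil>)) \<longlonglongrightarrow> 0"
proof (rule tendsto_sandwich)
  show "\<forall>\<^sub>F n in sequentially. 0 \<le> 7 * (real (2 * nat \<lceil>log 2 (real n)\<rceil>) + 1) * sqrt (sqrt (1 / real n))
    + real n / 2 ^ (L + 2 * nat \<lceil>log 2 (real n)\<rceil>)" by simp
  show "\<forall>\<^sub>F n in sequentially. 7 * (real (2 * nat \<lceil>log 2 (real n)\<rceil>) + 1) * sqrt (sqrt (1 / real n))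
    + real n / 2 ^ (L + 2 * nat \<lceil>log 2 (real n)\<rceil>) \<le> 7 * (2 * log 2 (real n) + 3) * sqrt (sqrt (1 / real n)) + 1 / real n"
    using eventually_ge_at_top[of 1]
  proof eventually_elim
    case (elim n)
    have n: "1 \<le> real n" using elim by simp
    have l0: "0 \<le> log 2 (real n)" using n by simp
    define m where "m = nat \<lceil>log 2 (real n)\<rceil>"
    have m: "log 2 (real n) \<le> real m" "real m \<le> log 2 (real n) + 1" using l0 unfolding m_def by linarith+
    have "real n = 2 powr (log 2 (real n))" using n by simp
    also have "\<dots> \<le> 2 powr real m" using m by (intro powr_mono) auto
    also have "\<dots> = 2^m" by (simp add: powr_realpow)
    finally have "real n * real n \<le> 2^m * 2^m" using n by (intro mult_mono) auto
    also have "\<dots> = 2^(2*m)" by (simp add: power_add mult_2)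
    also have "\<dots> \<le> 2^(L + 2*m)" by (intro power_increasing) auto
    finally have "real n / 2^(L + 2*m) \<le> 1 / real n" using n by (simp add: field_simps)
    moreover have "7 * (real (2 * m) + 1) * sqrt (sqrt (1 / real n)) \<le> 7 * (2 * log 2 (real n) + 3) * sqrt (sqrt (1 / real n))"
      using m by (intro mult_right_mono mult_left_mono) auto
    ultimately show ?case unfolding m_def by linarith
  qed
  show "(\<lambda>n. 7 * (2 * log 2 (real n) + 3) * sqrt (sqrt (1 / real n)) + 1 / real n) \<longlonglongrightarrow> 0" by real_asymp
qed simp

text \<open>At a continuity point the gap between r and r' can be closed. The negative half line is
  treated apart, since the comparisons concern nonnegative radii.\<close>

lemma weak_conv_m_sandwich:
  fixes Fn :: "nat \<Rightarrow> real measure" and G :: "real measure"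
  assumes G: "real_distribution G" and G0: "\<And>x. x < 0 \<Longrightarrow> cdf G x = 0"
    and F0: "\<And>x. x < 0 \<Longrightarrow> \<forall>\<^sub>F n in sequentially. cdf (Fn n) x = 0"
    and up: "\<And>r r' e. 0 \<le> r \<Longrightarrow> r < r' \<Longrightarrow> 0 < e \<Longrightarrow> \<forall>\<^sub>F n in sequentially. cdf (Fn n) r \<le> cdf G r' + e"
    and lo: "\<And>r r' e. 0 \<le> r \<Longrightarrow> r < r' \<Longrightarrow> 0 < e \<Longrightarrow> \<forall>\<^sub>F n in sequentially. cdf G r \<le> cdf (Fn n) r' + e"
  shows "weak_conv_m Fn G"
  unfolding weak_conv_m_def weak_conv_def
proof (intro allI impI)
  fix x assume cont: "isCont (cdf G) x"
  show "(\<lambda>n. cdf (Fn n) x) \<longlonglongrightarrow> cdf G x"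
  proof (cases "x < 0")
    case True
    show ?thesis unfolding G0[OF True] by (rule tendsto_eventually[OF F0[OF True]])
  next
    case False
    then have x: "0 \<le> x" by simp
    show ?thesis
    proof (rule tendstoI)
      fix e :: real assume e: "0 < e"
      obtain d where d: "0 < d" "\<And>y. \<bar>y - x\<bar> < d \<Longrightarrow> \<bar>cdf G y - cdf G x\<bar> < e / 3"
        using cont e unfolding continuous_at_eps_delta dist_real_def
        by (metis divide_pos_pos zero_less_numeral)
      have "\<forall>\<^sub>F n in sequentially. cdf (Fn n) x \<le> cdf G (x + d/2) + e / 3"
        using x d e by (intro up) auto
      moreover have "\<forall>\<^sub>F n in sequentially. cdf G x - e / 3 \<le> cdf (Fn n) x + e / 3"
      \<comment> \<open>At x = 0 there is no smaller nonnegative radius, but continuity and the zero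
        values on the negative axis make the limit less than e / 3 there.\<close>
      proof (cases "x = 0")
        case True
        have "cdf G (- d / 2) = 0" using d by (intro G0) simp
        then have "cdf G x < e / 3" using d(2)[of "- d / 2"] d(1) True by simp
        have "cdf G x - e / 3 \<le> cdf (Fn n) x + e / 3" for n
        proof -
          have "0 \<le> cdf (Fn n) x" by (simp add: cdf_def)
          then show ?thesis using \<open>cdf G x < e / 3\<close> e by linarith
        qed
        then show ?thesis by (rule always_eventually[OF allI])
      next
        case False
        define y where "y = max 0 (x - d/2)"
        have y: "0 \<le> y" "y < x" "\<bar>y - x\<bar> < d" using x False d by (auto simp: y_def)
        have "\<forall>\<^sub>F n in sequentially. cdf G y \<le> cdf (Fn n) x + e / 3" using y e by (intro lo) auto
        then show ?thesis by eventually_elim (use d(2)[OF y(3)] in linarith)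
      qed
      ultimately show "\<forall>\<^sub>F n in sequentially. dist (cdf (Fn n) x) (cdf G x) < e"
      proof eventually_elim
        case (elim n)
        then show ?case using d(2)[of "x + d/2"] d(1) e unfolding dist_real_def by (simp add: abs_if split: if_splits)
      qed
    qed
  qed
qed

text \<open>A triangular array of kernels whose decorrelation error tends to 0, with a shift b that
  is uniformly close to \<beta> at time F. The conditions are asymptotic because in the application
  they require n \<ge> 2 and a dimension large enough to exclude atoms.\<close>

locale array_convergence = brownian_bridge Q B for Q :: "'b measure" and B :: "real \<Rightarrow> 'b \<Rightarrow> real" +
  fixes \<mu> :: "nat \<Rightarrow> nat \<Rightarrow> 'x measure" and M0 :: "'x measure" and g :: "nat \<Rightarrow> 'x \<Rightarrow> 'x \<Rightarrow> real"
    and F :: "nat \<Rightarrow> real \<Rightarrow> real" and \<epsilon> :: "nat \<Rightarrow> real" and b :: "nat \<Rightarrow> real \<Rightarrow> real" and \<beta> :: "real \<Rightarrow> real"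
  assumes ev: "\<forall>\<^sub>F n in sequentially. law_kernel (\<mu> n) M0 n (g n) (F n) \<and> law_kernel.dec (\<mu> n) n (g n) (F n) (\<epsilon> n)
      \<and> 0 \<le> \<epsilon> n \<and> (\<forall>t. isCont (b n) t)"
    and \<epsilon>0: "\<epsilon> \<longlonglongrightarrow> 0"
    and bias: "\<And>x. 0 < x \<Longrightarrow> \<forall>\<^sub>F n in sequentially. \<forall>t\<in>{-1..1}. \<bar>b n t - \<beta> (F n t)\<bar> \<le> x" and \<beta>: "continuous_on {0..1} \<beta>"
begin

section \<open>Convergence in law of the supremum along the array\<close>

abbreviation "Pn n \<equiv> PiM {1..n} (\<mu> n)"
abbreviation "AL n u \<equiv> law_kernel.alpha n (g n) (F n) (law_kernel.quant (F n) u)"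
abbreviation "ST n \<equiv> law_kernel.stat n (g n) (F n) (b n)"

text \<open>At the quantiles of grid points the covariance of the process is exactly that of the
  bridge, because \<open>F (quant u) = u\<close>; so only the error in \<open>char_alpha\<close> has
  to vanish.\<close>

lemma char_conv: "char_convergence Pn Q (grid L) AL B"
proof (rule char_convergence.intro)
  show "finite (grid L)" by (rule grid)
  show "\<forall>\<^sub>F n in sequentially. prob_space (Pn n) \<and> (\<forall>u\<in>grid L. AL n u \<in> borel_measurable (Pn n))"
    using ev
  proof eventually_elim
    case (elim n)
    then interpret K: law_kernel "\<mu> n" M0 n "g n" "F n" by simp
    show ?case using K.PP.P.prob_space_axioms K.bm_measurable[OF K.bm_alpha] by blast
  qed
  show "prob_space Q" by (rule prob_Q)
  show "B u \<in> borel_measurable Q" if "u \<in> grid L" for u by (rule B_measurable[OF subsetD[OF grid(2) that]])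
  fix a :: "real \<Rightarrow> real"
  define A where "A = 1 + (\<Sum>u\<in>grid L. \<bar>a u\<bar>)"
  have lim: "(\<lambda>n. 6 * A^4 / sqrt (real n) + 4 * sqrt (A^4 * \<epsilon> n)) \<longlonglongrightarrow> 6 * 0 + 4 * sqrt (A^4 * 0)"
    by (intro tendsto_add tendsto_mult tendsto_const tendsto_real_sqrt \<epsilon>0) real_asymp
  have "(\<lambda>n. (\<integral>\<xi>. iexp (\<Sum>u\<in>grid L. a u * AL n u \<xi>) \<partial>Pn n) - (\<integral>\<omega>. iexp (\<Sum>u\<in>grid L. a u * B u \<omega>) \<partial>Q)) \<longlonglongrightarrow> 0"
  proof (rule Lim_null_comparison)
    show "(\<lambda>n. 6 * A^4 / sqrt (real n) + 4 * sqrt (A^4 * \<epsilon> n)) \<longlonglongrightarrow> 0" using lim by simp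
    show "\<forall>\<^sub>F n in sequentially. norm ((\<integral>\<xi>. iexp (\<Sum>u\<in>grid L. a u * AL n u \<xi>) \<partial>Pn n)
      - (\<integral>\<omega>. iexp (\<Sum>u\<in>grid L. a u * B u \<omega>) \<partial>Q)) \<le> 6 * A^4 / sqrt (real n) + 4 * sqrt (A^4 * \<epsilon> n)"
      using ev
    proof eventually_elim
      case (elim n)
      then interpret K: law_kernel "\<mu> n" M0 n "g n" "F n" by simp
      have Fq: "F n (K.quant u) = u" if "u \<in> grid L" for u using subsetD[OF grid(2) that] by (intro K.F_quant) auto
      have s: "(\<Sum>u\<in>grid L. \<Sum>w\<in>grid L. a u * a w * (min (F n (K.quant u)) (F n (K.quant w)) - F n (K.quant u) * F n (K.quant w)))
        = (\<Sum>u\<in>grid L. \<Sum>w\<in>grid L. a u * a w * (min u w - u * w))"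
        by (intro sum.cong refl) (simp add: Fq)
      show ?case unfolding B_char[OF grid] A_def
        using K.char_alpha[OF grid(1)[of L], of "\<epsilon> n" a K.quant] elim unfolding s by blast
    qed
  qed
  then show "(\<lambda>n. \<integral>\<xi>. iexp (\<Sum>u\<in>grid L. a u * AL n u \<xi>) \<partial>Pn n) \<longlonglongrightarrow> (\<integral>\<omega>. iexp (\<Sum>u\<in>grid L. a u * B u \<omega>) \<partial>Q)"
    by (rule LIM_zero_cancel)
qed

lemma grid_conv:
  assumes r: "0 \<le> r" "r < r'" and x: "0 < x"
  shows "\<forall>\<^sub>F n in sequentially.
    measure (Pn n) {\<xi> \<in> space (Pn n). \<forall>u\<in>grid L. \<bar>AL n u \<xi> + \<beta> u\<bar> \<le> r} \<le> measure Q {\<omega> \<in> space Q. \<forall>u\<in>grid L. \<bar>B u \<omega> + \<beta> u\<bar> \<le> r'} + x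
    \<and> measure Q {\<omega> \<in> space Q. \<forall>u\<in>grid L. \<bar>B u \<omega> + \<beta> u\<bar> \<le> r} \<le> measure (Pn n) {\<xi> \<in> space (Pn n). \<forall>u\<in>grid L. \<bar>AL n u \<xi> + \<beta> u\<bar> \<le> r'} + x"
proof -
  interpret C: char_convergence Pn Q "grid L" AL B by (rule char_conv)
  have MV: "\<forall>\<^sub>F n in sequentially. \<forall>u\<in>grid L. integrable (Pn n) (\<lambda>\<xi>. (AL n u \<xi>)\<^sup>2) \<and> (\<integral>\<xi>. (AL n u \<xi>)\<^sup>2 \<partial>Pn n) \<le> 4"
    using ev
  proof eventually_elim
    case (elim n)
    then interpret K: law_kernel "\<mu> n" M0 n "g n" "F n" by simp
    show ?case using K.alpha_second_moment K.bm_integrable[OF K.bm_power[OF K.bm_alpha]] by blast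
  qed
  have MW: "integrable Q (\<lambda>\<omega>. (B u \<omega>)\<^sup>2) \<and> (\<integral>\<omega>. (B u \<omega>)\<^sup>2 \<partial>Q) \<le> 4" if "u \<in> grid L" for u
    using B_single(2)[OF subsetD[OF grid(2) that]] B_second[OF subsetD[OF grid(2) that]] by simp
  show ?thesis using C.inside_conv[OF MV MW r x, of \<beta>] unfolding C.inside_def .
qed

text \<open>The maximum over a grid is at most the supremum, up to the bias error. First a level L
  is fixed at which the bridge event on the grid is close to the event for \<open>Z\<close>; the
  radius gap is then shared by the bias and the convergence on this grid.\<close>

lemma stat_upper:
  assumes r: "0 \<le> r" "r < r'" and x: "0 < x"
  shows "\<forall>\<^sub>F n in sequentially. measure (Pn n) {\<xi> \<in> space (Pn n). ST n \<xi> \<le> r} \<le> measure Q {\<omega> \<in> space Q. Z \<beta> \<omega> \<le> r'} + x"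
proof -
  have "\<forall>\<^sub>F L in sequentially. measure Q {\<omega> \<in> space Q. \<forall>u\<in>grid L. \<bar>B u \<omega> + \<beta> u\<bar> \<le> r'} < measure Q {\<omega> \<in> space Q. Z \<beta> \<omega> \<le> r'} + x / 2"
    using x by (intro order_tendstoD(2)[OF Z_limit[OF \<beta>]]) auto
  then obtain L where L: "measure Q {\<omega> \<in> space Q. \<forall>u\<in>grid L. \<bar>B u \<omega> + \<beta> u\<bar> \<le> r'} < measure Q {\<omega> \<in> space Q. Z \<beta> \<omega> \<le> r'} + x / 2"
    by (auto simp: eventually_sequentially)
  define r1 where "r1 = (r + r') / 2"
  have r1: "0 \<le> r1" "r < r1" "r1 < r'" using r by (auto simp: r1_def)
  have "\<forall>\<^sub>F n in sequentially. \<forall>t\<in>{-1..1}. \<bar>b n t - \<beta> (F n t)\<bar> \<le> r1 - r" using r1 by (intro bias) auto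
  then show ?thesis using grid_conv[OF r1(1,3), of "x/2" L, OF half_gt_zero[OF x]] ev
  proof eventually_elim
    case (elim n)
    then interpret K: law_kernel "\<mu> n" M0 n "g n" "F n" by simp
    have b: "\<And>t. isCont (b n) t" using elim by blast
    have "{\<xi> \<in> space (Pn n). ST n \<xi> \<le> r} \<subseteq> {\<xi> \<in> space (Pn n). \<forall>u\<in>grid L. \<bar>AL n u \<xi> + \<beta> u\<bar> \<le> r1}"
    proof safe
      fix \<xi> u assume Z: "ST n \<xi> \<le> r" and u: "u \<in> grid L"
      have "\<bar>AL n u \<xi> + \<beta> u\<bar> \<le> r + (r1 - r)"
        by (rule K.grid_le_stat[OF b _ Z subsetD[OF grid(2) u]]) (use elim in blast)
      then show "\<bar>AL n u \<xi> + \<beta> u\<bar> \<le> r1" by simp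
    qed
    moreover have "{\<xi> \<in> space (Pn n). \<forall>u\<in>grid L. \<bar>AL n u \<xi> + \<beta> u\<bar> \<le> r1} \<in> sets (Pn n)"
      using char_convergence.inside_measurable[OF char_conv, of L "AL n" "Pn n" \<beta> r1] K.bm_measurable[OF K.bm_alpha]
      unfolding char_convergence.inside_def[OF char_conv] by blast
    ultimately have "measure (Pn n) {\<xi> \<in> space (Pn n). ST n \<xi> \<le> r} \<le> measure (Pn n) {\<xi> \<in> space (Pn n). \<forall>u\<in>grid L. \<bar>AL n u \<xi> + \<beta> u\<bar> \<le> r1}"
      by (rule K.PP.P.finite_measure_mono)
    then show ?case using elim(2) L by linarith
  qed
qed

text \<open>The gap r' - r is cut into four parts \<open>\<kappa>\<close>: for the passage from the
  bridge to the process on the grid, the remainder, the oscillation of \<beta>, and the bias. The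
  coarse level L is fixed, while the depth d grows with n.\<close>

lemma stat_lower:
  assumes r: "0 \<le> r" "r < r'" and x: "0 < x"
  shows "\<forall>\<^sub>F n in sequentially. measure Q {\<omega> \<in> space Q. Z \<beta> \<omega> \<le> r} \<le> measure (Pn n) {\<xi> \<in> space (Pn n). ST n \<xi> \<le> r'} + x"
proof -
  define \<kappa> where "\<kappa> = (r' - r) / 4"
  have \<kappa>: "0 < \<kappa>" "r' = r + \<kappa> + \<kappa> + \<kappa> + \<kappa>" using r by (auto simp: \<kappa>_def field_simps)
  have "uniformly_continuous_on {0..1} \<beta>" by (rule compact_uniformly_continuous[OF \<beta>]) simp
  then obtain \<delta> where \<delta>: "0 < \<delta>" "\<And>s t. s \<in> {0..1} \<Longrightarrow> t \<in> {0..1} \<Longrightarrow> \<bar>s - t\<bar> < \<delta> \<Longrightarrow> \<bar>\<beta> s - \<beta> t\<bar> < \<kappa>"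
    unfolding uniformly_continuous_on_def dist_real_def using \<kappa>(1) by (metis abs_minus_commute)
  define \<rho> where "\<rho> = sqrt (sqrt (1/2 :: real))"
  have \<rho>: "0 < \<rho>" "\<rho> < 1" by (auto simp: \<rho>_def)
  have "(\<lambda>L. 14 * (\<rho>^L / (1 - \<rho>))) \<longlonglongrightarrow> 14 * (0 / (1 - \<rho>))"
    using \<rho> by (intro tendsto_mult tendsto_divide tendsto_const LIMSEQ_realpow_zero) auto
  then have "\<forall>\<^sub>F L in sequentially. 14 * (\<rho>^L / (1 - \<rho>)) < \<kappa> * x / 4" using \<kappa> x by (intro order_tendstoD(2)) auto
  moreover have "(\<lambda>L. 1 / 2^L) \<longlonglongrightarrow> (0::real)" by real_asymp
  then have "\<forall>\<^sub>F L in sequentially. 1 / 2^L < \<delta>" using \<delta> by (intro order_tendstoD(2)) auto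
  ultimately have "\<forall>\<^sub>F L in sequentially. 14 * (\<rho>^L / (1 - \<rho>)) < \<kappa> * x / 4 \<and> 1 / 2^L < \<delta>" by (rule eventually_conj)
  then obtain L where L: "14 * (\<rho>^L / (1 - \<rho>)) < \<kappa> * x / 4" "1 / 2^L < \<delta>" by (auto simp: eventually_sequentially)
  define d where "d n = 2 * nat \<lceil>log 2 (real n)\<rceil>" for n :: nat
  have "\<forall>\<^sub>F n in sequentially. 7 * (real (d n) + 1) * sqrt (sqrt (1 / real n)) + real n / 2^(L + d n) < \<kappa> * x / 4"
    unfolding d_def using \<kappa> x by (intro order_tendstoD(2)[OF rem_rate]) auto
  moreover have "\<forall>\<^sub>F n in sequentially. \<forall>t\<in>{-1..1}. \<bar>b n t - \<beta> (F n t)\<bar> \<le> \<kappa>" by (rule bias[OF \<kappa>(1)])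
  moreover have "r < r + \<kappa>" using \<kappa> by simp
  note grid_conv[OF r(1) this half_gt_zero[OF x], of L]
  ultimately show ?thesis using ev
  proof eventually_elim
    case (elim n)
    then interpret K: law_kernel "\<mu> n" M0 n "g n" "F n" by simp
    have b: "\<And>t. isCont (b n) t" using elim by blast
    have sM: "{\<xi> \<in> space (Pn n). ST n \<xi> \<le> r'} \<in> sets (Pn n)" using K.stat_measurable[OF b] by measurable
    have rM: "{\<xi> \<in> space (Pn n). \<kappa> < K.rem L (d n) \<xi>} \<in> sets (Pn n)"
      using K.bm_measurable[OF K.bm_rem[of L "d n"]] by measurable
    have sub: "{\<xi> \<in> space (Pn n). \<forall>u\<in>grid L. \<bar>AL n u \<xi> + \<beta> u\<bar> \<le> r + \<kappa>}
      \<subseteq> {\<xi> \<in> space (Pn n). ST n \<xi> \<le> r'} \<union> {\<xi> \<in> space (Pn n). \<kappa> < K.rem L (d n) \<xi>}"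
    proof safe
      fix \<xi> assume g: "\<forall>u\<in>grid L. \<bar>AL n u \<xi> + \<beta> u\<bar> \<le> r + \<kappa>" and rem: "\<not> \<kappa> < K.rem L (d n) \<xi>"
      have "ST n \<xi> \<le> (r + \<kappa>) + K.rem L (d n) \<xi> + \<kappa> + \<kappa>"
      proof (rule K.stat_le_grid[OF b])
        show "\<bar>b n t - \<beta> (F n t)\<bar> \<le> \<kappa>" if "t \<in> {-1..1}" for t using elim that by blast
        show "\<bar>AL n (real i / 2^L) \<xi> + \<beta> (real i / 2^L)\<bar> \<le> r + \<kappa>" if "i \<le> 2^L" for i
          using g that by (auto simp: grid_def)
        show "\<bar>\<beta> s - \<beta> t\<bar> \<le> \<kappa>" if "s \<in> {0..1}" "t \<in> {0..1}" "\<bar>s - t\<bar> \<le> 1 / 2^L" for s t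
          using \<delta>(2)[OF that(1,2)] that(3) L(2) by linarith
      qed
      then show "ST n \<xi> \<le> r'" using rem \<kappa>(2) by linarith
    qed
    have "measure Q {\<omega> \<in> space Q. Z \<beta> \<omega> \<le> r} \<le> measure Q {\<omega> \<in> space Q. \<forall>u\<in>grid L. \<bar>B u \<omega> + \<beta> u\<bar> \<le> r}"
      using Z_le_iff[OF \<beta>] grid_event_measurable
      by (intro finite_measure.finite_measure_mono prob_space.finite_measure prob_Q) auto
    also have "\<dots> \<le> measure (Pn n) {\<xi> \<in> space (Pn n). \<forall>u\<in>grid L. \<bar>AL n u \<xi> + \<beta> u\<bar> \<le> r + \<kappa>} + x / 2" using elim by blast
    also have "measure (Pn n) {\<xi> \<in> space (Pn n). \<forall>u\<in>grid L. \<bar>AL n u \<xi> + \<beta> u\<bar> \<le> r + \<kappa>}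
      \<le> measure (Pn n) ({\<xi> \<in> space (Pn n). ST n \<xi> \<le> r'} \<union> {\<xi> \<in> space (Pn n). \<kappa> < K.rem L (d n) \<xi>})"
      using sub sM rM by (intro K.PP.P.finite_measure_mono) auto
    also have "\<dots> \<le> measure (Pn n) {\<xi> \<in> space (Pn n). ST n \<xi> \<le> r'} + measure (Pn n) {\<xi> \<in> space (Pn n). \<kappa> < K.rem L (d n) \<xi>}"
      by (rule measure_Un_le[OF sM rM])
    also have "measure (Pn n) {\<xi> \<in> space (Pn n). \<kappa> < K.rem L (d n) \<xi>} \<le> x / 2"
    proof -
      have "measure (Pn n) {\<xi> \<in> space (Pn n). \<kappa> < K.rem L (d n) \<xi>} \<le> (\<integral>\<xi>. K.rem L (d n) \<xi> \<partial>Pn n) / \<kappa>"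
        by (rule K.rem_Markov[OF \<kappa>(1)])
      also have "\<dots> \<le> (\<kappa> * x / 2) / \<kappa>"
        using K.expectation_rem[of L "d n"] L(1) elim(1) \<kappa>(1) unfolding \<rho>_def by (intro divide_right_mono) linarith+
      finally show ?thesis using \<kappa>(1) by simp
    qed
    finally show ?case by simp
  qed
qed

theorem weak_convergence: "weak_conv_m (\<lambda>n. distr (Pn n) borel (ST n)) (distr Q borel (Z \<beta>))"
proof (rule weak_conv_m_sandwich)
  have Zm: "Z \<beta> \<in> borel_measurable Q" by (rule Z_measurable[OF \<beta>])
  show "real_distribution (distr Q borel (Z \<beta>))" by (rule prob_space.real_distribution_distr[OF prob_Q Zm])
  have cG: "cdf (distr Q borel (Z \<beta>)) x = measure Q {\<omega> \<in> space Q. Z \<beta> \<omega> \<le> x}" for x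
    unfolding cdf_def by (subst measure_distr[OF Zm]) (auto intro!: arg_cong[of _ _ "measure Q"])
  have cF: "\<forall>\<^sub>F n in sequentially. \<forall>x. cdf (distr (Pn n) borel (ST n)) x = measure (Pn n) {\<xi> \<in> space (Pn n). ST n \<xi> \<le> x}"
    using ev
  proof eventually_elim
    case (elim n)
    then interpret K: law_kernel "\<mu> n" M0 n "g n" "F n" by simp
    have m: "ST n \<in> borel_measurable (Pn n)" using elim by (intro K.stat_measurable) blast
    show ?case unfolding cdf_def by (subst measure_distr[OF m]) (auto intro!: arg_cong[of _ _ "measure (Pn n)"])
  qed
  show "cdf (distr Q borel (Z \<beta>)) x = 0" if x: "x < 0" for x
  proof -
    have "\<not> Z \<beta> \<omega> \<le> x" if "\<omega> \<in> space Q" for \<omega>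
      using Z_le_iff[OF \<beta> that, of x] x by (force simp: grid_def)
    then have "{\<omega> \<in> space Q. Z \<beta> \<omega> \<le> x} = {}" by blast
    then show ?thesis unfolding cG by (simp only: measure_empty)
  qed
  show "\<forall>\<^sub>F n in sequentially. cdf (distr (Pn n) borel (ST n)) x = 0" if x: "x < 0" for x
    using cF ev
  proof eventually_elim
    case (elim n)
    then interpret K: law_kernel "\<mu> n" M0 n "g n" "F n" by simp
    have b: "\<And>t. isCont (b n) t" using elim by blast
    have "\<not> ST n \<xi> \<le> x" for \<xi>
    proof
      assume "ST n \<xi> \<le> x"
      then have "\<bar>K.alpha 0 \<xi> + b n 0\<bar> \<le> x" unfolding K.stat_le_iff[OF b] by (auto dest: bspec[of _ _ 0])
      then show False using x by linarith
    qed
    then have "{\<xi> \<in> space (Pn n). ST n \<xi> \<le> x} = {}" by blast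
    then show ?case using elim(1) by (simp only: measure_empty)
  qed
  show "\<forall>\<^sub>F n in sequentially. cdf (distr (Pn n) borel (ST n)) r \<le> cdf (distr Q borel (Z \<beta>)) r' + x"
    if "0 \<le> r" "r < r'" "0 < x" for r r' x
    using cF stat_upper[OF that] by eventually_elim (simp only: cG)
  show "\<forall>\<^sub>F n in sequentially. cdf (distr Q borel (Z \<beta>)) r \<le> cdf (distr (Pn n) borel (ST n)) r' + x"
    if "0 \<le> r" "r < r'" "0 < x" for r r' x
    using cF stat_lower[OF that] by eventually_elim (simp only: cG)
qed

end

section \<open>The statistic and its bias\<close>

text \<open>The mean value theorem is applied twice in the scale, with s fixed. Since y \<ge> 1, the
  factor y is at most y^3, and the bound 8 on x^3 \<open>nphi x\<close> at x = s y makes the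
  remainder uniform in s.\<close>

lemma Phi_scale_expansion: assumes "1 \<le> \<rho>"
  shows "\<bar>Phi s - Phi (s * \<rho>) + (\<rho> - 1) * (s * nphi s)\<bar> \<le> 8 * (\<rho> - 1)\<^sup>2"
proof (cases "\<rho> = 1")
  case False
  then have \<rho>: "1 < \<rho>" using assms by simp
  have d1: "((\<lambda>r. Phi (s * r)) has_real_derivative s * nphi (s * r)) (at r)" for r
    using DERIV_chain2[OF Phi_deriv DERIV_cmult[OF DERIV_ident], of s r] by (simp add: mult.commute)
  have d2: "((\<lambda>r. s * nphi (s * r)) has_real_derivative - (s^3 * r * nphi (s * r))) (at r)" for r
    using DERIV_cmult[OF DERIV_chain2[OF nphi_deriv DERIV_cmult[OF DERIV_ident], of s r], of s]
    by (simp add: power3_eq_cube mult_ac)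
  obtain z where z: "1 < z" "z < \<rho>" "Phi (s * \<rho>) - Phi (s * 1) = (\<rho> - 1) * (s * nphi (s * z))"
    using MVT2[OF \<rho> d1] by blast
  obtain y where y: "1 < y" "y < z" "s * nphi (s * z) - s * nphi (s * 1) = (z - 1) * - (s^3 * y * nphi (s * y))"
    using MVT2[OF z(1) d2] by blast
  have "\<bar>s^3 * y * nphi (s * y)\<bar> \<le> \<bar>(s * y)^3 * nphi (s * y)\<bar>"
  proof -
    have "\<bar>y\<bar> \<le> \<bar>y\<bar>^3" using y by (intro self_le_power) auto
    then have "\<bar>s\<bar>^3 * \<bar>y\<bar> * nphi (s * y) \<le> \<bar>s\<bar>^3 * \<bar>y\<bar>^3 * nphi (s * y)"
      using nphi_pos[of "s * y"] by (intro mult_right_mono mult_left_mono) auto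
    then show ?thesis using nphi_pos[of "s * y"] by (simp add: abs_mult power_abs power_mult_distrib)
  qed
  then have b: "\<bar>s^3 * y * nphi (s * y)\<bar> \<le> 8" using abs_x3_nphi_le[of "s * y"] by linarith
  have "\<bar>(z - 1) * - (s^3 * y * nphi (s * y))\<bar> \<le> (\<rho> - 1) * 8"
    unfolding abs_mult abs_minus_cancel using z b by (intro mult_mono) auto
  then have "\<bar>s * nphi (s * z) - s * nphi s\<bar> \<le> (\<rho> - 1) * 8" using y(3) by simp
  then have "(\<rho> - 1) * \<bar>s * nphi (s * z) - s * nphi s\<bar> \<le> (\<rho> - 1) * ((\<rho> - 1) * 8)"
    using \<rho> by (intro mult_left_mono) auto
  moreover have "Phi s - Phi (s * \<rho>) + (\<rho> - 1) * (s * nphi s) = - ((\<rho> - 1) * (s * nphi (s * z) - s * nphi s))"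
    using z(3) by (simp add: algebra_simps)
  ultimately show ?thesis using \<rho> by (simp add: abs_mult power2_eq_square)
qed simp

lemma pair_sum:
  "(\<Sum>(i, j)\<in>{(i, j). 1 \<le> i \<and> i < j \<and> j \<le> n}. f i j) = (\<Sum>j\<in>{1..n}. \<Sum>i\<in>{1..<j}. f i (j::nat) :: real)"
proof -
  have "(\<Sum>j\<in>{1..n}. \<Sum>i\<in>{1..<j}. f i j) = (\<Sum>(j, i)\<in>Sigma {1..n} (\<lambda>j. {1..<j}). f i j)"
    by (rule sum.Sigma) auto
  also have "\<dots> = (\<Sum>(i, j)\<in>{(i, j). 1 \<le> i \<and> i < j \<and> j \<le> n}. f i j)"
    by (rule sum.reindex_bij_witness[of _ "\<lambda>(i, j). (j, i)" "\<lambda>(j, i). (i, j)"]) auto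
  finally show ?thesis ..
qed

lemma T_stat_eq: "T_stat p m n x = (SUP t\<in>{-1..1}. \<bar>2 / (real n * (real n - 1)) *
    (\<Sum>j\<in>{1..n}. \<Sum>i\<in>{1..<j}. if inner_p p (x i) (x j) \<le> t then 1 else 0) - m t\<bar>)"
  unfolding T_stat_def pair_sum indicator_def of_bool_def atMost_iff ..

lemma T_stat_cong: "(\<And>i. i \<in> {1..n} \<Longrightarrow> x i = y i) \<Longrightarrow> T_stat p m n x = T_stat p m n y"
  unfolding T_stat_eq
  by (intro SUP_cong refl arg_cong[where f=abs] arg_cong2[where f="(-)"] arg_cong2[where f="(*)"] sum.cong) auto

lemma T_stat_measurable:
  assumes X: "\<And>i. i \<in> {1..n} \<Longrightarrow> X i \<in> borel_measurable M"
    and m: "\<And>t. isCont m t" "\<And>t. \<bar>m t\<bar> \<le> 1"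
  shows "(\<lambda>\<omega>. T_stat p m n (\<lambda>i. X i \<omega>)) \<in> borel_measurable M"
  unfolding T_stat_eq
proof (rule SUP_right_continuous_measurable)
  let ?c = "2 / (real n * (real n - 1))"
  let ?s = "\<lambda>t \<omega>. (\<Sum>j\<in>{1..n}. \<Sum>i\<in>{1..<j}. if inner_p p (X i \<omega>) (X j \<omega>) \<le> t then 1 else 0 :: real)"
  show "(\<lambda>\<omega>. ?c * ?s t \<omega> - m t) \<in> borel_measurable M" for t
  proof (intro borel_measurable_diff borel_measurable_times borel_measurable_sum borel_measurable_const)
    fix i j assume "j \<in> {1..n}" "i \<in> {1..<j}"
    then have [measurable]: "X i \<in> borel_measurable M" "X j \<in> borel_measurable M" by (auto intro!: X)
    show "(\<lambda>\<omega>. if inner_p p (X i \<omega>) (X j \<omega>) \<le> t then 1 else 0 :: real) \<in> borel_measurable M" by measurable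
  qed
  show "((\<lambda>s. ?c * ?s s \<omega> - m s) \<longlongrightarrow> ?c * ?s t \<omega> - m t) (at_right t)" for \<omega> t
    by (intro tendsto_diff tendsto_mult tendsto_const tendsto_sum indicator_right_continuous
        tendsto_within_subset[OF m(1)[of t, unfolded isCont_def] subset_UNIV])
  show "bdd_above ((\<lambda>t. \<bar>?c * ?s t \<omega> - m t\<bar>) ` {-1..1})" for \<omega>
  proof (rule bdd_aboveI2)
    fix t
    have "0 \<le> ?s t \<omega>" by (intro sum_nonneg) auto
    moreover have "?s t \<omega> \<le> (\<Sum>j\<in>{1..n}. \<Sum>i\<in>{1..<j}. 1)" by (intro sum_mono) auto
    ultimately have "\<bar>?c * ?s t \<omega>\<bar> \<le> \<bar>?c\<bar> * (\<Sum>j\<in>{1..n}. \<Sum>i\<in>{1..<j}. 1)"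
      unfolding abs_mult by (intro mult_left_mono) auto
    then show "\<bar>?c * ?s t \<omega> - m t\<bar> \<le> \<bar>?c\<bar> * (\<Sum>j\<in>{1..n}. \<Sum>i\<in>{1..<j}. 1) + 1" using m(2)[of t] by linarith
  qed
qed

section \<open>The statistic as a supremum of the shifted process, and the asymptotics of the
  shift\<close>

context law_kernel
begin

text \<open>With g an inner product, \<open>alpha t \<xi>\<close> plus this shift is \<surd>N times
  the empirical frequency minus m t, and the positive factor \<surd>N commutes with the
  supremum.\<close>

lemma stat_eq_T_stat:
  assumes g: "\<And>x y. g x y = inner_p p (R x) (R y)" and m: "\<And>t. \<bar>m t\<bar> \<le> 1"
  shows "stat (\<lambda>t. sqrt N * (F t - m t)) \<xi> = sqrt (real n * (real n - 1) / 2) * T_stat p m n (\<lambda>i. R (\<xi> i))"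
proof -
  define h where "h t = 2 / (real n * (real n - 1)) *
    (\<Sum>j\<in>{1..n}. \<Sum>i\<in>{1..<j}. if inner_p p (R (\<xi> i)) (R (\<xi> j)) \<le> t then 1 else 0) - m t" for t
  have N: "0 < sqrt N" "N = sqrt N * sqrt N" using N_props by auto
  have h: "h t = cnt t \<xi> / N - m t" for t
    unfolding h_def cnt_def U_def D_def g N_def by simp
  have "alpha t \<xi> + sqrt N * (F t - m t) = sqrt N * h t" for t
  proof -
    have "sqrt N * h t = cnt t \<xi> * (sqrt N / N) - sqrt N * m t" unfolding h by (simp add: algebra_simps)
    also have "sqrt N / N = 1 / sqrt N" using N by (metis divide_divide_eq_left divide_self_if less_irrefl)
    finally have "sqrt N * h t = cnt t \<xi> / sqrt N - sqrt N * m t" by simp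
    moreover have "alpha t \<xi> = cnt t \<xi> / sqrt N - N / sqrt N * F t" by (simp add: alpha_cnt diff_divide_distrib)
    moreover have "N / sqrt N = sqrt N" using N_props by (simp add: real_div_sqrt)
    ultimately show ?thesis by (simp add: algebra_simps)
  qed
  then have e: "\<bar>alpha t \<xi> + sqrt N * (F t - m t)\<bar> = sqrt N * \<bar>h t\<bar>" for t using N by (simp add: abs_mult)
  have "\<bar>h t\<bar> \<le> 2" for t
  proof -
    have "0 \<le> cnt t \<xi> / N" "cnt t \<xi> / N \<le> 1" using cnt_bounds[of t \<xi>] N_props by (auto simp: divide_le_eq)
    then show ?thesis unfolding h using m[of t] by linarith
  qed
  then have bdd: "bdd_above ((\<lambda>t. \<bar>h t\<bar>) ` {-1..1})" by (rule bdd_aboveI2)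
  have "continuous (at_left x) ((*) (sqrt N))" for x by (intro continuous_intros)
  then have "(SUP t\<in>{-1..1}. sqrt N * \<bar>h t\<bar>) = sqrt N * (SUP t\<in>{-1..1}. \<bar>h t\<bar>)"
    using continuous_at_Sup_mono[of "\<lambda>x. sqrt N * x" "(\<lambda>t. \<bar>h t\<bar>) ` {-1..1}"] bdd N
    by (auto simp: image_image mono_def mult_left_mono)
  then show ?thesis unfolding stat_def e T_stat_eq h_def[symmetric] N_def[symmetric] .
qed

end

text \<open>Points off the sphere are moved onto it, so that the law of the kernel is the same for every,
  and not merely almost every, first argument.\<close>
definition on_sphere :: "nat \<Rightarrow> (nat \<Rightarrow> real) set \<Rightarrow> (nat \<Rightarrow> real) \<Rightarrow> nat \<Rightarrow> real" where
  "on_sphere p H x = (if x \<in> H \<inter> unit_sphere p then x else (SOME x. x \<in> H \<inter> unit_sphere p))"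

text \<open>For fixed x, moving y onto the sphere changes g only on a null set, so its law is given
  by \<open>ip_cdf\<close>. For the second claim the pointwise decorrelation bound is integrated,
  the squared inner product of two distinct observations having mean 1 / k.\<close>

lemma law_kernel_sphere:
  fixes \<mu> :: "nat \<Rightarrow> (nat \<Rightarrow> real) measure"
  assumes n: "2 \<le> n" and k: "3 \<le> k" and law: "\<And>i. unit_sphere_law (\<mu> i) p k H"
  defines "g \<equiv> \<lambda>x y. inner_p p (on_sphere p H x) (on_sphere p H y)"
    and "F \<equiv> unit_sphere_law.ip_cdf (\<mu> 1) p H"
  shows "law_kernel \<mu> borel n g F"
    and "0 < \<eta> \<Longrightarrow> \<eta> \<le> 1 \<Longrightarrow> law_kernel.dec \<mu> n g F (\<eta> + 12 / real k + 2 / (real k * \<eta>\<^sup>2))"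
proof -
  interpret A: unit_sphere_law "\<mu> i" p k H for i by (rule law)
  define R where "R = on_sphere p H"
  have S_eq: "H \<inter> unit_sphere p = A.S" by (simp add: A.S_def)
  have RS: "R x \<in> A.S" for x
    using A.S_nonempty k someI_ex[of "\<lambda>x. x \<in> A.S"] by (auto simp: R_def on_sphere_def S_eq)
  have R_id: "R x = x" if "x \<in> A.S" for x using that by (simp add: R_def on_sphere_def S_eq)
  have Rm [measurable]: "R \<in> borel_measurable borel"
    unfolding R_def on_sphere_def[abs_def] S_eq by (intro measurable_If_set) auto
  have g: "g x y = inner_p p (R x) (R y)" for x y by (simp add: g_def R_def)
  have Fi: "A.ip_cdf i = F" for i unfolding F_def using k by (intro ip_cdf_unique[OF law law]) simp
  have AE_g: "AE y in \<mu> i. g x y = inner_p p (R x) y" for x i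
    using A.AE_S[of i] by eventually_elim (simp add: g R_id)
  have gm [measurable]: "(\<lambda>(x, y). g x y) \<in> borel_measurable (borel \<Otimes>\<^sub>M borel)"
    unfolding g by measurable
  have gm2 [measurable]: "(\<lambda>y. g x y) \<in> borel_measurable borel" for x unfolding g by measurable
  show lk: "law_kernel \<mu> borel n g F"
  proof (unfold_locales)
    show "sets (\<mu> i) = sets borel" for i by (rule A.sets_mu)
    show "g x y = g y x" for x y by (simp add: g inner_p_commute)
    show "measure (\<mu> i) {y. g x y \<le> t} = F t" for i x t
    proof -
      have "measure (\<mu> i) {y. g x y \<le> t} = measure (\<mu> i) {y. inner_p p (R x) y \<le> t}"
      proof (rule A.finite_measure_eq_AE)
        show "AE y in \<mu> i. (y \<in> {y. g x y \<le> t}) = (y \<in> {y. inner_p p (R x) y \<le> t})"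
          using AE_g[of x i] by eventually_elim simp
        have "{y \<in> space borel. g x y \<le> t} \<in> sets borel" "{y \<in> space borel. inner_p p (R x) y \<le> t} \<in> sets borel" by measurable
        then show "{y. g x y \<le> t} \<in> sets (\<mu> i)" "{y. inner_p p (R x) y \<le> t} \<in> sets (\<mu> i)" by simp_all
      qed
      then show ?thesis using A.ip_cdf_eq[OF RS] Fi by simp
    qed
    show "isCont F t" for t using A.ip_cdf_isCont[OF k] Fi by metis
    show "F (- 1) = 0" using A.ip_cdf_minus_one[OF k] Fi by metis
    show "F 1 = 1" using A.ip_cdf_one k Fi by (metis One_nat_def Suc_leI le_trans numeral_3_eq_3 zero_less_Suc)
  qed (use n gm in auto)
  assume \<eta>: "0 < \<eta>" "\<eta> \<le> 1"
  interpret K: law_kernel \<mu> borel n g F by (rule lk)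
  have g1: "\<bar>g x y\<bar> \<le> 1" for x y unfolding g by (intro inner_p_abs_le_1) (auto intro: A.S_props RS)
  have kg: "K.kernel g" unfolding K.kernel_def using gm g1 by blast
  show "K.dec (\<eta> + 12 / real k + 2 / (real k * \<eta>\<^sup>2))"
    unfolding K.dec_def
  proof (intro allI impI)
    fix i i' j s t assume i: "i \<in> {1..n}" "i' \<in> {1..n}" "i \<noteq> i'"
    have pt: "\<bar>\<integral>y. K.cent s (g x y) * K.cent t (g x' y) \<partial>\<mu> j\<bar> \<le> \<eta> + 12 / real k + 2 / \<eta>\<^sup>2 * (g x x')\<^sup>2" for x x'
    proof -
      have "(\<integral>y. K.cent s (g x y) * K.cent t (g x' y) \<partial>\<mu> j)
        = (\<integral>y. ((if inner_p p (R x) y \<le> s then 1 else 0) - A.ip_cdf j s) * ((if inner_p p (R x') y \<le> t then 1 else 0) - A.ip_cdf j t) \<partial>\<mu> j)"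
      proof (rule integral_cong_AE)
        show "AE y in \<mu> j. K.cent s (g x y) * K.cent t (g x' y) = ((if inner_p p (R x) y \<le> s then 1 else 0) - A.ip_cdf j s)
          * ((if inner_p p (R x') y \<le> t then 1 else 0) - A.ip_cdf j t)"
          using AE_g[of x j] AE_g[of x' j] by eventually_elim (simp add: K.cent_def Fi)
      qed measurable
      then show ?thesis using A.indicator_decorrelation[OF k RS RS \<eta>, of j x s x' t] by (simp add: g)
    qed
    have "(\<integral>\<xi>. \<bar>\<integral>y. K.cent s (g (\<xi> i) y) * K.cent t (g (\<xi> i') y) \<partial>\<mu> j\<bar> \<partial>K.P)
      \<le> (\<integral>\<xi>. \<eta> + 12 / real k + 2 / \<eta>\<^sup>2 * (g (\<xi> i) (\<xi> i'))\<^sup>2 \<partial>K.P)"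
      by (intro integral_mono pt K.bm_integrable K.bm_abs K.bm_kernel[OF K.cent_prod_kernel] K.bm_add K.bm_const K.bm_mult
          K.bm_power K.bm_kernel[OF kg] i)
    also have "\<dots> = \<eta> + 12 / real k + 2 / \<eta>\<^sup>2 * (\<integral>\<xi>. (g (\<xi> i) (\<xi> i'))\<^sup>2 \<partial>K.P)"
      using K.bm_integrable[OF K.bm_power[OF K.bm_kernel[OF kg i(1,2)]], of 2] K.PP.P.prob_space by simp
    also have "(\<integral>\<xi>. (g (\<xi> i) (\<xi> i'))\<^sup>2 \<partial>K.P) = (\<integral>\<xi>. 1 / real k \<partial>K.P)"
    proof -
      have E: "(\<integral>y. (g x y)\<^sup>2 \<partial>\<mu> i') = 1 / real k" for x
      proof -
        have "(\<integral>y. (g x y)\<^sup>2 \<partial>\<mu> i') = (\<integral>y. (inner_p p (R x) y)\<^sup>2 \<partial>\<mu> i')"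
        proof (rule integral_cong_AE)
          show "AE y in \<mu> i'. (g x y)\<^sup>2 = (inner_p p (R x) y)\<^sup>2" using AE_g[of x i'] by eventually_elim simp
        qed measurable
        then show ?thesis using A.second_moment_unit[OF RS, of i' x] k by simp
      qed
      have "(\<integral>\<xi>. (g (\<xi> i) (\<xi> i'))\<^sup>2 \<partial>K.P) = (\<integral>\<xi>. (\<integral>y. (g ((\<xi>(i' := y)) i) ((\<xi>(i' := y)) i'))\<^sup>2 \<partial>\<mu> i') \<partial>K.P)"
        by (intro K.integral_out K.bm_power K.bm_kernel[OF kg] i)
      also have "\<dots> = (\<integral>\<xi>. (\<integral>y. (g (\<xi> i) y)\<^sup>2 \<partial>\<mu> i') \<partial>K.P)" using i(3) by simp
      also have "\<dots> = (\<integral>\<xi>. 1 / real k \<partial>K.P)" unfolding E ..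
      finally show ?thesis .
    qed
    also have "\<eta> + 12 / real k + 2 / \<eta>\<^sup>2 * (\<integral>\<xi>. 1 / real k \<partial>K.P) = \<eta> + 12 / real k + 2 / (real k * \<eta>\<^sup>2)"
      using K.PP.P.prob_space by simp
    finally show "(\<integral>\<xi>. \<bar>\<integral>y. K.cent s (g (\<xi> i) y) * K.cent t (g (\<xi> i') y) \<partial>\<mu> j\<bar> \<partial>K.P) \<le> \<eta> + 12 / real k + 2 / (real k * \<eta>\<^sup>2)" .
  qed
qed

text \<open>Since \<rho>^2 - 1 = (p - k) / (k - 2), the product n (\<rho>^2 - 1) tends to \<tau>.
  Division by \<rho> + 1, which tends to 2, and \<surd>N / n \<rightarrow> 1 / \<surd>2 give the
  constant \<tau> / (2 \<surd>2).\<close>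

lemma dimension_limits:
  fixes p k :: "nat \<Rightarrow> nat" and \<tau> :: real
  assumes k: "\<And>n. n \<ge> 1 \<Longrightarrow> 1 \<le> k n \<and> k n < p n"
    and p_n: "filterlim (\<lambda>n. real (p n) / real n) at_top sequentially"
    and k_p: "(\<lambda>n. (1 - real (k n) / real (p n)) * real n) \<longlonglongrightarrow> \<tau>"
  defines "\<rho> \<equiv> \<lambda>n. sqrt (real (p n) - 2) / sqrt (real (k n) - 2)"
  shows "filterlim (\<lambda>n. real (k n)) at_top sequentially"
    and "(\<lambda>n. real n / real (k n)) \<longlonglongrightarrow> 0"
    and "(\<lambda>n. sqrt (real n * (real n - 1) / 2) * (\<rho> n - 1)) \<longlonglongrightarrow> \<tau> / (2 * sqrt 2)"
    and "(\<lambda>n. sqrt (real n * (real n - 1) / 2) * (\<rho> n - 1)\<^sup>2) \<longlonglongrightarrow> 0"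
proof -
  have ev1: "\<forall>\<^sub>F n in sequentially. 1 \<le> n" by (rule eventually_ge_at_top)
  have n_inf: "filterlim (\<lambda>n. real n) at_top sequentially" by (rule filterlim_real_sequentially)
  have p_inf: "filterlim (\<lambda>n. real (p n)) at_top sequentially"
  proof (rule filterlim_at_top_mono[OF filterlim_at_top_mult_at_top[OF p_n n_inf]])
    show "\<forall>\<^sub>F n in sequentially. real (p n) / real n * real n \<le> real (p n)" using ev1 by eventually_elim simp
  qed
  have np: "(\<lambda>n. real n / real (p n)) \<longlonglongrightarrow> 0"
    using tendsto_inverse_0_at_top[OF p_n] by (simp add: inverse_eq_divide)
  have inv_n: "(\<lambda>n. 1 / real n) \<longlonglongrightarrow> 0" by real_asymp
  have inv_p: "(\<lambda>n. 1 / real (p n)) \<longlonglongrightarrow> 0"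
    using tendsto_inverse_0_at_top[OF p_inf] by (simp add: inverse_eq_divide)
  have "(\<lambda>n. 1 - (1 - real (k n) / real (p n)) * real n * (1 / real n)) \<longlonglongrightarrow> 1 - \<tau> * 0"
    by (intro tendsto_intros k_p inv_n)
  moreover have "\<forall>\<^sub>F n in sequentially. 1 - (1 - real (k n) / real (p n)) * real n * (1 / real n) = real (k n) / real (p n)"
    using ev1 by eventually_elim simp
  ultimately have kp: "(\<lambda>n. real (k n) / real (p n)) \<longlonglongrightarrow> 1" using Lim_transform_eventually by fastforce
  have k_eq: "\<forall>\<^sub>F n in sequentially. real (k n) / real (p n) * real (p n) = real (k n)"
    using ev1 by eventually_elim (use k in fastforce)
  show k_inf: "filterlim (\<lambda>n. real (k n)) at_top sequentially"
    using filterlim_tendsto_pos_mult_at_top[OF kp _ p_inf] k_eq by (auto cong: filterlim_cong)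
  have "(\<lambda>n. (real n / real (p n)) / (real (k n) / real (p n))) \<longlonglongrightarrow> 0 / 1" by (intro tendsto_divide np kp) simp
  moreover have "\<forall>\<^sub>F n in sequentially. (real n / real (p n)) / (real (k n) / real (p n)) = real n / real (k n)"
    using ev1 by eventually_elim (use k in fastforce)
  ultimately show "(\<lambda>n. real n / real (k n)) \<longlonglongrightarrow> 0" using Lim_transform_eventually by fastforce
  define \<delta> where "\<delta> n = real n * ((\<rho> n)\<^sup>2 - 1)" for n
  have k4: "\<forall>\<^sub>F n in sequentially. 4 \<le> real (k n)" using k_inf unfolding filterlim_at_top by blast
  have ev: "\<forall>\<^sub>F n in sequentially. 1 \<le> n \<and> 4 \<le> real (k n) \<and> real (k n) < real (p n)"
    using ev1 k4 by eventually_elim (use k in auto)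
  have rho2: "\<forall>\<^sub>F n in sequentially. (\<rho> n)\<^sup>2 = (real (p n) - 2) / (real (k n) - 2)"
    using ev by eventually_elim (simp add: \<rho>_def power_divide)
  have kp2: "(\<lambda>n. real (k n) / real (p n) - 2 * (1 / real (p n))) \<longlonglongrightarrow> 1 - 2 * 0" by (intro tendsto_intros kp inv_p)
  have "(\<lambda>n. ((1 - real (k n) / real (p n)) * real n) / (real (k n) / real (p n) - 2 * (1 / real (p n)))) \<longlonglongrightarrow> \<tau> / (1 - 2 * 0)"
    by (intro tendsto_divide k_p kp2) simp
  moreover have "\<forall>\<^sub>F n in sequentially. ((1 - real (k n) / real (p n)) * real n) / (real (k n) / real (p n) - 2 * (1 / real (p n))) = \<delta> n"
    using ev rho2
  proof eventually_elim
    case (elim n)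
    have p0: "real (p n) \<noteq> 0" "real (k n) - 2 \<noteq> 0" using elim by auto
    have "(1 - real (k n) / real (p n)) * real n = (real n * (real (p n) - real (k n))) / real (p n)"
      using p0 by (simp add: field_simps)
    moreover have "real (k n) / real (p n) - 2 * (1 / real (p n)) = (real (k n) - 2) / real (p n)"
      using p0 by (simp add: field_simps)
    moreover have "\<delta> n = (real n * (real (p n) - real (k n))) / (real (k n) - 2)"
      unfolding \<delta>_def elim(2) using p0 by (simp add: field_simps)
    ultimately show ?case using p0 by simp
  qed
  ultimately have \<delta>: "\<delta> \<longlonglongrightarrow> \<tau>" using Lim_transform_eventually by fastforce
  have "(\<lambda>n. sqrt (\<delta> n * (1 / real n) + 1)) \<longlonglongrightarrow> sqrt (\<tau> * 0 + 1)" by (intro tendsto_intros \<delta> inv_n)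
  moreover have "\<forall>\<^sub>F n in sequentially. sqrt (\<delta> n * (1 / real n) + 1) = \<rho> n"
    using ev by eventually_elim (auto simp: \<delta>_def \<rho>_def)
  ultimately have \<rho>1: "\<rho> \<longlonglongrightarrow> 1" using Lim_transform_eventually by fastforce
  have nn: "(\<lambda>n. sqrt (real n * (real n - 1) / 2) / real n) \<longlonglongrightarrow> 1 / sqrt 2"
  proof -
    have "(\<lambda>n. sqrt ((1 - 1 / real n) / 2)) \<longlonglongrightarrow> sqrt ((1 - 0) / 2)" by (intro tendsto_intros inv_n) simp
    moreover have "\<forall>\<^sub>F n in sequentially. sqrt ((1 - 1 / real n) / 2) = sqrt (real n * (real n - 1) / 2) / real n"
      using ev1
    proof eventually_elim
      case (elim n)
      have "(1 - 1 / real n) / 2 = (real n * (real n - 1) / 2) / (real n)\<^sup>2"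
        using elim by (simp add: field_simps power2_eq_square)
      then show ?case using elim by (simp add: real_sqrt_divide real_sqrt_mult)
    qed
    ultimately have "(\<lambda>n. sqrt (real n * (real n - 1) / 2) / real n) \<longlonglongrightarrow> sqrt ((1 - 0) / 2)" by (rule Lim_transform_eventually)
    then show ?thesis by (simp add: real_sqrt_divide)
  qed
  have "(\<lambda>n. sqrt (real n * (real n - 1) / 2) / real n * (\<delta> n / (\<rho> n + 1))) \<longlonglongrightarrow> 1 / sqrt 2 * (\<tau> / (1 + 1))"
    by (intro tendsto_intros nn \<delta> \<rho>1) simp
  moreover have "\<forall>\<^sub>F n in sequentially. sqrt (real n * (real n - 1) / 2) / real n * (\<delta> n / (\<rho> n + 1)) = sqrt (real n * (real n - 1) / 2) * (\<rho> n - 1)"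
    using ev
  proof eventually_elim
    case (elim n)
    have "0 \<le> \<rho> n" using elim by (simp add: \<rho>_def)
    then have r: "\<rho> n + 1 \<noteq> 0" by linarith
    have "\<delta> n = real n * ((\<rho> n - 1) * (\<rho> n + 1))" by (simp add: \<delta>_def power2_eq_square algebra_simps)
    then have "\<delta> n / (\<rho> n + 1) = real n * (\<rho> n - 1)" using r by simp
    then show ?case using elim by simp
  qed
  ultimately have "(\<lambda>n. sqrt (real n * (real n - 1) / 2) * (\<rho> n - 1)) \<longlonglongrightarrow> 1 / sqrt 2 * (\<tau> / (1 + 1))" by (rule Lim_transform_eventually)
  then show l: "(\<lambda>n. sqrt (real n * (real n - 1) / 2) * (\<rho> n - 1)) \<longlonglongrightarrow> \<tau> / (2 * sqrt 2)" by (simp add: mult.commute)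
  have "(\<lambda>n. sqrt (real n * (real n - 1) / 2) * (\<rho> n - 1) * (\<rho> n - 1)) \<longlonglongrightarrow> \<tau> / (2 * sqrt 2) * (1 - 1)"
    by (intro tendsto_mult l tendsto_diff \<rho>1 tendsto_const)
  then show "(\<lambda>n. sqrt (real n * (real n - 1) / 2) * (\<rho> n - 1)\<^sup>2) \<longlonglongrightarrow> 0" by (simp add: power2_eq_square mult.assoc)
qed

text \<open>The left hand side splits into the two normal approximation errors, the remainder of
  \<open>Phi_scale_expansion\<close>, and the error of the coefficient c, whose weight s
  \<open>nphi s\<close> is at most 1 in absolute value.\<close>

lemma bias_estimate:
  assumes F: "\<bar>F - Phi s\<bar> \<le> d" and m: "\<bar>m - Phi (s * \<rho>)\<bar> \<le> d" and \<rho>: "1 \<le> \<rho>" and r: "0 \<le> r"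
  shows "\<bar>r * (F - m) + c * (s * nphi s)\<bar> \<le> 2 * r * d + 8 * (r * (\<rho> - 1)\<^sup>2) + \<bar>r * (\<rho> - 1) - c\<bar>"
proof -
  have triangle: "\<bar>u + v - w\<bar> \<le> a + b + e" if "\<bar>u\<bar> \<le> a" "\<bar>v\<bar> \<le> b" "\<bar>w\<bar> \<le> e" for u v w a b e :: real
    using that by linarith
  have "\<bar>r * ((F - Phi s) - (m - Phi (s * \<rho>)))\<bar> \<le> r * (2 * d)"
    unfolding abs_mult using F m r by (intro mult_mono) auto
  moreover have "\<bar>r * (Phi s - Phi (s * \<rho>) + (\<rho> - 1) * (s * nphi s))\<bar> \<le> r * (8 * (\<rho> - 1)\<^sup>2)"
    unfolding abs_mult using Phi_scale_expansion[OF \<rho>, of s] r by (intro mult_mono) auto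
  moreover have "\<bar>(r * (\<rho> - 1) - c) * (s * nphi s)\<bar> \<le> \<bar>r * (\<rho> - 1) - c\<bar> * 1"
    unfolding abs_mult[of "r * (\<rho> - 1) - c"] using abs_x_nphi_le[of s] by (intro mult_left_mono) auto
  moreover have "r * (F - m) + c * (s * nphi s) = r * ((F - Phi s) - (m - Phi (s * \<rho>)))
      + r * (Phi s - Phi (s * \<rho>) + (\<rho> - 1) * (s * nphi s)) - (r * (\<rho> - 1) - c) * (s * nphi s)"
    by (simp add: algebra_simps)
  ultimately have "\<bar>r * (F - m) + c * (s * nphi s)\<bar> \<le> r * (2 * d) + r * (8 * (\<rho> - 1)\<^sup>2) + \<bar>r * (\<rho> - 1) - c\<bar> * 1"
    using triangle by metis
  then show ?thesis by (simp add: mult.commute mult.left_commute)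
qed

text \<open>At s = \<surd>(k - 2) t, \<open>bias_estimate\<close> compares the shift with a function
  of \<open>Phi s\<close>, and uniform continuity of \<open>Phi_inv_phi\<close> replaces
  \<open>Phi s\<close> by F t. The normal approximation errors become of order n / k, as \<surd>N is
  at most n.\<close>

lemma bias_limit:
  fixes p k :: "nat \<Rightarrow> nat" and \<tau> :: real and F m :: "nat \<Rightarrow> real \<Rightarrow> real"
  assumes k: "\<And>n. n \<ge> 1 \<Longrightarrow> 1 \<le> k n \<and> k n < p n"
    and p_n: "filterlim (\<lambda>n. real (p n) / real n) at_top sequentially"
    and k_p: "(\<lambda>n. (1 - real (k n) / real (p n)) * real n) \<longlonglongrightarrow> \<tau>"
    and F: "\<forall>\<^sub>F n in sequentially. \<forall>t. \<bar>F n t - Phi (sqrt (real (k n) - 2) * t)\<bar> \<le> 4 / real (k n) \<and> F n t \<in> {0..1}"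
    and m: "\<forall>\<^sub>F n in sequentially. \<forall>t. \<bar>m n t - Phi (sqrt (real (p n) - 2) * t)\<bar> \<le> 4 / real (k n)"
    and x: "0 < x"
  shows "\<forall>\<^sub>F n in sequentially. \<forall>t. \<bar>sqrt (real n * (real n - 1) / 2) * (F n t - m n t)
      - - (\<tau> / (2 * sqrt 2) * Phi_inv_phi (F n t))\<bar> \<le> x"
proof -
  define c where "c = \<tau> / (2 * sqrt 2)"
  define r where "r n = sqrt (real n * (real n - 1) / 2)" for n
  define \<rho> where "\<rho> n = sqrt (real (p n) - 2) / sqrt (real (k n) - 2)" for n
  note lim = dimension_limits[OF k p_n k_p, folded \<rho>_def r_def]
  \<comment> \<open>Two of the four errors carry a factor 8, so this choice leaves at most x / 4 for
    each of the four.\<close>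
  have x32: "0 < x / 32" using x by simp
  have k4: "\<forall>\<^sub>F n in sequentially. 4 \<le> real (k n)" using lim(1) unfolding filterlim_at_top by blast
  have "uniformly_continuous_on {0..1} (\<lambda>u. c * Phi_inv_phi u)"
    by (intro compact_uniformly_continuous continuous_intros Phi_inv_phi_continuous compact_Icc)
  then obtain d where d: "0 < d"
    and ud: "\<And>u v. u \<in> {0..1} \<Longrightarrow> v \<in> {0..1} \<Longrightarrow> \<bar>u - v\<bar> < d \<Longrightarrow> \<bar>c * Phi_inv_phi u - c * Phi_inv_phi v\<bar> < x / 4"
    using x unfolding uniformly_continuous_on_def dist_real_def by (metis abs_minus_commute divide_pos_pos zero_less_numeral)
  have "\<forall>\<^sub>F n in sequentially. 8 / d \<le> real (k n)" using lim(1) unfolding filterlim_at_top by blast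
  moreover have "\<forall>\<^sub>F n in sequentially. real n / real (k n) < x / 32" by (rule order_tendstoD(2)[OF lim(2) x32])
  moreover have "\<forall>\<^sub>F n in sequentially. r n * (\<rho> n - 1)\<^sup>2 < x / 32" by (rule order_tendstoD(2)[OF lim(4) x32])
  moreover have "\<forall>\<^sub>F n in sequentially. \<bar>r n * (\<rho> n - 1) - c\<bar> < x / 4"
    using tendstoD[OF lim(3), of "x / 4"] x by (simp add: dist_real_def c_def)
  ultimately show ?thesis using k4 F m eventually_ge_at_top[of 1]
  proof eventually_elim
    case (elim n)
    have kk: "0 < real (k n) - 2" "real (k n) < real (p n)" using elim(5) k[OF elim(8)] by auto
    have q: "0 < sqrt (real (k n) - 2)" using kk by simp
    have \<rho>1: "1 \<le> \<rho> n" using kk q by (simp add: \<rho>_def le_divide_eq)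
    have "r n \<le> real n" unfolding r_def
      by (rule real_le_lsqrt) (auto simp: power2_eq_square algebra_simps intro!: mult_mono)
    then have "r n / real (k n) \<le> real n / real (k n)" by (intro divide_right_mono) auto
    moreover have "2 * r n * (4 / real (k n)) = 8 * (r n / real (k n))" by simp
    ultimately have rk: "2 * r n * (4 / real (k n)) \<le> x / 4" using elim(2) by linarith
    have r0: "0 \<le> r n" using elim(8) by (simp add: r_def)
    have d4: "4 / real (k n) < d"
    proof -
      have "8 \<le> real (k n) * d" using elim(1) d by (simp add: divide_le_eq)
      then have "4 < real (k n) * d" by linarith
      then show ?thesis using kk by (simp add: divide_less_eq mult.commute)
    qed
    show ?case
    proof
      fix t
      define s where "s = sqrt (real (k n) - 2) * t"
      have s\<rho>: "s * \<rho> n = sqrt (real (p n) - 2) * t" using q by (simp add: s_def \<rho>_def)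
      have Fs: "\<bar>F n t - Phi s\<bar> \<le> 4 / real (k n)" "F n t \<in> {0..1}" using elim(6) by (auto simp: s_def)
      have ms: "\<bar>m n t - Phi (s * \<rho> n)\<bar> \<le> 4 / real (k n)" using elim(7) by (simp add: s\<rho>)
      have Ps: "Phi s \<in> {0..1}" using Phi_bounds[of s] by simp
      have "\<bar>F n t - Phi s\<bar> < d" using Fs(1) d4 by linarith
      then have "\<bar>c * Phi_inv_phi (F n t) - c * (s * nphi s)\<bar> < x / 4"
        using ud[OF Fs(2) Ps] by simp
      moreover have "\<bar>r n * (F n t - m n t) + c * (s * nphi s)\<bar> \<le> 2 * r n * (4 / real (k n)) + 8 * (r n * (\<rho> n - 1)\<^sup>2) + \<bar>r n * (\<rho> n - 1) - c\<bar>"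
        by (rule bias_estimate[OF Fs(1) ms \<rho>1 r0])
      ultimately have "\<bar>r n * (F n t - m n t) - - (c * Phi_inv_phi (F n t))\<bar> \<le> x" using rk elim(3,4) by linarith
      then show "\<bar>sqrt (real n * (real n - 1) / 2) * (F n t - m n t) - - (\<tau> / (2 * sqrt 2) * Phi_inv_phi (F n t))\<bar> \<le> x"
        by (simp add: r_def c_def)
    qed
  qed
qed

text \<open>Independence identifies the law of the sample with the product measure, and almost
  surely all observations lie on the sphere, where \<open>on_sphere\<close> is the identity. Indices
  outside {1..n} repeat the first observation, so that every marginal is a uniform law.\<close>

lemma distr_T_stat:
  fixes M :: "'a measure" and X :: "nat \<Rightarrow> 'a \<Rightarrow> nat \<Rightarrow> real"
  assumes M: "prob_space M" and indep: "prob_space.indep_vars M (\<lambda>_. borel) X {1..n}"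
    and law: "\<And>i. i \<in> {1..n} \<Longrightarrow> unit_sphere_law (distr M borel (X i)) p k H"
    and n: "2 \<le> n" and k: "3 \<le> k" and m: "\<And>t. isCont m t" "\<And>t. \<bar>m t\<bar> \<le> 1"
  defines "\<mu> \<equiv> \<lambda>i. distr M borel (X (if i \<in> {1..n} then i else 1))"
  defines "F \<equiv> unit_sphere_law.ip_cdf (\<mu> 1) p H"
  defines "g \<equiv> \<lambda>x y. inner_p p (on_sphere p H x) (on_sphere p H y)"
  shows "distr M borel (\<lambda>\<omega>. sqrt (real n * (real n - 1) / 2) * T_stat p m n (\<lambda>i. X i \<omega>))
    = distr (PiM {1..n} \<mu>) borel (law_kernel.stat n g F (\<lambda>t. sqrt (real n * (real n - 1) / 2) * (F t - m t)))"
proof -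
  interpret prob_space M by fact
  have rv: "X i \<in> borel_measurable M" if "i \<in> {1..n}" for i using indep that unfolding indep_vars_def by blast
  have law': "unit_sphere_law (\<mu> i) p k H" for i unfolding \<mu>_def using law n by auto
  interpret K: law_kernel \<mu> borel n g F
    unfolding F_def g_def by (rule law_kernel_sphere(1)[OF n k law'])
  define b where "b t = sqrt (real n * (real n - 1) / 2) * (F t - m t)" for t
  have b: "isCont b t" for t unfolding b_def[abs_def] by (intro continuous_intros K.F_isCont m)
  have Km: "K.stat b \<in> borel_measurable K.P" by (rule K.stat_measurable[OF b])
  define W where "W \<omega> = (\<lambda>i\<in>{1..n}. X i \<omega>)" for \<omega>
  have "distr M (PiM {1..n} (\<lambda>_. borel)) W = PiM {1..n} (\<lambda>i. distr M borel (X i))"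
    using indep_vars_iff_distr_eq_PiM'[where I="{1..n}" and M'="\<lambda>_. borel" and X=X] indep rv n unfolding W_def by fastforce
  also have "\<dots> = K.P" by (rule PiM_cong) (auto simp: \<mu>_def)
  finally have W: "distr M (PiM {1..n} (\<lambda>_. borel)) W = K.P" .
  have Wm: "W \<in> measurable M (PiM {1..n} (\<lambda>_. borel))"
    unfolding W_def[abs_def] by (intro measurable_restrict rv)
  have sP: "sets (PiM {1..n} (\<lambda>_. borel)) = sets K.P" by (simp flip: W)
  have Km': "K.stat b \<in> borel_measurable (PiM {1..n} (\<lambda>_. borel))" using Km by (simp cong: measurable_cong_sets add: sP)
  have "distr K.P borel (K.stat b) = distr M borel (K.stat b \<circ> W)"
    unfolding W[symmetric] by (rule distr_distr[OF Km' Wm])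
  also have "\<dots> = distr M borel (\<lambda>\<omega>. sqrt (real n * (real n - 1) / 2) * T_stat p m n (\<lambda>i. X i \<omega>))"
  proof (rule distr_cong_AE)
    have "AE \<omega> in M. \<forall>i\<in>{1..n}. X i \<omega> \<in> H \<inter> unit_sphere p"
    proof (rule AE_finite_allI)
      fix i assume i: "i \<in> {1..n}"
      have "AE x in distr M borel (X i). x \<in> H \<inter> unit_sphere p"
        using unit_sphere_law.unif[OF law[OF i]] by (simp add: uniform_on_unit_sphere_def)
      then show "AE \<omega> in M. X i \<omega> \<in> H \<inter> unit_sphere p" by (rule AE_distrD[OF rv[OF i]])
    qed simp
    then show "AE \<omega> in M. (K.stat b \<circ> W) \<omega> = sqrt (real n * (real n - 1) / 2) * T_stat p m n (\<lambda>i. X i \<omega>)"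
    proof eventually_elim
      case (elim \<omega>)
      have "K.stat b (W \<omega>) = sqrt (real n * (real n - 1) / 2) * T_stat p m n (\<lambda>i. on_sphere p H (W \<omega> i))"
        using K.stat_eq_T_stat[of p "on_sphere p H" m "W \<omega>"] m(2) by (simp add: g_def b_def[abs_def] K.N_def)
      also have "T_stat p m n (\<lambda>i. on_sphere p H (W \<omega> i)) = T_stat p m n (\<lambda>i. X i \<omega>)"
        using elim by (intro T_stat_cong) (simp add: W_def on_sphere_def)
      finally show ?case by simp
    qed
    show "K.stat b \<circ> W \<in> borel_measurable M" by (rule measurable_comp[OF Wm Km'])
    show "(\<lambda>\<omega>. sqrt (real n * (real n - 1) / 2) * T_stat p m n (\<lambda>i. X i \<omega>)) \<in> borel_measurable M"
      by (intro borel_measurable_times borel_measurable_const T_stat_measurable rv m)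
  qed simp_all
  finally show ?thesis unfolding b_def[abs_def] by simp
qed

theorem proposition6:
  fixes p k :: "nat \<Rightarrow> nat" and \<tau> :: real
    and H :: "nat \<Rightarrow> (nat \<Rightarrow> real) set"
    and M :: "nat \<Rightarrow> 'a measure" and X :: "nat \<Rightarrow> nat \<Rightarrow> 'a \<Rightarrow> (nat \<Rightarrow> real)"
    and \<nu> :: "nat \<Rightarrow> (nat \<Rightarrow> real) measure"
    and N :: "'b measure" and B :: "real \<Rightarrow> 'b \<Rightarrow> real"
  assumes k: "\<And>n. n \<ge> 1 \<Longrightarrow> 1 \<le> k n \<and> k n < p n"
    and p_n: "filterlim (\<lambda>n. real (p n) / real n) at_top sequentially"
    and \<tau>: "0 < \<tau>"
    and k_p: "(\<lambda>n. (1 - real (k n) / real (p n)) * real n) \<longlonglongrightarrow> \<tau>"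
    and H: "\<And>n. n \<ge> 1 \<Longrightarrow> H n \<subseteq> Rp (p n) \<and> subspace (H n) \<and> dim (H n) = k n"
    and M: "\<And>n. n \<ge> 1 \<Longrightarrow> prob_space (M n)"
    and indep: "\<And>n. n \<ge> 1 \<Longrightarrow> prob_space.indep_vars (M n) (\<lambda>_. borel) (X n) {1..n}"
    and unif: "\<And>n i. n \<ge> 1 \<Longrightarrow> i \<in> {1..n} \<Longrightarrow>
      uniform_on_unit_sphere (p n) (H n) (distr (M n) borel (X n i))"
    and \<nu>: "\<And>n. n \<ge> 1 \<Longrightarrow> uniform_on_unit_sphere (p n) (Rp (p n)) (\<nu> n)"
    and B: "standard_brownian_bridge N B"
  shows "weak_conv_m
    (\<lambda>n. distr (M n) borel (\<lambda>\<omega>. sqrt (real n * (real n - 1) / 2) *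
       T_stat (p n) (inner_cdf (p n) (\<nu> n)) n (\<lambda>i. X n i \<omega>)))
    (distr N borel (\<lambda>\<omega>. SUP t\<in>{0..1}. \<bar>B t \<omega> - \<tau> / (2 * sqrt 2) * Phi_inv_phi t\<bar>))"
proof -
  define \<mu> where "\<mu> n i = distr (M n) borel (X n (if i \<in> {1..n} then i else 1))" for n i
  define F where "F n = unit_sphere_law.ip_cdf (\<mu> n 1) (p n) (H n)" for n
  define m where "m n = inner_cdf (p n) (\<nu> n)" for n
  define g where "g n x y = inner_p (p n) (on_sphere (p n) (H n) x) (on_sphere (p n) (H n) y)" for n x y
  define b where "b n t = sqrt (real n * (real n - 1) / 2) * (F n t - m n t)" for n t
  define \<beta> where "\<beta> u = - (\<tau> / (2 * sqrt 2) * Phi_inv_phi u)" for u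
  \<comment> \<open>The choice k^(-1/4) makes both \<eta> and 2 / (k \<eta>^2), which is 2 k^(-1/2),
    tend to 0.\<close>
  define \<eta> where "\<eta> n = sqrt (sqrt (1 / real (k n)))" for n
  define \<epsilon> where "\<epsilon> n = \<eta> n + 12 / real (k n) + 2 / (real (k n) * (\<eta> n)\<^sup>2)" for n
  have lawX: "unit_sphere_law (distr (M n) borel (X n i)) (p n) (k n) (H n)" if "n \<ge> 1" "i \<in> {1..n}" for n i
    using unif[OF that] orthonormal_basis_exists[of "H n" "p n" "k n"] H[OF that(1)] k[OF that(1)]
    by (auto simp: unit_sphere_law_def unit_sphere_law_axioms_def uniform_on_unit_sphere_def)
  have law\<mu>: "unit_sphere_law (\<mu> n i) (p n) (k n) (H n)" if "n \<ge> 1" for n i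
    unfolding \<mu>_def using lawX[OF that] that by auto
  have law\<nu>: "unit_sphere_law (\<nu> n) (p n) (p n) (Rp (p n))" if "n \<ge> 1" for n
    using \<nu>[OF that] orthonormal_basis_Rp[of "p n"]
    by (auto simp: unit_sphere_law_def unit_sphere_law_axioms_def uniform_on_unit_sphere_def)
  have m_eq: "m n = unit_sphere_law.ip_cdf (\<nu> n) (p n) (Rp (p n))" if "n \<ge> 1" for n
    unfolding m_def using inner_cdf_eq[OF law\<nu>[OF that]] by blast
  have k_inf: "filterlim (\<lambda>n. real (k n)) at_top sequentially" by (rule dimension_limits(1)[OF k p_n k_p])
  then have "\<forall>\<^sub>F n in sequentially. 3 \<le> real (k n)" unfolding filterlim_at_top by blast
  then have large: "\<forall>\<^sub>F n in sequentially. 2 \<le> n \<and> 3 \<le> k n"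
    using eventually_ge_at_top[of "2::nat"] by eventually_elim simp
  have m: "isCont (m n) t" "\<bar>m n t\<bar> \<le> 1" "\<bar>m n t - Phi (sqrt (real (p n) - 2) * t)\<bar> \<le> 4 / real (k n)"
    if "2 \<le> n" "3 \<le> k n" for n t
  proof -
    have n: "n \<ge> 1" and p: "3 \<le> p n" "k n \<le> p n" using that k[of n] by auto
    note law = law\<nu>[OF n]
    show "isCont (m n) t" unfolding m_eq[OF n] by (rule unit_sphere_law.ip_cdf_isCont[OF law p(1)])
    show "\<bar>m n t\<bar> \<le> 1" unfolding m_eq[OF n]
      using unit_sphere_law.ip_cdf_bounds[OF law, of t] by simp
    have "\<bar>m n t - Phi (sqrt (real (p n) - 2) * t)\<bar> \<le> 4 / real (p n)"
      unfolding m_eq[OF n] using unit_sphere_law.ip_cdf_normal[OF law p(1), of t] p by (simp add: of_nat_diff)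
    \<comment> \<open>Since k < p, the weaker bound lets both normal approximations share one
      error.\<close>
    also have "\<dots> \<le> 4 / real (k n)" using p that by (intro divide_left_mono) auto
    finally show "\<bar>m n t - Phi (sqrt (real (p n) - 2) * t)\<bar> \<le> 4 / real (k n)" .
  qed
  have F: "isCont (F n) t" "\<bar>F n t - Phi (sqrt (real (k n) - 2) * t)\<bar> \<le> 4 / real (k n)" "F n t \<in> {0..1}"
    if "2 \<le> n" "3 \<le> k n" for n t
  proof -
    have n: "n \<ge> 1" using that by auto
    note law = law\<mu>[OF n, of 1]
    show "isCont (F n) t" unfolding F_def by (rule unit_sphere_law.ip_cdf_isCont[OF law that(2)])
    show "\<bar>F n t - Phi (sqrt (real (k n) - 2) * t)\<bar> \<le> 4 / real (k n)"
      unfolding F_def using unit_sphere_law.ip_cdf_normal[OF law that(2), of t] that by (simp add: of_nat_diff)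
    show "F n t \<in> {0..1}" unfolding F_def using unit_sphere_law.ip_cdf_bounds[OF law, of t] by simp
  qed
  interpret array_convergence N B \<mu> borel g F \<epsilon> b \<beta>
  proof
    show "standard_brownian_bridge N B" by fact
    show "\<forall>\<^sub>F n in sequentially. law_kernel (\<mu> n) borel n (g n) (F n) \<and> law_kernel.dec (\<mu> n) n (g n) (F n) (\<epsilon> n)
      \<and> 0 \<le> \<epsilon> n \<and> (\<forall>t. isCont (b n) t)"
      using large
    proof eventually_elim
      case (elim n)
      then have n: "2 \<le> n" "1 \<le> n" and k3: "3 \<le> k n" by auto
      have g: "g n = (\<lambda>x y. inner_p (p n) (on_sphere (p n) (H n) x) (on_sphere (p n) (H n) y))"
        by (simp add: g_def fun_eq_iff)
      have \<eta>: "0 < \<eta> n" "\<eta> n \<le> 1" using k3 by (auto simp: \<eta>_def)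
      note L = law_kernel_sphere[where \<mu>="\<mu> n", OF n(1) k3 law\<mu>[OF n(2)], folded F_def g]
      have "isCont (b n) t" for t unfolding b_def[abs_def] by (intro continuous_intros F(1) m(1) n(1) k3)
      then show ?case using L(1) L(2)[OF \<eta>] \<eta> by (simp add: \<epsilon>_def)
    qed
    show "\<epsilon> \<longlonglongrightarrow> 0"
    proof -
      have "filterlim (\<lambda>x::real. sqrt (sqrt (1 / x)) + 12 / x + 2 / (x * (sqrt (sqrt (1 / x)))\<^sup>2)) (nhds 0) at_top"
        by real_asymp
      from filterlim_compose[OF this k_inf] show ?thesis by (simp add: \<epsilon>_def[abs_def] \<eta>_def)
    qed
    show "\<forall>\<^sub>F n in sequentially. \<forall>t\<in>{-1..1}. \<bar>b n t - \<beta> (F n t)\<bar> \<le> x" if x: "0 < x" for x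
    proof -
      have "\<forall>\<^sub>F n in sequentially. \<forall>t. \<bar>F n t - Phi (sqrt (real (k n) - 2) * t)\<bar> \<le> 4 / real (k n) \<and> F n t \<in> {0..1}"
        using large by eventually_elim (use F in blast)
      moreover have "\<forall>\<^sub>F n in sequentially. \<forall>t. \<bar>m n t - Phi (sqrt (real (p n) - 2) * t)\<bar> \<le> 4 / real (k n)"
        using large by eventually_elim (use m in blast)
      ultimately show ?thesis
        using bias_limit[OF k p_n k_p _ _ x, of F m] unfolding b_def \<beta>_def by (auto elim: eventually_mono)
    qed
    show "continuous_on {0..1} \<beta>" unfolding \<beta>_def[abs_def] by (intro continuous_intros Phi_inv_phi_continuous)
  qed
  have Z: "Z \<beta> = (\<lambda>\<omega>. SUP t\<in>{0..1}. \<bar>B t \<omega> - \<tau> / (2 * sqrt 2) * Phi_inv_phi t\<bar>)"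
    unfolding Z_def \<beta>_def by simp
  have eq: "\<forall>\<^sub>F n in sequentially. distr (PiM {1..n} (\<mu> n)) borel (law_kernel.stat n (g n) (F n) (b n))
    = distr (M n) borel (\<lambda>\<omega>. sqrt (real n * (real n - 1) / 2) *
       T_stat (p n) (inner_cdf (p n) (\<nu> n)) n (\<lambda>i. X n i \<omega>))"
    using large
  proof eventually_elim
    case (elim n)
    then have n: "2 \<le> n" "1 \<le> n" and k3: "3 \<le> k n" by auto
    have *: "\<mu> n = (\<lambda>i. distr (M n) borel (X n (if i \<in> {1..n} then i else 1)))"
      "g n = (\<lambda>x y. inner_p (p n) (on_sphere (p n) (H n) x) (on_sphere (p n) (H n) y))"
      "b n = (\<lambda>t. sqrt (real n * (real n - 1) / 2) * (F n t - m n t))"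
      by (simp_all add: \<mu>_def g_def b_def fun_eq_iff)
    have F': "F n = unit_sphere_law.ip_cdf (distr (M n) borel (X n 1)) (p n) (H n)" using n by (simp add: F_def \<mu>_def)
    show ?case
      using distr_T_stat[OF M[OF n(2)] indep[OF n(2)] lawX[OF n(2)] n(1) k3 m(1)[OF n(1) k3] m(2)[OF n(1) k3],
          folded *(1) *(2)]
      by (simp add: F' m_def *(3))
  qed
  \<comment> \<open>The laws on the original and on the product spaces are identified for large n
    only, so the limit is transferred separately at each continuity point.\<close>
  show ?thesis using weak_convergence unfolding Z weak_conv_m_def weak_conv_def
  proof (intro allI impI)
    fix x assume "\<forall>x. isCont (cdf (distr N borel (\<lambda>\<omega>. SUP t\<in>{0..1}. \<bar>B t \<omega> - \<tau> / (2 * sqrt 2) * Phi_inv_phi t\<bar>))) x \<longrightarrow>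
        (\<lambda>n. cdf (distr (PiM {1..n} (\<mu> n)) borel (law_kernel.stat n (g n) (F n) (b n))) x) \<longlonglongrightarrow>
        cdf (distr N borel (\<lambda>\<omega>. SUP t\<in>{0..1}. \<bar>B t \<omega> - \<tau> / (2 * sqrt 2) * Phi_inv_phi t\<bar>)) x"
      and x: "isCont (cdf (distr N borel (\<lambda>\<omega>. SUP t\<in>{0..1}. \<bar>B t \<omega> - \<tau> / (2 * sqrt 2) * Phi_inv_phi t\<bar>))) x"
    then have "(\<lambda>n. cdf (distr (PiM {1..n} (\<mu> n)) borel (law_kernel.stat n (g n) (F n) (b n))) x) \<longlonglongrightarrow>
        cdf (distr N borel (\<lambda>\<omega>. SUP t\<in>{0..1}. \<bar>B t \<omega> - \<tau> / (2 * sqrt 2) * Phi_inv_phi t\<bar>)) x" by blast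
    then show "(\<lambda>n. cdf (distr (M n) borel (\<lambda>\<omega>. sqrt (real n * (real n - 1) / 2) *
       T_stat (p n) (inner_cdf (p n) (\<nu> n)) n (\<lambda>i. X n i \<omega>))) x) \<longlonglongrightarrow>
        cdf (distr N borel (\<lambda>\<omega>. SUP t\<in>{0..1}. \<bar>B t \<omega> - \<tau> / (2 * sqrt 2) * Phi_inv_phi t\<bar>)) x"
      by (rule Lim_transform_eventually) (use eq in \<open>auto elim: eventually_mono\<close>)
  qed
qed

end
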